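(* Let a pair $(g,\mathfrak T)$ on a smooth manifold $M$ be critical for the action $\bar J:(g,\mathfrak T)\mapsto\int_M\overline{\rm S}\,{\rm d\,vol}_g$, where $\overline{\rm S}$ is the scalar curvature of $\bar\nabla=\nabla+\mathfrak T$ on $(M,g)$. Then on any open set $\Omega\subset M$ on which there is a decomposition $TM=\mathcal D_1+\ldots+\mathcal D_k$ into the sum of one-dimensional, non-degenerate, pairwise $g$-orthogonal distributions, the Euler-Lagrange equations of the action $\bar J_{\mathcal D}:(g,\mathfrak T)\mapsto\int\overline{\rm S}_{\mathcal D_1,\ldots,\mathcal D_k}\,{\rm d\,vol}_g$ are satisfied, namely $\delta_g\bar J_{\mathcal D}=\lambda g$ (on each $\mathcal D_\mu\times\mathcal D_\mu$, for some $\lambda\in\mathbb R$) and $\delta_{\mathfrak T}\bar J_{\mathcal D}=0$.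
   Context: $g=\langle\cdot,\cdot\rangle$ is a pseudo-Riemannian metric with Levi-Civita connection $\nabla$; $\mathfrak T$ is a $(1,2)$-tensor (contorsion). $\bar R_{X,Y}=[\bar\nabla_Y,\bar\nabla_X]+\bar\nabla_{[X,Y]}$, and $\overline{\rm S}$ is the trace of the Ricci tensor of $\bar\nabla$. With local orthonormal frames $\{E_{\mu,a}\}$ of $\mathcal D_\mu$, $\varepsilon=\pm1$ the squares of frame vectors, the mixed scalar curvature is $\overline{\rm S}_{\mathcal D_1,\ldots,\mathcal D_k}=\frac12\sum_{\nu<\mu}\sum_{a,b}\varepsilon_a\varepsilon_b(\langle\bar R_{E_{\nu,a},E_{\mu,b}}E_{\nu,a},E_{\mu,b}\rangle+\langle\bar R_{E_{\mu,b},E_{\nu,a}}E_{\mu,b},E_{\nu,a}\rangle)$. A metric is adapted to $\mathcal D_1,\ldots,\mathcal D_k$ if these are non-degenerate and pairwise orthogonal. An adapted variation of $g$ is a smooth family $g_t$ of adapted metrics with $g_0=g$ and compactly supported $\partial_tg_t$ (so $\partial_tg_t$ is block diagonal). All variations of $g$ and $\mathfrak T$ are compactly supported; integrals over non-compact sets are taken over relatively compact domains containing the supports of the variations. The partial gradients are defined by $\frac{d}{dt}\bar J_{\mathcal D}(g_t,\mathfrak T)|_{t=0}=\int\langle\delta_g\bar J_{\mathcal D},B\rangle\,{\rm d\,vol}_g$ for adapted variations with $B=\partial_tg_t|_{t=0}$ and $\mathfrak T$ fixed ($\delta_g\bar J_{\mathcal D}$ is a section of $\bigoplus_\mu{\rm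 Sym}^2\mathcal D_\mu^*$), and $\frac{d}{dt}\bar J_{\mathcal D}(g,\mathfrak T_t)|_{t=0}=\int\langle\delta_{\mathfrak T}\bar J_{\mathcal D},\partial_t\mathfrak T_t|_{t=0}\rangle\,{\rm d\,vol}_g$ for variations of $\mathfrak T$ with $g$ fixed. The equation $\delta_g\bar J_{\mathcal D}=\lambda g$ characterizes criticality for adapted variations preserving the volume. A pair $(g,\mathfrak T)$ is critical for $\bar J$ if the derivative of $\bar J$ vanishes for all variations of $g$ (preserving the volume) with $\mathfrak T$ fixed, and for all variations of $\mathfrak T$ with $g$ fixed. *)

theory Defs
  imports "HOL-Analysis.Analysis"
begin

section \<open>Smooth maps between normed spaces\<close>

text \<open>For finite-dimensional domains and open \<open>S\<close> this is the usual notion of a map of class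
  \<open>C\<^sup>k\<close>: all directional derivatives of a derivative are again required to be \<open>C\<^sup>k\<close>.\<close>

primrec Ck_on :: "nat \<Rightarrow> 'a::real_normed_vector set \<Rightarrow> ('a \<Rightarrow> 'b::real_normed_vector) \<Rightarrow> bool" where
  "Ck_on 0 S f \<longleftrightarrow> continuous_on S f"
| "Ck_on (Suc k) S f \<longleftrightarrow>
     (\<forall>x\<in>S. f differentiable (at x)) \<and> (\<forall>v. Ck_on k S (\<lambda>x. frechet_derivative f (at x) v))"

definition smooth_on :: "'a::real_normed_vector set \<Rightarrow> ('a \<Rightarrow> 'b::real_normed_vector) \<Rightarrow> bool" where
  "smooth_on S f \<longleftrightarrow> (\<forall>k. Ck_on k S f)"


section \<open>Smooth manifolds and tangent spaces\<close>

text \<open>A manifold of dimension \<open>CARD('n)\<close> is a Hausdorff, second countable type \<open>'m\<close> together with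
  a smooth atlas. A chart is a pair of a domain and a coordinate map.\<close>

type_synonym ('m, 'n) chart = "'m set \<times> ('m \<Rightarrow> real ^ 'n)"

definition cinv :: "('m, 'n::finite) chart \<Rightarrow> real ^ 'n \<Rightarrow> 'm" where
  "cinv c = inv_into (fst c) (snd c)"

definition is_chart :: "('m::topological_space, 'n::finite) chart \<Rightarrow> bool" where
  "is_chart c \<longleftrightarrow> open (fst c) \<and> open (snd c ` fst c) \<and>
     homeomorphism (fst c) (snd c ` fst c) (snd c) (cinv c)"

definition smooth_atlas ::
  "('m::{t2_space,second_countable_topology}, 'n::finite) chart set \<Rightarrow> bool" where
  "smooth_atlas A \<longleftrightarrow> (\<forall>c\<in>A. is_chart c) \<and> (\<Union>c\<in>A. fst c) = UNIV \<and>
     (\<forall>c\<in>A. \<forall>c'\<in>A. smooth_on (snd c ` (fst c \<inter> fst c')) (snd c' \<circ> cinv c))"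

text \<open>The tangent space at every point \<open>p\<close> is \<open>real ^ 'n\<close>: a tangent vector at \<open>p\<close> is given by its
  components in the preferred chart \<open>chart_at A p\<close>, an arbitrary chart of the atlas around \<open>p\<close>.
  Components in another chart \<open>c\<close> around \<open>p\<close> are obtained through the derivative of the transition
  map (\<open>comps\<close>); \<open>tvec\<close> is the inverse operation. Accordingly, vector fields, tensor fields and
  distributions are functions of the point, and no regularity from point to point is visible
  except through the components in a fixed chart.\<close>

definition chart_at :: "('m, 'n::finite) chart set \<Rightarrow> 'm \<Rightarrow> ('m, 'n) chart" where
  "chart_at A p = (SOME c. c \<in> A \<and> p \<in> fst c)"

definition coord_change ::
  "('m, 'n::finite) chart \<Rightarrow> ('m, 'n) chart \<Rightarrow> 'm \<Rightarrow> real ^ 'n \<Rightarrow> real ^ 'n" where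
  "coord_change c c' p = frechet_derivative (snd c' \<circ> cinv c) (at (snd c p))"

definition comps ::
  "('m, 'n::finite) chart set \<Rightarrow> ('m, 'n) chart \<Rightarrow> 'm \<Rightarrow> real ^ 'n \<Rightarrow> real ^ 'n" where
  "comps A c p u = coord_change (chart_at A p) c p u"

definition tvec ::
  "('m, 'n::finite) chart set \<Rightarrow> ('m, 'n) chart \<Rightarrow> 'm \<Rightarrow> real ^ 'n \<Rightarrow> real ^ 'n" where
  "tvec A c p v = coord_change c (chart_at A p) p v"

type_synonym ('m, 'n) vfield = "'m \<Rightarrow> real ^ 'n"
type_synonym ('m, 'n) tensor02 = "'m \<Rightarrow> real ^ 'n \<Rightarrow> real ^ 'n \<Rightarrow> real"
type_synonym ('m, 'n) tensor12 = "'m \<Rightarrow> real ^ 'n \<Rightarrow> real ^ 'n \<Rightarrow> real ^ 'n"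

text \<open>Representations in a chart, as functions of the coordinates \<open>y\<close>.\<close>

definition vf_rep ::
  "('m, 'n::finite) chart set \<Rightarrow> ('m, 'n) chart \<Rightarrow> ('m, 'n) vfield \<Rightarrow> real ^ 'n \<Rightarrow> real ^ 'n" where
  "vf_rep A c X y = comps A c (cinv c y) (X (cinv c y))"

definition rep02 ::
  "('m, 'n::finite) chart set \<Rightarrow> ('m, 'n) chart \<Rightarrow> ('m, 'n) tensor02 \<Rightarrow>
     real ^ 'n \<Rightarrow> real ^ 'n \<Rightarrow> real ^ 'n \<Rightarrow> real" where
  "rep02 A c h y u v = h (cinv c y) (tvec A c (cinv c y) u) (tvec A c (cinv c y) v)"

definition rep12 ::
  "('m, 'n::finite) chart set \<Rightarrow> ('m, 'n) chart \<Rightarrow> ('m, 'n) tensor12 \<Rightarrow>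
     real ^ 'n \<Rightarrow> real ^ 'n \<Rightarrow> real ^ 'n \<Rightarrow> real ^ 'n" where
  "rep12 A c T y u v = comps A c (cinv c y)
     (T (cinv c y) (tvec A c (cinv c y) u) (tvec A c (cinv c y) v))"

definition smooth_vfield ::
  "('m, 'n::finite) chart set \<Rightarrow> 'm set \<Rightarrow> ('m, 'n) vfield \<Rightarrow> bool" where
  "smooth_vfield A W X \<longleftrightarrow> (\<forall>c\<in>A. smooth_on (snd c ` (fst c \<inter> W)) (vf_rep A c X))"

definition smooth_tensor02 ::
  "('m, 'n::finite) chart set \<Rightarrow> 'm set \<Rightarrow> ('m, 'n) tensor02 \<Rightarrow> bool" where
  "smooth_tensor02 A W h \<longleftrightarrow> (\<forall>p\<in>W. bilinear (h p)) \<and>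
     (\<forall>c\<in>A. \<forall>u v. smooth_on (snd c ` (fst c \<inter> W)) (\<lambda>y. rep02 A c h y u v))"

definition smooth_tensor12 ::
  "('m, 'n::finite) chart set \<Rightarrow> 'm set \<Rightarrow> ('m, 'n) tensor12 \<Rightarrow> bool" where
  "smooth_tensor12 A W T \<longleftrightarrow> (\<forall>p\<in>W. bilinear (T p)) \<and>
     (\<forall>c\<in>A. \<forall>u v. smooth_on (snd c ` (fst c \<inter> W)) (\<lambda>y. rep12 A c T y u v))"

text \<open>Joint smoothness in \<open>(t, p)\<close> of one-parameter families, \<open>t \<in> I\<close>.\<close>

definition smooth_family02 ::
  "('m, 'n::finite) chart set \<Rightarrow> 'm set \<Rightarrow> real set \<Rightarrow> (real \<Rightarrow> ('m, 'n) tensor02) \<Rightarrow> bool" where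
  "smooth_family02 A W I ht \<longleftrightarrow> (\<forall>c\<in>A. \<forall>u v.
     smooth_on (I \<times> (snd c ` (fst c \<inter> W))) (\<lambda>(t, y). rep02 A c (ht t) y u v))"

definition smooth_family12 ::
  "('m, 'n::finite) chart set \<Rightarrow> 'm set \<Rightarrow> real set \<Rightarrow> (real \<Rightarrow> ('m, 'n) tensor12) \<Rightarrow> bool" where
  "smooth_family12 A W I Tt \<longleftrightarrow> (\<forall>c\<in>A. \<forall>u v.
     smooth_on (I \<times> (snd c ` (fst c \<inter> W))) (\<lambda>(t, y). rep12 A c (Tt t) y u v))"

text \<open>Derivative of a function along a tangent vector at \<open>p\<close>, Lie bracket of vector fields, and the
  extension of a tangent vector at \<open>p\<close> to the vector field with constant components in the
  preferred chart at \<open>p\<close>. The preferred chart at \<open>p\<close> is used throughout; in it the components of a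
  tangent vector at \<open>p\<close> are the vector itself.\<close>

definition dir_deriv ::
  "('m, 'n::finite) chart set \<Rightarrow> 'm \<Rightarrow> real ^ 'n \<Rightarrow> ('m \<Rightarrow> real) \<Rightarrow> real" where
  "dir_deriv A p u f =
     frechet_derivative (f \<circ> cinv (chart_at A p)) (at (snd (chart_at A p) p)) u"

definition chart_deriv ::
  "('m, 'n::finite) chart set \<Rightarrow> 'm \<Rightarrow> real ^ 'n \<Rightarrow> ('m, 'n) vfield \<Rightarrow> real ^ 'n" where
  "chart_deriv A p u Y =
     frechet_derivative (vf_rep A (chart_at A p) Y) (at (snd (chart_at A p) p)) u"

definition lie_bracket ::
  "('m, 'n::finite) chart set \<Rightarrow> ('m, 'n) vfield \<Rightarrow> ('m, 'n) vfield \<Rightarrow> ('m, 'n) vfield" where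
  "lie_bracket A X Y p = chart_deriv A p (X p) Y - chart_deriv A p (Y p) X"

definition const_ext ::
  "('m, 'n::finite) chart set \<Rightarrow> 'm \<Rightarrow> real ^ 'n \<Rightarrow> ('m, 'n) vfield" where
  "const_ext A p u q = tvec A (chart_at A p) q u"


section \<open>Pseudo-Riemannian metrics\<close>

definition nondegenerate_on ::
  "('m, 'n::finite) tensor02 \<Rightarrow> 'm \<Rightarrow> (real ^ 'n) set \<Rightarrow> bool" where
  "nondegenerate_on g p V \<longleftrightarrow> (\<forall>u\<in>V. (\<forall>v\<in>V. g p u v = 0) \<longrightarrow> u = 0)"

definition metric_on ::
  "('m, 'n::finite) chart set \<Rightarrow> 'm set \<Rightarrow> ('m, 'n) tensor02 \<Rightarrow> bool" where
  "metric_on A W g \<longleftrightarrow> smooth_tensor02 A W g \<and>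
     (\<forall>p\<in>W. (\<forall>u v. g p u v = g p v u) \<and> nondegenerate_on g p UNIV)"

text \<open>An orthonormal basis of a subspace \<open>V\<close> of the tangent space at \<open>p\<close>, as a finite set. It exists
  iff \<open>g\<close> is non-degenerate on \<open>V\<close>; all traces below are independent of the choice. The sign
  \<open>\<epsilon>\<close> of a basis vector \<open>e\<close> is \<open>g p e e\<close>.\<close>

definition onb :: "('m, 'n::finite) tensor02 \<Rightarrow> 'm \<Rightarrow> (real ^ 'n) set \<Rightarrow> (real ^ 'n) set" where
  "onb g p V = (SOME F. finite F \<and> F \<subseteq> V \<and> span F = V \<and>
     (\<forall>e\<in>F. g p e e = 1 \<or> g p e e = -1) \<and> (\<forall>e\<in>F. \<forall>f\<in>F. e \<noteq> f \<longrightarrow> g p e f = 0))"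

text \<open>Inner products induced by \<open>g\<close> on (0,2)- and (1,2)-tensors at \<open>p\<close>.\<close>

definition inner02 ::
  "('m, 'n::finite) tensor02 \<Rightarrow> 'm \<Rightarrow> (real ^ 'n \<Rightarrow> real ^ 'n \<Rightarrow> real) \<Rightarrow>
     (real ^ 'n \<Rightarrow> real ^ 'n \<Rightarrow> real) \<Rightarrow> real" where
  "inner02 g p P B =
     (\<Sum>a\<in>onb g p UNIV. \<Sum>b\<in>onb g p UNIV. g p a a * g p b b * (P a b * B a b))"

definition inner12 ::
  "('m, 'n::finite) tensor02 \<Rightarrow> 'm \<Rightarrow> (real ^ 'n \<Rightarrow> real ^ 'n \<Rightarrow> real ^ 'n) \<Rightarrow>
     (real ^ 'n \<Rightarrow> real ^ 'n \<Rightarrow> real ^ 'n) \<Rightarrow> real" where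
  "inner12 g p Q C =
     (\<Sum>a\<in>onb g p UNIV. \<Sum>b\<in>onb g p UNIV. g p a a * g p b b * g p (Q a b) (C a b))"

text \<open>The volume measure of \<open>g\<close> on an open set \<open>W\<close>: the Borel measure on \<open>W\<close> which in every chart
  has density \<open>sqrt |det g|\<close>.\<close>

definition vol_density ::
  "('m, 'n::finite) chart set \<Rightarrow> ('m, 'n) chart \<Rightarrow> ('m, 'n) tensor02 \<Rightarrow> real ^ 'n \<Rightarrow> real" where
  "vol_density A c g y =
     sqrt \<bar>det ((\<chi> i j. rep02 A c g y (axis i 1) (axis j 1)) :: real ^ 'n ^ 'n)\<bar>"

definition vol_measure ::
  "('m::topological_space, 'n::finite) chart set \<Rightarrow> 'm set \<Rightarrow> ('m, 'n) tensor02 \<Rightarrow> 'm measure" where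
  "vol_measure A W g = (THE \<mu>. sets \<mu> = sets (restrict_space borel W) \<and>
     (\<forall>c\<in>A. \<forall>S\<in>sets borel. S \<subseteq> fst c \<inter> W \<longrightarrow>
        emeasure \<mu> S = (\<integral>\<^sup>+y\<in>snd c ` S. ennreal (vol_density A c g y) \<partial>lborel)))"


section \<open>Connections and curvature\<close>

text \<open>A linear connection is represented by its coefficients at each point \<open>p\<close> with respect to the
  preferred chart at \<open>p\<close>: the covariant derivative at \<open>p\<close> is the coordinate derivative in that chart
  plus a bilinear term. In particular, adding a (1,2)-tensor to the coefficients adds the same
  tensor to the covariant derivative.\<close>

definition nabla ::
  "('m, 'n::finite) chart set \<Rightarrow> ('m, 'n) tensor12 \<Rightarrow>
     ('m, 'n) vfield \<Rightarrow> ('m, 'n) vfield \<Rightarrow> ('m, 'n) vfield" where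
  "nabla A \<Gamma> X Y p = chart_deriv A p (X p) Y + \<Gamma> p (X p) (Y p)"

definition smooth_vfield_near ::
  "('m::topological_space, 'n::finite) chart set \<Rightarrow> 'm \<Rightarrow> ('m, 'n) vfield \<Rightarrow> bool" where
  "smooth_vfield_near A p X \<longleftrightarrow> (\<exists>W. open W \<and> p \<in> W \<and> smooth_vfield A W X)"

definition torsion_free_at ::
  "('m::topological_space, 'n::finite) chart set \<Rightarrow> ('m, 'n) tensor12 \<Rightarrow> 'm \<Rightarrow> bool" where
  "torsion_free_at A \<Gamma> p \<longleftrightarrow>
     (\<forall>X Y. smooth_vfield_near A p X \<longrightarrow> smooth_vfield_near A p Y \<longrightarrow>
        nabla A \<Gamma> X Y p - nabla A \<Gamma> Y X p = lie_bracket A X Y p)"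

definition metric_compatible_at ::
  "('m::topological_space, 'n::finite) chart set \<Rightarrow> ('m, 'n) tensor02 \<Rightarrow> ('m, 'n) tensor12 \<Rightarrow>
     'm \<Rightarrow> bool" where
  "metric_compatible_at A g \<Gamma> p \<longleftrightarrow>
     (\<forall>X Y Z. smooth_vfield_near A p X \<longrightarrow> smooth_vfield_near A p Y \<longrightarrow>
        smooth_vfield_near A p Z \<longrightarrow>
        dir_deriv A p (X p) (\<lambda>q. g q (Y q) (Z q)) =
          g p (nabla A \<Gamma> X Y p) (Z p) + g p (Y p) (nabla A \<Gamma> X Z p))"

text \<open>The Levi-Civita connection: the unique torsion-free metric connection. Both conditions at \<open>p\<close>
  involve only the coefficients at \<open>p\<close> and determine them.\<close>

definition levi_civita ::
  "('m::topological_space, 'n::finite) chart set \<Rightarrow> ('m, 'n) tensor02 \<Rightarrow> ('m, 'n) tensor12" where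
  "levi_civita A g p = (THE \<gamma>. bilinear \<gamma> \<and>
     torsion_free_at A (\<lambda>_. \<gamma>) p \<and> metric_compatible_at A g (\<lambda>_. \<gamma>) p)"

definition nabla_bar ::
  "('m::topological_space, 'n::finite) chart set \<Rightarrow> ('m, 'n) tensor02 \<Rightarrow> ('m, 'n) tensor12 \<Rightarrow>
     ('m, 'n) vfield \<Rightarrow> ('m, 'n) vfield \<Rightarrow> ('m, 'n) vfield" where
  "nabla_bar A g T X Y p = nabla A (levi_civita A g) X Y p + T p (X p) (Y p)"

definition curv_op ::
  "('m::topological_space, 'n::finite) chart set \<Rightarrow> ('m, 'n) tensor02 \<Rightarrow> ('m, 'n) tensor12 \<Rightarrow>
     ('m, 'n) vfield \<Rightarrow> ('m, 'n) vfield \<Rightarrow> ('m, 'n) vfield \<Rightarrow> ('m, 'n) vfield" where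
  "curv_op A g T X Y Z p =
     nabla_bar A g T Y (nabla_bar A g T X Z) p - nabla_bar A g T X (nabla_bar A g T Y Z) p
     + nabla_bar A g T (lie_bracket A X Y) Z p"

text \<open>The curvature tensor on tangent vectors at \<open>p\<close>; by tensoriality of \<open>curv_op\<close> any smooth
  extension of the vectors gives the same value.\<close>

definition curv ::
  "('m::topological_space, 'n::finite) chart set \<Rightarrow> ('m, 'n) tensor02 \<Rightarrow> ('m, 'n) tensor12 \<Rightarrow>
     'm \<Rightarrow> real ^ 'n \<Rightarrow> real ^ 'n \<Rightarrow> real ^ 'n \<Rightarrow> real ^ 'n" where
  "curv A g T p u v w = curv_op A g T (const_ext A p u) (const_ext A p v) (const_ext A p w) p"

text \<open>With the sign convention of \<open>curv_op\<close>, the following Ricci tensor is positive on round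
  spheres; its trace is the sum of \<open>\<epsilon>\<^sub>a \<epsilon>\<^sub>b \<langle>R(a,b)a, b\<rangle>\<close> over an orthonormal frame.\<close>

definition ricci ::
  "('m::topological_space, 'n::finite) chart set \<Rightarrow> ('m, 'n) tensor02 \<Rightarrow> ('m, 'n) tensor12 \<Rightarrow>
     ('m, 'n) tensor02" where
  "ricci A g T p v w = trace (matrix (\<lambda>x. curv A g T p v x w))"

definition scalar_curv ::
  "('m::topological_space, 'n::finite) chart set \<Rightarrow> ('m, 'n) tensor02 \<Rightarrow> ('m, 'n) tensor12 \<Rightarrow>
     'm \<Rightarrow> real" where
  "scalar_curv A g T p = (\<Sum>e\<in>onb g p UNIV. g p e e * ricci A g T p e e)"


section \<open>Distributions and mixed scalar curvature\<close>

definition smooth_distribution ::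
  "('m::topological_space, 'n::finite) chart set \<Rightarrow> 'm set \<Rightarrow> nat \<Rightarrow> ('m \<Rightarrow> (real ^ 'n) set) \<Rightarrow>
     bool" where
  "smooth_distribution A W r E \<longleftrightarrow> (\<forall>p\<in>W. subspace (E p) \<and> dim (E p) = r) \<and>
     (\<forall>p\<in>W. \<exists>V X. open V \<and> p \<in> V \<and> V \<subseteq> W \<and> (\<forall>i<r. smooth_vfield A V (X i)) \<and>
        (\<forall>q\<in>V. E q = span ((\<lambda>i. X i q) ` {..<r})))"

definition adapted_metric ::
  "('m, 'n::finite) chart set \<Rightarrow> 'm set \<Rightarrow> nat \<Rightarrow> (nat \<Rightarrow> 'm \<Rightarrow> (real ^ 'n) set) \<Rightarrow>
     ('m, 'n) tensor02 \<Rightarrow> bool" where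
  "adapted_metric A W k D g \<longleftrightarrow> metric_on A W g \<and>
     (\<forall>p\<in>W. \<forall>\<mu>\<in>{1..k}. nondegenerate_on g p (D \<mu> p)) \<and>
     (\<forall>p\<in>W. \<forall>\<mu>\<in>{1..k}. \<forall>\<nu>\<in>{1..k}. \<mu> \<noteq> \<nu> \<longrightarrow> (\<forall>u\<in>D \<mu> p. \<forall>v\<in>D \<nu> p. g p u v = 0))"

definition mixed_scalar_curv ::
  "('m::topological_space, 'n::finite) chart set \<Rightarrow> nat \<Rightarrow> (nat \<Rightarrow> 'm \<Rightarrow> (real ^ 'n) set) \<Rightarrow>
     ('m, 'n) tensor02 \<Rightarrow> ('m, 'n) tensor12 \<Rightarrow> 'm \<Rightarrow> real" where
  "mixed_scalar_curv A k D g T p =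
     1 / 2 * (\<Sum>\<mu>\<in>{1..k}. \<Sum>\<nu>\<in>{1..<\<mu>}. \<Sum>a\<in>onb g p (D \<nu> p). \<Sum>b\<in>onb g p (D \<mu> p).
       g p a a * g p b b * (g p (curv A g T p a b a) b + g p (curv A g T p b a b) a))"


section \<open>Actions, variations, gradients\<close>

definition total_action ::
  "('m::topological_space, 'n::finite) chart set \<Rightarrow> 'm set \<Rightarrow> ('m, 'n) tensor02 \<Rightarrow>
     ('m, 'n) tensor12 \<Rightarrow> real" where
  "total_action A U g T = (LINT p|vol_measure A U g. scalar_curv A g T p)"

definition mixed_action ::
  "('m::topological_space, 'n::finite) chart set \<Rightarrow> nat \<Rightarrow> (nat \<Rightarrow> 'm \<Rightarrow> (real ^ 'n) set) \<Rightarrow>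
     'm set \<Rightarrow> ('m, 'n) tensor02 \<Rightarrow> ('m, 'n) tensor12 \<Rightarrow> real" where
  "mixed_action A k D U g T = (LINT p|vol_measure A U g. mixed_scalar_curv A k D g T p)"

text \<open>Domains of integration: relatively compact open subsets \<open>U\<close> of \<open>W\<close> which contain the support
  \<open>K\<close> of the variation.\<close>

definition integration_domain :: "'m::topological_space set \<Rightarrow> 'm set \<Rightarrow> 'm set \<Rightarrow> bool" where
  "integration_domain W K U \<longleftrightarrow> open U \<and> K \<subseteq> U \<and> compact (closure U) \<and> closure U \<subseteq> W"

definition metric_variation ::
  "('m::topological_space, 'n::finite) chart set \<Rightarrow> 'm set \<Rightarrow> ('m, 'n) tensor02 \<Rightarrow> real \<Rightarrow>
     (real \<Rightarrow> ('m, 'n) tensor02) \<Rightarrow> 'm set \<Rightarrow> bool" where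
  "metric_variation A W g \<epsilon> gt K \<longleftrightarrow> \<epsilon> > 0 \<and>
     (\<forall>t\<in>{-\<epsilon><..<\<epsilon>}. metric_on A W (gt t)) \<and>
     smooth_family02 A W {-\<epsilon><..<\<epsilon>} gt \<and>
     (\<forall>p\<in>W. gt 0 p = g p) \<and>
     compact K \<and> K \<subseteq> W \<and>
     (\<forall>p\<in>W - K. \<forall>t\<in>{-\<epsilon><..<\<epsilon>}. \<forall>u v. ((\<lambda>s. gt s p u v) has_real_derivative 0) (at t))"

definition adapted_variation ::
  "('m::topological_space, 'n::finite) chart set \<Rightarrow> nat \<Rightarrow> (nat \<Rightarrow> 'm \<Rightarrow> (real ^ 'n) set) \<Rightarrow>
     'm set \<Rightarrow> ('m, 'n) tensor02 \<Rightarrow> real \<Rightarrow> (real \<Rightarrow> ('m, 'n) tensor02) \<Rightarrow> 'm set \<Rightarrow> bool" where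
  "adapted_variation A k D W g \<epsilon> gt K \<longleftrightarrow> metric_variation A W g \<epsilon> gt K \<and>
     (\<forall>t\<in>{-\<epsilon><..<\<epsilon>}. adapted_metric A W k D (gt t))"

definition contorsion_variation ::
  "('m::topological_space, 'n::finite) chart set \<Rightarrow> 'm set \<Rightarrow> ('m, 'n) tensor12 \<Rightarrow> real \<Rightarrow>
     (real \<Rightarrow> ('m, 'n) tensor12) \<Rightarrow> 'm set \<Rightarrow> bool" where
  "contorsion_variation A W T \<epsilon> Tt K \<longleftrightarrow> \<epsilon> > 0 \<and>
     (\<forall>t\<in>{-\<epsilon><..<\<epsilon>}. smooth_tensor12 A W (Tt t)) \<and>
     smooth_family12 A W {-\<epsilon><..<\<epsilon>} Tt \<and>
     (\<forall>p\<in>W. Tt 0 p = T p) \<and>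
     compact K \<and> K \<subseteq> W \<and>
     (\<forall>p\<in>W - K. \<forall>t\<in>{-\<epsilon><..<\<epsilon>}. \<forall>u v. ((\<lambda>s. Tt s p u v) has_vector_derivative 0) (at t))"

definition critical_pair ::
  "('m::topological_space, 'n::finite) chart set \<Rightarrow> ('m, 'n) tensor02 \<Rightarrow> ('m, 'n) tensor12 \<Rightarrow>
     bool" where
  "critical_pair A g T \<longleftrightarrow>
     (\<forall>\<epsilon> gt K U. metric_variation A UNIV g \<epsilon> gt K \<longrightarrow> integration_domain UNIV K U \<longrightarrow>
        (\<forall>t\<in>{-\<epsilon><..<\<epsilon>}. measure (vol_measure A U (gt t)) U = measure (vol_measure A U g) U) \<longrightarrow>
        ((\<lambda>t. total_action A U (gt t) T) has_real_derivative 0) (at 0)) \<and>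
     (\<forall>\<epsilon> Tt K U. contorsion_variation A UNIV T \<epsilon> Tt K \<longrightarrow> integration_domain UNIV K U \<longrightarrow>
        ((\<lambda>t. total_action A U g (Tt t)) has_real_derivative 0) (at 0))"

text \<open>\<open>metric_gradient A k D W g T P\<close> says that \<open>P\<close> is the partial gradient of the mixed action on \<open>W\<close>
  with respect to adapted variations of the metric, and \<open>contorsion_gradient A k D W g T Q\<close> that
  \<open>Q\<close> is its partial gradient with respect to the contorsion tensor. The first two conjuncts in
  \<open>metric_gradient\<close> say that \<open>P\<close> is a section of the direct sum of the symmetric squares of the
  duals of the \<open>D \<mu>\<close>.\<close>

definition metric_gradient ::
  "('m::topological_space, 'n::finite) chart set \<Rightarrow> nat \<Rightarrow> (nat \<Rightarrow> 'm \<Rightarrow> (real ^ 'n) set) \<Rightarrow>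
     'm set \<Rightarrow> ('m, 'n) tensor02 \<Rightarrow> ('m, 'n) tensor12 \<Rightarrow> ('m, 'n) tensor02 \<Rightarrow> bool" where
  "metric_gradient A k D W g T P \<longleftrightarrow>
     smooth_tensor02 A W P \<and>
     (\<forall>p\<in>W. (\<forall>u v. P p u v = P p v u) \<and>
        (\<forall>\<mu>\<in>{1..k}. \<forall>\<nu>\<in>{1..k}. \<mu> \<noteq> \<nu> \<longrightarrow> (\<forall>u\<in>D \<mu> p. \<forall>v\<in>D \<nu> p. P p u v = 0))) \<and>
     (\<forall>\<epsilon> gt K U. adapted_variation A k D W g \<epsilon> gt K \<longrightarrow> integration_domain W K U \<longrightarrow>
        ((\<lambda>t. mixed_action A k D U (gt t) T) has_real_derivative
          (LINT p|vol_measure A U g. inner02 g p (P p) (\<lambda>u v. deriv (\<lambda>t. gt t p u v) 0))) (at 0))"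

definition contorsion_gradient ::
  "('m::topological_space, 'n::finite) chart set \<Rightarrow> nat \<Rightarrow> (nat \<Rightarrow> 'm \<Rightarrow> (real ^ 'n) set) \<Rightarrow>
     'm set \<Rightarrow> ('m, 'n) tensor02 \<Rightarrow> ('m, 'n) tensor12 \<Rightarrow> ('m, 'n) tensor12 \<Rightarrow> bool" where
  "contorsion_gradient A k D W g T Q \<longleftrightarrow>
     smooth_tensor12 A W Q \<and>
     (\<forall>\<epsilon> Tt K U. contorsion_variation A W T \<epsilon> Tt K \<longrightarrow> integration_domain W K U \<longrightarrow>
        ((\<lambda>t. mixed_action A k D U g (Tt t)) has_real_derivative
          (LINT p|vol_measure A U g. inner12 g p (Q p)
             (\<lambda>u v. vector_derivative (\<lambda>t. Tt t p u v) (at 0)))) (at 0))"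

end

theory Submission
  imports Defs
begin

text \<open>At a point of \<open>\<Omega>\<close> the lines \<open>D \<mu>\<close> yield an orthonormal frame, so for every adapted metric the
  mixed scalar curvature is half the scalar curvature: every pair of distinct frame vectors is mixed
  and the diagonal terms vanish. Hence the mixed action is half of the total action, and a variation
  on \<open>\<Omega>\<close> extends by \<open>g\<close>, resp. \<open>T\<close>, to all of \<open>M\<close>. For the contorsion this is all.

  A variation \<open>g\<^sub>t\<close> of the metric need not preserve the volume. Let \<open>f\<^sub>t\<close> be the density of the volume of
  \<open>g\<^sub>t\<close> with respect to that of \<open>g\<close> and \<open>\<psi>\<close> its derivative at \<open>t = 0\<close>. For a function \<open>\<eta>\<close> with
  compact support and \<open>n\<close> the dimension, \<open>h\<^sub>t = ((1 + t \<eta>) / f\<^sub>t) powr (2 / n) g\<^sub>t\<close> has density \<open>1 + t \<eta>\<close>, so it preserves the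
  volume exactly as soon as \<open>\<eta>\<close> has integral zero. Take \<open>\<eta> = \<psi> - (c / c\<^sub>0) \<psi>\<^sub>0\<close> with \<open>c\<close> the integral of
  \<open>\<psi>\<close> and \<open>\<psi>\<^sub>0\<close>, \<open>c\<^sub>0 \<noteq> 0\<close> belonging to one fixed variation. The derivative of the action depends linearly
  on the derivative of the variation, so it equals a constant times \<open>c\<close>, and \<open>\<psi>\<close> is half the trace of
  \<open>\<partial>\<^sub>t g\<^sub>t\<close>.\<close>


section \<open>Calculus of smooth maps\<close>

text \<open>The linear dependence of the derivative of the action on the velocity of the metric is
  the main obstacle. The normalised family is not affine in \<open>t\<close>, so it can be compared
  with other families only through initial velocities. No formula for the first variation of the
  scalar curvature is derived: a linear relation between three velocities is carried through every
  operation from which the scalar curvature is built, spatial derivatives included. This requires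
  one expression in one fixed chart, whereas the definitions refer at each point to the preferred
  chart of that point and pick connection, frame and volume by description operators; hence the work
  on charts, Christoffel symbols and measures. The frames along the lines serve twice more: they
  show that orthonormal bases exist for every metric of an adapted variation, and they make Gram
  matrices diagonal. A conformal factor keeps a metric adapted, which is why the volume is corrected
  by rescaling. The gradient is never computed: once the derivative of the action is a multiple of
  that of the volume, a multiple of the metric represents it.\<close>

lemma Ck_on_cong:
  assumes "open S" "\<And>x. x \<in> S \<Longrightarrow> f x = g x" "Ck_on k S f"
  shows "Ck_on k S g"
  using assms(2,3)
proof (induction k arbitrary: f g)
  case 0
  then show ?case by (metis Ck_on.simps(1) continuous_on_cong)
next
  case (Suc k)
  have d: "f differentiable (at x)" if "x \<in> S" for x
    using Suc.prems(2) that by simp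
  have g: "g differentiable (at x)" if "x \<in> S" for x
    using d[OF that] Suc.prems(1) that assms(1)
    by (meson differentiable_def has_derivative_transform_within_open)
  have eq: "frechet_derivative f (at x) = frechet_derivative g (at x)" if "x \<in> S" for x
    using frechet_derivative_transform_within_open[OF d[OF that] assms(1) that] Suc.prems(1) by blast
  have "Ck_on k S (\<lambda>x. frechet_derivative g (at x) v)" for v
    by (rule Suc.IH[of "\<lambda>x. frechet_derivative f (at x) v"]) (use eq Suc.prems(2) in auto)
  with g show ?case by simp
qed

lemma Ck_on_Suc_D: "Ck_on (Suc k) S f \<Longrightarrow> Ck_on k S f"
proof (induction k arbitrary: f)
  case 0
  then show ?case
    by (auto intro!: continuous_at_imp_continuous_on differentiable_imp_continuous_within)
qed auto

lemma Ck_on_subset: "Ck_on k S f \<Longrightarrow> S' \<subseteq> S \<Longrightarrow> Ck_on k S' f"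
  by (induction k arbitrary: f) (auto intro: continuous_on_subset)

text \<open>Derivatives \<open>at x\<close> see only a neighbourhood of \<open>x\<close>, so an open
  cover suffices. This is how fields glued from two pieces, or read in a second chart, are
  recognised as smooth.\<close>

lemma Ck_on_locally:
  assumes "\<And>x. x \<in> S \<Longrightarrow> \<exists>V. open V \<and> x \<in> V \<and> Ck_on k V f"
  shows "Ck_on k S f"
  using assms
proof (induction k arbitrary: f)
  case 0
  then show ?case
    by (simp, meson at_within_open continuous_at_imp_continuous_on continuous_on_eq_continuous_at)
next
  case (Suc k)
  have "f differentiable (at x)" if "x \<in> S" for x
    using Suc.prems[OF that] by auto
  moreover have "Ck_on k S (\<lambda>x. frechet_derivative f (at x) v)" for v
    by (rule Suc.IH) (use Suc.prems in fastforce)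
  ultimately show ?case by simp
qed

lemma Ck_on_const: "Ck_on k S (\<lambda>x. c)"
  by (induction k arbitrary: c) auto

lemma Ck_on_bounded_linear: "bounded_linear f \<Longrightarrow> Ck_on k S f"
proof (induction k)
  case 0
  then show ?case by (simp add: linear_continuous_on)
next
  case (Suc k)
  then have "frechet_derivative f (at x) = f" for x
    by (metis bounded_linear_imp_has_derivative frechet_derivative_at)
  with Suc show ?case
    by (auto simp: Ck_on_const intro: bounded_linear_imp_differentiable)
qed

lemma Ck_on_add:
  assumes "open S" "Ck_on k S f" "Ck_on k S g"
  shows "Ck_on k S (\<lambda>x. f x + g x)"
  using assms(2,3)
proof (induction k arbitrary: f g)
  case 0
  then show ?case by (simp add: continuous_on_add)
next
  case (Suc k)
  have "Ck_on k S (\<lambda>x. frechet_derivative (\<lambda>x. f x + g x) (at x) v)" for v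
  proof (rule Ck_on_cong[OF assms(1)])
    show "Ck_on k S (\<lambda>x. frechet_derivative f (at x) v + frechet_derivative g (at x) v)"
      by (rule Suc.IH) (use Suc.prems in auto)
    fix x assume "x \<in> S"
    then have "f differentiable at x" "g differentiable at x" using Suc.prems by auto
    then have "((\<lambda>x. f x + g x) has_derivative
        (\<lambda>v. frechet_derivative f (at x) v + frechet_derivative g (at x) v)) (at x)"
      by (intro has_derivative_add) (auto simp: frechet_derivative_works[symmetric])
    from frechet_derivative_at[OF this]
    show "frechet_derivative f (at x) v + frechet_derivative g (at x) v =
          frechet_derivative (\<lambda>x. f x + g x) (at x) v" by metis
  qed
  with Suc.prems show ?case by auto
qed

text \<open>The product rule yields two terms of the same shape, so the induction runs over both
  factors at once. Each term pairs a derivative with an undifferentiated factor, whose order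
  \<open>Ck_on_Suc_D\<close> lowers to match.\<close>

lemma Ck_on_bilinear:
  assumes "bounded_bilinear b" "open S" "Ck_on k S f" "Ck_on k S g"
  shows "Ck_on k S (\<lambda>x. b (f x) (g x))"
  using assms(3,4)
proof (induction k arbitrary: f g)
  case 0
  then show ?case using bounded_bilinear.continuous_on[OF assms(1)] by auto
next
  case (Suc k)
  have D: "((\<lambda>x. b (f x) (g x)) has_derivative
        (\<lambda>v. b (f x) (frechet_derivative g (at x) v) + b (frechet_derivative f (at x) v) (g x))) (at x)"
    if "x \<in> S" for x
    by (rule bounded_bilinear.FDERIV[OF assms(1)])
       (use Suc.prems that in \<open>auto simp: frechet_derivative_works[symmetric]\<close>)
  have "Ck_on k S (\<lambda>x. frechet_derivative (\<lambda>x. b (f x) (g x)) (at x) v)" for v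
  proof (rule Ck_on_cong[OF assms(2)])
    show "Ck_on k S (\<lambda>x. b (f x) (frechet_derivative g (at x) v) + b (frechet_derivative f (at x) v) (g x))"
      by (intro Ck_on_add assms(2) Suc.IH Ck_on_Suc_D[OF Suc.prems(1)] Ck_on_Suc_D[OF Suc.prems(2)])
         (use Suc.prems in auto)
    fix x assume "x \<in> S"
    from frechet_derivative_at[OF D[OF this]]
    show "b (f x) (frechet_derivative g (at x) v) + b (frechet_derivative f (at x) v) (g x) =
          frechet_derivative (\<lambda>x. b (f x) (g x)) (at x) v" by metis
  qed
  with D show ?case by (auto simp: differentiable_def)
qed

lemma Ck_on_linear_image:
  assumes "bounded_linear h" "open S" "Ck_on k S f"
  shows "Ck_on k S (\<lambda>x. h (f x))"
  using assms(3)
proof (induction k arbitrary: f)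
  case 0
  then show ?case using bounded_linear.continuous_on[OF assms(1)] by simp
next
  case (Suc k)
  have D: "((\<lambda>x. h (f x)) has_derivative (\<lambda>v. h (frechet_derivative f (at x) v))) (at x)"
    if "x \<in> S" for x
    by (rule bounded_linear.has_derivative[OF assms(1)])
       (use Suc.prems that in \<open>auto simp: frechet_derivative_works[symmetric]\<close>)
  have "Ck_on k S (\<lambda>x. frechet_derivative (\<lambda>x. h (f x)) (at x) v)" for v
  proof (rule Ck_on_cong[OF assms(2)])
    show "Ck_on k S (\<lambda>x. h (frechet_derivative f (at x) v))"
      by (rule Suc.IH) (use Suc.prems in auto)
    fix x assume "x \<in> S"
    from frechet_derivative_at[OF D[OF this]]
    show "h (frechet_derivative f (at x) v) = frechet_derivative (\<lambda>x. h (f x)) (at x) v" by metis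
  qed
  with D show ?case by (auto simp: differentiable_def)
qed

lemma Ck_on_sum:
  assumes "open S" "\<And>i. i \<in> I \<Longrightarrow> Ck_on k S (f i)"
  shows "Ck_on k S (\<lambda>x. \<Sum>i\<in>I. f i x)"
  using assms(2)
  by (induction I rule: infinite_finite_induct) (auto simp: Ck_on_const Ck_on_add[OF assms(1)])

text \<open>By the chain rule the derivative of \<open>f\<close> is evaluated on a direction that
  moves with \<open>x\<close>, whereas \<open>Ck_on\<close> speaks of fixed directions. Expanding
  the direction in \<open>Basis\<close> leaves products of coefficients with derivatives of
  \<open>f\<close> in fixed directions; hence the Euclidean middle space.\<close>

lemma Ck_on_compose:
  fixes f :: "'b::euclidean_space \<Rightarrow> 'c::real_normed_vector" and g :: "'a::real_normed_vector \<Rightarrow> 'b"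
  assumes "open S" "open V" "Ck_on k V f" "Ck_on k S g" "g ` S \<subseteq> V"
  shows "Ck_on k S (\<lambda>x. f (g x))"
  using assms(3,4)
proof (induction k arbitrary: f)
  case 0
  then show ?case using assms(5) by (auto intro: continuous_on_compose2)
next
  case (Suc k)
  have D: "((\<lambda>x. f (g x)) has_derivative
        (\<lambda>v. frechet_derivative f (at (g x)) (frechet_derivative g (at x) v))) (at x)"
    if "x \<in> S" for x
    by (rule has_derivative_compose[of g])
       (use Suc.prems that assms(5) in \<open>auto simp: frechet_derivative_works[symmetric]\<close>)
  have "Ck_on k S (\<lambda>x. frechet_derivative (\<lambda>x. f (g x)) (at x) v)" for v
  proof (rule Ck_on_cong[OF assms(1)])
    show "Ck_on k S (\<lambda>x. \<Sum>i\<in>Basis. (frechet_derivative g (at x) v \<bullet> i) *\<^sub>R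
             frechet_derivative f (at (g x)) i)"
      by (intro Ck_on_sum assms(1) Ck_on_bilinear[OF bounded_bilinear_scaleR]
            Ck_on_bilinear[OF bounded_bilinear_inner] Ck_on_const Suc.IH Ck_on_Suc_D[OF Suc.prems(2)])
         (use Suc.prems in auto)
    fix x assume x: "x \<in> S"
    then have "linear (frechet_derivative f (at (g x)))"
      using Suc.prems assms(5) by (auto intro!: linear_frechet_derivative)
    then have "(\<Sum>i\<in>Basis. (w \<bullet> i) *\<^sub>R frechet_derivative f (at (g x)) i)
        = frechet_derivative f (at (g x)) (\<Sum>i\<in>Basis. (w \<bullet> i) *\<^sub>R i)" for w
      by (simp add: linear_sum linear_scale)
    then have "(\<Sum>i\<in>Basis. (frechet_derivative g (at x) v \<bullet> i) *\<^sub>R frechet_derivative f (at (g x)) i)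
        = frechet_derivative f (at (g x)) (frechet_derivative g (at x) v)"
      by (simp add: euclidean_representation)
    also have "\<dots> = frechet_derivative (\<lambda>x. f (g x)) (at x) v"
      using frechet_derivative_at[OF D[OF x]] by metis
    finally show "(\<Sum>i\<in>Basis. (frechet_derivative g (at x) v \<bullet> i) *\<^sub>R frechet_derivative f (at (g x)) i)
        = frechet_derivative (\<lambda>x. f (g x)) (at x) v" .
  qed
  with D show ?case by (auto simp: differentiable_def)
qed

text \<open>Differentiation lowers the exponent by one, so the induction needs all exponents at
  once.\<close>

lemma Ck_on_powr: "Ck_on k {0<..} (\<lambda>x::real. x powr a)"
proof (induction k arbitrary: a)
  case 0
  then show ?case by (auto intro!: continuous_intros)
next
  case (Suc k)
  have D: "((\<lambda>x. x powr a) has_derivative (\<lambda>v. v * (a * x powr (a - 1)))) (at x)" if "x > 0" for x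
    using has_real_derivative_powr[OF that, of a]
    by (simp add: has_field_derivative_def mult_commute_abs)
  have "Ck_on k {0<..} (\<lambda>x::real. frechet_derivative (\<lambda>x. x powr a) (at x) v)" for v
  proof (rule Ck_on_cong)
    show "Ck_on k {0<..} (\<lambda>x. v * (a * x powr (a - 1)))"
      by (intro Ck_on_bilinear[OF bounded_bilinear_mult] Ck_on_const Suc) auto
    show "v * (a * x powr (a - 1)) = frechet_derivative (\<lambda>x. x powr a) (at x) v" if "x \<in> {0<..}" for x
      using frechet_derivative_at[OF D] that by (metis greaterThan_iff)
  qed auto
  then show ?case using D by (auto simp: differentiable_def)
qed

lemma Ck_on_inverse: "Ck_on k (- {0}) (inverse :: real \<Rightarrow> real)"
proof (induction k)
  case 0
  then show ?case by (auto intro!: continuous_intros)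
next
  case (Suc k)
  have D: "(inverse has_derivative (\<lambda>v. - (inverse x * v * inverse x))) (at x)" if "x \<noteq> 0" for x :: real
    using has_derivative_inverse'[OF that] .
  have "Ck_on k (- {0}) (\<lambda>x::real. frechet_derivative inverse (at x) v)" for v
  proof (rule Ck_on_cong)
    show "Ck_on k (- {0}) (\<lambda>x. (- v) * (inverse x * inverse x))"
      by (intro Ck_on_bilinear[OF bounded_bilinear_mult] Ck_on_const Suc) auto
    show "(- v) * (inverse x * inverse x) = frechet_derivative inverse (at x) v"
      if "x \<in> - {0}" for x
    proof -
      have "frechet_derivative inverse (at x) v = - (inverse x * v * inverse x)"
        using frechet_derivative_at[OF D, of x] that by (metis ComplD insertI1)
      then show ?thesis by simp
    qed
  qed auto
  then show ?case using D by (auto simp: differentiable_def)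
qed

lemma smooth_on_Ck: "smooth_on S f \<Longrightarrow> Ck_on k S f"
  by (simp add: smooth_on_def)

lemma smooth_on_cong:
  "open S \<Longrightarrow> (\<And>x. x \<in> S \<Longrightarrow> f x = g x) \<Longrightarrow> smooth_on S f \<Longrightarrow> smooth_on S g"
  unfolding smooth_on_def using Ck_on_cong by blast

lemma smooth_on_subset: "smooth_on S f \<Longrightarrow> S' \<subseteq> S \<Longrightarrow> smooth_on S' f"
  unfolding smooth_on_def using Ck_on_subset by blast

lemma smooth_on_locally:
  "(\<And>x. x \<in> S \<Longrightarrow> \<exists>V. open V \<and> x \<in> V \<and> smooth_on V f) \<Longrightarrow> smooth_on S f"
  unfolding smooth_on_def by (meson Ck_on_locally)

lemma smooth_on_const [simp]: "smooth_on S (\<lambda>x. c)"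
  by (simp add: smooth_on_def Ck_on_const)

lemma smooth_on_bounded_linear: "bounded_linear f \<Longrightarrow> smooth_on S f"
  by (simp add: smooth_on_def Ck_on_bounded_linear)

lemma smooth_on_linear_image: "bounded_linear h \<Longrightarrow> open S \<Longrightarrow> smooth_on S f \<Longrightarrow> smooth_on S (\<lambda>x. h (f x))"
  by (simp add: smooth_on_def Ck_on_linear_image)

lemma smooth_on_add: "open S \<Longrightarrow> smooth_on S f \<Longrightarrow> smooth_on S g \<Longrightarrow> smooth_on S (\<lambda>x. f x + g x)"
  by (simp add: smooth_on_def Ck_on_add)

lemma smooth_on_sum:
  "open S \<Longrightarrow> (\<And>i. i \<in> I \<Longrightarrow> smooth_on S (f i)) \<Longrightarrow> smooth_on S (\<lambda>x. \<Sum>i\<in>I. f i x)"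
  by (simp add: smooth_on_def Ck_on_sum)

lemma smooth_on_scaleR:
  "open S \<Longrightarrow> smooth_on S f \<Longrightarrow> smooth_on S g \<Longrightarrow> smooth_on S (\<lambda>x. f x *\<^sub>R g x)"
  by (simp add: smooth_on_def Ck_on_bilinear[OF bounded_bilinear_scaleR])

lemma smooth_on_mult:
  fixes f g :: "_ \<Rightarrow> real"
  shows "open S \<Longrightarrow> smooth_on S f \<Longrightarrow> smooth_on S g \<Longrightarrow> smooth_on S (\<lambda>x. f x * g x)"
  by (simp add: smooth_on_def Ck_on_bilinear[OF bounded_bilinear_mult])

lemma smooth_on_compose:
  fixes f :: "'b::euclidean_space \<Rightarrow> 'c::real_normed_vector"
  shows "open S \<Longrightarrow> open V \<Longrightarrow> smooth_on V f \<Longrightarrow> smooth_on S g \<Longrightarrow> g ` S \<subseteq> V \<Longrightarrow> smooth_on S (\<lambda>x. f (g x))"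
  unfolding smooth_on_def using Ck_on_compose by blast

lemma smooth_on_powr:
  fixes f :: "_ \<Rightarrow> real"
  shows "open S \<Longrightarrow> smooth_on S f \<Longrightarrow> (\<And>x. x \<in> S \<Longrightarrow> f x > 0) \<Longrightarrow> smooth_on S (\<lambda>x. f x powr a)"
  using smooth_on_compose[of S "{0<..}" "\<lambda>x. x powr a" f]
  by (auto simp: smooth_on_def Ck_on_powr)

lemma smooth_on_inverse:
  fixes f :: "_ \<Rightarrow> real"
  shows "open S \<Longrightarrow> smooth_on S f \<Longrightarrow> (\<And>x. x \<in> S \<Longrightarrow> f x \<noteq> 0) \<Longrightarrow> smooth_on S (\<lambda>x. inverse (f x))"
  by (rule smooth_on_compose[of S "- {0}" inverse f])
     (auto simp: smooth_on_def Ck_on_inverse open_Compl)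

lemma smooth_on_differentiable: "smooth_on S f \<Longrightarrow> x \<in> S \<Longrightarrow> f differentiable (at x)"
  using smooth_on_Ck[of S f "Suc 0"] by auto

lemma smooth_on_has_derivative:
  "smooth_on S f \<Longrightarrow> x \<in> S \<Longrightarrow> (f has_derivative frechet_derivative f (at x)) (at x)"
  using smooth_on_differentiable frechet_derivative_works by blast

lemma smooth_on_frechet_derivative:
  "smooth_on S f \<Longrightarrow> smooth_on S (\<lambda>x. frechet_derivative f (at x) v)"
  unfolding smooth_on_def by (metis Ck_on.simps(2))

lemma smooth_on_imp_continuous_on: "smooth_on S f \<Longrightarrow> continuous_on S f"
  using smooth_on_Ck[of S f 0] by auto

lemma smooth_on_componentwise:
  fixes f :: "_ \<Rightarrow> 'b::euclidean_space"
  assumes "open S"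
  shows "smooth_on S f \<longleftrightarrow> (\<forall>b\<in>Basis. smooth_on S (\<lambda>x. f x \<bullet> b))"
proof
  assume "smooth_on S f"
  then show "\<forall>b\<in>Basis. smooth_on S (\<lambda>x. f x \<bullet> b)"
    using smooth_on_linear_image[OF bounded_linear_inner_left assms] by blast
next
  assume "\<forall>b\<in>Basis. smooth_on S (\<lambda>x. f x \<bullet> b)"
  then have "smooth_on S (\<lambda>x. \<Sum>b\<in>Basis. (f x \<bullet> b) *\<^sub>R b)"
    by (intro smooth_on_sum smooth_on_scaleR assms) auto
  then show "smooth_on S f" by (simp add: euclidean_representation)
qed


section \<open>Symmetry of second derivatives\<close>

lemma smooth_on_inner_derivative:
  fixes f :: "'a::real_normed_vector \<Rightarrow> 'b::euclidean_space"
  assumes "smooth_on S f" "x \<in> S"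
  shows "frechet_derivative (\<lambda>y. f y \<bullet> b) (at x) v = frechet_derivative f (at x) v \<bullet> b"
proof -
  have "((\<lambda>y. f y \<bullet> b) has_derivative (\<lambda>v. frechet_derivative f (at x) v \<bullet> b)) (at x)"
    by (rule has_derivative_inner_left[OF smooth_on_has_derivative[OF assms]])
  from frechet_derivative_at[OF this] show ?thesis by metis
qed

text \<open>The mixed second difference is symmetric in \<open>v\<close> and \<open>w\<close>, while
  its expression on the right is not; comparing the two readings proves Schwarz's theorem.\<close>

lemma second_difference_mean_value:
  fixes f :: "'a::real_normed_vector \<Rightarrow> real"
  assumes f: "smooth_on S f" and S: "ball x r \<subseteq> S" and h: "h > 0" "h * (norm v + norm w) < r"
  shows "\<exists>y\<in>ball x r. f (x + h *\<^sub>R v + h *\<^sub>R w) - f (x + h *\<^sub>R v) - f (x + h *\<^sub>R w) + f x =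
           h\<^sup>2 * frechet_derivative (\<lambda>y. frechet_derivative f (at y) v) (at y) w"
proof -
  have inb: "x + s *\<^sub>R v + t *\<^sub>R w \<in> ball x r" if "0 \<le> s" "s \<le> h" "0 \<le> t" "t \<le> h" for s t
  proof -
    have "norm (s *\<^sub>R v + t *\<^sub>R w) \<le> s * norm v + t * norm w"
      using that by (metis abs_of_nonneg norm_scaleR norm_triangle_ineq)
    also have "\<dots> \<le> h * norm v + h * norm w"
      using that by (intro add_mono mult_right_mono) auto
    finally have "norm (s *\<^sub>R v + t *\<^sub>R w) < r" using h by (simp add: algebra_simps)
    moreover have "dist x (x + s *\<^sub>R v + t *\<^sub>R w) = norm (s *\<^sub>R v + t *\<^sub>R w)"
      using dist_norm[of "x + (s *\<^sub>R v + t *\<^sub>R w)" x] by (simp add: dist_commute add.assoc)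
    ultimately show ?thesis by simp
  qed
  have line: "((\<lambda>s. F (a + s *\<^sub>R u)) has_real_derivative frechet_derivative F (at (a + s *\<^sub>R u)) u) (at s)"
    if "smooth_on S F" "a + s *\<^sub>R u \<in> S" for F :: "'a \<Rightarrow> real" and a s u
  proof -
    have "((\<lambda>s. a + s *\<^sub>R u) has_derivative (\<lambda>t. t *\<^sub>R u)) (at s)"
      by (auto intro!: derivative_eq_intros)
    from has_derivative_compose[OF this smooth_on_has_derivative[OF that]]
    show ?thesis
      using linear_scale[OF linear_frechet_derivative[OF smooth_on_differentiable[OF that]]]
      by (simp add: has_field_derivative_def mult_commute_abs)
  qed
  \<comment> \<open>Mean value theorem in direction \<open>v\<close>, for the difference of
    \<open>f\<close> along two parallel segments that are \<open>h *\<^sub>R w\<close>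
    apart.\<close>
  have "\<exists>s>0. s < h \<and> (f (x + h *\<^sub>R w + h *\<^sub>R v) - f (x + h *\<^sub>R v)) - (f (x + h *\<^sub>R w + 0 *\<^sub>R v) - f (x + 0 *\<^sub>R v)) =
      (h - 0) * (frechet_derivative f (at (x + h *\<^sub>R w + s *\<^sub>R v)) v - frechet_derivative f (at (x + s *\<^sub>R v)) v)"
  proof (rule MVT2[OF h(1)])
    fix s assume s: "0 \<le> s" "s \<le> h"
    show "((\<lambda>s. f (x + h *\<^sub>R w + s *\<^sub>R v) - f (x + s *\<^sub>R v)) has_real_derivative
       frechet_derivative f (at (x + h *\<^sub>R w + s *\<^sub>R v)) v - frechet_derivative f (at (x + s *\<^sub>R v)) v) (at s)"
      using inb[OF s, of h] inb[OF s, of 0] h(1) S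
      by (intro DERIV_diff line f) (auto simp: algebra_simps)
  qed
  then obtain s where s: "0 < s" "s < h" and
    eq1: "(f (x + h *\<^sub>R w + h *\<^sub>R v) - f (x + h *\<^sub>R v)) - (f (x + h *\<^sub>R w) - f x) =
      h * (frechet_derivative f (at (x + h *\<^sub>R w + s *\<^sub>R v)) v - frechet_derivative f (at (x + s *\<^sub>R v)) v)"
    by auto
  define F where "F = (\<lambda>y. frechet_derivative f (at y) v)"
  have F: "smooth_on S F" unfolding F_def by (rule smooth_on_frechet_derivative[OF f])
  \<comment> \<open>Mean value theorem in direction \<open>w\<close>, for the derivative
    \<open>F\<close>, starting from the point found on the first segment.\<close>
  have "\<exists>t>0. t < h \<and> F (x + s *\<^sub>R v + h *\<^sub>R w) - F (x + s *\<^sub>R v + 0 *\<^sub>R w) =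
      (h - 0) * frechet_derivative F (at (x + s *\<^sub>R v + t *\<^sub>R w)) w"
    using inb s S by (intro MVT2[OF h(1)] line F) auto
  then obtain t where t: "0 < t" "t < h" and
    eq2: "F (x + s *\<^sub>R v + h *\<^sub>R w) - F (x + s *\<^sub>R v) = h * frechet_derivative F (at (x + s *\<^sub>R v + t *\<^sub>R w)) w"
    by auto
  have "x + s *\<^sub>R v + t *\<^sub>R w \<in> ball x r" using inb s t by simp
  moreover have "f (x + h *\<^sub>R v + h *\<^sub>R w) - f (x + h *\<^sub>R v) - f (x + h *\<^sub>R w) + f x =
           h\<^sup>2 * frechet_derivative F (at (x + s *\<^sub>R v + t *\<^sub>R w)) w"
  proof -
    have "f (x + h *\<^sub>R v + h *\<^sub>R w) - f (x + h *\<^sub>R v) - f (x + h *\<^sub>R w) + f x =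
       h * (F (x + h *\<^sub>R w + s *\<^sub>R v) - F (x + s *\<^sub>R v))"
      using eq1 unfolding F_def by (simp add: add.assoc add.commute[of "h *\<^sub>R v"])
    also have "F (x + h *\<^sub>R w + s *\<^sub>R v) = F (x + s *\<^sub>R v + h *\<^sub>R w)"
      by (simp add: add.assoc add.commute[of "h *\<^sub>R w"])
    finally show ?thesis unfolding eq2 by (simp add: power2_eq_square)
  qed
  ultimately show ?thesis unfolding F_def by blast
qed

text \<open>Both iterated derivatives, taken at suitable nearby points, equal the same difference
  quotient. If they differed at \<open>x\<close>, continuity would keep them apart near
  \<open>x\<close>.\<close>

lemma second_derivative_symmetric_real:
  fixes f :: "'a::real_normed_vector \<Rightarrow> real"
  assumes f: "smooth_on S f" and S: "open S" "x \<in> S"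
  shows "frechet_derivative (\<lambda>y. frechet_derivative f (at y) v) (at x) w =
         frechet_derivative (\<lambda>y. frechet_derivative f (at y) w) (at x) v" (is "?a = ?b")
proof (rule ccontr)
  assume "?a \<noteq> ?b"
  then have e: "\<bar>?a - ?b\<bar> / 2 > 0" by simp
  let ?A = "\<lambda>y. frechet_derivative (\<lambda>y. frechet_derivative f (at y) v) (at y) w"
  let ?B = "\<lambda>y. frechet_derivative (\<lambda>y. frechet_derivative f (at y) w) (at y) v"
  have "continuous_on S ?A" "continuous_on S ?B"
    by (intro smooth_on_imp_continuous_on smooth_on_frechet_derivative f)+
  then have "isCont ?A x" "isCont ?B x" using S by (simp_all add: continuous_on_eq_continuous_at)
  then have cA: "\<exists>d>0. \<forall>y. dist y x < d \<longrightarrow> dist (?A y) ?a < \<bar>?a - ?b\<bar> / 2"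
    and cB: "\<exists>d>0. \<forall>y. dist y x < d \<longrightarrow> dist (?B y) ?b < \<bar>?a - ?b\<bar> / 2"
    using e unfolding continuous_at_eps_delta by (fast, fast)
  obtain r1 where r1: "r1 > 0" "\<forall>y. dist y x < r1 \<longrightarrow> dist (?A y) ?a < \<bar>?a - ?b\<bar> / 2"
    using cA by (elim exE conjE)
  obtain r2 where r2: "r2 > 0" "\<forall>y. dist y x < r2 \<longrightarrow> dist (?B y) ?b < \<bar>?a - ?b\<bar> / 2"
    using cB by (elim exE conjE)
  obtain r3 where r3: "r3 > 0" "ball x r3 \<subseteq> S" using S openE by blast
  define r where "r = min r1 (min r2 r3)"
  have rp: "r > 0" "ball x r \<subseteq> S" using r1 r2 r3 by (auto simp: r_def)
  define N where "N = norm v + norm w"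
  have N: "0 \<le> N" by (simp add: N_def)
  \<comment> \<open>Small enough to stay in the ball; adding 1 to \<open>N\<close> covers the case
    that both vectors vanish.\<close>
  define h where "h = r / (2 * (N + 1))"
  have h: "h > 0" using rp(1) N by (simp add: h_def)
  have "h * N < r" using rp(1) N by (simp add: h_def field_simps add_nonneg_pos)
  then have h': "h * (norm w + norm v) < r" "h * (norm v + norm w) < r" by (simp_all add: N_def add.commute)
  obtain y z where y: "y \<in> ball x r" "z \<in> ball x r" and
    e1: "f (x + h *\<^sub>R v + h *\<^sub>R w) - f (x + h *\<^sub>R v) - f (x + h *\<^sub>R w) + f x = h\<^sup>2 * ?A y"
    and e2: "f (x + h *\<^sub>R w + h *\<^sub>R v) - f (x + h *\<^sub>R w) - f (x + h *\<^sub>R v) + f x = h\<^sup>2 * ?B z"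
    using second_difference_mean_value[OF f rp(2) h h'(2)]
      second_difference_mean_value[OF f rp(2) h h'(1)] by blast
  have "x + h *\<^sub>R w + h *\<^sub>R v = x + h *\<^sub>R v + h *\<^sub>R w" by (simp add: add.assoc add.commute)
  note e2[unfolded this]
  with e1 have "h\<^sup>2 * ?A y = h\<^sup>2 * ?B z" by linarith
  then have "?A y = ?B z" using h by simp
  moreover have "\<bar>?A y - ?a\<bar> < \<bar>?a - ?b\<bar> / 2" "\<bar>?B z - ?b\<bar> < \<bar>?a - ?b\<bar> / 2"
    using y r1(2) r2(2) by (auto simp: r_def dist_commute dist_real_def)
  moreover have False if "p = q" "\<bar>p - a\<bar> < \<bar>a - b\<bar> / 2" "\<bar>q - b\<bar> < \<bar>a - b\<bar> / 2" for p q a b :: real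
    using that by (auto simp: abs_if split: if_splits)
  ultimately show False by blast
qed

lemma second_derivative_symmetric:
  fixes f :: "'a::real_normed_vector \<Rightarrow> 'b::euclidean_space"
  assumes f: "smooth_on S f" and S: "open S" "x \<in> S"
  shows "frechet_derivative (\<lambda>y. frechet_derivative f (at y) v) (at x) w =
         frechet_derivative (\<lambda>y. frechet_derivative f (at y) w) (at x) v"
proof (rule euclidean_eqI)
  fix b :: 'b assume "b \<in> Basis"
  have sm: "smooth_on S (\<lambda>y. f y \<bullet> b)"
    by (rule smooth_on_linear_image[OF bounded_linear_inner_left S(1) f])
  have *: "frechet_derivative (\<lambda>y. frechet_derivative f (at y) v) (at x) w \<bullet> b =
      frechet_derivative (\<lambda>y. frechet_derivative (\<lambda>y. f y \<bullet> b) (at y) v) (at x) w" for v w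
  proof -
    have "frechet_derivative (\<lambda>y. frechet_derivative f (at y) v) (at x) w \<bullet> b =
       frechet_derivative (\<lambda>y. frechet_derivative f (at y) v \<bullet> b) (at x) w"
      using smooth_on_inner_derivative[OF smooth_on_frechet_derivative[OF f] S(2)] by metis
    also have "\<dots> = frechet_derivative (\<lambda>y. frechet_derivative (\<lambda>y. f y \<bullet> b) (at y) v) (at x) w"
    proof -
      have "frechet_derivative (\<lambda>y. frechet_derivative f (at y) v \<bullet> b) (at x) =
            frechet_derivative (\<lambda>y. frechet_derivative (\<lambda>y. f y \<bullet> b) (at y) v) (at x)"
        by (rule frechet_derivative_transform_within_open[OF _ S])
           (auto simp: smooth_on_inner_derivative[OF f] intro!: smooth_on_differentiable[OF _ S(2)]
              smooth_on_linear_image[OF bounded_linear_inner_left S(1)] smooth_on_frechet_derivative f)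
      then show ?thesis by simp
    qed
    finally show ?thesis .
  qed
  show "frechet_derivative (\<lambda>y. frechet_derivative f (at y) v) (at x) w \<bullet> b =
     frechet_derivative (\<lambda>y. frechet_derivative f (at y) w) (at x) v \<bullet> b"
    unfolding * by (rule second_derivative_symmetric_real[OF sm S])
qed


section \<open>Charts and components\<close>

text \<open>Smoothness of a field of linear maps is known argument by argument; expanding the moving
  argument in a basis reduces to fixed arguments.\<close>

lemma smooth_on_differential_apply:
  fixes f :: "'a::real_normed_vector \<Rightarrow> 'b::real_normed_vector" and X :: "_ \<Rightarrow> real ^ 'n"
    and f' :: "'a \<Rightarrow> real ^ 'n \<Rightarrow> 'b"
  assumes "open S" "\<And>v. smooth_on S (\<lambda>y. f' y v)" "\<And>y. y \<in> S \<Longrightarrow> linear (f' y)" "smooth_on S X"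
  shows "smooth_on S (\<lambda>y. f' y (X y))"
proof (rule smooth_on_cong[OF assms(1)])
  show "smooth_on S (\<lambda>y. \<Sum>i\<in>Basis. (X y \<bullet> i) *\<^sub>R f' y i)"
    by (intro smooth_on_sum smooth_on_scaleR assms smooth_on_linear_image[OF bounded_linear_inner_left])
  fix y assume "y \<in> S"
  then have "linear (f' y)" using assms(3) by blast
  then have "(\<Sum>i\<in>Basis. (X y \<bullet> i) *\<^sub>R f' y i) = f' y (\<Sum>i\<in>Basis. (X y \<bullet> i) *\<^sub>R i)"
    by (simp add: linear_sum linear_scale)
  then show "(\<Sum>i\<in>Basis. (X y \<bullet> i) *\<^sub>R f' y i) = f' y (X y)"
    by (simp add: euclidean_representation)
qed

lemma bilinear_expansion:
  fixes H :: "'v::euclidean_space \<Rightarrow> 'w::euclidean_space \<Rightarrow> 'b::real_vector"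
  assumes "bilinear H"
  shows "H u v = (\<Sum>i\<in>Basis. \<Sum>j\<in>Basis. ((u \<bullet> i) * (v \<bullet> j)) *\<^sub>R H i j)"
proof -
  have l: "linear (\<lambda>u. H u v)" for v using assms by (simp add: bilinear_def)
  have r: "linear (\<lambda>v. H u v)" for u using assms by (simp add: bilinear_def)
  have "H u v = H (\<Sum>i\<in>Basis. (u \<bullet> i) *\<^sub>R i) (\<Sum>j\<in>Basis. (v \<bullet> j) *\<^sub>R j)"
    by (simp add: euclidean_representation)
  also have "\<dots> = (\<Sum>i\<in>Basis. (u \<bullet> i) *\<^sub>R H i (\<Sum>j\<in>Basis. (v \<bullet> j) *\<^sub>R j))"
    by (subst linear_sum[OF l]) (simp only: linear_scale[OF l])
  also have "\<dots> = (\<Sum>i\<in>Basis. (u \<bullet> i) *\<^sub>R (\<Sum>j\<in>Basis. (v \<bullet> j) *\<^sub>R H i j))"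
    by (subst linear_sum[OF r]) (simp only: linear_scale[OF r])
  finally show ?thesis by (simp add: scaleR_sum_right)
qed

text \<open>A product rule with three moving parts, the form and both arguments. After expansion in
  bases it is the product rule for scalar coefficients.\<close>

lemma has_derivative_bilinear_field:
  fixes H :: "'a::real_normed_vector \<Rightarrow> 'v::euclidean_space \<Rightarrow> 'w::euclidean_space \<Rightarrow> 'b::real_normed_vector"
  assumes S: "open S" "x \<in> S" and bil: "\<And>y. y \<in> S \<Longrightarrow> bilinear (H y)"
    and H: "\<And>u v. ((\<lambda>y. H y u v) has_derivative H' u v) (at x)"
    and a: "(a has_derivative a') (at x)" and b: "(b has_derivative b') (at x)"
  shows "((\<lambda>y. H y (a y) (b y)) has_derivative
           (\<lambda>w. H' (a x) (b x) w + H x (a' w) (b x) + H x (a x) (b' w))) (at x)"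
proof -
  let ?F = "\<lambda>y. \<Sum>i\<in>Basis. \<Sum>j\<in>Basis. ((a y \<bullet> i) * (b y \<bullet> j)) *\<^sub>R H y i j"
  have "(?F has_derivative (\<lambda>w. \<Sum>i\<in>Basis. \<Sum>j\<in>Basis. ((a x \<bullet> i) * (b x \<bullet> j)) *\<^sub>R H' i j w +
       ((a x \<bullet> i) * (b' w \<bullet> j) + (a' w \<bullet> i) * (b x \<bullet> j)) *\<^sub>R H x i j)) (at x)"
    by (intro has_derivative_sum has_derivative_scaleR has_derivative_mult has_derivative_inner_left a b H)
  then have D: "((\<lambda>y. H y (a y) (b y)) has_derivative (\<lambda>w. \<Sum>i\<in>Basis. \<Sum>j\<in>Basis. ((a x \<bullet> i) * (b x \<bullet> j)) *\<^sub>R H' i j w +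
       ((a x \<bullet> i) * (b' w \<bullet> j) + (a' w \<bullet> i) * (b x \<bullet> j)) *\<^sub>R H x i j)) (at x)"
    by (rule has_derivative_transform_within_open[OF _ S]) (simp add: bilinear_expansion[OF bil])
  \<comment> \<open>\<open>H'\<close> inherits the basis expansion from \<open>H\<close> near
    \<open>x\<close>, by uniqueness of derivatives.\<close>
  have H': "H' u v = (\<lambda>w. \<Sum>i\<in>Basis. \<Sum>j\<in>Basis. ((u \<bullet> i) * (v \<bullet> j)) *\<^sub>R H' i j w)" for u v
  proof (rule has_derivative_unique[OF H])
    have "((\<lambda>y. \<Sum>i\<in>Basis. \<Sum>j\<in>Basis. ((u \<bullet> i) * (v \<bullet> j)) *\<^sub>R H y i j) has_derivative
        (\<lambda>w. \<Sum>i\<in>Basis. \<Sum>j\<in>Basis. ((u \<bullet> i) * (v \<bullet> j)) *\<^sub>R H' i j w)) (at x)"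
      by (intro has_derivative_sum has_derivative_scaleR_right H)
    then show "((\<lambda>y. H y u v) has_derivative (\<lambda>w. \<Sum>i\<in>Basis. \<Sum>j\<in>Basis. ((u \<bullet> i) * (v \<bullet> j)) *\<^sub>R H' i j w)) (at x)"
      by (rule has_derivative_transform_within_open[OF _ S]) (simp add: bilinear_expansion[OF bil, symmetric])
  qed
  have "(\<lambda>w. \<Sum>i\<in>Basis. \<Sum>j\<in>Basis. ((a x \<bullet> i) * (b x \<bullet> j)) *\<^sub>R H' i j w +
       ((a x \<bullet> i) * (b' w \<bullet> j) + (a' w \<bullet> i) * (b x \<bullet> j)) *\<^sub>R H x i j) =
     (\<lambda>w. H' (a x) (b x) w + H x (a' w) (b x) + H x (a x) (b' w))"
    by (subst H', subst bilinear_expansion[OF bil[OF S(2)], of "a' _"],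
        subst bilinear_expansion[OF bil[OF S(2)], of "a x"])
       (simp add: sum.distrib scaleR_add_left ac_simps)
  with D show ?thesis by simp
qed

lemma smooth_on_bilinear_apply:
  fixes H :: "'a::real_normed_vector \<Rightarrow> 'v::euclidean_space \<Rightarrow> 'w::euclidean_space \<Rightarrow> 'b::real_normed_vector"
  assumes "open S" "\<And>y. y \<in> S \<Longrightarrow> bilinear (H y)" "\<And>u v. smooth_on S (\<lambda>y. H y u v)"
    "smooth_on S a" "smooth_on S b"
  shows "smooth_on S (\<lambda>y. H y (a y) (b y))"
proof (rule smooth_on_cong[OF assms(1)])
  show "smooth_on S (\<lambda>y. \<Sum>i\<in>Basis. \<Sum>j\<in>Basis. ((a y \<bullet> i) * (b y \<bullet> j)) *\<^sub>R H y i j)"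
    by (intro smooth_on_sum smooth_on_scaleR smooth_on_mult assms
         smooth_on_linear_image[OF bounded_linear_inner_left])
qed (simp add: bilinear_expansion[OF assms(2), symmetric])

section \<open>Transition maps and components of vectors and tensors\<close>

locale smooth_manifold =
  fixes A :: "('m::{t2_space,second_countable_topology}, 'n::finite) chart set"
  assumes atlas: "smooth_atlas A"
begin

lemma chart_open: "c \<in> A \<Longrightarrow> open (fst c)"
  and chart_image_open: "c \<in> A \<Longrightarrow> open (snd c ` fst c)"
  and chart_homeomorphism: "c \<in> A \<Longrightarrow> homeomorphism (fst c) (snd c ` fst c) (snd c) (cinv c)"
  using atlas by (auto simp: smooth_atlas_def is_chart_def)

lemma cinv_chart [simp]: "c \<in> A \<Longrightarrow> p \<in> fst c \<Longrightarrow> cinv c (snd c p) = p"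
  using chart_homeomorphism[of c] unfolding homeomorphism_def by blast

lemma chart_image_Int: "c \<in> A \<Longrightarrow> snd c ` (fst c \<inter> W) = {y \<in> snd c ` fst c. cinv c y \<in> W}"
  by force

lemma chart_image_open_Int: 
  assumes "c \<in> A" "open W" shows "open (snd c ` (fst c \<inter> W))"
proof -
  have "continuous_on (snd c ` fst c) (cinv c)" using chart_homeomorphism[OF assms(1)] by (simp add: homeomorphism_def)
  then show ?thesis
    unfolding chart_image_Int[OF assms(1)]
    using continuous_open_preimage[OF _ chart_image_open[OF assms(1)] assms(2)]
    by (simp add: Int_def vimage_def)
qed

lemma continuous_on_chart: "c \<in> A \<Longrightarrow> continuous_on (fst c) (snd c)"
  and continuous_on_cinv: "c \<in> A \<Longrightarrow> continuous_on (snd c ` fst c) (cinv c)"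
  using chart_homeomorphism unfolding homeomorphism_def by blast+

lemma chart_at_in [simp]: "chart_at A p \<in> A" "p \<in> fst (chart_at A p)"
proof -
  have "\<exists>c. c \<in> A \<and> p \<in> fst c" using atlas unfolding smooth_atlas_def by blast
  from someI_ex[OF this] show "chart_at A p \<in> A" "p \<in> fst (chart_at A p)" by (auto simp: chart_at_def)
qed

lemma smooth_on_transition:
  "c \<in> A \<Longrightarrow> c' \<in> A \<Longrightarrow> smooth_on (snd c ` (fst c \<inter> fst c')) (snd c' \<circ> cinv c)"
  using atlas by (auto simp: smooth_atlas_def)

lemma has_derivative_transition:
  assumes "c \<in> A" "c' \<in> A" "p \<in> fst c" "p \<in> fst c'"
  shows "((snd c' \<circ> cinv c) has_derivative coord_change c c' p) (at (snd c p))"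
  unfolding coord_change_def
  using smooth_on_has_derivative[OF smooth_on_transition[OF assms(1,2)]] assms by blast

lemma linear_coord_change:
  "c \<in> A \<Longrightarrow> c' \<in> A \<Longrightarrow> p \<in> fst c \<Longrightarrow> p \<in> fst c' \<Longrightarrow> linear (coord_change c c' p)"
  using has_derivative_transition has_derivative_linear by blast

lemma coord_change_same:
  assumes "c \<in> A" "p \<in> fst c" shows "coord_change c c p = (\<lambda>v. v)"
proof -
  have "((snd c \<circ> cinv c) has_derivative (\<lambda>v. v)) (at (snd c p))"
    by (rule has_derivative_transform_within_open[OF has_derivative_ident chart_image_open[OF assms(1)]])
       (use assms in auto)
  with has_derivative_transition[OF assms(1) assms(1) assms(2) assms(2)]
  show ?thesis by (rule has_derivative_unique)
qed

text \<open>The chain rule for transition maps. With equal first and third chart it inverts a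
  coordinate change, which makes \<open>comps\<close> and \<open>tvec\<close> mutually
  inverse.\<close>

lemma coord_change_trans:
  assumes "c \<in> A" "c' \<in> A" "c'' \<in> A" "p \<in> fst c" "p \<in> fst c'" "p \<in> fst c''"
  shows "coord_change c' c'' p (coord_change c c' p v) = coord_change c c'' p v"
proof -
  have eq: "(snd c' \<circ> cinv c) (snd c p) = snd c' p" using assms by simp
  have "((snd c'' \<circ> cinv c') has_derivative coord_change c' c'' p) (at ((snd c' \<circ> cinv c) (snd c p)))"
    unfolding eq by (rule has_derivative_transition[OF assms(2,3,5,6)])
  from has_derivative_compose[OF has_derivative_transition[OF assms(1,2,4,5)] this]
  have "((\<lambda>y. (snd c'' \<circ> cinv c') ((snd c' \<circ> cinv c) y)) has_derivative
      (\<lambda>v. coord_change c' c'' p (coord_change c c' p v))) (at (snd c p))" .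
  then have "((snd c'' \<circ> cinv c) has_derivative
      (\<lambda>v. coord_change c' c'' p (coord_change c c' p v))) (at (snd c p))"
    by (rule has_derivative_transform_within_open[OF _ chart_image_open_Int[OF assms(1) chart_open[OF assms(2)]]])
       (use assms in auto)
  from has_derivative_unique[OF this has_derivative_transition[OF assms(1,3,4,6)]] show ?thesis
    by metis
qed

lemma comps_tvec [simp]: "c \<in> A \<Longrightarrow> p \<in> fst c \<Longrightarrow> comps A c p (tvec A c p v) = v"
  and tvec_comps [simp]: "c \<in> A \<Longrightarrow> p \<in> fst c \<Longrightarrow> tvec A c p (comps A c p v) = v"
  by (simp_all add: comps_def tvec_def coord_change_trans coord_change_same)

lemma comps_chart_at [simp]: "comps A (chart_at A p) p v = v"
  and tvec_chart_at [simp]: "tvec A (chart_at A p) p v = v"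
  by (simp_all add: comps_def tvec_def coord_change_same)

lemma linear_comps: "c \<in> A \<Longrightarrow> p \<in> fst c \<Longrightarrow> linear (comps A c p)"
  and linear_tvec: "c \<in> A \<Longrightarrow> p \<in> fst c \<Longrightarrow> linear (tvec A c p)"
  unfolding comps_def [abs_def] tvec_def [abs_def]
  by (rule linear_coord_change; simp)+

lemma comps_eq_coord_change:
  "c \<in> A \<Longrightarrow> c' \<in> A \<Longrightarrow> p \<in> fst c \<Longrightarrow> p \<in> fst c' \<Longrightarrow>
     comps A c' p v = coord_change c c' p (comps A c p v)"
  by (simp add: comps_def coord_change_trans)

lemma tvec_coord_change:
  "c \<in> A \<Longrightarrow> c' \<in> A \<Longrightarrow> p \<in> fst c \<Longrightarrow> p \<in> fst c' \<Longrightarrow>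
     tvec A c' p (coord_change c c' p v) = tvec A c p v"
  by (simp add: tvec_def coord_change_trans)

lemma vf_rep_coord_change:
  "c \<in> A \<Longrightarrow> c' \<in> A \<Longrightarrow> p \<in> fst c \<Longrightarrow> p \<in> fst c' \<Longrightarrow>
     vf_rep A c' X (snd c' p) = coord_change c c' p (vf_rep A c X (snd c p))"
  by (simp add: vf_rep_def comps_eq_coord_change[of c c'])

lemma rep02_coord_change:
  "c \<in> A \<Longrightarrow> c' \<in> A \<Longrightarrow> p \<in> fst c \<Longrightarrow> p \<in> fst c' \<Longrightarrow>
     rep02 A c h (snd c p) u v = rep02 A c' h (snd c' p) (coord_change c c' p u) (coord_change c c' p v)"
  by (simp add: rep02_def tvec_coord_change)

lemma rep12_coord_change:
  "c \<in> A \<Longrightarrow> c' \<in> A \<Longrightarrow> p \<in> fst c \<Longrightarrow> p \<in> fst c' \<Longrightarrow>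
     rep12 A c' T (snd c' p) (coord_change c c' p u) (coord_change c c' p v) =
     coord_change c c' p (rep12 A c T (snd c p) u v)"
  by (simp add: rep12_def tvec_coord_change comps_eq_coord_change[of c c'])

lemma rep02_chart_at: "rep02 A (chart_at A p) h (snd (chart_at A p) p) u v = h p u v"
  by (simp add: rep02_def)

lemma rep12_chart_at: "rep12 A (chart_at A p) T (snd (chart_at A p) p) u v = T p u v"
  by (simp add: rep12_def)

lemma bilinear_rep02:
  assumes "c \<in> A" "p \<in> fst c" "bilinear (h p)" shows "bilinear (rep02 A c h (snd c p))"
proof -
  have l: "linear (\<lambda>u. h p u v)" "linear (h p u)" for u v using assms(3) by (simp_all add: bilinear_def)
  show ?thesis
    using linear_compose[OF linear_tvec[OF assms(1,2)] l(1)] linear_compose[OF linear_tvec[OF assms(1,2)] l(2)]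
      assms(1,2) by (simp add: bilinear_def rep02_def o_def)
qed

lemma bilinear_rep12:
  assumes "c \<in> A" "p \<in> fst c" "bilinear (T p)" shows "bilinear (rep12 A c T (snd c p))"
proof -
  have l: "linear (\<lambda>u. T p u v)" "linear (T p u)" for u v using assms(3) by (simp_all add: bilinear_def)
  show ?thesis
    using linear_compose[OF linear_compose[OF linear_tvec[OF assms(1,2)] l(1)] linear_comps[OF assms(1,2)]]
      linear_compose[OF linear_compose[OF linear_tvec[OF assms(1,2)] l(2)] linear_comps[OF assms(1,2)]]
      assms(1,2) by (simp add: bilinear_def rep12_def o_def)
qed

lemma smooth_vfield_on: "smooth_vfield A W X \<Longrightarrow> c \<in> A \<Longrightarrow> smooth_on (snd c ` (fst c \<inter> W)) (vf_rep A c X)"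
  by (simp add: smooth_vfield_def)

lemma smooth_tensor02_on:
  "smooth_tensor02 A W h \<Longrightarrow> c \<in> A \<Longrightarrow> smooth_on (snd c ` (fst c \<inter> W)) (\<lambda>y. rep02 A c h y u v)"
  by (simp add: smooth_tensor02_def)

lemma smooth_tensor12_on:
  "smooth_tensor12 A W h \<Longrightarrow> c \<in> A \<Longrightarrow> smooth_on (snd c ` (fst c \<inter> W)) (\<lambda>y. rep12 A c h y u v)"
  by (simp add: smooth_tensor12_def)

lemma smooth_on_coord_change:
  assumes "c \<in> A" "c' \<in> A"
  shows "smooth_on (snd c ` (fst c \<inter> fst c')) (\<lambda>y. coord_change c c' (cinv c y) v)"
proof (rule smooth_on_cong)
  show "smooth_on (snd c ` (fst c \<inter> fst c')) (\<lambda>y. frechet_derivative (snd c' \<circ> cinv c) (at y) v)"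
    by (rule smooth_on_frechet_derivative[OF smooth_on_transition[OF assms]])
qed (use assms in \<open>auto simp: coord_change_def chart_image_open_Int chart_open\<close>)

text \<open>One chart around each point is enough: in any other chart the components are transformed
  by the differential of a transition map, which is smooth in the point and linear in the
  vector.\<close>

lemma smooth_vfieldI:
  assumes "open W" "\<And>p. p \<in> W \<Longrightarrow> \<exists>c\<in>A. p \<in> fst c \<and> (\<exists>V. open V \<and> p \<in> V \<and> smooth_on (snd c ` (fst c \<inter> V)) (vf_rep A c X))"
  shows "smooth_vfield A W X"
  unfolding smooth_vfield_def
proof (intro ballI smooth_on_locally)
  fix c' y assume c': "c' \<in> A" and y: "y \<in> snd c' ` (fst c' \<inter> W)"
  then obtain p where p: "p \<in> fst c'" "p \<in> W" "y = snd c' p" by blast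
  from assms(2)[OF p(2)] obtain c V where c: "c \<in> A" "p \<in> fst c" "open V" "p \<in> V"
    "smooth_on (snd c ` (fst c \<inter> V)) (vf_rep A c X)" by blast
  define N where "N = snd c' ` (fst c' \<inter> (fst c \<inter> V))"
  have N: "open N" unfolding N_def using c c' by (intro chart_image_open_Int open_Int chart_open)
  have "smooth_on N (vf_rep A c' X)"
  proof (rule smooth_on_cong[OF N])
    have sub: "(snd c \<circ> cinv c') ` N \<subseteq> snd c ` (fst c \<inter> (fst c' \<inter> V))"
      using c' by (auto simp: N_def)
    have s0: "smooth_on N (snd c \<circ> cinv c')"
      by (rule smooth_on_subset[OF smooth_on_transition[OF c' c(1)]]) (auto simp: N_def)
    have s1: "smooth_on N (\<lambda>y. vf_rep A c X ((snd c \<circ> cinv c') y))"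
      by (rule smooth_on_compose[OF N chart_image_open_Int[OF c(1) c(3)] c(5) s0])
         (use c' in \<open>auto simp: N_def\<close>)
    have s2: "smooth_on N (\<lambda>y. coord_change c c' (cinv c ((snd c \<circ> cinv c') y)) v)" for v
      by (rule smooth_on_compose[OF N chart_image_open_Int[OF c(1) chart_open[OF c']]
           smooth_on_coord_change[OF c(1) c'] s0]) (use c' in \<open>auto simp: N_def\<close>)
    show "smooth_on N (\<lambda>y. coord_change c c' (cinv c ((snd c \<circ> cinv c') y)) (vf_rep A c X ((snd c \<circ> cinv c') y)))"
      by (rule smooth_on_differential_apply[OF N s2 _ s1])
         (use c c' in \<open>auto simp: N_def linear_coord_change\<close>)
    fix y assume "y \<in> N"
    then show "coord_change c c' (cinv c ((snd c \<circ> cinv c') y)) (vf_rep A c X ((snd c \<circ> cinv c') y)) = vf_rep A c' X y"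
      using c c' vf_rep_coord_change[OF c(1) c'] by (auto simp: N_def)
  qed
  moreover have "y \<in> N" using p c by (auto simp: N_def)
  ultimately show "\<exists>V. open V \<and> y \<in> V \<and> smooth_on V (vf_rep A c' X)" using N by blast
qed

text \<open>In the preferred chart of \<open>p\<close> the components are constant, so its domain is
  a neighbourhood on which the extensions entering \<open>curv\<close> are smooth.\<close>

lemma smooth_vfield_const_ext: "smooth_vfield A (fst (chart_at A p)) (const_ext A p u)"
proof (rule smooth_vfieldI)
  let ?c = "chart_at A p"
  fix q assume q: "q \<in> fst ?c"
  have "smooth_on (snd ?c ` (fst ?c \<inter> fst ?c)) (vf_rep A ?c (const_ext A p u))"
    by (rule smooth_on_cong[where f = "\<lambda>y. u"])
       (auto simp: vf_rep_def const_ext_def chart_image_open)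
  then show "\<exists>c\<in>A. q \<in> fst c \<and> (\<exists>V. open V \<and> q \<in> V \<and> smooth_on (snd c ` (fst c \<inter> V)) (vf_rep A c (const_ext A p u)))"
    using q chart_open[of ?c] by (intro bexI[of _ ?c]) auto
qed (simp add: chart_open)

lemma const_ext_at [simp]: "const_ext A p u p = u"
  by (simp add: const_ext_def)

lemma vf_rep_at: "c \<in> A \<Longrightarrow> p \<in> fst c \<Longrightarrow> vf_rep A c X (snd c p) = comps A c p (X p)"
  by (simp add: vf_rep_def)

end


section \<open>Nondegenerate bilinear forms and their Christoffel symbols\<close>

definition gram :: "(real ^ 'n \<Rightarrow> real ^ 'n \<Rightarrow> real) \<Rightarrow> real ^ 'n ^ 'n" where
  "gram G = (\<chi> i j. G (axis i 1) (axis j 1))"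

text \<open>The vector \<open>G\<close>-dual to the \<open>l\<close>-th coordinate form, written with Cramer's rule so that its
  smooth dependence on \<open>G\<close> is evident.\<close>

definition dual_axis :: "(real ^ 'n::finite \<Rightarrow> real ^ 'n \<Rightarrow> real) \<Rightarrow> 'n \<Rightarrow> real ^ 'n" where
  "dual_axis G l = (\<chi> i. det (\<chi> r s. if s = i then axis l 1 $ r else gram G $ r $ s) / det (gram G))"

lemma bilinear_axis_expansion:
  fixes H :: "real ^ 'n::finite \<Rightarrow> real ^ 'n \<Rightarrow> 'b::real_vector"
  assumes "bilinear H"
  shows "H u v = (\<Sum>i\<in>UNIV. \<Sum>j\<in>UNIV. (u $ i * v $ j) *\<^sub>R H (axis i 1) (axis j 1))"
proof -
  have eqB: "(Basis :: (real ^ 'n) set) = range (\<lambda>i. axis i 1)"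
    by (auto simp: Basis_vec_def)
  have inj: "inj (\<lambda>i. axis i (1::real) :: real ^ 'n)" by (auto simp: inj_on_def axis_eq_axis)
  show ?thesis
    unfolding bilinear_expansion[OF assms, of u v] eqB
    by (simp add: sum.reindex[OF inj] o_def cart_eq_inner_axis)
qed

lemma linear_axis_expansion:
  fixes h :: "real ^ 'n::finite \<Rightarrow> 'b::real_vector"
  assumes "linear h" shows "h u = (\<Sum>i\<in>UNIV. u $ i *\<^sub>R h (axis i 1))"
proof -
  have "h u = h (\<Sum>i\<in>UNIV. u $ i *\<^sub>R axis i 1)"
    using basis_expansion[of u] by (simp add: scalar_mult_eq_scaleR)
  then show ?thesis using assms by (simp add: linear_sum linear_scale)
qed

lemma bilinear_gram:
  fixes G :: "real ^ 'n::finite \<Rightarrow> real ^ 'n \<Rightarrow> real"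
  assumes "bilinear G" shows "G u v = u \<bullet> (gram G *v v)"
  unfolding bilinear_axis_expansion[OF assms, of u v]
  by (simp add: gram_def inner_vec_def matrix_vector_mult_def sum_distrib_left ac_simps)

lemma det_gram_nonzero:
  fixes G :: "real ^ 'n::finite \<Rightarrow> real ^ 'n \<Rightarrow> real"
  assumes "bilinear G" "\<And>u v. G u v = G v u" "\<And>u. (\<And>v. G u v = 0) \<Longrightarrow> u = 0"
  shows "det (gram G) \<noteq> 0"
proof -
  have "u = 0" if "gram G *v u = 0" for u
    using assms(3)[of u] that assms(2)[of u] by (simp add: bilinear_gram[OF assms(1)])
  then show ?thesis
    using matrix_left_invertible_ker[of "gram G"] invertible_left_inverse invertible_det_nz by blast
qed

lemma dual_axis:
  fixes G :: "real ^ 'n::finite \<Rightarrow> real ^ 'n \<Rightarrow> real"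
  assumes "bilinear G" "det (gram G) \<noteq> 0"
  shows "G u (dual_axis G l) = u $ l"
proof -
  have "gram G *v dual_axis G l = axis l 1"
    using cramer[OF assms(2), of "dual_axis G l" "axis l 1"] by (simp add: dual_axis_def)
  then show ?thesis by (simp add: bilinear_gram[OF assms(1)] cart_eq_inner_axis)
qed

text \<open>Nondegeneracy is recorded by the Gram determinant, the form in which Cramer's rule uses
  it; no signature is fixed.\<close>

definition metric_field :: "'a::euclidean_space set \<Rightarrow> ('a \<Rightarrow> real ^ 'n::finite \<Rightarrow> real ^ 'n \<Rightarrow> real) \<Rightarrow> bool" where
  "metric_field S G \<longleftrightarrow> open S \<and> (\<forall>y\<in>S. bilinear (G y) \<and> (\<forall>u v. G y u v = G y v u) \<and> det (gram (G y)) \<noteq> 0) \<and>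
     (\<forall>u v. smooth_on S (\<lambda>y. G y u v))"

text \<open>The direction comes before the tensor arguments, so that
  \<open>pderiv_field H y w\<close> can again be treated as a bilinear map.\<close>

definition pderiv_field :: "('a::real_normed_vector \<Rightarrow> 'v \<Rightarrow> 'w \<Rightarrow> 'b::real_normed_vector) \<Rightarrow> 'a \<Rightarrow> 'a \<Rightarrow> 'v \<Rightarrow> 'w \<Rightarrow> 'b" where
  "pderiv_field H y w u v = frechet_derivative (\<lambda>y. H y u v) (at y) w"

text \<open>Christoffel symbols of the first kind: Koszul's formula for constant coordinate fields,
  whose brackets vanish.\<close>

definition koszul :: "(real ^ 'n \<Rightarrow> real ^ 'n \<Rightarrow> real ^ 'n \<Rightarrow> real) \<Rightarrow> real ^ 'n::finite \<Rightarrow> real ^ 'n \<Rightarrow> real ^ 'n \<Rightarrow> real ^ 'n \<Rightarrow> real" where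
  "koszul G y u v w = (pderiv_field G y u v w + pderiv_field G y v u w - pderiv_field G y w u v) / 2"

text \<open>Christoffel symbols of the second kind, the index being raised through the vectors dual
  to the coordinate axes.\<close>

definition christoffel :: "(real ^ 'n \<Rightarrow> real ^ 'n \<Rightarrow> real ^ 'n \<Rightarrow> real) \<Rightarrow> real ^ 'n::finite \<Rightarrow> real ^ 'n \<Rightarrow> real ^ 'n \<Rightarrow> real ^ 'n" where
  "christoffel G y u v = (\<Sum>l\<in>UNIV. koszul G y u v (axis l 1) *\<^sub>R dual_axis (G y) l)"

text \<open>The identities of bilinearity hold on a neighbourhood, so they may be differentiated;
  uniqueness of derivatives transfers them.\<close>

lemma bilinear_pderiv_field:
  fixes H :: "'a::real_normed_vector \<Rightarrow> 'v::euclidean_space \<Rightarrow> 'w::euclidean_space \<Rightarrow> 'b::real_normed_vector"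
  assumes S: "open S" "x \<in> S" and bil: "\<And>y. y \<in> S \<Longrightarrow> bilinear (H y)"
    and H: "\<And>u v. (\<lambda>y. H y u v) differentiable (at x)"
  shows "bilinear (pderiv_field H x w)"
proof -
  have D: "((\<lambda>y. H y u v) has_derivative (\<lambda>w. pderiv_field H x w u v)) (at x)" for u v
    using H frechet_derivative_works by (auto simp: pderiv_field_def)
  have l: "(\<lambda>w. pderiv_field H x w (u + u') v) = (\<lambda>w. pderiv_field H x w u v + pderiv_field H x w u' v)" for u u' v
    by (rule has_derivative_unique[OF D], rule has_derivative_transform_within_open[OF has_derivative_add[OF D D] S])
       (simp add: bilinear_ladd[OF bil])
  have r: "(\<lambda>w. pderiv_field H x w u (v + v')) = (\<lambda>w. pderiv_field H x w u v + pderiv_field H x w u v')" for u v' v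
    by (rule has_derivative_unique[OF D], rule has_derivative_transform_within_open[OF has_derivative_add[OF D D] S])
       (simp add: bilinear_radd[OF bil])
  have ls: "(\<lambda>w. pderiv_field H x w (a *\<^sub>R u) v) = (\<lambda>w. a *\<^sub>R pderiv_field H x w u v)" for a u v
    by (rule has_derivative_unique[OF D], rule has_derivative_transform_within_open[OF has_derivative_scaleR_right[OF D] S])
       (simp add: bilinear_lmul[OF bil])
  have rs: "(\<lambda>w. pderiv_field H x w u (a *\<^sub>R v)) = (\<lambda>w. a *\<^sub>R pderiv_field H x w u v)" for a u v
    by (rule has_derivative_unique[OF D], rule has_derivative_transform_within_open[OF has_derivative_scaleR_right[OF D] S])
       (simp add: bilinear_rmul[OF bil])
  show ?thesis
    unfolding bilinear_def using fun_cong[OF l, of w] fun_cong[OF r, of w] fun_cong[OF ls, of w] fun_cong[OF rs, of w]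
    by (auto intro!: linearI)
qed

lemma metric_fieldD:
  assumes "metric_field S G"
  shows "open S" "\<And>y. y \<in> S \<Longrightarrow> bilinear (G y)" "\<And>y u v. y \<in> S \<Longrightarrow> G y u v = G y v u"
    "\<And>y. y \<in> S \<Longrightarrow> det (gram (G y)) \<noteq> 0" "\<And>u v. smooth_on S (\<lambda>y. G y u v)"
    "\<And>y u v. y \<in> S \<Longrightarrow> (\<lambda>y. G y u v) differentiable (at y)"
  using assms unfolding metric_field_def by (blast, blast, blast, blast, blast, meson smooth_on_differentiable)

lemma metric_field_nondegenerate:
  assumes "metric_field S G" "y \<in> S" "\<And>w. G y w u = G y w v" shows "u = v"
proof -
  have "gram (G y) *v (u - v) = 0"
  proof (rule vector_eq_ldot[THEN iffD1], intro allI)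
    fix w show "w \<bullet> (gram (G y) *v (u - v)) = w \<bullet> 0"
      using assms(3)[of w] bilinear_rsub[OF metric_fieldD(2)[OF assms(1,2)], of w u v]
      by (simp add: bilinear_gram[OF metric_fieldD(2)[OF assms(1,2)], symmetric])
  qed
  then have "u - v = 0"
    using metric_fieldD(4)[OF assms(1,2)] matrix_left_invertible_ker[of "gram (G y)"]
      invertible_left_inverse invertible_det_nz by blast
  then show ?thesis by simp
qed

context
  fixes S and G :: "real ^ 'n::finite \<Rightarrow> real ^ 'n \<Rightarrow> real ^ 'n \<Rightarrow> real" and y
  assumes G: "metric_field S G" and y: "y \<in> S"
begin

lemma bilinear_pderiv_metric: "bilinear (pderiv_field G y w)"
  using bilinear_pderiv_field[of S y G] metric_fieldD[OF G] y by blast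

lemma pderiv_metric_sym: "pderiv_field G y w u v = pderiv_field G y w v u"
proof -
  have "frechet_derivative (\<lambda>y. G y u v) (at y) = frechet_derivative (\<lambda>y. G y v u) (at y)"
    by (rule frechet_derivative_transform_within_open[OF metric_fieldD(6)[OF G y] metric_fieldD(1)[OF G] y])
       (rule metric_fieldD(3)[OF G])
  then show ?thesis by (simp add: pderiv_field_def)
qed

lemma linear_pderiv_metric: "linear (\<lambda>w. pderiv_field G y w u v)"
  unfolding pderiv_field_def
  using linear_frechet_derivative[OF metric_fieldD(6)[OF G y, of u v]] by simp

lemmas pderiv_metric_linear =
  linear_add[OF linear_pderiv_metric] linear_scale[OF linear_pderiv_metric]
  bilinear_ladd[OF bilinear_pderiv_metric] bilinear_radd[OF bilinear_pderiv_metric]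
  bilinear_lmul[OF bilinear_pderiv_metric] bilinear_rmul[OF bilinear_pderiv_metric]

lemma bilinear_koszul: "bilinear (\<lambda>u v. koszul G y u v w)"
  unfolding bilinear_def koszul_def
  by (auto intro!: linearI simp: pderiv_metric_linear add_divide_distrib diff_divide_distrib algebra_simps)

lemma linear_koszul: "linear (koszul G y u v)"
  unfolding koszul_def [abs_def]
  by (auto intro!: linearI simp: pderiv_metric_linear add_divide_distrib diff_divide_distrib algebra_simps)

lemma metric_christoffel: "G y w (christoffel G y u v) = koszul G y u v w"
proof -
  have "linear (G y w)" using metric_fieldD(2)[OF G y] by (simp add: bilinear_def)
  then have "G y w (christoffel G y u v) = (\<Sum>l\<in>UNIV. koszul G y u v (axis l 1) * (w $ l))"
    by (simp add: christoffel_def linear_sum linear_scale dual_axis[OF metric_fieldD(2,4)[OF G y]])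
  then show ?thesis by (simp add: linear_axis_expansion[OF linear_koszul, of u v w] mult.commute)
qed

lemma christoffel_sym: "christoffel G y u v = christoffel G y v u"
  by (simp add: christoffel_def koszul_def pderiv_metric_sym[of _ u v] add.commute)

lemma bilinear_christoffel: "bilinear (christoffel G y)"
  unfolding bilinear_def christoffel_def
  by (auto intro!: linearI simp: bilinear_ladd[OF bilinear_koszul] bilinear_radd[OF bilinear_koszul]
      bilinear_lmul[OF bilinear_koszul] bilinear_rmul[OF bilinear_koszul]
      scaleR_add_left sum.distrib scaleR_sum_right)

lemma christoffel_compatible:
  "pderiv_field G y w u v = G y (christoffel G y w u) v + G y u (christoffel G y w v)"
proof -
  have "G y (christoffel G y w u) v = koszul G y w u v"
    using metric_christoffel[of v w u] metric_fieldD(3)[OF G y] by metis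
  moreover have "G y u (christoffel G y w v) = koszul G y w v u"
    by (rule metric_christoffel)
  moreover have "pderiv_field G y w v u = pderiv_field G y w u v" by (rule pderiv_metric_sym)
  ultimately show ?thesis unfolding koszul_def by simp
qed

text \<open>Koszul's argument: in the alternating sum of three compatibility equations, symmetry
  cancels everything except twice \<open>G y w (\<gamma> u v)\<close>, and nondegeneracy recovers
  \<open>\<gamma>\<close>.\<close>

lemma christoffel_unique:
  assumes symm: "\<And>u v. \<gamma> u v = \<gamma> v u"
    and compat: "\<And>u v w. pderiv_field G y w u v = G y (\<gamma> w u) v + G y u (\<gamma> w v)"
  shows "\<gamma> = christoffel G y"
proof (intro ext)
  fix u v
  show "\<gamma> u v = christoffel G y u v"
  proof (rule metric_field_nondegenerate[OF G y])
    fix w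
    have "koszul G y u v w = G y w (\<gamma> u v)"
      unfolding koszul_def compat
      using symm[of u v] symm[of u w] symm[of v w] metric_fieldD(3)[OF G y] by simp
    then show "G y w (\<gamma> u v) = G y w (christoffel G y u v)" by (simp add: metric_christoffel)
  qed
qed

end

text \<open>The classical transformation law follows from uniqueness: pushing the symbols of
  \<open>G\<close> forward and subtracting the second derivative of \<open>\<tau>\<close> gives a
  map that is symmetric and compatible with \<open>G'\<close>. No components are calculated.\<close>

lemma christoffel_transform:
  fixes G G' :: "real ^ 'n::finite \<Rightarrow> real ^ 'n \<Rightarrow> real ^ 'n \<Rightarrow> real"
  assumes G: "metric_field S G" "x \<in> S" and G': "metric_field S' G'" and \<tau>: "smooth_on S \<tau>" "\<tau> ` S \<subseteq> S'"
    and eq: "\<And>y u v. y \<in> S \<Longrightarrow> G y u v = G' (\<tau> y) (frechet_derivative \<tau> (at y) u) (frechet_derivative \<tau> (at y) v)"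
    and M: "\<And>u. L (M u) = u" and L: "L = frechet_derivative \<tau> (at x)"
  shows "L (christoffel G x u v) =
     christoffel G' (\<tau> x) (L u) (L v) + frechet_derivative (\<lambda>y. frechet_derivative \<tau> (at y) v) (at x) u"
proof -
  have x': "\<tau> x \<in> S'" using \<tau> G by auto
  let ?D2 = "\<lambda>u v. frechet_derivative (\<lambda>y. frechet_derivative \<tau> (at y) v) (at x) u"
  have linL: "linear L" unfolding L by (rule linear_frechet_derivative[OF smooth_on_differentiable[OF \<tau>(1) G(2)]])
  \<comment> \<open>\<open>M\<close> is a right inverse of an endomorphism of a finite-dimensional
    space, hence also a left inverse.\<close>
  have MoL: "M (L u) = u" for u
    using linear_surjective_imp_injective[OF linL] M by (metis injD surj_def)
  have D2sym: "?D2 u v = ?D2 v u" for u v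
    by (rule second_derivative_symmetric[OF \<tau>(1) metric_fieldD(1)[OF G(1)] G(2)])
  define \<gamma> where "\<gamma> u v = L (christoffel G x (M u) (M v)) - ?D2 (M u) (M v)" for u v
  have "\<gamma> = christoffel G' (\<tau> x)"
  proof (rule christoffel_unique[OF G' x'])
    fix u v show "\<gamma> u v = \<gamma> v u"
      unfolding \<gamma>_def by (simp add: christoffel_sym[OF G, of "M u"] D2sym[of "M u"])
  next
    fix u' v' w'
    define u v w where "u = M u'" and "v = M v'" and "w = M w'"
    have uvw: "u' = L u" "v' = L v" "w' = L w" by (simp_all add: u_def v_def w_def M)
    have D\<tau>: "(\<tau> has_derivative L) (at x)" unfolding L by (rule smooth_on_has_derivative[OF \<tau>(1) G(2)])
    have DH: "((\<lambda>y. G' (\<tau> y) a b) has_derivative (\<lambda>w. pderiv_field G' (\<tau> x) (L w) a b)) (at x)" for a b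
      unfolding pderiv_field_def
      by (rule has_derivative_compose[OF D\<tau> smooth_on_has_derivative[OF metric_fieldD(5)[OF G'] x']])
    have Da: "((\<lambda>y. frechet_derivative \<tau> (at y) a) has_derivative (\<lambda>w. ?D2 w a)) (at x)" for a
      by (rule smooth_on_has_derivative[OF smooth_on_frechet_derivative[OF \<tau>(1)] G(2)])
    \<comment> \<open>The pull-back relation \<open>eq\<close> is differentiated: the form moves
      along \<open>\<tau>\<close>, and both differentials move with \<open>y\<close>.\<close>
    have "((\<lambda>y. G' (\<tau> y) (frechet_derivative \<tau> (at y) u) (frechet_derivative \<tau> (at y) v)) has_derivative
        (\<lambda>w. pderiv_field G' (\<tau> x) (L w) (frechet_derivative \<tau> (at x) u) (frechet_derivative \<tau> (at x) v)
           + G' (\<tau> x) (?D2 w u) (frechet_derivative \<tau> (at x) v)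
           + G' (\<tau> x) (frechet_derivative \<tau> (at x) u) (?D2 w v))) (at x)"
      by (rule has_derivative_bilinear_field[OF metric_fieldD(1)[OF G(1)] G(2) _ DH Da Da])
         (use metric_fieldD(2)[OF G'] \<tau>(2) in blast)
    then have "((\<lambda>y. G y u v) has_derivative
        (\<lambda>w. pderiv_field G' (\<tau> x) (L w) (L u) (L v) + G' (\<tau> x) (?D2 w u) (L v) + G' (\<tau> x) (L u) (?D2 w v))) (at x)"
      unfolding L
      by (rule has_derivative_transform_within_open[OF _ metric_fieldD(1)[OF G(1)] G(2)]) (simp add: eq)
    from fun_cong[OF frechet_derivative_at[OF this], of w, symmetric]
    have "pderiv_field G x w u v =
       pderiv_field G' (\<tau> x) (L w) (L u) (L v) + G' (\<tau> x) (?D2 w u) (L v) + G' (\<tau> x) (L u) (?D2 w v)"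
      unfolding pderiv_field_def[of G] .
    moreover have "pderiv_field G x w u v = G' (\<tau> x) (L (christoffel G x w u)) (L v) + G' (\<tau> x) (L u) (L (christoffel G x w v))"
      using christoffel_compatible[OF G, of w u v] unfolding eq[OF G(2)] L .
    ultimately show "pderiv_field G' (\<tau> x) w' u' v' = G' (\<tau> x) (\<gamma> w' u') v' + G' (\<tau> x) u' (\<gamma> w' v')"
      unfolding uvw \<gamma>_def MoL bilinear_lsub[OF metric_fieldD(2)[OF G' x']]
        bilinear_rsub[OF metric_fieldD(2)[OF G' x']]
      by linarith
  qed
  from fun_cong[OF fun_cong[OF this, of "L u"], of "L v"] show ?thesis
    unfolding \<gamma>_def MoL by (simp add: algebra_simps)
qed

lemma smooth_on_prod:
  fixes f :: "'i \<Rightarrow> 'a::real_normed_vector \<Rightarrow> real"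
  assumes "open S" "\<And>i. i \<in> I \<Longrightarrow> smooth_on S (f i)"
  shows "smooth_on S (\<lambda>x. \<Prod>i\<in>I. f i x)"
  using assms(2) by (induction I rule: infinite_finite_induct) (auto simp: smooth_on_mult[OF assms(1)])

lemma smooth_on_det:
  fixes M :: "'a::real_normed_vector \<Rightarrow> real ^ 'n::finite ^ 'n"
  assumes "open S" "\<And>i j. smooth_on S (\<lambda>y. M y $ i $ j)"
  shows "smooth_on S (\<lambda>y. det (M y))"
  unfolding det_def by (intro smooth_on_sum smooth_on_mult smooth_on_prod assms smooth_on_const)

lemma smooth_on_vecI:
  fixes f :: "'a::real_normed_vector \<Rightarrow> real ^ 'n::finite"
  assumes "open S" "\<And>i. smooth_on S (\<lambda>y. f y $ i)"
  shows "smooth_on S f"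
  unfolding smooth_on_componentwise[OF assms(1), of f]
  using assms(2) by (auto simp: Basis_vec_def cart_eq_inner_axis[symmetric])

lemma smooth_on_christoffel:
  assumes G: "metric_field S G"
  shows "smooth_on S (\<lambda>y. christoffel G y u v)"
proof -
  note S = metric_fieldD(1)[OF G]
  have k: "smooth_on S (\<lambda>y. koszul G y u v w)" for w
  proof -
    have "smooth_on S (\<lambda>y. (1/2) * (pderiv_field G y u v w + (pderiv_field G y v u w + (-1) * pderiv_field G y w u v)))"
      unfolding pderiv_field_def
      by (intro smooth_on_mult smooth_on_add smooth_on_const smooth_on_frechet_derivative metric_fieldD(5)[OF G] S)
    moreover have "koszul G y u v w = (1/2) * (pderiv_field G y u v w + (pderiv_field G y v u w + (-1) * pderiv_field G y w u v))" for y
      unfolding koszul_def by (simp only: mult_minus1 add_uminus_conv_diff times_divide_eq_left mult_1 add_diff_eq)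
    ultimately show ?thesis by (simp only:)
  qed
  have "smooth_on S (\<lambda>y. dual_axis (G y) l $ i)" for l i
  proof -
    have "smooth_on S (\<lambda>y. det (\<chi> r s. if s = i then axis l 1 $ r else gram (G y) $ r $ s) * inverse (det (gram (G y))))"
    proof (intro smooth_on_mult smooth_on_inverse smooth_on_det S)
      fix r s
      show "smooth_on S (\<lambda>y. (\<chi> r s. if s = i then axis l 1 $ r else gram (G y) $ r $ s) $ r $ s)"
        by (cases "s = i") (simp_all add: gram_def metric_fieldD(5)[OF G])
      show "smooth_on S (\<lambda>y. gram (G y) $ r $ s)" by (simp add: gram_def metric_fieldD(5)[OF G])
    qed (rule metric_fieldD(4)[OF G])
    then show ?thesis by (simp add: dual_axis_def divide_inverse)
  qed
  then show ?thesis unfolding christoffel_def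
    by (intro smooth_on_sum smooth_on_scaleR S k smooth_on_vecI)
qed


section \<open>The Levi-Civita connection and curvature in charts\<close>

text \<open>Coefficients of the full connection in one chart over its whole domain. Values of
  \<open>levi_civita\<close> at different points may refer to different charts, so they cannot be
  differentiated from point to point.\<close>

definition conn_coeff ::
  "('m::topological_space, 'n::finite) chart set \<Rightarrow> ('m, 'n) tensor02 \<Rightarrow> ('m, 'n) tensor12 \<Rightarrow>
     ('m, 'n) chart \<Rightarrow> real ^ 'n \<Rightarrow> real ^ 'n \<Rightarrow> real ^ 'n \<Rightarrow> real ^ 'n" where
  "conn_coeff A g T c y u v = christoffel (rep02 A c g) y u v + rep12 A c T y u v"

text \<open>The curvature of constant coordinate fields with the sign convention of
  \<open>curv_op\<close>; their bracket contributes nothing.\<close>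

definition coord_curv :: "(real ^ 'n \<Rightarrow> real ^ 'n \<Rightarrow> real ^ 'n \<Rightarrow> real ^ 'n::finite) \<Rightarrow>
    real ^ 'n \<Rightarrow> real ^ 'n \<Rightarrow> real ^ 'n \<Rightarrow> real ^ 'n \<Rightarrow> real ^ 'n" where
  "coord_curv \<Gamma> y u v w = pderiv_field \<Gamma> y v u w - pderiv_field \<Gamma> y u v w
     + \<Gamma> y v (\<Gamma> y u w) - \<Gamma> y u (\<Gamma> y v w)"

lemma smooth_tensor02_subset: "smooth_tensor02 A W h \<Longrightarrow> W' \<subseteq> W \<Longrightarrow> smooth_tensor02 A W' h"
  unfolding smooth_tensor02_def by (meson Int_mono image_mono smooth_on_subset subset_iff subset_refl)

lemma smooth_tensor12_subset: "smooth_tensor12 A W h \<Longrightarrow> W' \<subseteq> W \<Longrightarrow> smooth_tensor12 A W' h"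
  unfolding smooth_tensor12_def by (meson Int_mono image_mono smooth_on_subset subset_iff subset_refl)

lemma smooth_vfield_subset: "smooth_vfield A W X \<Longrightarrow> W' \<subseteq> W \<Longrightarrow> smooth_vfield A W' X"
  unfolding smooth_vfield_def by (meson Int_mono image_mono smooth_on_subset subset_refl)

lemma metric_on_subset: "metric_on A W g \<Longrightarrow> W' \<subseteq> W \<Longrightarrow> metric_on A W' g"
  unfolding metric_on_def by (meson smooth_tensor02_subset subsetD)

context smooth_manifold
begin

lemma metric_field_rep02:
  assumes g: "metric_on A W g" "open W" "c \<in> A"
  shows "metric_field (snd c ` (fst c \<inter> W)) (rep02 A c g)"
  unfolding metric_field_def
proof (intro conjI ballI allI)
  show "open (snd c ` (fst c \<inter> W))" using g by (simp add: chart_image_open_Int)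
  show "smooth_on (snd c ` (fst c \<inter> W)) (\<lambda>y. rep02 A c g y u v)" for u v
    using g by (simp add: metric_on_def smooth_tensor02_on)
  fix y assume "y \<in> snd c ` (fst c \<inter> W)"
  then obtain p where p: "p \<in> fst c" "p \<in> W" "y = snd c p" by blast
  have gp: "bilinear (g p)" "\<And>u v. g p u v = g p v u" "nondegenerate_on g p UNIV"
    using g p by (auto simp: metric_on_def smooth_tensor02_def)
  show bil: "bilinear (rep02 A c g y)" unfolding p(3) by (rule bilinear_rep02[where h = g, OF g(3) p(1) gp(1)])
  show sym: "rep02 A c g y u v = rep02 A c g y v u" for u v
    using gp(2) p(1) g(3) by (simp add: p(3) rep02_def)
  show "det (gram (rep02 A c g y)) \<noteq> 0"
  proof (rule det_gram_nonzero[OF bil sym])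
    fix u assume *: "\<And>v. rep02 A c g y u v = 0"
    have "g p (tvec A c p u) v = 0" for v
      using *[of "comps A c p v"] p g(3) by (simp add: rep02_def)
    then have "tvec A c p u = 0" using gp(3) by (simp add: nondegenerate_on_def)
    then show "u = 0" using comps_tvec[OF g(3) p(1), of u] linear_0[OF linear_comps[OF g(3) p(1)]] by simp
  qed
qed

section \<open>Derivatives of vector fields under a change of chart\<close>

lemma smooth_vfield_near_const_ext: "smooth_vfield_near A p (const_ext A p u)"
  unfolding smooth_vfield_near_def using smooth_vfield_const_ext chart_open by (meson chart_at_in)

text \<open>Differentiating the transformation rule of components adds an inhomogeneous term with
  the second derivative of the transition map. The bracket and the connection coefficients have to
  compensate this term.\<close>

lemma vf_rep_derivative_transform:
  assumes c: "c \<in> A" "c' \<in> A" "p \<in> fst c" "p \<in> fst c'" and X: "smooth_vfield_near A p X"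
  shows "frechet_derivative (vf_rep A c' X) (at (snd c' p)) (coord_change c c' p w) =
    frechet_derivative (\<lambda>y. frechet_derivative (snd c' \<circ> cinv c) (at y) (vf_rep A c X (snd c p))) (at (snd c p)) w
    + coord_change c c' p (frechet_derivative (vf_rep A c X) (at (snd c p)) w)"
proof -
  obtain W where W: "open W" "p \<in> W" "smooth_vfield A W X" using X by (auto simp: smooth_vfield_near_def)
  define N where "N = snd c ` (fst c \<inter> (fst c' \<inter> W))"
  have N: "open N" unfolding N_def using c W by (intro chart_image_open_Int open_Int chart_open)
  have y: "snd c p \<in> N" using c W by (auto simp: N_def)
  let ?\<tau> = "snd c' \<circ> cinv c"
  have sm\<tau>: "smooth_on N ?\<tau>"
    by (rule smooth_on_subset[OF smooth_on_transition[OF c(1,2)]]) (auto simp: N_def)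
  have lin: "linear (frechet_derivative ?\<tau> (at y))" if "y \<in> N" for y
    by (rule linear_frechet_derivative[OF smooth_on_differentiable[OF sm\<tau> that]])
  have smX: "smooth_on N (vf_rep A c X)"
    by (rule smooth_on_subset[OF smooth_vfield_on[OF W(3) c(1)]]) (auto simp: N_def)
  have smX': "smooth_on (snd c' ` (fst c' \<inter> W)) (vf_rep A c' X)"
    by (rule smooth_vfield_on[OF W(3) c(2)])
  have \<tau>y: "?\<tau> (snd c p) = snd c' p" using c by simp
  have DX': "(vf_rep A c' X has_derivative frechet_derivative (vf_rep A c' X) (at (snd c' p))) (at (?\<tau> (snd c p)))"
    unfolding \<tau>y by (rule smooth_on_has_derivative[OF smX']) (use c W in auto)
  have D1: "((\<lambda>y. vf_rep A c' X (?\<tau> y)) has_derivative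
     (\<lambda>w. frechet_derivative (vf_rep A c' X) (at (snd c' p)) (coord_change c c' p w))) (at (snd c p))"
    by (rule has_derivative_compose[OF has_derivative_transition[OF c] DX'])
  \<comment> \<open>A field of linear maps is treated as a bilinear one whose second argument is a
    real scalar, here the constant 1.\<close>
  have "((\<lambda>y. (1::real) *\<^sub>R frechet_derivative ?\<tau> (at y) (vf_rep A c X y)) has_derivative
     (\<lambda>w. 1 *\<^sub>R frechet_derivative (\<lambda>y. frechet_derivative ?\<tau> (at y) (vf_rep A c X (snd c p))) (at (snd c p)) w
        + 1 *\<^sub>R frechet_derivative ?\<tau> (at (snd c p)) (frechet_derivative (vf_rep A c X) (at (snd c p)) w)
        + 0 *\<^sub>R frechet_derivative ?\<tau> (at (snd c p)) (vf_rep A c X (snd c p)))) (at (snd c p))"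
  proof (rule has_derivative_bilinear_field[OF N y, where H = "\<lambda>y u (r::real). r *\<^sub>R frechet_derivative ?\<tau> (at y) u"
      and b = "\<lambda>_. 1" and b' = "\<lambda>_. 0"])
    show "bilinear (\<lambda>u (r::real). r *\<^sub>R frechet_derivative ?\<tau> (at y) u)" if "y \<in> N" for y
      using lin[OF that] by (auto simp: bilinear_def linear_add linear_scale scaleR_add_left algebra_simps intro!: linearI)
    show "((\<lambda>y. r *\<^sub>R frechet_derivative ?\<tau> (at y) u) has_derivative
       (\<lambda>w. r *\<^sub>R frechet_derivative (\<lambda>y. frechet_derivative ?\<tau> (at y) u) (at (snd c p)) w)) (at (snd c p))" for u and r :: real
      by (intro has_derivative_scaleR_right smooth_on_has_derivative[OF smooth_on_frechet_derivative[OF sm\<tau>] y])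
  qed (auto intro: smooth_on_has_derivative[OF smX y])
  then have D2: "((\<lambda>y. vf_rep A c' X (?\<tau> y)) has_derivative
     (\<lambda>w. 1 *\<^sub>R frechet_derivative (\<lambda>y. frechet_derivative ?\<tau> (at y) (vf_rep A c X (snd c p))) (at (snd c p)) w
        + 1 *\<^sub>R frechet_derivative ?\<tau> (at (snd c p)) (frechet_derivative (vf_rep A c X) (at (snd c p)) w)
        + 0 *\<^sub>R frechet_derivative ?\<tau> (at (snd c p)) (vf_rep A c X (snd c p)))) (at (snd c p))"
  proof (rule has_derivative_transform_within_open[OF _ N y])
    fix y assume "y \<in> N"
    then obtain q where q: "q \<in> fst c" "q \<in> fst c'" "y = snd c q" by (auto simp: N_def)
    show "1 *\<^sub>R frechet_derivative ?\<tau> (at y) (vf_rep A c X y) = vf_rep A c' X (?\<tau> y)"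
      using vf_rep_coord_change[OF c(1,2) q(1,2), of X] q c by (simp add: coord_change_def)
  qed
  from fun_cong[OF has_derivative_unique[OF D1 D2], of w] show ?thesis
    by (simp add: coord_change_def)
qed

text \<open>The inhomogeneous terms of the two derivatives cancel because second derivatives are
  symmetric, so the bracket has the same formula in every chart.\<close>

lemma vf_rep_lie_bracket:
  assumes c: "c \<in> A" "p \<in> fst c" and X: "smooth_vfield_near A p X" "smooth_vfield_near A p Y"
  shows "vf_rep A c (lie_bracket A X Y) (snd c p) =
     frechet_derivative (vf_rep A c Y) (at (snd c p)) (vf_rep A c X (snd c p)) -
     frechet_derivative (vf_rep A c X) (at (snd c p)) (vf_rep A c Y (snd c p))"
proof -
  let ?c = "chart_at A p"
  note cc = chart_at_in(1)[of p] c(1) chart_at_in(2)[of p] c(2)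
  have "frechet_derivative (\<lambda>y. frechet_derivative (snd c \<circ> cinv ?c) (at y) u) (at (snd ?c p)) v =
    frechet_derivative (\<lambda>y. frechet_derivative (snd c \<circ> cinv ?c) (at y) v) (at (snd ?c p)) u" for u v
    by (rule second_derivative_symmetric[OF smooth_on_transition[OF cc(1,2)]
        chart_image_open_Int[OF cc(1) chart_open[OF c(1)]]]) (use cc in auto)
  moreover have "coord_change ?c c p (a - b) = coord_change ?c c p a - coord_change ?c c p b" for a b
    by (rule linear_diff[OF linear_coord_change[OF cc]])
  ultimately show ?thesis
    using vf_rep_derivative_transform[OF cc X(1), of "Y p"] vf_rep_derivative_transform[OF cc X(2), of "X p"] c
    by (simp add: vf_rep_at lie_bracket_def chart_deriv_def comps_def coord_change_same)
qed

text \<open>The derivative terms of the two covariant derivatives make up the bracket. What remains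
  restricts only the coefficients at \<open>p\<close>, and constant extensions realise every pair of
  vectors.\<close>

lemma torsion_free_at_iff: "torsion_free_at A (\<lambda>_. \<gamma>) p \<longleftrightarrow> (\<forall>u v. \<gamma> u v = \<gamma> v u)"
proof
  assume *: "torsion_free_at A (\<lambda>_. \<gamma>) p"
  show "\<forall>u v. \<gamma> u v = \<gamma> v u"
  proof (intro allI)
    fix u v
    show "\<gamma> u v = \<gamma> v u"
      using *[unfolded torsion_free_at_def, rule_format, OF smooth_vfield_near_const_ext[of p u] smooth_vfield_near_const_ext[of p v]]
      by (simp add: nabla_def lie_bracket_def)
  qed
qed (simp add: torsion_free_at_def nabla_def lie_bracket_def)

text \<open>By the product rule the derivatives of \<open>Y\<close> and \<open>Z\<close> occur
  equally on both sides. The remaining condition is algebraic in the coefficients at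
  \<open>p\<close>; constant extensions give the forward direction.\<close>

lemma metric_compatible_at_iff:
  assumes g: "metric_on A W g" "open W" "p \<in> W"
  shows "metric_compatible_at A g (\<lambda>_. \<gamma>) p \<longleftrightarrow>
    (\<forall>u v w. pderiv_field (rep02 A (chart_at A p) g) (snd (chart_at A p) p) w u v = g p (\<gamma> w u) v + g p u (\<gamma> w v))"
proof -
  let ?c = "chart_at A p" let ?y = "snd (chart_at A p) p"
  have bil: "bilinear (g p)" using g by (simp add: metric_on_def smooth_tensor02_def)
  have main: "dir_deriv A p (X p) (\<lambda>q. g q (Y q) (Z q)) = pderiv_field (rep02 A ?c g) ?y (X p) (Y p) (Z p)
      + g p (chart_deriv A p (X p) Y) (Z p) + g p (Y p) (chart_deriv A p (X p) Z)"
    if YZ: "smooth_vfield_near A p Y" "smooth_vfield_near A p Z" for X Y Z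
  proof -
    obtain W1 W2 where W: "open W1" "p \<in> W1" "smooth_vfield A W1 Y" "open W2" "p \<in> W2" "smooth_vfield A W2 Z"
      using YZ by (auto simp: smooth_vfield_near_def)
    define V where "V = W \<inter> W1 \<inter> W2"
    have V: "open V" "p \<in> V" "V \<subseteq> W" "V \<subseteq> W1" "V \<subseteq> W2" using W g by (auto simp: V_def)
    define N where "N = snd ?c ` (fst ?c \<inter> V)"
    have N: "open N" "?y \<in> N" using V by (auto simp: N_def chart_image_open_Int)
    have mf: "metric_field N (rep02 A ?c g)" unfolding N_def
      by (rule metric_field_rep02[OF metric_on_subset[OF g(1) V(3)] V(1)]) simp
    have smY: "smooth_on N (vf_rep A ?c Y)" "smooth_on N (vf_rep A ?c Z)"
      using smooth_vfield_subset[OF W(3) V(4)] smooth_vfield_subset[OF W(6) V(5)] by (auto simp: N_def smooth_vfield_def)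
    have DG: "((\<lambda>y. rep02 A ?c g y u v) has_derivative (\<lambda>w. pderiv_field (rep02 A ?c g) ?y w u v)) (at ?y)" for u v
      unfolding pderiv_field_def by (rule smooth_on_has_derivative[OF metric_fieldD(5)[OF mf] N(2)])
    have D: "((\<lambda>y. rep02 A ?c g y (vf_rep A ?c Y y) (vf_rep A ?c Z y)) has_derivative
       (\<lambda>w. pderiv_field (rep02 A ?c g) ?y w (vf_rep A ?c Y ?y) (vf_rep A ?c Z ?y)
        + rep02 A ?c g ?y (frechet_derivative (vf_rep A ?c Y) (at ?y) w) (vf_rep A ?c Z ?y)
        + rep02 A ?c g ?y (vf_rep A ?c Y ?y) (frechet_derivative (vf_rep A ?c Z) (at ?y) w))) (at ?y)"
      by (rule has_derivative_bilinear_field[OF N metric_fieldD(2)[OF mf] DG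
            smooth_on_has_derivative[OF smY(1) N(2)] smooth_on_has_derivative[OF smY(2) N(2)]])
    have "(((\<lambda>q. g q (Y q) (Z q)) \<circ> cinv ?c) has_derivative
       (\<lambda>w. pderiv_field (rep02 A ?c g) ?y w (vf_rep A ?c Y ?y) (vf_rep A ?c Z ?y)
        + rep02 A ?c g ?y (frechet_derivative (vf_rep A ?c Y) (at ?y) w) (vf_rep A ?c Z ?y)
        + rep02 A ?c g ?y (vf_rep A ?c Y ?y) (frechet_derivative (vf_rep A ?c Z) (at ?y) w))) (at ?y)"
      by (rule has_derivative_transform_within_open[OF D N]) (auto simp: N_def rep02_def vf_rep_def)
    from fun_cong[OF frechet_derivative_at[OF this], of "X p", symmetric]
    show ?thesis by (simp add: dir_deriv_def chart_deriv_def vf_rep_at rep02_chart_at)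
  qed
  show ?thesis
  proof
    assume *: "metric_compatible_at A g (\<lambda>_. \<gamma>) p"
    show "\<forall>u v w. pderiv_field (rep02 A ?c g) ?y w u v = g p (\<gamma> w u) v + g p u (\<gamma> w v)"
    proof (intro allI)
      fix u v w
      show "pderiv_field (rep02 A ?c g) ?y w u v = g p (\<gamma> w u) v + g p u (\<gamma> w v)"
        using *[unfolded metric_compatible_at_def, rule_format,
          OF smooth_vfield_near_const_ext[of p w] smooth_vfield_near_const_ext[of p u] smooth_vfield_near_const_ext[of p v]]
          main[of "const_ext A p u" "const_ext A p v" "const_ext A p w"]
        by (simp add: nabla_def smooth_vfield_near_const_ext bilinear_ladd[OF bil] bilinear_radd[OF bil])
    qed
  next
    assume *: "\<forall>u v w. pderiv_field (rep02 A ?c g) ?y w u v = g p (\<gamma> w u) v + g p u (\<gamma> w v)"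
    show "metric_compatible_at A g (\<lambda>_. \<gamma>) p"
      unfolding metric_compatible_at_def
      by (simp add: main * nabla_def bilinear_ladd[OF bil] bilinear_radd[OF bil])
  qed
qed

text \<open>Both defining conditions having become algebraic at \<open>p\<close>, existence and
  uniqueness for the description operator are those of the Christoffel symbols.\<close>

lemma levi_civita_eq:
  assumes g: "metric_on A W g" "open W" "p \<in> W"
  shows "levi_civita A g p = christoffel (rep02 A (chart_at A p) g) (snd (chart_at A p) p)"
proof -
  let ?c = "chart_at A p" let ?y = "snd (chart_at A p) p"
  have mf: "metric_field (snd ?c ` (fst ?c \<inter> W)) (rep02 A ?c g)"
    by (rule metric_field_rep02[OF g(1,2)]) simp
  have y: "?y \<in> snd ?c ` (fst ?c \<inter> W)" using g by auto
  show ?thesis unfolding levi_civita_def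
  proof (rule the_equality)
    show "bilinear (christoffel (rep02 A ?c g) ?y) \<and> torsion_free_at A (\<lambda>_. christoffel (rep02 A ?c g) ?y) p \<and>
        metric_compatible_at A g (\<lambda>_. christoffel (rep02 A ?c g) ?y) p"
      unfolding torsion_free_at_iff metric_compatible_at_iff[OF g]
      using bilinear_christoffel[OF mf y] christoffel_sym[OF mf y] christoffel_compatible[OF mf y]
      by (simp add: rep02_chart_at)
    fix \<gamma> assume "bilinear \<gamma> \<and> torsion_free_at A (\<lambda>_. \<gamma>) p \<and> metric_compatible_at A g (\<lambda>_. \<gamma>) p"
    then show "\<gamma> = christoffel (rep02 A ?c g) ?y"
      unfolding torsion_free_at_iff metric_compatible_at_iff[OF g]
      by (intro christoffel_unique[OF mf y]) (auto simp: rep02_chart_at)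
  qed
qed

text \<open>The bridge from pointwise definitions to calculus. The covariant derivative is defined
  at each point in the preferred chart of that point; on passing to a fixed chart the second
  derivatives of the transition map, from the Christoffel symbols and from the components of
  \<open>Y\<close>, cancel and leave the classical formula.\<close>

lemma vf_rep_nabla_bar:
  assumes g: "metric_on A W g" "open W" "p \<in> W" and c: "c \<in> A" "p \<in> fst c" and Y: "smooth_vfield_near A p Y"
  shows "vf_rep A c (nabla_bar A g T X Y) (snd c p) =
     frechet_derivative (vf_rep A c Y) (at (snd c p)) (vf_rep A c X (snd c p)) +
     conn_coeff A g T c (snd c p) (vf_rep A c X (snd c p)) (vf_rep A c Y (snd c p))"
proof -
  let ?c = "chart_at A p" let ?y = "snd (chart_at A p) p" let ?L = "coord_change (chart_at A p) c p"
  let ?\<tau> = "snd c \<circ> cinv ?c"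
  let ?S = "snd ?c ` (fst ?c \<inter> (fst c \<inter> W))"
  note cc = chart_at_in(1)[of p] c(1) chart_at_in(2)[of p] c(2)
  have lin: "linear ?L" by (rule linear_coord_change[OF cc])
  have VW: "open (fst c \<inter> W)" using chart_open[OF c(1)] g by auto
  have mf: "metric_field ?S (rep02 A ?c g)"
    by (rule metric_field_rep02[OF metric_on_subset[OF g(1)] VW]) auto
  have mf': "metric_field (snd c ` (fst c \<inter> W)) (rep02 A c g)"
    by (rule metric_field_rep02[OF g(1,2) c(1)])
  have \<tau>y: "?\<tau> ?y = snd c p" by simp
  have "?L (christoffel (rep02 A ?c g) ?y (X p) (Y p)) =
     christoffel (rep02 A c g) (?\<tau> ?y) (?L (X p)) (?L (Y p)) +
     frechet_derivative (\<lambda>y. frechet_derivative ?\<tau> (at y) (Y p)) (at ?y) (X p)"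
  proof (rule christoffel_transform[OF mf _ mf'])
    show "?y \<in> ?S" using g c by auto
    show "smooth_on ?S ?\<tau>"
      by (rule smooth_on_subset[OF smooth_on_transition[OF cc(1,2)]]) auto
    show "?\<tau> ` ?S \<subseteq> snd c ` (fst c \<inter> W)" by auto
    show "?L = frechet_derivative ?\<tau> (at ?y)" by (simp add: coord_change_def)
    show "?L (coord_change c ?c p u) = u" for u using cc by (simp add: coord_change_trans coord_change_same)
    fix y u v assume "y \<in> ?S"
    then obtain q where q: "q \<in> fst ?c" "q \<in> fst c" "y = snd ?c q" by auto
    show "rep02 A ?c g y u v = rep02 A c g (?\<tau> y) (frechet_derivative ?\<tau> (at y) u) (frechet_derivative ?\<tau> (at y) v)"
      using rep02_coord_change[OF cc(1,2) q(1,2), of g u v] q by (simp add: coord_change_def)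
  qed
  moreover have "frechet_derivative (vf_rep A c Y) (at (snd c p)) (?L (X p)) =
    frechet_derivative (\<lambda>y. frechet_derivative ?\<tau> (at y) (Y p)) (at ?y) (X p)
    + ?L (frechet_derivative (vf_rep A ?c Y) (at ?y) (X p))"
    using vf_rep_derivative_transform[OF cc Y, of "X p"] by (simp add: vf_rep_at)
  moreover have "rep12 A c T (snd c p) (?L (X p)) (?L (Y p)) = ?L (T p (X p) (Y p))"
    using rep12_coord_change[OF cc, of T "X p" "Y p"] by (simp add: rep12_chart_at)
  ultimately show ?thesis
    using c by (simp add: vf_rep_at nabla_bar_def nabla_def levi_civita_eq[OF g] chart_deriv_def
        conn_coeff_def comps_def linear_add[OF lin])
qed

section \<open>Curvature in an arbitrary chart\<close>

lemma bilinear_conn_coeff: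
  assumes "metric_on A W g" "smooth_tensor12 A W T" "open W" "c \<in> A" "y \<in> snd c ` (fst c \<inter> W)"
  shows "bilinear (conn_coeff A g T c y)"
proof -
  have "bilinear (christoffel (rep02 A c g) y)"
    by (rule bilinear_christoffel[OF metric_field_rep02[OF assms(1,3,4)] assms(5)])
  moreover have "bilinear (rep12 A c T y)"
    using assms by (auto simp: smooth_tensor12_def intro!: bilinear_rep12[where T = T])
  ultimately show ?thesis
    unfolding bilinear_def conn_coeff_def by (auto intro: linear_compose_add)
qed

lemma smooth_on_conn_coeff:
  assumes "metric_on A W g" "smooth_tensor12 A W T" "open W" "c \<in> A"
  shows "smooth_on (snd c ` (fst c \<inter> W)) (\<lambda>y. conn_coeff A g T c y u v)"
  unfolding conn_coeff_def
  by (intro smooth_on_add chart_image_open_Int assms smooth_tensor12_on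
       smooth_on_christoffel[OF metric_field_rep02[OF assms(1,3,4)]])

lemma smooth_vfield_nearI: "smooth_vfield A W X \<Longrightarrow> open W \<Longrightarrow> p \<in> W \<Longrightarrow> smooth_vfield_near A p X"
  by (auto simp: smooth_vfield_near_def)

lemma smooth_vfield_nabla_bar:
  assumes g: "metric_on A W g" "smooth_tensor12 A W T" "open W" and X: "smooth_vfield A W X" "smooth_vfield A W Y"
  shows "smooth_vfield A W (nabla_bar A g T X Y)"
  unfolding smooth_vfield_def
proof
  fix c assume c: "c \<in> A"
  let ?S = "snd c ` (fst c \<inter> W)"
  have S: "open ?S" using c g by (simp add: chart_image_open_Int)
  show "smooth_on ?S (vf_rep A c (nabla_bar A g T X Y))"
  proof (rule smooth_on_cong[OF S])
    show "smooth_on ?S (\<lambda>y. frechet_derivative (vf_rep A c Y) (at y) (vf_rep A c X y) +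
       conn_coeff A g T c y (vf_rep A c X y) (vf_rep A c Y y))"
    proof (rule smooth_on_add[OF S])
      note sX = smooth_vfield_on[OF X(1) c] and sY = smooth_vfield_on[OF X(2) c]
      show "smooth_on ?S (\<lambda>y. frechet_derivative (vf_rep A c Y) (at y) (vf_rep A c X y))"
        by (rule smooth_on_differential_apply[OF S smooth_on_frechet_derivative[OF sY] _ sX])
           (rule linear_frechet_derivative[OF smooth_on_differentiable[OF sY]])
      show "smooth_on ?S (\<lambda>y. conn_coeff A g T c y (vf_rep A c X y) (vf_rep A c Y y))"
        by (rule smooth_on_bilinear_apply[OF S bilinear_conn_coeff[OF g c] smooth_on_conn_coeff[OF g c] sX sY])
    qed
    fix y assume "y \<in> ?S"
    then obtain p where p: "p \<in> fst c" "p \<in> W" "y = snd c p" by auto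
    show "frechet_derivative (vf_rep A c Y) (at y) (vf_rep A c X y) +
       conn_coeff A g T c y (vf_rep A c X y) (vf_rep A c Y y) = vf_rep A c (nabla_bar A g T X Y) y"
      unfolding p(3) by (rule vf_rep_nabla_bar[OF g(1,3) p(2) c p(1) smooth_vfield_nearI[OF X(2) g(3) p(2)], symmetric])
  qed
qed

text \<open>All derivatives of the three fields cancel, which is the tensoriality of the curvature.
  Iterating covariant derivatives requires the inner one in the same chart near \<open>p\<close>,
  not only at \<open>p\<close>.\<close>

lemma vf_rep_curv_op:
  assumes g: "metric_on A W g" "smooth_tensor12 A W T" "open W" and p: "p \<in> W" and c: "c \<in> A" "p \<in> fst c"
    and X: "smooth_vfield A W X" "smooth_vfield A W Y" "smooth_vfield A W Z"
  shows "vf_rep A c (curv_op A g T X Y Z) (snd c p) =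
    coord_curv (conn_coeff A g T c) (snd c p) (vf_rep A c X (snd c p)) (vf_rep A c Y (snd c p)) (vf_rep A c Z (snd c p))"
proof -
  let ?S = "snd c ` (fst c \<inter> W)"
  have S: "open ?S" using c g by (simp add: chart_image_open_Int)
  define y where "y = snd c p"
  have y: "y \<in> ?S" using c p by (auto simp: y_def)
  define \<Gamma> where "\<Gamma> = conn_coeff A g T c"
  have bil: "bilinear (\<Gamma> y)" if "y \<in> ?S" for y unfolding \<Gamma>_def by (rule bilinear_conn_coeff[OF g c(1) that])
  have D\<Gamma>: "((\<lambda>y. \<Gamma> y u v) has_derivative (\<lambda>w. pderiv_field \<Gamma> y w u v)) (at y)" for u v
    unfolding pderiv_field_def \<Gamma>_def by (rule smooth_on_has_derivative[OF smooth_on_conn_coeff[OF g c(1)] y])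
  define Zc where "Zc = vf_rep A c Z"
  have smZ: "smooth_on ?S Zc" unfolding Zc_def by (rule smooth_vfield_on[OF X(3) c(1)])
  have linZ: "linear (frechet_derivative Zc (at y))" if "y \<in> ?S" for y
    by (rule linear_frechet_derivative[OF smooth_on_differentiable[OF smZ that]])
  note nb = smooth_vfield_nabla_bar[OF g]
  note near = smooth_vfield_nearI[OF _ g(3) p]
  define D2 where "D2 u v = frechet_derivative (\<lambda>y. frechet_derivative Zc (at y) v) (at y) u" for u v
  \<comment> \<open>The second covariant derivative for a general pair of fields, so that both
    orders in \<open>curv_op\<close> are instances.\<close>
  have key: "vf_rep A c (nabla_bar A g T V (nabla_bar A g T U Z)) y =
     D2 (Vc y) (Uc y) + frechet_derivative Zc (at y) (frechet_derivative Uc (at y) (Vc y))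
     + (pderiv_field \<Gamma> y (Vc y) (Uc y) (Zc y) + \<Gamma> y (frechet_derivative Uc (at y) (Vc y)) (Zc y)
        + \<Gamma> y (Uc y) (frechet_derivative Zc (at y) (Vc y)))
     + (\<Gamma> y (Vc y) (frechet_derivative Zc (at y) (Uc y)) + \<Gamma> y (Vc y) (\<Gamma> y (Uc y) (Zc y)))"
    if UV: "smooth_vfield A W U" "smooth_vfield A W V" and Uc: "Uc = vf_rep A c U" "Vc = vf_rep A c V" for U V Uc Vc
  proof -
    have smU: "smooth_on ?S Uc" unfolding Uc by (rule smooth_vfield_on[OF UV(1) c(1)])
    note DU = smooth_on_has_derivative[OF smU y] and DZ = smooth_on_has_derivative[OF smZ y]
    have rep: "vf_rep A c (nabla_bar A g T U Z) y = frechet_derivative Zc (at y) (Uc y) + \<Gamma> y (Uc y) (Zc y)"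
      if "y \<in> ?S" for y
      using that vf_rep_nabla_bar[OF g(1,3) _ c(1) _ smooth_vfield_nearI[OF X(3) g(3)]] by (auto simp: Uc Zc_def \<Gamma>_def)
    have "((\<lambda>y. (1::real) *\<^sub>R frechet_derivative Zc (at y) (Uc y)) has_derivative
       (\<lambda>w. 1 *\<^sub>R D2 w (Uc y) + 1 *\<^sub>R frechet_derivative Zc (at y) (frechet_derivative Uc (at y) w)
          + 0 *\<^sub>R frechet_derivative Zc (at y) (Uc y))) (at y)"
    proof (rule has_derivative_bilinear_field[OF S y, where H = "\<lambda>y u (r::real). r *\<^sub>R frechet_derivative Zc (at y) u"
        and b = "\<lambda>_. 1" and b' = "\<lambda>_. 0"])
      show "bilinear (\<lambda>u (r::real). r *\<^sub>R frechet_derivative Zc (at y) u)" if "y \<in> ?S" for y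
        using linZ[OF that] by (auto simp: bilinear_def linear_add linear_scale scaleR_add_left algebra_simps intro!: linearI)
      show "((\<lambda>y. r *\<^sub>R frechet_derivative Zc (at y) u) has_derivative (\<lambda>w. r *\<^sub>R D2 w u)) (at y)" for u and r :: real
        unfolding D2_def
        by (intro has_derivative_scaleR_right smooth_on_has_derivative[OF smooth_on_frechet_derivative[OF smZ] y])
    qed (auto intro: DU)
    then have "((\<lambda>y. frechet_derivative Zc (at y) (Uc y)) has_derivative
       (\<lambda>w. D2 w (Uc y) + frechet_derivative Zc (at y) (frechet_derivative Uc (at y) w))) (at y)" by simp
    from has_derivative_add[OF this has_derivative_bilinear_field[OF S y bil D\<Gamma> DU DZ]]
    have "(vf_rep A c (nabla_bar A g T U Z) has_derivative
       (\<lambda>w. D2 w (Uc y) + frechet_derivative Zc (at y) (frechet_derivative Uc (at y) w) +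
        (pderiv_field \<Gamma> y w (Uc y) (Zc y) + \<Gamma> y (frechet_derivative Uc (at y) w) (Zc y) +
          \<Gamma> y (Uc y) (frechet_derivative Zc (at y) w)))) (at y)"
      by (rule has_derivative_transform_within_open[OF _ S y]) (simp_all add: rep)
    from fun_cong[OF frechet_derivative_at[OF this], of "Vc y", symmetric]
    have *: "frechet_derivative (vf_rep A c (nabla_bar A g T U Z)) (at y) (Vc y) =
       D2 (Vc y) (Uc y) + frechet_derivative Zc (at y) (frechet_derivative Uc (at y) (Vc y)) +
        (pderiv_field \<Gamma> y (Vc y) (Uc y) (Zc y) + \<Gamma> y (frechet_derivative Uc (at y) (Vc y)) (Zc y) +
          \<Gamma> y (Uc y) (frechet_derivative Zc (at y) (Vc y)))" .
    have "vf_rep A c (nabla_bar A g T V (nabla_bar A g T U Z)) y =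
      frechet_derivative (vf_rep A c (nabla_bar A g T U Z)) (at y) (Vc y) +
      \<Gamma> y (Vc y) (vf_rep A c (nabla_bar A g T U Z) y)"
      unfolding y_def Uc(2) \<Gamma>_def
      by (rule vf_rep_nabla_bar[OF g(1,3) p c near[OF nb[OF UV(1) X(3)]]])
    then show ?thesis unfolding * rep[OF y] by (simp add: bilinear_radd[OF bil[OF y]])
  qed
  define Xc Yc where "Xc = vf_rep A c X" and "Yc = vf_rep A c Y"
  have "vf_rep A c (nabla_bar A g T (lie_bracket A X Y) Z) y =
     frechet_derivative Zc (at y) (vf_rep A c (lie_bracket A X Y) y) + \<Gamma> y (vf_rep A c (lie_bracket A X Y) y) (Zc y)"
    unfolding y_def Zc_def \<Gamma>_def by (rule vf_rep_nabla_bar[OF g(1,3) p c near[OF X(3)]])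
  also have "vf_rep A c (lie_bracket A X Y) y = frechet_derivative Yc (at y) (Xc y) - frechet_derivative Xc (at y) (Yc y)"
    unfolding y_def Xc_def Yc_def by (rule vf_rep_lie_bracket[OF c near[OF X(1)] near[OF X(2)]])
  finally have br: "vf_rep A c (nabla_bar A g T (lie_bracket A X Y) Z) y =
     frechet_derivative Zc (at y) (frechet_derivative Yc (at y) (Xc y)) - frechet_derivative Zc (at y) (frechet_derivative Xc (at y) (Yc y))
     + (\<Gamma> y (frechet_derivative Yc (at y) (Xc y)) (Zc y) - \<Gamma> y (frechet_derivative Xc (at y) (Yc y)) (Zc y))"
    by (simp add: linear_diff[OF linZ[OF y]] bilinear_lsub[OF bil[OF y]])
  \<comment> \<open>The bracket absorbs first derivatives of \<open>Z\<close>; its second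
    derivatives cancel by symmetry.\<close>
  have D2sym: "D2 (Xc y) (Yc y) = D2 (Yc y) (Xc y)"
    unfolding D2_def by (rule second_derivative_symmetric[OF smZ S y])
  have "vf_rep A c (curv_op A g T X Y Z) y =
     vf_rep A c (nabla_bar A g T Y (nabla_bar A g T X Z)) y - vf_rep A c (nabla_bar A g T X (nabla_bar A g T Y Z)) y
     + vf_rep A c (nabla_bar A g T (lie_bracket A X Y) Z) y"
    using c by (simp add: y_def vf_rep_at curv_op_def linear_add[OF linear_comps[OF c]] linear_diff[OF linear_comps[OF c]])
  also have "\<dots> = coord_curv \<Gamma> y (Xc y) (Yc y) (Zc y)"
    unfolding br key[OF X(1,2) Xc_def Yc_def] key[OF X(2,1) Yc_def Xc_def] D2sym coord_curv_def
    by (simp add: algebra_simps)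
  finally show ?thesis by (simp add: y_def \<Gamma>_def Xc_def Yc_def Zc_def)
qed

text \<open>\<open>curv\<close> uses extensions that are constant in the preferred chart, yet by
  tensoriality it can be evaluated from components in any chart. The restriction to
  \<open>?W\<close> keeps the extensions smooth.\<close>

lemma comps_curv:
  assumes g: "metric_on A W g" "smooth_tensor12 A W T" "open W" and p: "p \<in> W" and c: "c \<in> A" "p \<in> fst c"
  shows "comps A c p (curv A g T p u v w) =
    coord_curv (conn_coeff A g T c) (snd c p) (comps A c p u) (comps A c p v) (comps A c p w)"
proof -
  let ?W = "W \<inter> fst (chart_at A p)"
  have W: "?W \<subseteq> W" "open ?W" "p \<in> ?W" using g(3) p chart_open[of "chart_at A p"] by auto
  have "smooth_vfield A ?W (const_ext A p u)" for u
    by (rule smooth_vfield_subset[OF smooth_vfield_const_ext]) auto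
  from vf_rep_curv_op[OF metric_on_subset[OF g(1) W(1)] smooth_tensor12_subset[OF g(2) W(1)] W(2,3) c this this this, of u v w]
  show ?thesis using c by (simp add: vf_rep_at curv_def)
qed

end


section \<open>Orthonormal frames and the scalar curvature\<close>

definition orthonormal_frame :: "(real ^ 'n \<Rightarrow> real ^ 'n \<Rightarrow> real) \<Rightarrow> (real ^ 'n::finite) set \<Rightarrow> bool" where
  "orthonormal_frame G F \<longleftrightarrow> finite F \<and> span F = UNIV \<and> (\<forall>e\<in>F. G e e = 1 \<or> G e e = -1) \<and>
     (\<forall>e\<in>F. \<forall>f\<in>F. e \<noteq> f \<longrightarrow> G e f = 0)"

lemma orthonormal_frame_sign: "orthonormal_frame G F \<Longrightarrow> e \<in> F \<Longrightarrow> G e e * G e e = 1"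
  by (auto simp: orthonormal_frame_def)

lemma bilinear_sum_left: "bilinear H \<Longrightarrow> H (\<Sum>i\<in>I. f i) v = (\<Sum>i\<in>I. H (f i) v)"
  and bilinear_sum_right: "bilinear H \<Longrightarrow> H u (\<Sum>i\<in>I. f i) = (\<Sum>i\<in>I. H u (f i))"
  by (simp_all add: bilinear_def linear_sum linear_sum[of "\<lambda>u. H u v"])

context
  fixes G :: "real ^ 'n::finite \<Rightarrow> real ^ 'n \<Rightarrow> real" and F
  assumes bil: "bilinear G" and det: "det (gram G) \<noteq> 0"
    and F: "orthonormal_frame G F"
begin

text \<open>Orthogonality to a spanning set extends to all vectors; testing against dual vectors
  reads off the coordinates of \<open>u\<close>.\<close>

lemma frame_orthogonal_zero:
  assumes "\<And>f. f \<in> F \<Longrightarrow> G u f = 0" shows "u = 0"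
proof -
  have "linear (G u)" using bil by (simp add: bilinear_def)
  then have "G u w = 0" for w
    using linear_eq_0_on_span[of "G u" F w] assms F by (auto simp: orthonormal_frame_def)
  then have "u $ l = 0" for l using dual_axis[OF bil det, of u l] by simp
  then show ?thesis by (simp add: vec_eq_iff)
qed

lemma frame_sum_right: 
  assumes "f \<in> F" shows "(\<Sum>e\<in>F. c e * G e f) = c f * G f f"
proof -
  have "finite F" using F by (simp add: orthonormal_frame_def)
  moreover have "(\<Sum>e\<in>F. c e * G e f) = (\<Sum>e\<in>F. if e = f then c f * G f f else 0)"
    by (rule sum.cong) (use F assms in \<open>auto simp: orthonormal_frame_def\<close>)
  ultimately show ?thesis using assms by simp
qed

text \<open>A frame vector has square 1 or -1, so \<open>G e e\<close> stands for its own inverse in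
  the usual orthogonal expansion.\<close>

lemma frame_expansion: "u = (\<Sum>e\<in>F. (G e e * G u e) *\<^sub>R e)"
proof -
  let ?v = "\<Sum>e\<in>F. (G e e * G u e) *\<^sub>R e"
  have "G (u - ?v) f = 0" if f: "f \<in> F" for f
  proof -
    have "G ?v f = (\<Sum>e\<in>F. (G e e * G u e) * G e f)"
      by (simp add: bilinear_sum_left[OF bil] bilinear_lmul[OF bil])
    also have "\<dots> = G f f * G u f * G f f" by (rule frame_sum_right[OF f])
    also have "\<dots> = G u f" using orthonormal_frame_sign[OF F f] by (simp add: mult.commute mult.left_commute)
    finally show ?thesis by (simp add: bilinear_lsub[OF bil])
  qed
  from frame_orthogonal_zero[OF this] show ?thesis by simp
qed

text \<open>The right side is a trace over a pair of dual bases and does not mention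
  \<open>F\<close>: it gives independence of the frame and an expression that depends smoothly on
  \<open>G\<close>.\<close>

lemma frame_trace:
  fixes \<beta> :: "real ^ 'n \<Rightarrow> real ^ 'n \<Rightarrow> real"
  assumes sym: "\<And>u v. G u v = G v u" and \<beta>: "bilinear \<beta>"
  shows "(\<Sum>e\<in>F. G e e * \<beta> e e) = (\<Sum>l\<in>UNIV. \<beta> (axis l 1) (dual_axis G l))"
proof -
  have E: "dual_axis G l = (\<Sum>e\<in>F. (G e e * e $ l) *\<^sub>R e)" for l
    using frame_expansion[of "dual_axis G l"] sym[of "dual_axis G l"] dual_axis[OF bil det] by simp
  have "(\<Sum>l\<in>UNIV. \<beta> (axis l 1) (dual_axis G l)) = (\<Sum>l\<in>UNIV. \<Sum>e\<in>F. G e e * (e $ l * \<beta> (axis l 1) e))"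
    unfolding E by (simp add: bilinear_sum_right[OF \<beta>] bilinear_rmul[OF \<beta>] mult.assoc)
  also have "\<dots> = (\<Sum>e\<in>F. G e e * (\<Sum>l\<in>UNIV. e $ l * \<beta> (axis l 1) e))"
    by (subst sum.swap) (simp add: sum_distrib_left)
  also have "\<dots> = (\<Sum>e\<in>F. G e e * \<beta> e e)"
  proof (rule sum.cong)
    fix e assume "e \<in> F"
    have "linear (\<lambda>u. \<beta> u e)" using \<beta> by (simp add: bilinear_def)
    from linear_axis_expansion[OF this, of e]
    show "G e e * (\<Sum>l\<in>UNIV. e $ l * \<beta> (axis l 1) e) = G e e * \<beta> e e" by simp
  qed simp
  finally show ?thesis by simp
qed

lemma frame_trace_matrix:
  assumes sym: "\<And>u v. G u v = G v u" and L: "linear L"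
  shows "(\<Sum>f\<in>F. G f f * G (L f) f) = trace (matrix L)"
proof -
  have "bilinear (\<lambda>u v. G (L u) v)"
    using bil L by (auto simp: bilinear_def linear_add linear_scale intro!: linearI)
      (auto simp: bilinear_ladd[OF bil] bilinear_lmul[OF bil])
  from frame_trace[OF sym this] show ?thesis
    by (simp add: dual_axis[OF bil det] trace_def matrix_def)
qed

text \<open>The matrix of frame vectors enters the Gram determinants of \<open>G\<close> and \<open>H\<close> with the same square.\<close>

lemma det_gram_diagonal:
  fixes H :: "real ^ 'n \<Rightarrow> real ^ 'n \<Rightarrow> real"
  assumes sym: "\<And>u v. G u v = G v u" and H: "bilinear H" "\<And>e f. e \<in> F \<Longrightarrow> f \<in> F \<Longrightarrow> e \<noteq> f \<Longrightarrow> H e f = 0"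
  shows "det (gram H) = det (gram G) * (\<Prod>e\<in>F. G e e * H e e)"
proof -
  have fin: "finite F" using F by (simp add: orthonormal_frame_def)
  have "independent F"
  proof (rule independent_if_scalars_zero[OF fin])
    fix c f assume c: "(\<Sum>x\<in>F. c x *\<^sub>R x) = 0" and f: "f \<in> F"
    have "G (\<Sum>x\<in>F. c x *\<^sub>R x) f = 0" unfolding c by (simp add: bilinear_lzero[OF bil])
    then have "c f * G f f = 0"
      using frame_sum_right[OF f, of c] by (simp add: bilinear_sum_left[OF bil] bilinear_lmul[OF bil])
    then show "c f = 0" using orthonormal_frame_sign[OF F f] by auto
  qed
  \<comment> \<open>Independence fixes the number of frame vectors, so they can be listed as the
    columns of a square matrix \<open>P\<close>.\<close>
  then have "card F = CARD('n)"
    using dim_eq_card[of F UNIV] F dim_UNIV[where 'a = "real ^ 'n"] DIM_cart[where 'a = real and 'b = 'n] dim_span[of F] dim_eq_card_independent[of F]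
    by (simp add: orthonormal_frame_def)
  then obtain b where b: "bij_betw b (UNIV :: 'n set) F"
    using finite_same_card_bij[of "UNIV :: 'n set" F] fin by auto
  then have bF: "b i \<in> F" and inj: "b i = b j \<longleftrightarrow> i = j" for i j
    by (auto simp: bij_betw_def inj_on_def)
  define P where "P = (\<chi> i j. b j $ i)"
  have key: "det P * det P * det (gram K) = (\<Prod>i\<in>UNIV. K (b i) (b i))"
    if K: "bilinear K" "\<And>e f. e \<in> F \<Longrightarrow> f \<in> F \<Longrightarrow> e \<noteq> f \<Longrightarrow> K e f = 0" for K
  proof -
    have "(transpose P ** (gram K ** P)) $ i $ j = K (b i) (b j)" for i j
      by (subst bilinear_gram[OF K(1)]) (simp add: matrix_matrix_mult_def matrix_vector_mult_def transpose_def P_def inner_vec_def)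
    then have "det (transpose P ** (gram K ** P)) = (\<Prod>i\<in>UNIV. K (b i) (b i))"
      by (subst det_diagonal) (auto simp: K(2) bF inj)
    then show ?thesis by (simp add: det_mul det_transpose ac_simps)
  qed
  have G1: "det P * det P * det (gram G) = (\<Prod>i\<in>UNIV. G (b i) (b i))"
    by (rule key[OF bil]) (use F in \<open>auto simp: orthonormal_frame_def\<close>)
  have sq: "(\<Prod>i\<in>UNIV. G (b i) (b i)) * (\<Prod>i\<in>UNIV. G (b i) (b i)) = 1"
    by (simp add: prod.distrib[symmetric] orthonormal_frame_sign[OF F bF])
  \<comment> \<open>The product of the signs has square 1, so the equation \<open>G1\<close> forbids
    a vanishing determinant of \<open>P\<close>.\<close>
  have P0: "det P \<noteq> 0"
  proof
    assume "det P = 0"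
    then have z: "(\<Prod>i\<in>UNIV. G (b i) (b i)) = 0" using G1 by (simp only: mult_zero_left)
    then show False using sq unfolding z by simp
  qed
  have "(\<Prod>e\<in>F. G e e * H e e) = (\<Prod>i\<in>UNIV. G (b i) (b i)) * (\<Prod>i\<in>UNIV. H (b i) (b i))"
    using prod.reindex_bij_betw[OF b, of "\<lambda>e. G e e * H e e"] by (simp add: prod.distrib)
  then have "det P * det P * (det (gram G) * (\<Prod>e\<in>F. G e e * H e e)) =
     ((\<Prod>i\<in>UNIV. G (b i) (b i)) * (\<Prod>i\<in>UNIV. G (b i) (b i))) * (\<Prod>i\<in>UNIV. H (b i) (b i))"
    using G1 by (simp add: ac_simps)
  also have "\<dots> = det P * det P * det (gram H)" unfolding sq using key[OF H] by simp
  finally show ?thesis using P0 by simp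
qed

end

text \<open>The scalar curvature as a double trace over dual bases instead of a frame; no choice
  depending on the point enters.\<close>

definition coord_scal :: "(real ^ 'n \<Rightarrow> real ^ 'n \<Rightarrow> real) \<Rightarrow>
    (real ^ 'n \<Rightarrow> real ^ 'n \<Rightarrow> real ^ 'n \<Rightarrow> real ^ 'n) \<Rightarrow> real ^ 'n::finite \<Rightarrow> real" where
  "coord_scal G \<Gamma> y = (\<Sum>l\<in>UNIV. \<Sum>m\<in>UNIV. coord_curv \<Gamma> y (axis l 1) (axis m 1) (dual_axis G l) $ m)"

definition trilinear :: "(real ^ 'n::finite \<Rightarrow> real ^ 'n \<Rightarrow> real ^ 'n \<Rightarrow> real ^ 'n) \<Rightarrow> bool" where
  "trilinear R \<longleftrightarrow> (\<forall>v w. linear (\<lambda>u. R u v w)) \<and> (\<forall>u w. linear (\<lambda>v. R u v w)) \<and> (\<forall>u v. linear (\<lambda>w. R u v w))"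

lemma trilinear_coord_curv:
  assumes S: "open S" "y \<in> S" and \<Gamma>: "\<And>y. y \<in> S \<Longrightarrow> bilinear (\<Gamma> y)" "\<And>u v. smooth_on S (\<lambda>y. \<Gamma> y u v)"
  shows "trilinear (coord_curv \<Gamma> y)"
proof -
  have b: "bilinear (\<Gamma> y)" using S \<Gamma> by blast
  have p: "bilinear (pderiv_field \<Gamma> y w)" for w
    by (rule bilinear_pderiv_field[OF S]) (use \<Gamma> S smooth_on_differentiable in blast)+
  have l: "linear (\<lambda>w. pderiv_field \<Gamma> y w u v)" for u v
    unfolding pderiv_field_def
    using linear_frechet_derivative[OF smooth_on_differentiable[OF \<Gamma>(2) S(2), of u v]] by simp
  note rules = linear_add[OF l] linear_scale[OF l] bilinear_ladd[OF b] bilinear_radd[OF b]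
    bilinear_lmul[OF b] bilinear_rmul[OF b] bilinear_ladd[OF p] bilinear_radd[OF p] bilinear_lmul[OF p] bilinear_rmul[OF p]
  show ?thesis
    unfolding trilinear_def coord_curv_def
    by (intro conjI allI linearI; simp add: rules scaleR_diff_right scaleR_add_right)
qed

context
  fixes G :: "real ^ 'n::finite \<Rightarrow> real ^ 'n \<Rightarrow> real" and F
    and R :: "real ^ 'n \<Rightarrow> real ^ 'n \<Rightarrow> real ^ 'n \<Rightarrow> real ^ 'n"
  assumes bil: "bilinear G" and det: "det (gram G) \<noteq> 0" and sym: "\<And>u v. G u v = G v u"
    and F: "orthonormal_frame G F" and R: "trilinear R"
begin

text \<open>The inner sum is the Ricci trace of an endomorphism, the outer one the trace of the
  resulting bilinear form.\<close>

lemma frame_double_trace: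
  "(\<Sum>e\<in>F. \<Sum>f\<in>F. G e e * G f f * G (R e f e) f) =
   (\<Sum>l\<in>UNIV. \<Sum>m\<in>UNIV. R (axis l 1) (axis m 1) (dual_axis G l) $ m)"
proof -
  have "bilinear (\<lambda>u w. trace (matrix (\<lambda>x. R u x w)))"
    using R by (auto simp: trilinear_def bilinear_def trace_def matrix_def linear_add linear_scale sum.distrib
        sum_distrib_left intro!: linearI)
       (simp_all add: linear_add[of "\<lambda>u. R u _ _"] linear_scale[of "\<lambda>u. R u _ _"] sum.distrib sum_distrib_left)
  from frame_trace[OF bil det F sym this]
  have "(\<Sum>e\<in>F. G e e * trace (matrix (\<lambda>x. R e x e))) =
     (\<Sum>l\<in>UNIV. \<Sum>m\<in>UNIV. R (axis l 1) (axis m 1) (dual_axis G l) $ m)"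
    by (simp add: trace_def matrix_def)
  moreover have "trace (matrix (\<lambda>x. R e x e)) = (\<Sum>f\<in>F. G f f * G (R e f e) f)" for e
    using R by (intro frame_trace_matrix[OF bil det F sym, symmetric]) (auto simp: trilinear_def)
  ultimately show ?thesis by (simp add: sum_distrib_left mult.assoc)
qed

end

section \<open>Chosen orthonormal bases and frames along the lines\<close>

lemma orthonormal_frame_onb:
  assumes "orthonormal_frame (g p) F" shows "orthonormal_frame (g p) (onb g p UNIV)"
proof -
  have "\<exists>F. finite F \<and> F \<subseteq> UNIV \<and> span F = UNIV \<and>
     (\<forall>e\<in>F. g p e e = 1 \<or> g p e e = -1) \<and> (\<forall>e\<in>F. \<forall>f\<in>F. e \<noteq> f \<longrightarrow> g p e f = 0)"
    using assms by (auto simp: orthonormal_frame_def)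
  from someI_ex[OF this, folded onb_def] show ?thesis by (auto simp: orthonormal_frame_def)
qed

text \<open>Members of an orthonormal set in a line are multiples of one vector. Two distinct ones
  would be orthogonal, against the nonvanishing square of that vector, so the set chosen by
  \<open>onb\<close> is a singleton.\<close>

lemma onb_line:
  assumes V: "subspace V" "dim V = 1" and bil: "bilinear (g p)" and nd: "nondegenerate_on g p V"
  obtains e where "onb g p V = {e}" "span {e} = V" "g p e e = 1 \<or> g p e e = -1"
proof -
  obtain B where B: "B \<subseteq> V" "independent B" "V \<subseteq> span B" "card B = dim V" using basis_exists by blast
  then obtain v where v: "B = {v}" using V(2) card_1_singletonE by metis
  have spv: "span {v} = V" using B v V(1) by (simp add: span_subspace)
  have v0: "v \<noteq> 0" using B(2) v by auto
  have gvv: "g p v v \<noteq> 0"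
  proof
    assume 0: "g p v v = 0"
    have "g p v w = 0" if w: "w \<in> V" for w
    proof -
      obtain a where "w = a *\<^sub>R v" using w spv[unfolded span_singleton] by blast
      then show ?thesis using 0 by (simp add: bilinear_rmul[OF bil])
    qed
    then show False using nd v0 B(1) v by (auto simp: nondegenerate_on_def)
  qed
  \<comment> \<open>Shows that some orthonormal basis exists; the absolute value allows for a
    negative square.\<close>
  define e0 where "e0 = (1 / sqrt \<bar>g p v v\<bar>) *\<^sub>R v"
  have "v = sqrt \<bar>g p v v\<bar> *\<^sub>R e0" using gvv by (simp add: e0_def)
  then have "v \<in> span {e0}" using span_scale[OF span_base[of e0 "{e0}"]] by (metis insertI1)
  moreover have "e0 \<in> span {v}" unfolding e0_def by (intro span_scale span_base) simp
  ultimately have e0: "span {e0} = V" unfolding spv[symmetric] span_eq by simp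
  have "g p e0 e0 = g p v v / \<bar>g p v v\<bar>"
    using gvv by (simp add: e0_def bilinear_lmul[OF bil] bilinear_rmul[OF bil])
  then have "g p e0 e0 = 1 \<or> g p e0 e0 = -1" using gvv by (auto simp: abs_if)
  with e0 have "\<exists>F. finite F \<and> F \<subseteq> V \<and> span F = V \<and>
     (\<forall>e\<in>F. g p e e = 1 \<or> g p e e = -1) \<and> (\<forall>e\<in>F. \<forall>f\<in>F. e \<noteq> f \<longrightarrow> g p e f = 0)"
    using span_superset[of "{e0}"] by (intro exI[of _ "{e0}"]) auto
  from someI_ex[OF this, folded onb_def]
  have o: "onb g p V \<subseteq> V" "span (onb g p V) = V" "\<And>e. e \<in> onb g p V \<Longrightarrow> g p e e = 1 \<or> g p e e = -1"
    "\<And>e f. e \<in> onb g p V \<Longrightarrow> f \<in> onb g p V \<Longrightarrow> e \<noteq> f \<Longrightarrow> g p e f = 0" by auto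
  have "onb g p V \<noteq> {}"
  proof
    assume "onb g p V = {}"
    then have "V = {0}" using o(2) by simp
    then show False using B(1) v v0 by auto
  qed
  then obtain e where e: "e \<in> onb g p V" by blast
  have "f = e" if f: "f \<in> onb g p V" for f
  proof (rule ccontr)
    assume ne: "f \<noteq> e"
    obtain a b where ab: "e = a *\<^sub>R v" "f = b *\<^sub>R v" using e f o(1) spv by (force simp: span_singleton)
    have "a * b * g p v v = 0" using o(4)[OF e f] ne ab by (auto simp: bilinear_lmul[OF bil] bilinear_rmul[OF bil])
    then have "a = 0 \<or> b = 0" using gvv by simp
    then show False using o(3)[OF e] o(3)[OF f] ab by (auto simp: bilinear_lzero[OF bil])
  qed
  then have "onb g p V = {e}" using e by blast
  then show thesis using that o(2,3) e by metis
qed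

context smooth_manifold
begin

lemma orthonormal_frame_comps:
  assumes c: "c \<in> A" "p \<in> fst c" and F: "orthonormal_frame (g p) F"
  shows "orthonormal_frame (rep02 A c g (snd c p)) (comps A c p ` F)" "inj_on (comps A c p) F"
proof -
  have lin: "linear (comps A c p)" by (rule linear_comps[OF c])
  have eq: "rep02 A c g (snd c p) (comps A c p u) (comps A c p v) = g p u v" for u v
    using c by (simp add: rep02_def)
  have "surj (comps A c p)" using comps_tvec[OF c] by (metis surjI)
  then show "orthonormal_frame (rep02 A c g (snd c p)) (comps A c p ` F)"
    using F linear_span_image[OF lin, of F] by (auto simp: orthonormal_frame_def eq)
  show "inj_on (comps A c p) F" using tvec_comps[OF c] by (metis inj_on_inverseI)
qed

lemma scalar_curv_frame_chart:
  assumes g: "metric_on A W g" "smooth_tensor12 A W T" "open W" "p \<in> W" and c: "c \<in> A" "p \<in> fst c"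
    and F: "orthonormal_frame (g p) F"
  shows "(\<Sum>e\<in>F. \<Sum>f\<in>F. g p e e * g p f f * g p (curv A g T p e f e) f) =
    coord_scal (rep02 A c g (snd c p)) (conn_coeff A g T c) (snd c p)"
proof -
  let ?y = "snd c p" let ?K = "comps A c p"
  let ?G = "rep02 A c g ?y" and ?S = "snd c ` (fst c \<inter> W)"
  have y: "?y \<in> ?S" using c g by auto
  have mf: "metric_field ?S (rep02 A c g)" by (rule metric_field_rep02[OF g(1,3) c(1)])
  note fr = orthonormal_frame_comps[where g = g, OF c F]
  have eq: "g p u v = ?G (?K u) (?K v)" for u v using c by (simp add: rep02_def)
  have tri: "trilinear (coord_curv (conn_coeff A g T c) ?y)"
    by (rule trilinear_coord_curv[OF metric_fieldD(1)[OF mf] y bilinear_conn_coeff[OF g(1-3) c(1)]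
         smooth_on_conn_coeff[OF g(1-3) c(1)]])
  have "(\<Sum>e\<in>F. \<Sum>f\<in>F. g p e e * g p f f * g p (curv A g T p e f e) f) =
    (\<Sum>e\<in>F. \<Sum>f\<in>F. ?G (?K e) (?K e) * ?G (?K f) (?K f) *
       ?G (coord_curv (conn_coeff A g T c) ?y (?K e) (?K f) (?K e)) (?K f))"
    unfolding eq comps_curv[OF g c] ..
  also have "\<dots> = (\<Sum>e\<in>?K ` F. \<Sum>f\<in>?K ` F. ?G e e * ?G f f * ?G (coord_curv (conn_coeff A g T c) ?y e f e) f)"
    by (simp add: sum.reindex[OF fr(2)])
  also have "\<dots> = coord_scal ?G (conn_coeff A g T c) ?y"
    unfolding coord_scal_def
    by (rule frame_double_trace[OF metric_fieldD(2)[OF mf y] metric_fieldD(4)[OF mf y] metric_fieldD(3)[OF mf y] fr(1) tri])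
  finally show ?thesis .
qed

text \<open>The basis selected by \<open>onb\<close> may be exchanged for any frame, since both
  double sums have the same value in a chart.\<close>

lemma scalar_curv_frame:
  assumes g: "metric_on A W g" "smooth_tensor12 A W T" "open W" "p \<in> W" and F: "orthonormal_frame (g p) F"
  shows "scalar_curv A g T p = (\<Sum>e\<in>F. \<Sum>f\<in>F. g p e e * g p f f * g p (curv A g T p e f e) f)"
proof -
  let ?c = "chart_at A p" let ?y = "snd ?c p"
  have c: "?c \<in> A" "p \<in> fst ?c" by simp_all
  have mf: "metric_field (snd ?c ` (fst ?c \<inter> W)) (rep02 A ?c g)" by (rule metric_field_rep02[OF g(1,3) c(1)])
  have y: "?y \<in> snd ?c ` (fst ?c \<inter> W)" using g by auto
  have G: "rep02 A ?c g ?y = g p" by (intro ext) (simp add: rep02_chart_at)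
  have gp: "bilinear (g p)" "det (gram (g p)) \<noteq> 0" "g p u v = g p v u" for u v
    using metric_fieldD(2)[OF mf y] metric_fieldD(3)[OF mf y, of u v] metric_fieldD(4)[OF mf y] unfolding G by blast+
  have tri: "trilinear (coord_curv (conn_coeff A g T ?c) ?y)"
    by (rule trilinear_coord_curv[OF metric_fieldD(1)[OF mf] y bilinear_conn_coeff[OF g(1-3) c(1)]
         smooth_on_conn_coeff[OF g(1-3) c(1)]])
  have cv: "curv A g T p u v w = coord_curv (conn_coeff A g T ?c) ?y u v w" for u v w
    using comps_curv[OF g c] by simp
  let ?F = "onb g p UNIV"
  have fr: "orthonormal_frame (g p) ?F" by (rule orthonormal_frame_onb[where g = g, OF F])
  have "scalar_curv A g T p = (\<Sum>e\<in>?F. g p e e * trace (matrix (\<lambda>x. curv A g T p e x e)))"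
    by (simp add: scalar_curv_def ricci_def)
  also have "\<dots> = (\<Sum>e\<in>?F. g p e e * (\<Sum>f\<in>?F. g p f f * g p (curv A g T p e f e) f))"
  proof (intro sum.cong refl arg_cong2[where f = "(*)"])
    fix e
    have "linear (\<lambda>x. curv A g T p e x e)" unfolding cv using tri by (simp add: trilinear_def)
    then show "trace (matrix (\<lambda>x. curv A g T p e x e)) = (\<Sum>f\<in>?F. g p f f * g p (curv A g T p e f e) f)"
      by (rule frame_trace_matrix[OF gp(1,2) fr gp(3), symmetric])
  qed
  also have "\<dots> = (\<Sum>e\<in>?F. \<Sum>f\<in>?F. g p e e * g p f f * g p (curv A g T p e f e) f)"
    by (simp add: sum_distrib_left mult.assoc)
  also have "\<dots> = (\<Sum>e\<in>F. \<Sum>f\<in>F. g p e e * g p f f * g p (curv A g T p e f e) f)"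
    unfolding scalar_curv_frame_chart[OF g c fr] scalar_curv_frame_chart[OF g c F] ..
  finally show ?thesis .
qed

lemma scalar_curv_chart:
  assumes "metric_on A W g" "smooth_tensor12 A W T" "open W" "p \<in> W" "c \<in> A" "p \<in> fst c"
    "orthonormal_frame (g p) F"
  shows "scalar_curv A g T p = coord_scal (rep02 A c g (snd c p)) (conn_coeff A g T c) (snd c p)"
  using scalar_curv_frame[OF assms(1-4,7)] scalar_curv_frame_chart[OF assms] by simp

text \<open>Unit vectors of the lines are orthogonal because the metric is adapted, and they span
  because the lines do.\<close>

lemma adapted_frame:
  assumes ad: "adapted_metric A W k D g" and W: "p \<in> W"
    and D: "\<And>\<mu>. \<mu> \<in> {1..k} \<Longrightarrow> subspace (D \<mu> p) \<and> dim (D \<mu> p) = 1"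
    and span: "span (\<Union>\<mu>\<in>{1..k}. D \<mu> p) = UNIV"
  obtains e where "\<And>\<mu>. \<mu> \<in> {1..k} \<Longrightarrow> onb g p (D \<mu> p) = {e \<mu>}" "\<And>\<mu>. \<mu> \<in> {1..k} \<Longrightarrow> e \<mu> \<in> D \<mu> p"
    "inj_on e {1..k}" "orthonormal_frame (g p) (e ` {1..k})"
proof -
  have bil: "bilinear (g p)" using ad W by (simp add: adapted_metric_def metric_on_def smooth_tensor02_def)
  have "\<exists>e. onb g p (D \<mu> p) = {e} \<and> span {e} = D \<mu> p \<and> (g p e e = 1 \<or> g p e e = -1)" if "\<mu> \<in> {1..k}" for \<mu>
  proof -
    have "nondegenerate_on g p (D \<mu> p)" using ad W that by (auto simp: adapted_metric_def)
    then show ?thesis using onb_line[of "D \<mu> p" g p] D[OF that] bil by metis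
  qed
  then obtain e where e: "\<And>\<mu>. \<mu> \<in> {1..k} \<Longrightarrow> onb g p (D \<mu> p) = {e \<mu>} \<and> span {e \<mu>} = D \<mu> p \<and> (g p (e \<mu>) (e \<mu>) = 1 \<or> g p (e \<mu>) (e \<mu>) = -1)"
    by metis
  have eD: "e \<mu> \<in> D \<mu> p" if "\<mu> \<in> {1..k}" for \<mu> using e[OF that] span_base[of "e \<mu>" "{e \<mu>}"] by auto
  have orth: "g p (e \<mu>) (e \<nu>) = 0" if "\<mu> \<in> {1..k}" "\<nu> \<in> {1..k}" "\<mu> \<noteq> \<nu>" for \<mu> \<nu>
    using ad W that eD by (auto simp: adapted_metric_def)
  \<comment> \<open>Equal vectors from different lines would be orthogonal to themselves.
    Injectivity lets sums over the frame be indexed by the lines.\<close>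
  have inj: "inj_on e {1..k}"
  proof (rule inj_onI, rule ccontr)
    fix \<mu> \<nu> assume *: "\<mu> \<in> {1..k}" "\<nu> \<in> {1..k}" "e \<mu> = e \<nu>" "\<mu> \<noteq> \<nu>"
    then have "g p (e \<mu>) (e \<mu>) = 0" using orth[of \<mu> \<nu>] by simp
    then show False using e[OF *(1)] by auto
  qed
  have "(\<Union>\<mu>\<in>{1..k}. D \<mu> p) \<subseteq> span (e ` {1..k})"
  proof clarify
    fix \<mu> x assume "\<mu> \<in> {1..k}" "x \<in> D \<mu> p"
    moreover have "span {e \<mu>} \<subseteq> span (e ` {1..k})" by (rule span_mono) (use calculation in blast)
    ultimately show "x \<in> span (e ` {1..k})" using e[of \<mu>] by blast
  qed
  then have "span (e ` {1..k}) = UNIV" using span_minimal[OF _ subspace_span] span by blast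
  moreover have "g p a b = 0" if "a \<in> e ` {1..k}" "b \<in> e ` {1..k}" "a \<noteq> b" for a b
    using that orth by blast
  ultimately have "orthonormal_frame (g p) (e ` {1..k})"
    using e by (auto simp: orthonormal_frame_def)
  then show thesis using that e eD inj by metis
qed

text \<open>\<open>Q\<close> need not be symmetric for a connection with contorsion. The mixed
  curvature adds both orders of each pair, which is exactly what the sum over ordered pairs
  requires.\<close>

lemma mixed_scalar_curv_eq:
  assumes ad: "adapted_metric A W k D g" and T: "smooth_tensor12 A W T" and W: "open W" "p \<in> W"
    and D: "\<And>\<mu>. \<mu> \<in> {1..k} \<Longrightarrow> subspace (D \<mu> p) \<and> dim (D \<mu> p) = 1"
    and span: "span (\<Union>\<mu>\<in>{1..k}. D \<mu> p) = UNIV"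
  shows "mixed_scalar_curv A k D g T p = scalar_curv A g T p / 2"
proof -
  obtain e where e: "\<And>\<mu>. \<mu> \<in> {1..k} \<Longrightarrow> onb g p (D \<mu> p) = {e \<mu>}" "inj_on e {1..k}"
    "orthonormal_frame (g p) (e ` {1..k})" using adapted_frame[OF ad W(2) D span] by metis
  have g: "metric_on A W g" using ad by (simp add: adapted_metric_def)
  have bil: "bilinear (g p)" using g W by (simp add: metric_on_def smooth_tensor02_def)
  define Q where "Q \<mu> \<nu> = g p (e \<mu>) (e \<mu>) * g p (e \<nu>) (e \<nu>) * g p (curv A g T p (e \<mu>) (e \<nu>) (e \<mu>)) (e \<nu>)" for \<mu> \<nu>
  have cv: "curv A g T p u v w = coord_curv (conn_coeff A g T (chart_at A p)) (snd (chart_at A p) p) u v w" for u v w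
    using comps_curv[OF g T W chart_at_in] by simp
  \<comment> \<open>\<open>coord_curv\<close> is alternating in its first two arguments, which
    coincide here.\<close>
  have Q0: "Q \<mu> \<mu> = 0" for \<mu>
    by (simp add: Q_def cv coord_curv_def bilinear_lzero[OF bil])
  have "mixed_scalar_curv A k D g T p = 1 / 2 * (\<Sum>\<mu>\<in>{1..k}. \<Sum>\<nu>\<in>{1..<\<mu>}. Q \<nu> \<mu> + Q \<mu> \<nu>)"
    unfolding mixed_scalar_curv_def
  proof (intro arg_cong2[where f = "(*)"] refl sum.cong)
    fix \<mu> \<nu> assume *: "\<mu> \<in> {1..k}" "\<nu> \<in> {1..<\<mu>}"
    then have "onb g p (D \<mu> p) = {e \<mu>}" "onb g p (D \<nu> p) = {e \<nu>}" using e(1) by auto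
    then show "(\<Sum>a\<in>onb g p (D \<nu> p). \<Sum>b\<in>onb g p (D \<mu> p).
       g p a a * g p b b * (g p (curv A g T p a b a) b + g p (curv A g T p b a b) a)) = Q \<nu> \<mu> + Q \<mu> \<nu>"
      by (simp add: Q_def algebra_simps)
  qed
  also have "(\<Sum>\<mu>\<in>{1..k}. \<Sum>\<nu>\<in>{1..<\<mu>}. Q \<nu> \<mu> + Q \<mu> \<nu>) = (\<Sum>\<mu>\<in>{1..k}. \<Sum>\<nu>\<in>{1..k}. Q \<mu> \<nu>)"
  proof (induction k)
    \<comment> \<open>A further line adds one row and one column to the square of indices; the new
      diagonal entry vanishes.\<close>
    case (Suc k)
    have "(\<Sum>\<mu>\<in>{1..Suc k}. \<Sum>\<nu>\<in>{1..Suc k}. Q \<mu> \<nu>) =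
      (\<Sum>\<mu>\<in>{1..k}. \<Sum>\<nu>\<in>{1..k}. Q \<mu> \<nu>) + (\<Sum>\<mu>\<in>{1..k}. Q \<mu> (Suc k)) + (\<Sum>\<nu>\<in>{1..k}. Q (Suc k) \<nu>)"
      by (simp add: sum.distrib Q0)
    moreover have "{1..<Suc k} = {1..k}" by auto
    ultimately show ?case using Suc by (simp add: sum.distrib)
  qed simp
  also have "\<dots> = scalar_curv A g T p"
    unfolding scalar_curv_frame[OF g T W e(3)] sum.reindex[OF e(2)] o_def Q_def ..
  finally show ?thesis by simp
qed

end


section \<open>Change of variables for arbitrary finite index types\<close>

text \<open>The library states the change of variables formula for well-ordered index types only. The
  type \<open>'n ix\<close> is a well-ordered copy of the finite type \<open>'n\<close>.\<close>

typedef ('n::finite) ix = "{..<CARD('n)}"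
  using zero_less_card_finite by blast

instance ix :: (finite) finite
proof
  have "(UNIV :: 'a ix set) = Abs_ix ` {..<CARD('a)}"
    by (metis type_definition.Abs_image type_definition_ix)
  then show "finite (UNIV :: 'a ix set)" by (metis finite_imageI finite_lessThan)
qed

instantiation ix :: (finite) wellorder
begin

definition less_eq_ix :: "'a ix \<Rightarrow> 'a ix \<Rightarrow> bool" where "less_eq_ix x y \<longleftrightarrow> Rep_ix x \<le> Rep_ix y"
definition less_ix :: "'a ix \<Rightarrow> 'a ix \<Rightarrow> bool" where "less_ix x y \<longleftrightarrow> Rep_ix x < Rep_ix y"

instance
proof
  fix P :: "'a ix \<Rightarrow> bool" and a :: "'a ix"
  assume step: "\<And>x. (\<And>y. y < x \<Longrightarrow> P y) \<Longrightarrow> P x"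
  show "P a"
    by (induction a rule: measure_induct_rule[of Rep_ix]) (rule step, simp add: less_ix_def)
qed (auto simp: less_eq_ix_def less_ix_def Rep_ix_inject)

end

lemma ix_bijection: "\<exists>\<pi> :: 'n::finite ix \<Rightarrow> 'n. bij \<pi>"
proof -
  have "CARD('n ix) = CARD('n)"
    using type_definition.card[OF type_definition_ix[where 'n = 'n]] by simp
  then show ?thesis using finite_same_card_bij[of "UNIV :: 'n ix set" "UNIV :: 'n set"] by auto
qed

text \<open>Conjugation by a bijection turns the transposition of two elements into that of their
  images, so a sequence of swaps keeps its length.\<close>

lemma swapidseq_conjugate:
  assumes "bij \<pi>" "swapidseq n p"
  shows "swapidseq n (\<pi> \<circ> p \<circ> inv \<pi>)"
  using assms(2)
proof induction
  case id
  have "\<pi> \<circ> id \<circ> inv \<pi> = id" using assms(1) by (auto simp: fun_eq_iff bij_is_surj surj_f_inv_f)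
  then show ?case by (simp only: swapidseq.id)
next
  case (comp_Suc n p a b)
  have "\<pi> \<circ> (Transposition.transpose a b \<circ> p) \<circ> inv \<pi> = Transposition.transpose (\<pi> a) (\<pi> b) \<circ> (\<pi> \<circ> p \<circ> inv \<pi>)"
    using assms(1) by (auto simp: fun_eq_iff Transposition.transpose_def bij_is_inj inj_eq)
  moreover have "\<pi> a \<noteq> \<pi> b" using comp_Suc.hyps assms(1) by (auto simp: bij_is_inj inj_eq)
  ultimately show ?case using swapidseq.comp_Suc[OF comp_Suc.IH] by metis
qed

lemma sign_conjugate:
  fixes \<pi> :: "'m::finite \<Rightarrow> 'n::finite"
  assumes "bij \<pi>" "p permutes UNIV" shows "sign (\<pi> \<circ> p \<circ> inv \<pi>) = sign p"
proof -
  obtain n where n: "swapidseq n p" using permutation_permutes assms(2) finite_class.finite_UNIV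
    unfolding permutation_def by blast
  show ?thesis
    using evenperm_unique[OF n refl] evenperm_unique[OF swapidseq_conjugate[OF assms(1) n] refl]
    by (simp add: sign_def)
qed

text \<open>Relabelling rows and columns alike conjugates the permutations in the Leibniz formula,
  which preserves their signs.\<close>

lemma det_reindex:
  fixes M :: "real ^ 'n::finite ^ 'n" and \<pi> :: "'m::finite \<Rightarrow> 'n"
  assumes \<pi>: "bij \<pi>"
  shows "det (\<chi> i j. M $ \<pi> i $ \<pi> j) = det M"
proof -
  have inv: "\<pi> (inv \<pi> x) = x" "inv \<pi> (\<pi> y) = y" for x y
    using \<pi> by (simp_all add: bij_is_surj surj_f_inv_f bij_is_inj)
  let ?c = "\<lambda>p. \<pi> \<circ> p \<circ> inv \<pi>"
  have bij: "bij_betw ?c {p. p permutes UNIV} {p. p permutes UNIV}"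
  proof (rule bij_betwI[of _ _ _ "\<lambda>q. inv \<pi> \<circ> q \<circ> \<pi>"])
    have pb: "p permutes UNIV \<longleftrightarrow> bij p" for p :: "'x \<Rightarrow> 'x" by (simp add: permutes_univ bij_iff)
    show "?c \<in> {p. p permutes UNIV} \<rightarrow> {p. p permutes UNIV}"
      using \<pi> by (auto simp: pb intro!: bij_comp bij_imp_bij_inv)
    show "(\<lambda>q. inv \<pi> \<circ> q \<circ> \<pi>) \<in> {p. p permutes UNIV} \<rightarrow> {p. p permutes UNIV}"
      using \<pi> by (auto simp: pb intro!: bij_comp bij_imp_bij_inv)
  qed (auto simp: fun_eq_iff inv)
  have "det M = (\<Sum>p\<in>{p. p permutes (UNIV :: 'm set)}. of_int (sign (?c p)) * (\<Prod>i\<in>UNIV. M $ i $ (?c p) i))"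
    unfolding det_def by (rule sum.reindex_bij_betw[OF bij, symmetric])
  also have "\<dots> = det (\<chi> i j. M $ \<pi> i $ \<pi> j)"
    unfolding det_def
  proof (rule sum.cong)
    fix p :: "'m \<Rightarrow> 'm" assume p: "p \<in> {p. p permutes UNIV}"
    have "(\<Prod>i\<in>UNIV. M $ i $ (?c p) i) = (\<Prod>i\<in>UNIV. M $ \<pi> i $ (?c p) (\<pi> i))"
      by (rule prod.reindex_bij_betw[OF \<pi>, symmetric])
    then show "of_int (sign (?c p)) * (\<Prod>i\<in>UNIV. M $ i $ (?c p) i) =
        of_int (sign p) * (\<Prod>i\<in>UNIV. (\<chi> i j. M $ \<pi> i $ \<pi> j) $ i $ p i)"
      using p by (simp add: sign_conjugate[OF \<pi>] inv)
  qed simp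
  finally show ?thesis by simp
qed

section \<open>Lebesgue measure and substitution under relabelling of coordinates\<close>

definition reindex_vec :: "('m \<Rightarrow> 'n) \<Rightarrow> real ^ 'n \<Rightarrow> real ^ 'm" where
  "reindex_vec \<pi> x = (\<chi> i. x $ \<pi> i)"

lemma linear_reindex_vec: "linear (reindex_vec \<pi>)"
  by (auto intro!: linearI simp: reindex_vec_def vec_eq_iff)

lemma prod_Basis_vec: "(\<Prod>b\<in>Basis. f b) = (\<Prod>i\<in>UNIV. f (axis i 1 :: real ^ 'n::finite))"
proof -
  have eq: "(Basis :: (real ^ 'n) set) = range (\<lambda>i. axis i 1)" by (auto simp: Basis_vec_def)
  have inj: "inj (\<lambda>i. axis i (1::real) :: real ^ 'n)" by (auto simp: inj_on_def axis_eq_axis)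
  show ?thesis unfolding eq prod.reindex[OF inj] o_def ..
qed

lemma borel_measurable_reindex_vec [measurable]:
  fixes \<pi> :: "'m::finite \<Rightarrow> 'n::finite" shows "reindex_vec \<pi> \<in> borel_measurable borel"
  by (intro borel_measurable_continuous_onI linear_continuous_on linear_conv_bounded_linear[THEN iffD1] linear_reindex_vec)

text \<open>Lebesgue measure is determined by its values on boxes, and relabelling maps a box to a
  box with the same edge lengths.\<close>

lemma distr_lborel_reindex:
  fixes \<pi> :: "'m::finite \<Rightarrow> 'n::finite"
  assumes \<pi>: "bij \<pi>"
  shows "lborel = distr lborel borel (reindex_vec \<pi>)"
proof (rule lborel_eqI)
  have inv: "\<pi> (inv \<pi> x) = x" "inv \<pi> (\<pi> y) = y" for x y
    using \<pi> by (simp_all add: bij_is_surj surj_f_inv_f bij_is_inj)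
  fix l u :: "real ^ 'm" assume lu: "\<And>b. b \<in> Basis \<Longrightarrow> l \<bullet> b \<le> u \<bullet> b"
  have le: "l $ i \<le> u $ i" for i using lu[of "axis i 1"] by (simp add: cart_eq_inner_axis)
  let ?r = "reindex_vec (inv \<pi>)"
  have pre: "reindex_vec \<pi> -` box l u = box (?r l) (?r u)"
  proof (intro set_eqI iffI)
    fix x assume "x \<in> reindex_vec \<pi> -` box l u"
    then have *: "l $ i < x $ \<pi> i \<and> x $ \<pi> i < u $ i" for i by (simp add: mem_box_cart reindex_vec_def)
    show "x \<in> box (?r l) (?r u)" using *[of "inv \<pi> _"] by (simp add: mem_box_cart reindex_vec_def inv)
  next
    fix x assume "x \<in> box (?r l) (?r u)"
    then have *: "l $ inv \<pi> i < x $ i \<and> x $ i < u $ inv \<pi> i" for i by (simp add: mem_box_cart reindex_vec_def)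
    show "x \<in> reindex_vec \<pi> -` box l u" using *[of "\<pi> _"] by (simp add: mem_box_cart reindex_vec_def inv)
  qed
  have "emeasure (distr lborel borel (reindex_vec \<pi>)) (box l u) = emeasure lborel (box (?r l) (?r u))"
    by (simp add: emeasure_distr pre)
  also have "\<dots> = (\<Prod>i\<in>UNIV. u $ inv \<pi> i - l $ inv \<pi> i)"
  proof (subst emeasure_lborel_box)
    fix b :: "real ^ 'n" assume "b \<in> Basis"
    then show "?r l \<bullet> b \<le> ?r u \<bullet> b" by (auto simp: Basis_vec_def inner_axis reindex_vec_def le)
  qed (simp add: prod_Basis_vec inner_axis reindex_vec_def)
  also have "(\<Prod>i\<in>UNIV. u $ inv \<pi> i - l $ inv \<pi> i) = (\<Prod>i\<in>UNIV. u $ i - l $ i)"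
    by (rule prod.reindex_bij_betw[OF bij_imp_bij_inv[OF \<pi>], of "\<lambda>i. u $ i - l $ i"])
  also have "\<dots> = (\<Prod>b\<in>Basis. (u - l) \<bullet> b)" by (simp add: prod_Basis_vec inner_axis)
  finally show "emeasure (distr lborel borel (reindex_vec \<pi>)) (box l u) = (\<Prod>b\<in>Basis. (u - l) \<bullet> b)" .
qed simp

text \<open>Links the integral in which the substitution rule is phrased with the nonnegative
  integral over \<open>lborel\<close> that defines volumes.\<close>

lemma absolutely_integrable_iff_nn_integral:
  fixes f :: "'a::euclidean_space \<Rightarrow> real"
  assumes m: "(\<lambda>x. indicator S x * f x) \<in> borel_measurable borel" and nn: "\<And>x. x \<in> S \<Longrightarrow> f x \<ge> 0"
  shows "f absolutely_integrable_on S \<longleftrightarrow> (\<integral>\<^sup>+x\<in>S. ennreal (f x) \<partial>lborel) < \<infinity>"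
    and "f absolutely_integrable_on S \<Longrightarrow> (\<integral>\<^sup>+x\<in>S. ennreal (f x) \<partial>lborel) = ennreal (integral S f)"
proof -
  let ?g = "\<lambda>x. indicator S x *\<^sub>R f x"
  have m': "?g \<in> borel_measurable lborel" using m by simp
  have nn': "0 \<le> ?g x" for x using nn by (simp add: indicator_def)
  have eq: "(\<integral>\<^sup>+x\<in>S. ennreal (f x) \<partial>lborel) = (\<integral>\<^sup>+x. ennreal (?g x) \<partial>lborel)"
    by (intro nn_integral_cong) (simp add: indicator_def)
  have i: "f absolutely_integrable_on S \<longleftrightarrow> integrable lborel ?g"
    unfolding set_integrable_def using integrable_completion[OF m'] by simp
  also have "\<dots> \<longleftrightarrow> (\<integral>\<^sup>+x\<in>S. ennreal (f x) \<partial>lborel) < \<infinity>"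
    unfolding eq integrable_iff_bounded using m' nn' by simp
  finally show "f absolutely_integrable_on S \<longleftrightarrow> (\<integral>\<^sup>+x\<in>S. ennreal (f x) \<partial>lborel) < \<infinity>" .
  assume ai: "f absolutely_integrable_on S"
  have "integral S f = integral\<^sup>L lebesgue ?g"
    using set_lebesgue_integral_eq_integral(2)[OF ai] by (simp add: set_lebesgue_integral_def)
  also have "\<dots> = integral\<^sup>L lborel ?g" by (rule integral_completion[OF m'])
  finally show "(\<integral>\<^sup>+x\<in>S. ennreal (f x) \<partial>lborel) = ennreal (integral S f)"
    unfolding eq using nn_integral_eq_integral[of lborel ?g] ai i nn' by simp
qed

text \<open>Substitution is an equivalence of absolute integrability with equal integrals. For
  nonnegative functions failure of integrability means the value infinity on both sides, so the
  formula covers infinite values too.\<close>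

lemma nn_integral_substitution_wellorder:
  fixes \<tau> :: "real ^ 'm::{finite,wellorder} \<Rightarrow> real ^ 'm::_" and f :: "real ^ 'm::_ \<Rightarrow> real"
  assumes S: "S \<in> sets borel" and der: "\<And>x. x \<in> S \<Longrightarrow> (\<tau> has_derivative \<tau>' x) (at x)" and inj: "inj_on \<tau> S"
    and m: "(\<lambda>y. indicator (\<tau> ` S) y * f y) \<in> borel_measurable borel"
      "(\<lambda>x. indicator S x * (\<bar>det (matrix (\<tau>' x))\<bar> * f (\<tau> x))) \<in> borel_measurable borel"
    and nn: "\<And>x. x \<in> S \<Longrightarrow> f (\<tau> x) \<ge> 0"
  shows "(\<integral>\<^sup>+y\<in>\<tau> ` S. ennreal (f y) \<partial>lborel) = (\<integral>\<^sup>+x\<in>S. ennreal (\<bar>det (matrix (\<tau>' x))\<bar> * f (\<tau> x)) \<partial>lborel)"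
proof -
  let ?h = "\<lambda>x. \<bar>det (matrix (\<tau>' x))\<bar> * f (\<tau> x)"
  have S': "S \<in> sets lebesgue" using S by (simp add: sets_completionI_sets)
  have cov: "(?h absolutely_integrable_on S \<and> integral S ?h = b) \<longleftrightarrow>
     (f absolutely_integrable_on \<tau> ` S \<and> integral (\<tau> ` S) f = b)" for b
  proof -
    \<comment> \<open>Real values are passed as vectors of length one, the form in which the
      substitution rule takes them.\<close>
    have "((\<lambda>x. \<bar>det (matrix (\<tau>' x))\<bar> *\<^sub>R (vec (f (\<tau> x)) :: real ^ 1)) absolutely_integrable_on S \<and>
        integral S (\<lambda>x. \<bar>det (matrix (\<tau>' x))\<bar> *\<^sub>R (vec (f (\<tau> x)) :: real ^ 1)) = vec b) \<longleftrightarrow>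
      ((\<lambda>x. vec (f x) :: real ^ 1) absolutely_integrable_on \<tau> ` S \<and> integral (\<tau> ` S) (\<lambda>x. vec (f x) :: real ^ 1) = vec b)"
      by (rule has_absolute_integral_change_of_variables[OF S' has_derivative_at_withinI[OF der] inj])
    then show ?thesis
      unfolding absolutely_integrable_on_1_iff integral_on_1_eq by (simp add: vec_eq_iff)
  qed
  have nn1: "f y \<ge> 0" if "y \<in> \<tau> ` S" for y using nn that by blast
  have nn2: "?h x \<ge> 0" if "x \<in> S" for x using nn that by simp
  note F = absolutely_integrable_iff_nn_integral[OF m(1) nn1] and H = absolutely_integrable_iff_nn_integral[OF m(2) nn2]
  show ?thesis
  proof (cases "f absolutely_integrable_on \<tau> ` S")
    case True
    then have "?h absolutely_integrable_on S" "integral S ?h = integral (\<tau> ` S) f" using cov by blast+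
    then show ?thesis using F(2) H(2) True by simp
  next
    case False
    then have "\<not> ?h absolutely_integrable_on S" using cov by blast
    then show ?thesis using F(1) H(1) False by (simp add: not_less top_unique)
  qed
qed

text \<open>Conjugation with the relabelling \<open>\<phi>\<close> moves the claim to a well-ordered
  index type; neither Lebesgue measure nor the Jacobian determinant changes.\<close>

lemma nn_integral_substitution:
  fixes \<tau> :: "real ^ 'n::finite \<Rightarrow> real ^ 'n" and f :: "real ^ 'n \<Rightarrow> real"
  assumes S: "S \<in> sets borel" and der: "\<And>x. x \<in> S \<Longrightarrow> (\<tau> has_derivative \<tau>' x) (at x)" and inj: "inj_on \<tau> S"
    and m: "(\<lambda>y. indicator (\<tau> ` S) y * f y) \<in> borel_measurable borel"
      "(\<lambda>x. indicator S x * (\<bar>det (matrix (\<tau>' x))\<bar> * f (\<tau> x))) \<in> borel_measurable borel"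
    and nn: "\<And>x. x \<in> S \<Longrightarrow> f (\<tau> x) \<ge> 0"
  shows "(\<integral>\<^sup>+y\<in>\<tau> ` S. ennreal (f y) \<partial>lborel) = (\<integral>\<^sup>+x\<in>S. ennreal (\<bar>det (matrix (\<tau>' x))\<bar> * f (\<tau> x)) \<partial>lborel)"
proof -
  obtain \<pi> :: "'n ix \<Rightarrow> 'n" where \<pi>: "bij \<pi>" using ix_bijection by blast
  have inv: "\<pi> (inv \<pi> x) = x" "inv \<pi> (\<pi> y) = y" for x y
    using \<pi> by (simp_all add: bij_is_surj surj_f_inv_f bij_is_inj)
  define \<phi> where "\<phi> = (reindex_vec \<pi> :: real ^ 'n \<Rightarrow> real ^ 'n ix)"
  define \<psi> where "\<psi> = (reindex_vec (inv \<pi>) :: real ^ 'n ix \<Rightarrow> real ^ 'n)"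
  have \<phi>\<psi>: "\<phi> (\<psi> z) = z" "\<psi> (\<phi> x) = x" for x z by (simp_all add: \<phi>_def \<psi>_def reindex_vec_def inv vec_eq_iff)
  have meas: "\<phi> \<in> borel_measurable borel" "\<psi> \<in> borel_measurable borel" unfolding \<phi>_def \<psi>_def by simp_all
  have bl: "bounded_linear \<phi>" "bounded_linear \<psi>"
    unfolding \<phi>_def \<psi>_def using linear_reindex_vec linear_conv_bounded_linear by blast+
  have lb: "(lborel :: (real ^ 'n) measure) = distr lborel borel \<psi>"
    unfolding \<psi>_def by (rule distr_lborel_reindex[OF bij_imp_bij_inv[OF \<pi>]])
  \<comment> \<open>Images under \<open>\<phi>\<close> are preimages under \<open>\<psi>\<close>,
    which makes them Borel sets.\<close>
  have imv: "\<phi> ` X = \<psi> -` X" for X by (auto simp: \<phi>\<psi> image_iff intro!: bexI[of _ "\<psi> _"])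
  have ind: "indicator (\<phi> ` X) z = indicator X (\<psi> z)" for X and z by (simp add: imv indicator_def)
  have tr: "(\<integral>\<^sup>+x\<in>X. ennreal (F x) \<partial>lborel) = (\<integral>\<^sup>+z\<in>\<phi> ` X. ennreal (F (\<psi> z)) \<partial>lborel)"
    if "(\<lambda>x. indicator X x * F x) \<in> borel_measurable borel" for X and F :: "real ^ 'n \<Rightarrow> real"
  proof -
    have e: "(\<lambda>x. ennreal (F x) * indicator X x) = (\<lambda>x. ennreal (indicator X x * F x))"
      by (auto simp: indicator_def)
    have "(\<integral>\<^sup>+x\<in>X. ennreal (F x) \<partial>lborel) = (\<integral>\<^sup>+x. ennreal (indicator X x * F x) \<partial>distr lborel borel \<psi>)"
      unfolding e using lb by simp
    also have "\<dots> = (\<integral>\<^sup>+z. ennreal (indicator X (\<psi> z) * F (\<psi> z)) \<partial>lborel)"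
      by (rule nn_integral_distr) (use meas that in \<open>auto simp: measurable_lborel1\<close>)
    also have "\<dots> = (\<integral>\<^sup>+z\<in>\<phi> ` X. ennreal (F (\<psi> z)) \<partial>lborel)"
      unfolding ind by (intro nn_integral_cong) (simp add: indicator_def)
    finally show ?thesis .
  qed
  define \<sigma> where "\<sigma> = \<phi> \<circ> \<tau> \<circ> \<psi>"
  define \<sigma>' where "\<sigma>' z = \<phi> \<circ> \<tau>' (\<psi> z) \<circ> \<psi>" for z
  have dt: "det (matrix (\<sigma>' z)) = det (matrix (\<tau>' (\<psi> z)))" for z
  proof -
    have "\<psi> (axis j 1) = axis (\<pi> j) 1" for j
      using inv by (auto simp: \<psi>_def reindex_vec_def vec_eq_iff axis_def)
    then have "matrix (\<sigma>' z) = (\<chi> i j. matrix (\<tau>' (\<psi> z)) $ \<pi> i $ \<pi> j)"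
      by (simp add: \<sigma>'_def matrix_def \<phi>_def reindex_vec_def)
    then show ?thesis by (simp add: det_reindex[OF \<pi>])
  qed
  have im: "\<sigma> ` (\<phi> ` S) = \<phi> ` (\<tau> ` S)" by (auto simp: \<sigma>_def image_comp o_def \<phi>\<psi>)
  have comp: "(\<lambda>z. h (\<psi> z)) \<in> borel_measurable borel" if "h \<in> borel_measurable borel" for h :: "real ^ 'n \<Rightarrow> real"
    using measurable_compose[OF meas(2) that] by simp
  have "(\<integral>\<^sup>+y\<in>\<tau> ` S. ennreal (f y) \<partial>lborel) = (\<integral>\<^sup>+z\<in>\<sigma> ` (\<phi> ` S). ennreal (f (\<psi> z)) \<partial>lborel)"
    unfolding im by (rule tr[OF m(1)])
  also have "\<dots> = (\<integral>\<^sup>+z\<in>\<phi> ` S. ennreal (\<bar>det (matrix (\<sigma>' z))\<bar> * f (\<psi> (\<sigma> z))) \<partial>lborel)"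
  proof (rule nn_integral_substitution_wellorder)
    show "\<phi> ` S \<in> sets borel" unfolding imv using measurable_sets[OF meas(2) S] by simp
    show "(\<sigma> has_derivative \<sigma>' z) (at z)" if "z \<in> \<phi> ` S" for z
    proof -
      have z: "\<psi> z \<in> S" using that \<phi>\<psi> by auto
      have "(\<psi> has_derivative \<psi>) (at z)" by (rule bounded_linear_imp_has_derivative[OF bl(2)])
      from has_derivative_compose[OF this der[OF z]]
      have "((\<lambda>z. \<tau> (\<psi> z)) has_derivative (\<lambda>v. \<tau>' (\<psi> z) (\<psi> v))) (at z)" .
      from bounded_linear.has_derivative[OF bl(1) this] show ?thesis
        by (simp add: \<sigma>_def \<sigma>'_def o_def)
    qed
    show "inj_on \<sigma> (\<phi> ` S)"
    proof (rule inj_onI)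
      fix z z' assume "z \<in> \<phi> ` S" "z' \<in> \<phi> ` S" "\<sigma> z = \<sigma> z'"
      then have "\<tau> (\<psi> z) = \<tau> (\<psi> z')" "\<psi> z \<in> S" "\<psi> z' \<in> S"
        using \<phi>\<psi> by (auto simp: \<sigma>_def) (metis \<phi>\<psi>(2))
      then have "\<psi> z = \<psi> z'" using inj by (simp add: inj_on_def)
      then show "z = z'" by (metis \<phi>\<psi>(1))
    qed
    show "(\<lambda>z. indicator (\<sigma> ` \<phi> ` S) z * f (\<psi> z)) \<in> borel_measurable borel"
      unfolding im ind by (rule comp[OF m(1)])
    show "(\<lambda>z. indicator (\<phi> ` S) z * (\<bar>det (matrix (\<sigma>' z))\<bar> * f (\<psi> (\<sigma> z)))) \<in> borel_measurable borel"
      unfolding ind dt using comp[OF m(2)] by (simp add: \<sigma>_def \<phi>\<psi>)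
    show "0 \<le> f (\<psi> (\<sigma> z))" if "z \<in> \<phi> ` S" for z using that nn by (auto simp: \<sigma>_def \<phi>\<psi>)
  qed
  also have "\<dots> = (\<integral>\<^sup>+x\<in>S. ennreal (\<bar>det (matrix (\<tau>' x))\<bar> * f (\<tau> x)) \<partial>lborel)"
    unfolding tr[OF m(2)] dt by (simp add: \<sigma>_def \<phi>\<psi>)
  finally show ?thesis .
qed


section \<open>The volume measure\<close>

text \<open>Tonelli's theorem for counting measure.\<close>

lemma ennreal_suminf_swap:
  fixes a :: "nat \<Rightarrow> nat \<Rightarrow> ennreal"
  shows "(\<Sum>i. \<Sum>n. a i n) = (\<Sum>n. \<Sum>i. a i n)"
proof -
  have "(\<Sum>i. \<Sum>n. a i n) = (\<integral>\<^sup>+i. (\<Sum>n. a i n) \<partial>count_space UNIV)"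
    by (simp add: nn_integral_count_space_nat)
  also have "\<dots> = (\<Sum>n. \<integral>\<^sup>+i. a i n \<partial>count_space UNIV)" by (rule nn_integral_suminf) simp
  finally show ?thesis by (simp add: nn_integral_count_space_nat)
qed

lemma sets_restrict_UNIV: "sets (restrict_space M UNIV) = sets M"
  by (simp add: sets_restrict_space)

context smooth_manifold
begin

text \<open>The condition under the description operator of \<open>vol_measure\<close>, named so
  that existence and uniqueness can be shown separately.\<close>

definition is_volume :: "'m set \<Rightarrow> ('m, 'n) tensor02 \<Rightarrow> 'm measure \<Rightarrow> bool" where
  "is_volume W g \<mu> \<longleftrightarrow> sets \<mu> = sets (restrict_space borel W) \<and>
     (\<forall>c\<in>A. \<forall>S\<in>sets borel. S \<subseteq> fst c \<inter> W \<longrightarrow>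
        emeasure \<mu> S = (\<integral>\<^sup>+y\<in>snd c ` S. ennreal (vol_density A c g y) \<partial>lborel))"

lemma chart_image_borel:
  assumes c: "c \<in> A" and S: "S \<in> sets borel" "S \<subseteq> fst c" shows "snd c ` S \<in> sets borel"
proof -
  have "cinv c \<in> measurable (restrict_space borel (snd c ` fst c)) borel"
    by (rule borel_measurable_continuous_on_restrict[OF continuous_on_cinv[OF c]])
  from measurable_sets[OF this S(1)]
  have "cinv c -` S \<inter> snd c ` fst c \<in> sets borel"
    using chart_image_open[OF c] by (simp add: space_restrict_space sets_restrict_space_iff)
  moreover have "cinv c -` S \<inter> snd c ` fst c = snd c ` S" using c S(2) by force
  ultimately show ?thesis by simp
qed

lemma inj_on_chart: "c \<in> A \<Longrightarrow> inj_on (snd c) (fst c)"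
  by (metis cinv_chart inj_on_inverseI)

text \<open>Second countability enters through Lindelof's theorem; charts may repeat in the
  enumeration.\<close>

lemma countable_atlas:
  obtains C :: "nat \<Rightarrow> ('m, 'n) chart" where "\<And>i. C i \<in> A" "(\<Union>i. fst (C i)) = UNIV"
proof -
  obtain F where F: "F \<subseteq> fst ` A" "countable F" "\<Union>F = \<Union>(fst ` A)"
    using Lindelof[of "fst ` A"] chart_open by blast
  have U: "\<Union>F = UNIV" using F(3) atlas by (simp add: smooth_atlas_def)
  then have "F \<noteq> {}" by auto
  define C where "C i = (SOME c. c \<in> A \<and> fst c = from_nat_into F i)" for i
  have C: "C i \<in> A \<and> fst (C i) = from_nat_into F i" for i
  proof -
    have "from_nat_into F i \<in> fst ` A" using from_nat_into[OF \<open>F \<noteq> {}\<close>] F(1) by blast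
    then have "\<exists>c. c \<in> A \<and> fst c = from_nat_into F i" by auto
    from someI_ex[OF this] show ?thesis unfolding C_def .
  qed
  have "(\<Union>i. fst (C i)) = UNIV"
    using C U range_from_nat_into[OF \<open>F \<noteq> {}\<close> F(2)] by auto
  with C show thesis using that by blast
qed

lemma disjoint_cover:
  obtains C :: "nat \<Rightarrow> ('m, 'n) chart" and B where "\<And>i. C i \<in> A" "(\<Union>i. B i) = UNIV" "disjoint_family B"
    "\<And>i. B i \<in> sets borel" "\<And>i. B i \<subseteq> fst (C i)"
proof -
  obtain C :: "nat \<Rightarrow> ('m, 'n) chart" where C: "\<And>i. C i \<in> A" "(\<Union>i. fst (C i)) = UNIV"
    using countable_atlas by blast
  show thesis
  proof (rule that[of C "disjointed (\<lambda>i. fst (C i))"])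
    show "(\<Union>i. disjointed (\<lambda>i. fst (C i)) i) = UNIV" using UN_disjointed_eq[of "\<lambda>i. fst (C i)"] C by simp
    show "disjointed (\<lambda>i. fst (C i)) i \<in> sets borel" for i
      unfolding disjointed_def using chart_open[OF C(1)] by (intro sets.Diff sets.finite_UN) auto
  qed (auto simp: C disjoint_family_disjointed disjointed_def)
qed

text \<open>A change of chart multiplies the Gram matrix on both sides by the Jacobian matrix. The
  signed version makes the ratio of two Gram determinants independent of the chart.\<close>

lemma vol_density_coord_change:
  assumes c: "c \<in> A" "c' \<in> A" "p \<in> fst c" "p \<in> fst c'" and h: "bilinear (h p)"
  shows "det (gram (rep02 A c h (snd c p))) =
     (det (matrix (coord_change c c' p)))\<^sup>2 * det (gram (rep02 A c' h (snd c' p)))"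
    and "vol_density A c h (snd c p) = \<bar>det (matrix (coord_change c c' p))\<bar> * vol_density A c' h (snd c' p)"
proof -
  let ?L = "coord_change c c' p" let ?H = "rep02 A c' h (snd c' p)"
  have lin: "linear ?L" by (rule linear_coord_change[OF c])
  have bil: "bilinear ?H" by (rule bilinear_rep02[where h = h, OF c(2,4) h])
  have "gram (rep02 A c h (snd c p)) = transpose (matrix ?L) ** (gram ?H ** matrix ?L)"
  proof -
    have "rep02 A c h (snd c p) u v = ?L u \<bullet> (gram ?H *v ?L v)" for u v
      using rep02_coord_change[OF c, of h u v] bilinear_gram[OF bil] by simp
    then have "gram (rep02 A c h (snd c p)) $ i $ j = ?L (axis i 1) \<bullet> (gram ?H *v ?L (axis j 1))" for i j
      by (simp add: gram_def)
    moreover have "(transpose (matrix ?L) ** (gram ?H ** matrix ?L)) $ i $ j = ?L (axis i 1) \<bullet> (gram ?H *v ?L (axis j 1))" for i j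
      by (simp add: matrix_matrix_mult_def matrix_vector_mult_def transpose_def matrix_def inner_vec_def)
    ultimately show ?thesis by (simp add: vec_eq_iff)
  qed
  then show *: "det (gram (rep02 A c h (snd c p))) = (det (matrix ?L))\<^sup>2 * det (gram ?H)"
    by (simp add: det_mul det_transpose power2_eq_square)
  show "vol_density A c h (snd c p) = \<bar>det (matrix ?L)\<bar> * vol_density A c' h (snd c' p)"
    using * by (simp add: vol_density_def gram_def[symmetric] abs_mult real_sqrt_mult)
qed

lemma continuous_on_vol_density:
  assumes g: "metric_on A W g" "open W" "c \<in> A"
  shows "continuous_on (snd c ` (fst c \<inter> W)) (vol_density A c g)"
proof -
  note mf = metric_field_rep02[OF g]
  have "continuous_on (snd c ` (fst c \<inter> W)) (\<lambda>y. det (gram (rep02 A c g y)))"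
    by (intro smooth_on_imp_continuous_on smooth_on_det metric_fieldD(1)[OF mf])
       (simp add: gram_def metric_fieldD(5)[OF mf])
  then show ?thesis
    unfolding vol_density_def [abs_def] gram_def[symmetric] by (intro continuous_intros)
qed

lemma vol_density_nonneg: "0 \<le> vol_density A c g y"
  by (simp add: vol_density_def)

lemma borel_measurable_vol_density:
  assumes g: "metric_on A W g" "open W" "c \<in> A" and S: "S \<in> sets borel" "S \<subseteq> fst c \<inter> W"
  shows "(\<lambda>y. indicator (snd c ` S) y * vol_density A c g y) \<in> borel_measurable borel"
proof -
  have "continuous_on (snd c ` S) (vol_density A c g)"
    by (rule continuous_on_subset[OF continuous_on_vol_density[OF g]]) (use S in auto)
  from borel_measurable_continuous_on_indicator[OF chart_image_borel[OF g(3) S(1)] this] S(2)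
  show ?thesis by simp
qed

text \<open>The Jacobian from substituting the transition map is the factor by which the two
  densities differ.\<close>

lemma vol_integral_chart_independent:
  assumes g: "metric_on A UNIV g" and c: "c \<in> A" "c' \<in> A" and S: "S \<in> sets borel" "S \<subseteq> fst c" "S \<subseteq> fst c'"
  shows "(\<integral>\<^sup>+y\<in>snd c' ` S. ennreal (vol_density A c' g y) \<partial>lborel) =
    (\<integral>\<^sup>+y\<in>snd c ` S. ennreal (vol_density A c g y) \<partial>lborel)"
proof -
  let ?\<tau> = "snd c' \<circ> cinv c"
  have im: "?\<tau> ` (snd c ` S) = snd c' ` S"
    using c S by (force simp: image_iff)
  have bor: "snd c ` S \<in> sets borel" by (rule chart_image_borel[OF c(1) S(1,2)])
  have gb: "bilinear (g p)" for p using g by (simp add: metric_on_def smooth_tensor02_def)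
  have eq: "\<bar>det (matrix (coord_change c c' (cinv c x)))\<bar> * vol_density A c' g (?\<tau> x) = vol_density A c g x"
    if x: "x \<in> snd c ` S" for x
  proof -
    obtain p where p: "p \<in> fst c" "p \<in> fst c'" "x = snd c p" using x S by auto
    show ?thesis using vol_density_coord_change(2)[where h = g, OF c p(1,2) gb] p c by simp
  qed
  have "(\<integral>\<^sup>+y\<in>?\<tau> ` (snd c ` S). ennreal (vol_density A c' g y) \<partial>lborel) =
    (\<integral>\<^sup>+x\<in>snd c ` S. ennreal (\<bar>det (matrix (coord_change c c' (cinv c x)))\<bar> * vol_density A c' g (?\<tau> x)) \<partial>lborel)"
  proof (rule nn_integral_substitution[OF bor])
    show "(?\<tau> has_derivative coord_change c c' (cinv c x)) (at x)" if x: "x \<in> snd c ` S" for x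
    proof -
      obtain p where p: "p \<in> fst c" "p \<in> fst c'" "x = snd c p" using x S by auto
      show ?thesis using has_derivative_transition[OF c p(1,2)] p c by simp
    qed
    show "inj_on ?\<tau> (snd c ` S)"
    proof (rule inj_onI)
      fix x y assume xy: "x \<in> snd c ` S" "y \<in> snd c ` S" "?\<tau> x = ?\<tau> y"
      then obtain p q where pq: "p \<in> S" "q \<in> S" "x = snd c p" "y = snd c q" by blast
      then have "p \<in> fst c" "q \<in> fst c" "p \<in> fst c'" "q \<in> fst c'" using S by auto
      then have "p = q" using xy(3) pq(3,4) c inj_onD[OF inj_on_chart[OF c(2)], of p q] by simp
      then show "x = y" using pq by simp
    qed
    show "(\<lambda>y. indicator (?\<tau> ` snd c ` S) y * vol_density A c' g y) \<in> borel_measurable borel"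
      unfolding im by (rule borel_measurable_vol_density[OF g open_UNIV c(2) S(1)]) (use S in auto)
    have "(\<lambda>x. indicator (snd c ` S) x * vol_density A c g x) \<in> borel_measurable borel"
      by (rule borel_measurable_vol_density[OF g open_UNIV c(1) S(1)]) (use S in auto)
    moreover have "(\<lambda>x. indicator (snd c ` S) x * (\<bar>det (matrix (coord_change c c' (cinv c x)))\<bar> * vol_density A c' g (?\<tau> x))) =
        (\<lambda>x. indicator (snd c ` S) x * vol_density A c g x)"
    proof
      fix x
      show "indicator (snd c ` S) x * (\<bar>det (matrix (coord_change c c' (cinv c x)))\<bar> * vol_density A c' g (?\<tau> x)) =
         indicator (snd c ` S) x * vol_density A c g x"
        using eq[of x] by (cases "x \<in> snd c ` S") simp_all
    qed
    ultimately show "(\<lambda>x. indicator (snd c ` S) x * (\<bar>det (matrix (coord_change c c' (cinv c x)))\<bar> * vol_density A c' g (?\<tau> x)))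
      \<in> borel_measurable borel" by simp
  qed (simp add: vol_density_nonneg)
  also have "\<dots> = (\<integral>\<^sup>+x\<in>snd c ` S. ennreal (vol_density A c g x) \<partial>lborel)"
    by (intro nn_integral_cong) (auto simp: indicator_def eq simp del: o_apply)
  finally show ?thesis unfolding im .
qed

lemma nn_integral_chart_disjoint:
  assumes c: "c \<in> A" and S: "\<And>n. S n \<in> sets borel" "\<And>n. S n \<subseteq> fst c" "disjoint_family S"
    and d: "(\<lambda>y. indicator (snd c ` fst c) y * d y) \<in> borel_measurable borel" "\<And>y. 0 \<le> d y"
  shows "(\<integral>\<^sup>+y\<in>snd c ` (\<Union>n. S n). ennreal (d y) \<partial>lborel) = (\<Sum>n. \<integral>\<^sup>+y\<in>snd c ` S n. ennreal (d y) \<partial>lborel)"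
proof -
  have dj: "disjoint_family (\<lambda>n. snd c ` S n)"
    unfolding disjoint_family_on_def
  proof (intro ballI impI)
    fix m n :: nat assume "m \<noteq> n"
    then have "S m \<inter> S n = {}" using S(3) by (auto simp: disjoint_family_on_def)
    then show "snd c ` S m \<inter> snd c ` S n = {}"
      using inj_on_image_Int[OF inj_on_chart[OF c] S(2)[of m] S(2)[of n]] by simp
  qed
  have meas: "(\<lambda>y. ennreal (d y) * indicator (snd c ` S n) y) \<in> borel_measurable lborel" for n
  proof -
    have "(\<lambda>y. ennreal (indicator (snd c ` fst c) y * d y) * indicator (snd c ` S n) y) \<in> borel_measurable borel"
      using d(1) chart_image_borel[OF c S(1,2)] by measurable
    moreover have "(\<lambda>y. ennreal (indicator (snd c ` fst c) y * d y) * indicator (snd c ` S n) y) =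
        (\<lambda>y. ennreal (d y) * indicator (snd c ` S n) y)"
      using S(2)[of n] by (auto simp: indicator_def fun_eq_iff)
    ultimately show ?thesis by simp
  qed
  have "(\<integral>\<^sup>+y\<in>snd c ` (\<Union>n. S n). ennreal (d y) \<partial>lborel) =
      (\<integral>\<^sup>+y. (\<Sum>n. ennreal (d y) * indicator (snd c ` S n) y) \<partial>lborel)"
    by (intro nn_integral_cong) (simp add: image_UN suminf_indicator[OF dj, symmetric])
  also have "\<dots> = (\<Sum>n. \<integral>\<^sup>+y\<in>snd c ` S n. ennreal (d y) \<partial>lborel)"
    by (rule nn_integral_suminf[OF meas])
  finally show ?thesis .
qed

text \<open>The measure is assembled from disjoint Borel pieces, each inside one chart. Countable
  additivity is an exchange of two sums, and chart independence on each piece gives the required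
  density in every chart.\<close>

lemma volume_exists:
  assumes g: "metric_on A UNIV g"
  shows "\<exists>\<mu>. is_volume UNIV g \<mu>"
proof -
  obtain C :: "nat \<Rightarrow> ('m, 'n) chart" and B where C: "\<And>i. C i \<in> A" "(\<Union>i. B i) = UNIV" "disjoint_family B" "\<And>i. B i \<in> sets borel" "\<And>i. B i \<subseteq> fst (C i)"
    by (rule disjoint_cover) blast
  define m where "m S = (\<Sum>i. \<integral>\<^sup>+y\<in>snd (C i) ` (S \<inter> B i). ennreal (vol_density A (C i) g y) \<partial>lborel)" for S
  have d: "(\<lambda>y. indicator (snd c ` fst c) y * vol_density A c g y) \<in> borel_measurable borel" if "c \<in> A" for c
    by (rule borel_measurable_vol_density[OF g open_UNIV that]) (use chart_open[OF that] in auto)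
  define \<mu> where "\<mu> = measure_of UNIV (sets borel) m"
  have sets: "sets \<mu> = sets borel" unfolding \<mu>_def by (simp add: sets.sigma_sets_eq[of borel, simplified])
  have em: "emeasure \<mu> S = m S" if "S \<in> sets borel" for S
  proof (rule emeasure_measure_of[OF \<mu>_def])
    show "S \<in> sets \<mu>" using that sets by simp
    show "positive (sets \<mu>) m" by (simp add: positive_def m_def)
    show "countably_additive (sets \<mu>) m"
      unfolding countably_additive_def
    proof (intro allI impI)
      fix X :: "nat \<Rightarrow> 'm set" assume X: "range X \<subseteq> sets \<mu>" "disjoint_family X"
      have "m (\<Union>n. X n) = (\<Sum>i. \<Sum>n. \<integral>\<^sup>+y\<in>snd (C i) ` (X n \<inter> B i). ennreal (vol_density A (C i) g y) \<partial>lborel)"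
        unfolding m_def
      proof (rule suminf_cong)
        fix i
        have "(\<Union>n. X n) \<inter> B i = (\<Union>n. X n \<inter> B i)" by auto
        show "(\<integral>\<^sup>+y\<in>snd (C i) ` ((\<Union>n. X n) \<inter> B i). ennreal (vol_density A (C i) g y) \<partial>lborel) =
          (\<Sum>n. \<integral>\<^sup>+y\<in>snd (C i) ` (X n \<inter> B i). ennreal (vol_density A (C i) g y) \<partial>lborel)"
          unfolding \<open>(\<Union>n. X n) \<inter> B i = _\<close> using X C(4)[of i] C(5)[of i] sets
          by (intro nn_integral_chart_disjoint[OF C(1) _ _ _ d[OF C(1)] vol_density_nonneg])
             (auto simp: disjoint_family_on_def)
      qed
      also have "\<dots> = (\<Sum>n. m (X n))" unfolding m_def by (rule ennreal_suminf_swap)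
      finally show "(\<Sum>n. m (X n)) = m (\<Union>n. X n)" by simp
    qed
  qed auto
  have "is_volume UNIV g \<mu>"
    unfolding is_volume_def
  proof (intro conjI ballI impI)
    show "sets \<mu> = sets (restrict_space borel UNIV)" by (simp add: sets sets_restrict_UNIV)
    fix c S assume c: "c \<in> A" and S: "S \<in> sets borel" "S \<subseteq> fst c \<inter> UNIV"
    have "emeasure \<mu> S = (\<Sum>i. \<integral>\<^sup>+y\<in>snd c ` (S \<inter> B i). ennreal (vol_density A c g y) \<partial>lborel)"
      unfolding em[OF S(1)] m_def
    proof (rule suminf_cong)
      fix i
      show "(\<integral>\<^sup>+y\<in>snd (C i) ` (S \<inter> B i). ennreal (vol_density A (C i) g y) \<partial>lborel) =
        (\<integral>\<^sup>+y\<in>snd c ` (S \<inter> B i). ennreal (vol_density A c g y) \<partial>lborel)"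
        by (rule vol_integral_chart_independent[OF g c C(1)]) (use S C(4,5) in auto)
    qed
    also have "\<dots> = (\<integral>\<^sup>+y\<in>snd c ` (\<Union>i. S \<inter> B i). ennreal (vol_density A c g y) \<partial>lborel)"
      using S C(3,4) by (intro nn_integral_chart_disjoint[OF c _ _ _ d[OF c] vol_density_nonneg, symmetric])
        (auto simp: disjoint_family_on_def)
    also have "(\<Union>i. S \<inter> B i) = S" using C(2) by blast
    finally show "emeasure \<mu> S = (\<integral>\<^sup>+y\<in>snd c ` S. ennreal (vol_density A c g y) \<partial>lborel)" .
  qed
  then show ?thesis by blast
qed

text \<open>Countably many disjoint pieces, each inside one chart, cover the manifold, and on each
  piece the value is prescribed.\<close>

lemma volume_unique:
  assumes W: "open W" and \<mu>: "is_volume W g \<mu>" "is_volume W g \<mu>'"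
  shows "\<mu> = \<mu>'"
proof (rule measure_eqI)
  obtain C :: "nat \<Rightarrow> ('m, 'n) chart" and B where C: "\<And>i. C i \<in> A" "(\<Union>i. B i) = UNIV" "disjoint_family B" "\<And>i. B i \<in> sets borel" "\<And>i. B i \<subseteq> fst (C i)"
    by (rule disjoint_cover) blast
  show "sets \<mu> = sets \<mu>'" using \<mu> by (simp add: is_volume_def)
  fix X assume "X \<in> sets \<mu>"
  then have X: "X \<in> sets borel" "X \<subseteq> W" using \<mu>(1) W by (auto simp: is_volume_def sets_restrict_space_iff)
  have *: "emeasure \<rho> X = (\<Sum>i. \<integral>\<^sup>+y\<in>snd (C i) ` (X \<inter> B i). ennreal (vol_density A (C i) g y) \<partial>lborel)"
    if \<rho>: "is_volume W g \<rho>" for \<rho>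
  proof -
    have s: "X \<inter> B i \<in> sets \<rho>" for i
      using \<rho> X C(4) W by (auto simp: is_volume_def sets_restrict_space_iff)
    have "(\<Sum>i. emeasure \<rho> (X \<inter> B i)) = emeasure \<rho> (\<Union>i. X \<inter> B i)"
      by (rule suminf_emeasure) (use s C(3) in \<open>auto simp: disjoint_family_on_def\<close>)
    moreover have "(\<Union>i. X \<inter> B i) = X" using C(2) by blast
    moreover have "emeasure \<rho> (X \<inter> B i) = (\<integral>\<^sup>+y\<in>snd (C i) ` (X \<inter> B i). ennreal (vol_density A (C i) g y) \<partial>lborel)" for i
    proof -
      have "X \<inter> B i \<in> sets borel" "X \<inter> B i \<subseteq> fst (C i) \<inter> W" using X C(4)[of i] C(5)[of i] by auto
      with \<rho> C(1)[of i] show ?thesis unfolding is_volume_def by blast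
    qed
    ultimately show ?thesis by simp
  qed
  show "emeasure \<mu> X = emeasure \<mu>' X" using *[OF \<mu>(1)] *[OF \<mu>(2)] by simp
qed

lemma vol_measure_eqI: "open W \<Longrightarrow> is_volume W g \<mu> \<Longrightarrow> vol_measure A W g = \<mu>"
  unfolding vol_measure_def is_volume_def[symmetric]
  by (rule the_equality) (auto intro: volume_unique)

lemma is_volume_vol_measure: "metric_on A UNIV g \<Longrightarrow> is_volume UNIV g (vol_measure A UNIV g)"
  using volume_exists vol_measure_eqI by (metis open_UNIV)

section \<open>Integration against the volume of one fixed metric\<close>

context
  fixes g :: "('m, 'n) tensor02" and \<nu> :: "'m measure"
  assumes g: "metric_on A UNIV g" and \<nu>_def: "\<nu> = vol_measure A UNIV g"
begin

lemma sets_vol: "sets \<nu> = sets borel" and space_vol: "space \<nu> = UNIV"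
proof -
  show s: "sets \<nu> = sets borel"
    using is_volume_vol_measure[OF g] by (simp add: \<nu>_def is_volume_def sets_restrict_UNIV)
  show "space \<nu> = UNIV" using sets_eq_imp_space_eq[OF s] by simp
qed

lemma emeasure_vol: "c \<in> A \<Longrightarrow> S \<in> sets borel \<Longrightarrow> S \<subseteq> fst c \<Longrightarrow>
    emeasure \<nu> S = (\<integral>\<^sup>+y\<in>snd c ` S. ennreal (vol_density A c g y) \<partial>lborel)"
  using is_volume_vol_measure[OF g] by (simp add: \<nu>_def is_volume_def)

text \<open>On the chart domain the volume is the push-forward of a density on coordinate space, so
  nonnegative integrals can be pulled back.\<close>

lemma nn_integral_vol_chart:
  assumes c: "c \<in> A" and S: "S \<in> sets borel" "S \<subseteq> fst c" and h: "h \<in> borel_measurable borel"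
  shows "(\<integral>\<^sup>+p\<in>S. h p \<partial>\<nu>) = (\<integral>\<^sup>+y\<in>snd c ` S. h (cinv c y) * ennreal (vol_density A c g y) \<partial>lborel)"
proof -
  \<comment> \<open>Outside the image of the chart the inverse takes an arbitrary constant value.
    This makes it Borel on the whole coordinate space, and the density of \<open>N\<close> vanishes
    there.\<close>
  define \<kappa> where "\<kappa> y = (if y \<in> snd c ` fst c then cinv c y else undefined)" for y
  let ?I = "snd c ` fst c"
  have I: "?I \<in> sets borel" using chart_image_open[OF c] by simp
  have pre: "\<kappa> -` X \<inter> ?I = snd c ` (X \<inter> fst c)" for X using c by (force simp: \<kappa>_def)
  have \<kappa>: "\<kappa> \<in> measurable borel borel"
  proof (rule measurableI)
    fix X :: "'m set" assume X: "X \<in> sets borel"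
    have "X \<inter> fst c \<in> sets borel" using X chart_open[OF c] by auto
    then have 1: "\<kappa> -` X \<inter> ?I \<in> sets borel" unfolding pre by (intro chart_image_borel[OF c]) auto
    have 2: "\<kappa> -` X - ?I = (if undefined \<in> X then - ?I else {})" by (auto simp: \<kappa>_def split: if_splits)
    have "\<kappa> -` X - ?I \<in> sets borel" unfolding 2 using I by auto
    then have "(\<kappa> -` X \<inter> ?I) \<union> (\<kappa> -` X - ?I) \<in> sets borel" using 1 by blast
    then show "\<kappa> -` X \<inter> space borel \<in> sets borel" by (simp add: Int_Diff_Un)
  qed auto
  have dm: "(\<lambda>y. ennreal (vol_density A c g y) * indicator ?I y) \<in> borel_measurable borel"
  proof -
    have "(\<lambda>y. ennreal (indicator ?I y * vol_density A c g y)) \<in> borel_measurable borel"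
      using borel_measurable_vol_density[OF g open_UNIV c, of "fst c"] chart_open[OF c] by simp
    then show ?thesis
      by (rule measurable_cong[THEN iffD1, rotated]) (auto simp: indicator_def)
  qed
  define N where "N = density lborel (\<lambda>y. ennreal (vol_density A c g y) * indicator ?I y)"
  have cb: "fst c \<in> sets borel" using chart_open[OF c] by simp
  have eq: "density \<nu> (indicator (fst c)) = distr N borel \<kappa>"
  proof (rule measure_eqI)
    show "sets (density \<nu> (indicator (fst c))) = sets (distr N borel \<kappa>)" by (simp add: sets_vol)
    fix X assume "X \<in> sets (density \<nu> (indicator (fst c)))"
    then have X: "X \<in> sets borel" by (simp add: sets_vol)
    have XS: "X \<inter> fst c \<in> sets borel" using X cb by auto
    have "emeasure (density \<nu> (indicator (fst c))) X = (\<integral>\<^sup>+p. indicator (fst c \<inter> X) p \<partial>\<nu>)"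
      using X cb by (subst emeasure_density) (auto simp: sets_vol measurable_cong_sets[OF sets_vol refl] indicator_inter_arith[symmetric])
    also have "\<dots> = emeasure \<nu> (X \<inter> fst c)" using XS by (simp add: sets_vol Int_commute)
    also have "\<dots> = (\<integral>\<^sup>+y\<in>snd c ` (X \<inter> fst c). ennreal (vol_density A c g y) \<partial>lborel)"
      by (rule emeasure_vol[OF c XS]) auto
    also have "\<dots> = (\<integral>\<^sup>+y. ennreal (vol_density A c g y) * indicator ?I y * indicator (\<kappa> -` X) y \<partial>lborel)"
      unfolding pre[symmetric] by (intro nn_integral_cong) (auto simp: indicator_def)
    also have "\<dots> = emeasure N (\<kappa> -` X)"
      unfolding N_def using measurable_sets[OF \<kappa> X] dm by (subst emeasure_density) auto
    also have "\<dots> = emeasure (distr N borel \<kappa>) X"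
      using X \<kappa> by (subst emeasure_distr) (auto simp: N_def)
    finally show "emeasure (density \<nu> (indicator (fst c))) X = emeasure (distr N borel \<kappa>) X" .
  qed
  have hS: "(\<lambda>p. h p * indicator S p) \<in> borel_measurable borel" using h S(1) by measurable
  have h\<nu>: "(\<lambda>p. h p * indicator S p) \<in> borel_measurable \<nu>" using hS by (simp add: measurable_cong_sets[OF sets_vol refl])
  have "(\<integral>\<^sup>+p\<in>S. h p \<partial>\<nu>) = (\<integral>\<^sup>+p. indicator (fst c) p * (h p * indicator S p) \<partial>\<nu>)"
    using S(2) by (intro nn_integral_cong) (auto simp: indicator_def)
  also have "\<dots> = (\<integral>\<^sup>+p. h p * indicator S p \<partial>density \<nu> (indicator (fst c)))"
    using cb h\<nu> by (intro nn_integral_density[symmetric]) (auto simp: measurable_cong_sets[OF sets_vol refl])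
  also have "\<dots> = (\<integral>\<^sup>+y. h (\<kappa> y) * indicator S (\<kappa> y) \<partial>N)"
    unfolding eq using \<kappa> hS by (intro nn_integral_distr) (auto simp: N_def)
  also have "\<dots> = (\<integral>\<^sup>+y. (ennreal (vol_density A c g y) * indicator ?I y) * (h (\<kappa> y) * indicator S (\<kappa> y)) \<partial>lborel)"
    unfolding N_def using dm measurable_compose[OF \<kappa> hS] by (intro nn_integral_density) auto
  also have "\<dots> = (\<integral>\<^sup>+y\<in>snd c ` S. h (cinv c y) * ennreal (vol_density A c g y) \<partial>lborel)"
  proof (intro nn_integral_cong)
    fix y
    have "y \<in> snd c ` S \<longleftrightarrow> y \<in> ?I \<and> \<kappa> y \<in> S" using S(2) pre[of S] by (auto simp: Int_absorb2)
    then show "(ennreal (vol_density A c g y) * indicator ?I y) * (h (\<kappa> y) * indicator S (\<kappa> y)) =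
      h (cinv c y) * ennreal (vol_density A c g y) * indicator (snd c ` S) y"
      by (auto simp: indicator_def \<kappa>_def mult.commute)
  qed
  finally show ?thesis .
qed

text \<open>Volumes of different metrics are expressed by the single measure \<open>\<nu>\<close>. A
  family of measures thus becomes a family of integrands, which can be differentiated. The indicator
  cuts off where \<open>f\<close> is not controlled.\<close>

lemma vol_measure_density:
  assumes U: "open U" and f: "(\<lambda>p. indicator U p * f p) \<in> borel_measurable borel" "\<And>p. p \<in> U \<Longrightarrow> 0 \<le> f p"
    and dens: "\<And>c p. c \<in> A \<Longrightarrow> p \<in> fst c \<Longrightarrow> p \<in> U \<Longrightarrow> vol_density A c g' (snd c p) = f p * vol_density A c g (snd c p)"
  shows "vol_measure A U g' = restrict_space (density \<nu> (\<lambda>p. ennreal (indicator U p * f p))) U"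
proof (rule vol_measure_eqI[OF U])
  let ?f = "\<lambda>p. ennreal (indicator U p * f p)"
  have fm: "?f \<in> borel_measurable borel" using f(1) by measurable
  then have fm': "?f \<in> borel_measurable \<nu>" by (simp add: measurable_cong_sets[OF sets_vol refl])
  show "is_volume U g' (restrict_space (density \<nu> ?f) U)"
    unfolding is_volume_def
  proof (intro conjI ballI impI)
    show "sets (restrict_space (density \<nu> ?f) U) = sets (restrict_space borel U)"
      by (rule sets_restrict_space_cong) (simp add: sets_vol)
    fix c S assume c: "c \<in> A" and S: "S \<in> sets borel" "S \<subseteq> fst c \<inter> U"
    have "emeasure (restrict_space (density \<nu> ?f) U) S = emeasure (density \<nu> ?f) S"
      using S U by (intro emeasure_restrict_space) (auto simp: sets_vol space_vol)
    also have "\<dots> = (\<integral>\<^sup>+p\<in>S. ?f p \<partial>\<nu>)" using S fm' by (intro emeasure_density) (auto simp: sets_vol)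
    also have "\<dots> = (\<integral>\<^sup>+y\<in>snd c ` S. ?f (cinv c y) * ennreal (vol_density A c g y) \<partial>lborel)"
      by (rule nn_integral_vol_chart[OF c S(1) _ fm]) (use S in auto)
    also have "\<dots> = (\<integral>\<^sup>+y\<in>snd c ` S. ennreal (vol_density A c g' y) \<partial>lborel)"
    proof (intro nn_integral_cong)
      fix y
      show "?f (cinv c y) * ennreal (vol_density A c g y) * indicator (snd c ` S) y =
        ennreal (vol_density A c g' y) * indicator (snd c ` S) y"
      proof (cases "y \<in> snd c ` S")
        case True
        then obtain p where p: "p \<in> fst c" "p \<in> U" "y = snd c p" using S by auto
        show ?thesis using dens[OF c p(1,2)] p c f(2)[OF p(2)]
          by (simp add: ennreal_mult vol_density_nonneg)
      qed simp
    qed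
    finally show "emeasure (restrict_space (density \<nu> ?f) U) S = (\<integral>\<^sup>+y\<in>snd c ` S. ennreal (vol_density A c g' y) \<partial>lborel)" .
  qed
qed

lemma integral_vol_density:
  fixes s :: "'m \<Rightarrow> real"
  assumes U: "open U" and f: "(\<lambda>p. indicator U p * f p) \<in> borel_measurable borel" "\<And>p. p \<in> U \<Longrightarrow> 0 \<le> f p"
    and dens: "\<And>c p. c \<in> A \<Longrightarrow> p \<in> fst c \<Longrightarrow> p \<in> U \<Longrightarrow> vol_density A c g' (snd c p) = f p * vol_density A c g (snd c p)"
    and s: "(\<lambda>p. indicator U p * s p) \<in> borel_measurable borel"
  shows "(LINT p|vol_measure A U g'. s p) = (LINT p|\<nu>. indicator U p * (f p * s p))"
proof -
  have eq: "vol_measure A U g' = restrict_space (density \<nu> (\<lambda>p. ennreal (indicator U p * f p))) U"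
    by (rule vol_measure_density[OF U f dens])
  have "(LINT p|vol_measure A U g'. s p) = (LINT p|density \<nu> (\<lambda>p. ennreal (indicator U p * f p)). indicator U p * s p)"
    unfolding eq
    using U by (subst integral_restrict_space) (auto simp: space_vol sets_vol)
  also have "\<dots> = (LINT p|\<nu>. (indicator U p * f p) *\<^sub>R (indicator U p * s p))"
    using f s by (intro integral_density) (auto simp: measurable_cong_sets[OF sets_vol refl] indicator_def)
  also have "\<dots> = (LINT p|\<nu>. indicator U p * (f p * s p))"
    by (intro Bochner_Integration.integral_cong) (auto simp: indicator_def)
  finally show ?thesis .
qed

lemma measure_vol_density:
  assumes U: "open U" and f: "(\<lambda>p. indicator U p * f p) \<in> borel_measurable borel" "\<And>p. p \<in> U \<Longrightarrow> 0 \<le> f p"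
    and dens: "\<And>c p. c \<in> A \<Longrightarrow> p \<in> fst c \<Longrightarrow> p \<in> U \<Longrightarrow> vol_density A c g' (snd c p) = f p * vol_density A c g (snd c p)"
  shows "measure (vol_measure A U g') U = (LINT p|\<nu>. indicator U p * f p)"
proof -
  have eq: "vol_measure A U g' = restrict_space (density \<nu> (\<lambda>p. ennreal (indicator U p * f p))) U"
    by (rule vol_measure_density[OF U f dens])
  have "space (vol_measure A U g') = U"
    unfolding eq by (simp add: space_restrict_space space_vol)
  then have "measure (vol_measure A U g') U = (LINT p|vol_measure A U g'. 1)" by simp
  also have "\<dots> = (LINT p|\<nu>. indicator U p * (f p * 1))"
    by (rule integral_vol_density[where f = f and g' = g', OF U f dens]) (use U in auto)
  finally show ?thesis by simp
qed

lemma integral_vol_restrict: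
  fixes s :: "'m \<Rightarrow> real"
  assumes U: "open U" and s: "(\<lambda>p. indicator U p * s p) \<in> borel_measurable borel"
  shows "(LINT p|vol_measure A U g. s p) = (LINT p|\<nu>. indicator U p * s p)"
  using integral_vol_density[OF U, of "\<lambda>_. 1" g s] U s by simp

text \<open>In a chart the density is bounded on a closed ball, so every point has a neighbourhood
  of finite volume; compactness leaves finitely many.\<close>

lemma finite_vol_compact_closure:
  assumes U: "compact (closure U)" "U \<in> sets borel" shows "emeasure \<nu> U < \<infinity>"
proof -
  have "\<exists>N. open N \<and> p \<in> N \<and> emeasure \<nu> N < \<infinity>" for p
  proof -
    let ?c = "chart_at A p"
    have c: "?c \<in> A" "p \<in> fst ?c" by simp_all
    obtain r where r: "r > 0" "cball (snd ?c p) r \<subseteq> snd ?c ` fst ?c"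
      using open_contains_cball[of "snd ?c ` fst ?c"] chart_image_open[OF c(1)] c(2) by (meson imageI)
    let ?B = "ball (snd ?c p) r"
    define N where "N = fst ?c \<inter> snd ?c -` ?B"
    have N: "open N" unfolding N_def
      using continuous_open_preimage[OF continuous_on_chart[OF c(1)] chart_open[OF c(1)] open_ball] .
    have cont: "continuous_on (cball (snd ?c p) r) (vol_density A ?c g)"
      using continuous_on_subset[OF continuous_on_vol_density[OF g open_UNIV c(1)]] r by simp
    have "bounded (vol_density A ?c g ` cball (snd ?c p) r)"
      by (rule compact_imp_bounded[OF compact_continuous_image[OF cont compact_cball]])
    then obtain K where K: "\<forall>y\<in>cball (snd ?c p) r. \<bar>vol_density A ?c g y\<bar> \<le> K"
      unfolding bounded_iff by auto
    have "emeasure \<nu> N = (\<integral>\<^sup>+y\<in>snd ?c ` N. ennreal (vol_density A ?c g y) \<partial>lborel)"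
      using N by (intro emeasure_vol[OF c(1)]) (auto simp: N_def)
    also have "\<dots> \<le> (\<integral>\<^sup>+y\<in>?B. ennreal K \<partial>lborel)"
    proof (rule nn_integral_mono)
      fix y
      show "ennreal (vol_density A ?c g y) * indicator (snd ?c ` N) y \<le> ennreal K * indicator ?B y"
      proof (cases "y \<in> snd ?c ` N")
        case True
        then have "y \<in> ?B" by (auto simp: N_def)
        then show ?thesis using K[rule_format, of y] by (auto simp: indicator_def intro!: ennreal_leI)
      qed simp
    qed
    also have "\<dots> = ennreal K * emeasure lborel ?B" by (simp add: nn_integral_cmult_indicator)
    also have "\<dots> < \<infinity>" using emeasure_lborel_ball_finite[of "snd ?c p" r] by (simp add: ennreal_mult_less_top)
    finally have "emeasure \<nu> N < \<infinity>" .
    moreover have "p \<in> N" using c r by (simp add: N_def)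
    ultimately show ?thesis using N by blast
  qed
  then obtain N where N: "\<And>p. open (N p)" "\<And>p. p \<in> N p" "\<And>p. emeasure \<nu> (N p) < \<infinity>" by metis
  obtain P where P: "finite P" "closure U \<subseteq> (\<Union>p\<in>P. N p)"
    using compactE_image[OF U(1), of UNIV N] N by (metis UN_I UNIV_I subsetI)
  have "emeasure \<nu> U \<le> emeasure \<nu> (\<Union>p\<in>P. N p)"
    using P closure_subset N by (intro emeasure_mono) (auto simp: sets_vol)
  also have "\<dots> \<le> (\<Sum>p\<in>P. emeasure \<nu> (N p))"
    using P N by (intro emeasure_subadditive_finite) (auto simp: sets_vol)
  also have "\<dots> < \<infinity>" using N(3) by (simp add: less_top P)
  finally show ?thesis .
qed

end

end


section \<open>First-order jets in time\<close>

text \<open>A Frechet derivative of the joint function in direction \<open>(1, 0)\<close>, so that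
  Schwarz's theorem can exchange it with derivatives in space.\<close>

definition time_deriv :: "(real \<times> 'a::real_normed_vector \<Rightarrow> real) \<Rightarrow> 'a \<Rightarrow> real" where
  "time_deriv \<phi> y = frechet_derivative \<phi> (at (0, y)) (1, 0)"

text \<open>The time derivative of \<open>\<phi>3\<close> at time \<open>0\<close> is a fixed linear combination of those of \<open>\<phi>1\<close> and
  \<open>\<phi>2\<close>, the initial values being equal. The relation is preserved by all smooth operations and by
  spatial derivatives, hence is inherited by every differential expression in the metric.\<close>

definition jet3 :: "real \<Rightarrow> real \<Rightarrow> real set \<Rightarrow> 'a::euclidean_space set \<Rightarrow>
    (real \<times> 'a \<Rightarrow> real) \<Rightarrow> (real \<times> 'a \<Rightarrow> real) \<Rightarrow> (real \<times> 'a \<Rightarrow> real) \<Rightarrow> bool" where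
  "jet3 a b I V \<phi>1 \<phi>2 \<phi>3 \<longleftrightarrow> smooth_on (I \<times> V) \<phi>1 \<and> smooth_on (I \<times> V) \<phi>2 \<and> smooth_on (I \<times> V) \<phi>3 \<and>
     (\<forall>y\<in>V. \<phi>1 (0, y) = \<phi>3 (0, y) \<and> \<phi>2 (0, y) = \<phi>3 (0, y) \<and>
        time_deriv \<phi>3 y = a * time_deriv \<phi>1 y + b * time_deriv \<phi>2 y)"

lemma smooth_on_time_slice:
  fixes \<phi> :: "real \<times> 'a::real_normed_vector \<Rightarrow> real"
  assumes "smooth_on (I \<times> V) \<phi>" "t \<in> I" "y \<in> V"
  shows "((\<lambda>s. \<phi> (s, y)) has_real_derivative frechet_derivative \<phi> (at (t, y)) (1, 0)) (at t)"
proof -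
  have D: "(\<phi> has_derivative frechet_derivative \<phi> (at (t, y))) (at (t, y))"
    by (rule smooth_on_has_derivative[OF assms(1)]) (use assms in auto)
  have "((\<lambda>s. (s, y)) has_derivative (\<lambda>s. (s, 0))) (at t)"
    by (intro has_derivative_Pair has_derivative_ident has_derivative_const)
  from has_derivative_compose[OF this D]
  have "((\<lambda>s. \<phi> (s, y)) has_derivative (\<lambda>s. frechet_derivative \<phi> (at (t, y)) (s, 0))) (at t)" .
  moreover have "(\<lambda>s. frechet_derivative \<phi> (at (t, y)) (s, 0)) = (*) (frechet_derivative \<phi> (at (t, y)) (1, 0))"
  proof
    fix s
    have "frechet_derivative \<phi> (at (t, y)) (s *\<^sub>R (1, 0)) = s *\<^sub>R frechet_derivative \<phi> (at (t, y)) (1, 0)"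
      by (rule linear_scale[OF has_derivative_linear[OF D]])
    then show "frechet_derivative \<phi> (at (t, y)) (s, 0) = frechet_derivative \<phi> (at (t, y)) (1, 0) * s" by simp
  qed
  ultimately show ?thesis by (simp add: has_field_derivative_def)
qed

lemma smooth_on_space_slice:
  fixes \<phi> :: "real \<times> 'a::real_normed_vector \<Rightarrow> 'b::real_normed_vector"
  assumes "smooth_on (I \<times> V) \<phi>" "t \<in> I" "y \<in> V"
  shows "((\<lambda>y. \<phi> (t, y)) has_derivative (\<lambda>w. frechet_derivative \<phi> (at (t, y)) (0, w))) (at y)"
proof -
  have D: "(\<phi> has_derivative frechet_derivative \<phi> (at (t, y))) (at (t, y))"
    by (rule smooth_on_has_derivative[OF assms(1)]) (use assms in auto)
  have "((\<lambda>z. (t, z)) has_derivative (\<lambda>w. (0, w))) (at y)"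
    by (intro has_derivative_Pair has_derivative_ident has_derivative_const)
  from has_derivative_compose[OF this D] show ?thesis .
qed

lemma smooth_on_snd:
  fixes f :: "'a::euclidean_space \<Rightarrow> 'b::real_normed_vector" and I :: "real set"
  assumes "open I" "open V" "smooth_on V f" shows "smooth_on (I \<times> V) (\<lambda>z. f (snd z))"
  by (rule smooth_on_compose[OF open_Times[OF assms(1,2)] assms(2,3) smooth_on_bounded_linear[OF bounded_linear_snd]]) auto

lemma time_deriv_eqI:
  assumes "smooth_on (I \<times> V) \<phi>" "0 \<in> I" "y \<in> V" "((\<lambda>s. \<phi> (s, y)) has_real_derivative d) (at 0)"
  shows "time_deriv \<phi> y = d"
  using DERIV_unique[OF smooth_on_time_slice[OF assms(1-3)] assms(4)] by (simp add: time_deriv_def)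

lemma time_deriv_slice:
  assumes "smooth_on (I \<times> V) \<phi>" "0 \<in> I" "y \<in> V"
  shows "((\<lambda>s. \<phi> (s, y)) has_real_derivative time_deriv \<phi> y) (at 0)"
  using smooth_on_time_slice[OF assms] by (simp add: time_deriv_def)

context
  fixes a b :: real and I :: "real set" and V :: "'a::euclidean_space set"
  assumes I: "open I" "0 \<in> I" and V: "open V"
begin

lemma IV: "open (I \<times> V)" using I V by (simp add: open_Times)

lemma jet3_cong:
  assumes "jet3 a b I V \<phi>1 \<phi>2 \<phi>3" and eq: "\<And>t y. t \<in> I \<Longrightarrow> y \<in> V \<Longrightarrow> \<phi>1 (t, y) = \<psi>1 (t, y)"
    "\<And>t y. t \<in> I \<Longrightarrow> y \<in> V \<Longrightarrow> \<phi>2 (t, y) = \<psi>2 (t, y)" "\<And>t y. t \<in> I \<Longrightarrow> y \<in> V \<Longrightarrow> \<phi>3 (t, y) = \<psi>3 (t, y)"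
  shows "jet3 a b I V \<psi>1 \<psi>2 \<psi>3"
proof -
  have sm: "smooth_on (I \<times> V) \<psi>" if "smooth_on (I \<times> V) \<phi>" "\<And>t y. t \<in> I \<Longrightarrow> y \<in> V \<Longrightarrow> \<phi> (t, y) = \<psi> (t, y)" for \<phi> \<psi> :: "real \<times> 'a \<Rightarrow> real"
    by (rule smooth_on_cong[OF IV _ that(1)]) (use that(2) in auto)
  have td: "time_deriv \<psi> y = time_deriv \<phi> y" if "smooth_on (I \<times> V) \<phi>" "\<And>t y. t \<in> I \<Longrightarrow> y \<in> V \<Longrightarrow> \<phi> (t, y) = \<psi> (t, y)" "y \<in> V"
    for \<phi> \<psi> :: "real \<times> 'a \<Rightarrow> real" and y
  proof -
    have "frechet_derivative \<phi> (at (0, y)) = frechet_derivative \<psi> (at (0, y))"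
      by (rule frechet_derivative_transform_within_open[OF smooth_on_differentiable[OF that(1)] IV]) (use that I in auto)
    then show ?thesis by (simp add: time_deriv_def)
  qed
  have s: "smooth_on (I \<times> V) \<phi>1" "smooth_on (I \<times> V) \<phi>2" "smooth_on (I \<times> V) \<phi>3" using assms(1) by (auto simp: jet3_def)
  show ?thesis unfolding jet3_def
    using assms(1) sm[OF s(1) eq(1)] sm[OF s(2) eq(2)] sm[OF s(3) eq(3)]
      td[OF s(1) eq(1)] td[OF s(2) eq(2)] td[OF s(3) eq(3)] I(2)
    by (simp add: jet3_def eq[symmetric])
qed

lemma jet3_static: "smooth_on V f \<Longrightarrow> jet3 a b I V (\<lambda>z. f (snd z)) (\<lambda>z. f (snd z)) (\<lambda>z. f (snd z))"
  unfolding jet3_def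
  using smooth_on_snd[OF I(1) V] time_deriv_eqI[of I V "\<lambda>z. f (snd z)" _ 0] I by auto

lemma jet3_const: "jet3 a b I V (\<lambda>z. r) (\<lambda>z. r) (\<lambda>z. r)"
  using jet3_static[of "\<lambda>_. r"] by simp

lemma jet3_add:
  assumes "jet3 a b I V \<phi>1 \<phi>2 \<phi>3" "jet3 a b I V \<psi>1 \<psi>2 \<psi>3"
  shows "jet3 a b I V (\<lambda>z. \<phi>1 z + \<psi>1 z) (\<lambda>z. \<phi>2 z + \<psi>2 z) (\<lambda>z. \<phi>3 z + \<psi>3 z)"
proof -
  have td: "time_deriv (\<lambda>z. \<phi> z + \<psi> z) y = time_deriv \<phi> y + time_deriv \<psi> y"
    if "smooth_on (I \<times> V) \<phi>" "smooth_on (I \<times> V) \<psi>" "y \<in> V" for \<phi> \<psi> :: "real \<times> 'a \<Rightarrow> real" and y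
    by (intro time_deriv_eqI[OF smooth_on_add[OF IV that(1,2)] I(2) that(3)] DERIV_add time_deriv_slice[OF _ I(2) that(3)] that)
  show ?thesis using assms unfolding jet3_def
    by (auto simp: td algebra_simps intro!: smooth_on_add[OF IV])
qed

text \<open>In the product rule the undifferentiated factors are taken at time 0, where the three
  families agree, so they act as common coefficients.\<close>

lemma jet3_mult:
  assumes "jet3 a b I V \<phi>1 \<phi>2 \<phi>3" "jet3 a b I V \<psi>1 \<psi>2 \<psi>3"
  shows "jet3 a b I V (\<lambda>z. \<phi>1 z * \<psi>1 z) (\<lambda>z. \<phi>2 z * \<psi>2 z) (\<lambda>z. \<phi>3 z * \<psi>3 z)"
proof -
  have td: "time_deriv (\<lambda>z. \<phi> z * \<psi> z) y = time_deriv \<phi> y * \<psi> (0, y) + time_deriv \<psi> y * \<phi> (0, y)"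
    if "smooth_on (I \<times> V) \<phi>" "smooth_on (I \<times> V) \<psi>" "y \<in> V" for \<phi> \<psi> :: "real \<times> 'a \<Rightarrow> real" and y
    by (intro time_deriv_eqI[OF smooth_on_mult[OF IV that(1,2)] I(2) that(3)] DERIV_mult time_deriv_slice[OF _ I(2) that(3)] that)
  show ?thesis using assms unfolding jet3_def
    by (auto simp: td algebra_simps intro!: smooth_on_mult[OF IV])
qed

text \<open>The chain rule contributes the derivative of \<open>h\<close> at the common initial
  value. The set \<open>X\<close> keeps the arguments where \<open>h\<close> is smooth: off zero for
  inverses, positive for powers.\<close>

lemma jet3_compose:
  assumes h: "open X" "smooth_on X h" and \<phi>: "jet3 a b I V \<phi>1 \<phi>2 \<phi>3"
    and X: "\<And>z. z \<in> I \<times> V \<Longrightarrow> \<phi>1 z \<in> X" "\<And>z. z \<in> I \<times> V \<Longrightarrow> \<phi>2 z \<in> X" "\<And>z. z \<in> I \<times> V \<Longrightarrow> \<phi>3 z \<in> X"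
  shows "jet3 a b I V (\<lambda>z. h (\<phi>1 z)) (\<lambda>z. h (\<phi>2 z)) (\<lambda>z. h (\<phi>3 z :: real) :: real)"
proof -
  have sm: "smooth_on (I \<times> V) (\<lambda>z. h (\<phi> z))" if "smooth_on (I \<times> V) \<phi>" "\<And>z. z \<in> I \<times> V \<Longrightarrow> \<phi> z \<in> X" for \<phi>
    by (rule smooth_on_compose[OF IV h that(1)]) (use that(2) in blast)
  have td: "time_deriv (\<lambda>z. h (\<phi> z)) y = deriv h (\<phi> (0, y)) * time_deriv \<phi> y"
    if "smooth_on (I \<times> V) \<phi>" "\<And>z. z \<in> I \<times> V \<Longrightarrow> \<phi> z \<in> X" "y \<in> V" for \<phi> y
  proof (rule time_deriv_eqI[OF sm[OF that(1,2)] I(2) that(3)])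
    have "\<phi> (0, y) \<in> X" using that I by auto
    then have "h differentiable (at (\<phi> (0, y)))" by (rule smooth_on_differentiable[OF h(2)])
    then have "(h has_real_derivative deriv h (\<phi> (0, y))) (at (\<phi> (0, y)))"
      by (simp add: real_differentiable_def DERIV_deriv_iff_real_differentiable)
    then show "((\<lambda>s. h (\<phi> (s, y))) has_real_derivative deriv h (\<phi> (0, y)) * time_deriv \<phi> y) (at 0)"
      by (rule DERIV_chain2[OF _ time_deriv_slice[OF that(1) I(2) that(3)]])
  qed
  have s: "smooth_on (I \<times> V) \<phi>1" "smooth_on (I \<times> V) \<phi>2" "smooth_on (I \<times> V) \<phi>3" using \<phi> by (auto simp: jet3_def)
  show ?thesis unfolding jet3_def
    using \<phi> sm[OF s(1) X(1)] sm[OF s(2) X(2)] sm[OF s(3) X(3)]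
      td[OF s(1) X(1)] td[OF s(2) X(2)] td[OF s(3) X(3)]
    by (simp add: jet3_def algebra_simps)
qed

lemma jet3_sum:
  assumes "\<And>i. i \<in> J \<Longrightarrow> jet3 a b I V (\<phi>1 i) (\<phi>2 i) (\<phi>3 i)"
  shows "jet3 a b I V (\<lambda>z. \<Sum>i\<in>J. \<phi>1 i z) (\<lambda>z. \<Sum>i\<in>J. \<phi>2 i z) (\<lambda>z. \<Sum>i\<in>J. \<phi>3 i z)"
  using assms by (induction J rule: infinite_finite_induct) (auto simp: jet3_const jet3_add)

lemma jet3_prod:
  assumes "\<And>i. i \<in> J \<Longrightarrow> jet3 a b I V (\<phi>1 i) (\<phi>2 i) (\<phi>3 i)"
  shows "jet3 a b I V (\<lambda>z. \<Prod>i\<in>J. \<phi>1 i z) (\<lambda>z. \<Prod>i\<in>J. \<phi>2 i z) (\<lambda>z. \<Prod>i\<in>J. \<phi>3 i z)"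
  using assms by (induction J rule: infinite_finite_induct) (auto simp: jet3_const jet3_mult)

lemma jet3_det:
  fixes M1 M2 M3 :: "real \<times> 'a \<Rightarrow> real ^ 'n::finite ^ 'n"
  assumes "\<And>i j. jet3 a b I V (\<lambda>z. M1 z $ i $ j) (\<lambda>z. M2 z $ i $ j) (\<lambda>z. M3 z $ i $ j)"
  shows "jet3 a b I V (\<lambda>z. det (M1 z)) (\<lambda>z. det (M2 z)) (\<lambda>z. det (M3 z))"
  unfolding det_def by (intro jet3_sum jet3_mult jet3_prod assms jet3_const)

lemma jet3_inverse:
  assumes "jet3 a b I V \<phi>1 \<phi>2 \<phi>3"
    and "\<And>z. z \<in> I \<times> V \<Longrightarrow> \<phi>1 z \<noteq> 0" "\<And>z. z \<in> I \<times> V \<Longrightarrow> \<phi>2 z \<noteq> 0" "\<And>z. z \<in> I \<times> V \<Longrightarrow> \<phi>3 z \<noteq> 0"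
  shows "jet3 a b I V (\<lambda>z. inverse (\<phi>1 z)) (\<lambda>z. inverse (\<phi>2 z)) (\<lambda>z. inverse (\<phi>3 z))"
  by (rule jet3_compose[where X = "- {0}", OF _ _ assms(1)])
     (use assms(2-) in \<open>auto simp: open_Compl smooth_on_def Ck_on_inverse\<close>)

lemma jet3_powr:
  assumes "jet3 a b I V \<phi>1 \<phi>2 \<phi>3"
    and "\<And>z. z \<in> I \<times> V \<Longrightarrow> \<phi>1 z > 0" "\<And>z. z \<in> I \<times> V \<Longrightarrow> \<phi>2 z > 0" "\<And>z. z \<in> I \<times> V \<Longrightarrow> \<phi>3 z > 0"
  shows "jet3 a b I V (\<lambda>z. \<phi>1 z powr r) (\<lambda>z. \<phi>2 z powr r) (\<lambda>z. \<phi>3 z powr r)"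
  by (rule jet3_compose[where X = "{0<..}", OF _ _ assms(1)])
     (use assms(2-) in \<open>auto simp: smooth_on_def Ck_on_powr\<close>)

text \<open>The relation holds at all points of the open set \<open>V\<close>, so it may be
  differentiated in space; by Schwarz's theorem this yields the time derivative of the spatial
  derivative.\<close>

lemma jet3_space_deriv:
  assumes \<phi>: "jet3 a b I V \<phi>1 \<phi>2 \<phi>3"
  shows "jet3 a b I V (\<lambda>z. frechet_derivative \<phi>1 (at z) (0, w)) (\<lambda>z. frechet_derivative \<phi>2 (at z) (0, w))
     (\<lambda>z. frechet_derivative \<phi>3 (at z) (0, w))"
proof -
  have s: "smooth_on (I \<times> V) \<phi>1" "smooth_on (I \<times> V) \<phi>2" "smooth_on (I \<times> V) \<phi>3" using \<phi> by (auto simp: jet3_def)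
  \<comment> \<open>Derivatives along \<open>V\<close> depend only on the restriction to time
    0.\<close>
  have v: "frechet_derivative \<phi> (at (0, y)) (0, w) = frechet_derivative \<psi> (at (0, y)) (0, w)"
    if "smooth_on (I \<times> V) \<phi>" "smooth_on (I \<times> V) \<psi>" "\<And>y. y \<in> V \<Longrightarrow> \<phi> (0, y) = \<psi> (0, y)" "y \<in> V" for \<phi> \<psi> :: "real \<times> 'a \<Rightarrow> real" and y
  proof -
    have "((\<lambda>y. \<psi> (0, y)) has_derivative (\<lambda>w. frechet_derivative \<phi> (at (0, y)) (0, w))) (at y)"
      by (rule has_derivative_transform_within_open[OF smooth_on_space_slice[OF that(1) I(2) that(4)] V that(4)]) (rule that(3))
    from fun_cong[OF has_derivative_unique[OF this smooth_on_space_slice[OF that(2) I(2) that(4)]]] show ?thesis .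
  qed
  have td: "time_deriv (\<lambda>z. frechet_derivative \<phi> (at z) (0, w)) y =
      frechet_derivative (\<lambda>z. frechet_derivative \<phi> (at z) (1, 0)) (at (0, y)) (0, w)"
    if "smooth_on (I \<times> V) \<phi>" "y \<in> V" for \<phi> :: "real \<times> 'a \<Rightarrow> real" and y
    unfolding time_deriv_def by (rule second_derivative_symmetric[OF that(1) IV]) (use that I in auto)
  let ?d = "\<lambda>\<phi> z. frechet_derivative \<phi> (at z) (1, 0) :: real"
  have sd: "smooth_on (I \<times> V) (?d \<phi>)" if "smooth_on (I \<times> V) \<phi>" for \<phi> :: "real \<times> 'a \<Rightarrow> real"
    by (rule smooth_on_frechet_derivative[OF that])
  have lin: "frechet_derivative (\<lambda>z. a * ?d \<phi>1 z + b * ?d \<phi>2 z) (at (0, y)) (0, w) =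
     a * frechet_derivative (?d \<phi>1) (at (0, y)) (0, w) + b * frechet_derivative (?d \<phi>2) (at (0, y)) (0, w)" if "y \<in> V" for y
  proof -
    have "((\<lambda>z. a * ?d \<phi>1 z + b * ?d \<phi>2 z) has_derivative
       (\<lambda>v. a * frechet_derivative (?d \<phi>1) (at (0, y)) v + b * frechet_derivative (?d \<phi>2) (at (0, y)) v)) (at (0, y))"
      by (intro has_derivative_add has_derivative_mult_right smooth_on_has_derivative[OF sd[OF s(1)]]
           smooth_on_has_derivative[OF sd[OF s(2)]]) (use that I in auto)
    from fun_cong[OF frechet_derivative_at[OF this], of "(0, w)"] show ?thesis by simp
  qed
  show ?thesis unfolding jet3_def
  proof (intro conjI ballI)
    fix y assume y: "y \<in> V"
    show "frechet_derivative \<phi>1 (at (0, y)) (0, w) = frechet_derivative \<phi>3 (at (0, y)) (0, w)"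
      by (rule v[OF s(1,3) _ y]) (use \<phi> in \<open>auto simp: jet3_def\<close>)
    show "frechet_derivative \<phi>2 (at (0, y)) (0, w) = frechet_derivative \<phi>3 (at (0, y)) (0, w)"
      by (rule v[OF s(2,3) _ y]) (use \<phi> in \<open>auto simp: jet3_def\<close>)
    have "frechet_derivative (?d \<phi>3) (at (0, y)) (0, w) = frechet_derivative (\<lambda>z. a * ?d \<phi>1 z + b * ?d \<phi>2 z) (at (0, y)) (0, w)"
      by (rule v[OF sd[OF s(3)] smooth_on_add[OF IV smooth_on_mult[OF IV smooth_on_const sd[OF s(1)]]
            smooth_on_mult[OF IV smooth_on_const sd[OF s(2)]]] _ y])
         (use \<phi> in \<open>auto simp: jet3_def time_deriv_def\<close>)
    then show "time_deriv (\<lambda>z. frechet_derivative \<phi>3 (at z) (0, w)) y =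
       a * time_deriv (\<lambda>z. frechet_derivative \<phi>1 (at z) (0, w)) y +
       b * time_deriv (\<lambda>z. frechet_derivative \<phi>2 (at z) (0, w)) y"
      unfolding td[OF s(1) y] td[OF s(2) y] td[OF s(3) y] lin[OF y] .
  qed (intro smooth_on_frechet_derivative s)+
qed

end

section \<open>Differentiation under the integral\<close>

context smooth_manifold
begin

text \<open>Joint smoothness in time and space; the bounds uniform in time that dominated
  convergence needs rest on it.\<close>

definition smooth_ffam :: "'m set \<Rightarrow> real set \<Rightarrow> (real \<Rightarrow> 'm \<Rightarrow> real) \<Rightarrow> bool" where
  "smooth_ffam W I F \<longleftrightarrow> (\<forall>c\<in>A. smooth_on (I \<times> snd c ` (fst c \<inter> W)) (\<lambda>z. F (fst z) (cinv c (snd z))))"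

lemma smooth_ffam_DERIV:
  assumes F: "smooth_ffam W I F" "t \<in> I" "p \<in> W"
  shows "((\<lambda>s. F s p) has_real_derivative deriv (\<lambda>s. F s p) t) (at t)"
proof -
  let ?c = "chart_at A p"
  have "((\<lambda>s. F s (cinv ?c (snd ?c p))) has_real_derivative
      frechet_derivative (\<lambda>z. F (fst z) (cinv ?c (snd z))) (at (t, snd ?c p)) (1, 0)) (at t)"
    using smooth_on_time_slice[of I "snd ?c ` (fst ?c \<inter> W)" "\<lambda>z. F (fst z) (cinv ?c (snd z))" t "snd ?c p"] F
    by (auto simp: smooth_ffam_def)
  then show ?thesis by (simp add: DERIV_imp_deriv)
qed

lemma smooth_ffam_deriv:
  assumes F: "smooth_ffam W I F" and W: "open I" "open W"
  shows "smooth_ffam W I (\<lambda>t p. deriv (\<lambda>s. F s p) t)"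
  unfolding smooth_ffam_def
proof
  fix c assume c: "c \<in> A"
  let ?V = "snd c ` (fst c \<inter> W)" let ?\<phi> = "\<lambda>z. F (fst z) (cinv c (snd z))"
  have sm: "smooth_on (I \<times> ?V) ?\<phi>" using F c by (simp add: smooth_ffam_def)
  have V: "open ?V" using c W by (simp add: chart_image_open_Int)
  show "smooth_on (I \<times> ?V) (\<lambda>z. deriv (\<lambda>s. F s (cinv c (snd z))) (fst z))"
  proof (rule smooth_on_cong[OF open_Times[OF W(1) V] _ smooth_on_frechet_derivative[OF sm, of "(1, 0)"]])
    fix z assume "z \<in> I \<times> ?V"
    then have "((\<lambda>s. F s (cinv c (snd z))) has_real_derivative frechet_derivative ?\<phi> (at z) (1, 0)) (at (fst z))"
      using smooth_on_time_slice[OF sm, of "fst z" "snd z"] by (simp add: mem_Times_iff)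
    then show "frechet_derivative ?\<phi> (at z) (1, 0) = deriv (\<lambda>s. F s (cinv c (snd z))) (fst z)"
      by (simp add: DERIV_imp_deriv)
  qed
qed

lemma smooth_ffam_continuous_on:
  assumes F: "smooth_ffam W I F" and W: "open W" and t: "t \<in> I"
  shows "continuous_on W (F t)"
proof (rule continuous_at_imp_continuous_on, rule ballI)
  fix p assume p: "p \<in> W"
  let ?c = "chart_at A p"
  have c: "?c \<in> A" "p \<in> fst ?c" by simp_all
  let ?V = "snd ?c ` (fst ?c \<inter> W)"
  have "continuous_on (I \<times> ?V) (\<lambda>z. F (fst z) (cinv ?c (snd z)))"
    using F c by (auto simp: smooth_ffam_def intro: smooth_on_imp_continuous_on)
  then have "continuous_on ?V (\<lambda>y. F t (cinv ?c y))"
  proof -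
    assume F': "continuous_on (I \<times> ?V) (\<lambda>z. F (fst z) (cinv ?c (snd z)))"
    have "continuous_on ?V (\<lambda>y. (t, y))" by (intro continuous_intros)
    from continuous_on_compose2[OF F' this] t show ?thesis by auto
  qed
  then have "continuous_on (fst ?c \<inter> W) (\<lambda>q. F t (cinv ?c (snd ?c q)))"
    by (rule continuous_on_compose2[OF _ continuous_on_subset[OF continuous_on_chart[OF c(1)]]]) auto
  then have "continuous_on (fst ?c \<inter> W) (F t)" by (rule continuous_on_cong[THEN iffD1, rotated 2]) (auto simp: c)
  then show "isCont (F t) p"
    using p c W chart_open[OF c(1)] continuous_on_eq_continuous_at[of "fst ?c \<inter> W"] by blast
qed

lemma smooth_ffam_measurable:
  assumes F: "smooth_ffam W I F" and W: "open W" and t: "t \<in> I" and U: "open U" "U \<subseteq> W"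
  shows "(\<lambda>p. indicator U p * F t p) \<in> borel_measurable borel"
  using borel_measurable_continuous_on_indicator[OF _ continuous_on_subset[OF smooth_ffam_continuous_on[OF F W t] U(2)]] U(1)
  by simp

text \<open>Joint continuity on the compact product of a time interval and a coordinate ball gives
  local bounds, and finitely many balls cover \<open>K\<close>.\<close>

lemma smooth_ffam_bounded:
  assumes F: "smooth_ffam W {-\<epsilon><..<\<epsilon>} F" and \<epsilon>: "\<epsilon> > 0" and W: "open W" and K: "compact K" "K \<subseteq> W"
  obtains \<delta> C where "\<delta> > 0" "\<delta> < \<epsilon>" "\<And>t p. \<bar>t\<bar> \<le> \<delta> \<Longrightarrow> p \<in> K \<Longrightarrow> \<bar>F t p\<bar> \<le> C"
proof -
  \<comment> \<open>Half of the interval, so that the closed time interval stays inside the open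
    one.\<close>
  define \<delta> where "\<delta> = \<epsilon> / 2"
  have \<delta>: "\<delta> > 0" "\<delta> < \<epsilon>" using \<epsilon> by (auto simp: \<delta>_def)
  have "\<exists>N C. open N \<and> p \<in> N \<and> (\<forall>t q. \<bar>t\<bar> \<le> \<delta> \<longrightarrow> q \<in> N \<longrightarrow> \<bar>F t q\<bar> \<le> C)" if p: "p \<in> W" for p
  proof -
    let ?c = "chart_at A p"
    have c: "?c \<in> A" "p \<in> fst ?c" by simp_all
    let ?V = "snd ?c ` (fst ?c \<inter> W)"
    have V: "open ?V" using c W by (simp add: chart_image_open_Int)
    obtain r where r: "r > 0" "cball (snd ?c p) r \<subseteq> ?V"
      using open_contains_cball[of ?V] V c(2) p by (meson imageI IntI)
    define N where "N = fst ?c \<inter> snd ?c -` ball (snd ?c p) r"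
    have N: "open N" unfolding N_def
      using continuous_open_preimage[OF continuous_on_chart[OF c(1)] chart_open[OF c(1)] open_ball] .
    have cont: "continuous_on ({-\<epsilon><..<\<epsilon>} \<times> ?V) (\<lambda>z. F (fst z) (cinv ?c (snd z)))"
      using F c by (auto simp: smooth_ffam_def intro: smooth_on_imp_continuous_on)
    have sub: "{-\<delta>..\<delta>} \<times> cball (snd ?c p) r \<subseteq> {-\<epsilon><..<\<epsilon>} \<times> ?V" using r \<delta> by auto
    have "compact ({-\<delta>..\<delta>} \<times> cball (snd ?c p) r)" by (intro compact_Times) auto
    from compact_imp_bounded[OF compact_continuous_image[OF continuous_on_subset[OF cont sub] this]]
    obtain C where C: "\<forall>z\<in>{-\<delta>..\<delta>} \<times> cball (snd ?c p) r. \<bar>F (fst z) (cinv ?c (snd z))\<bar> \<le> C"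
      unfolding bounded_iff by auto
    have "\<bar>F t q\<bar> \<le> C" if "\<bar>t\<bar> \<le> \<delta>" "q \<in> N" for t q
      using C[rule_format, of "(t, snd ?c q)"] that c by (auto simp: N_def abs_le_iff)
    moreover have "p \<in> N" using c r by (simp add: N_def)
    ultimately show ?thesis using N by blast
  qed
  then obtain N C where N: "\<And>p. p \<in> W \<Longrightarrow> open (N p)" "\<And>p. p \<in> W \<Longrightarrow> p \<in> N p"
    "\<And>p t q. p \<in> W \<Longrightarrow> \<bar>t\<bar> \<le> \<delta> \<Longrightarrow> q \<in> N p \<Longrightarrow> \<bar>F t q\<bar> \<le> C p" by metis
  obtain P where P: "P \<subseteq> K" "finite P" "K \<subseteq> (\<Union>p\<in>P. N p)"
  proof (rule compactE_image[OF K(1), of K N])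
    show "open (N p)" if "p \<in> K" for p using N(1) K(2) that by blast
    show "K \<subseteq> (\<Union>p\<in>K. N p)" using N(2) K(2) by blast
  qed
  \<comment> \<open>Inserting 0 gives the maximum a value when \<open>K\<close> is empty.\<close>
  show thesis
  proof (rule that[OF \<delta>, of "Max (insert 0 (C ` P))"])
    fix t p assume t: "\<bar>t\<bar> \<le> \<delta>" and p: "p \<in> K"
    obtain q where q: "q \<in> P" "p \<in> N q" using P p by blast
    have "\<bar>F t p\<bar> \<le> C q" using N(3)[OF _ t q(2)] q P K by blast
    also have "\<dots> \<le> Max (insert 0 (C ` P))" using P q by (intro Max_ge) auto
    finally show "\<bar>F t p\<bar> \<le> Max (insert 0 (C ` P))" .
  qed
qed

context
  fixes g :: "('m, 'n) tensor02" and \<nu> :: "'m measure"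
  assumes g: "metric_on A UNIV g" and \<nu>_def: "\<nu> = vol_measure A UNIV g"
begin

lemma integrable_vol_bounded:
  fixes s :: "'m \<Rightarrow> real"
  assumes U: "open U" "compact (closure U)" and s: "(\<lambda>p. indicator U p * s p) \<in> borel_measurable borel" "\<And>p. p \<in> U \<Longrightarrow> \<bar>s p\<bar> \<le> C"
  shows "integrable \<nu> (\<lambda>p. indicator U p * s p)"
proof (rule Bochner_Integration.integrable_bound)
  have "emeasure \<nu> U < \<infinity>" using finite_vol_compact_closure[OF g \<nu>_def U(2)] U(1) by simp
  then show "integrable \<nu> (\<lambda>p. C * indicator U p)"
    using U by (intro integrable_mult_right integrable_real_indicator) (auto simp: sets_vol[OF g \<nu>_def])
  show "(\<lambda>p. indicator U p * s p) \<in> borel_measurable \<nu>"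
    using s(1) by (simp add: measurable_cong_sets[OF sets_vol[OF g \<nu>_def] refl])
  have "norm (indicator U p * s p) \<le> norm (C * indicator U p)" for p
    using s(2)[of p] by (auto simp: indicator_def)
  then show "AE p in \<nu>. norm (indicator U p * s p) \<le> norm (C * indicator U p)" by simp
qed

text \<open>Dominated convergence: by the mean value theorem the difference quotients on
  \<open>U\<close> are bounded by a constant, which is integrable because \<open>closure U\<close>
  is compact.\<close>

lemma leibniz_vol:
  assumes F: "smooth_ffam W {-\<epsilon><..<\<epsilon>} F" and \<epsilon>: "\<epsilon> > 0" and W: "open W"
    and U: "open U" "compact (closure U)" "closure U \<subseteq> W"
  shows "((\<lambda>t. LINT p|\<nu>. indicator U p * F t p) has_real_derivative
     (LINT p|\<nu>. indicator U p * deriv (\<lambda>s. F s p) 0)) (at 0)"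
proof -
  let ?I = "{-\<epsilon><..<\<epsilon>}" let ?D = "\<lambda>t p. deriv (\<lambda>s. F s p) t"
  have UW: "U \<subseteq> W" using U closure_subset by blast
  have D: "smooth_ffam W ?I ?D" by (rule smooth_ffam_deriv[OF F _ W]) simp
  obtain \<delta>1 C1 where b1: "\<delta>1 > 0" "\<delta>1 < \<epsilon>" "\<And>t p. \<bar>t\<bar> \<le> \<delta>1 \<Longrightarrow> p \<in> closure U \<Longrightarrow> \<bar>F t p\<bar> \<le> C1"
    using smooth_ffam_bounded[OF F \<epsilon> W U(2,3)] by metis
  obtain \<delta>2 C2 where b2: "\<delta>2 > 0" "\<delta>2 < \<epsilon>" "\<And>t p. \<bar>t\<bar> \<le> \<delta>2 \<Longrightarrow> p \<in> closure U \<Longrightarrow> \<bar>?D t p\<bar> \<le> C2"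
    using smooth_ffam_bounded[OF D \<epsilon> W U(2,3)] by metis
  define \<delta> where "\<delta> = min \<delta>1 \<delta>2"
  have \<delta>: "\<delta> > 0" "\<delta> < \<epsilon>" using b1 b2 by (auto simp: \<delta>_def)
  define S where "S = {-\<delta><..<\<delta>}"
  have S: "t \<in> ?I" "\<bar>t\<bar> \<le> \<delta>1" "\<bar>t\<bar> \<le> \<delta>2" if "t \<in> S" for t using that \<delta> by (auto simp: S_def \<delta>_def)
  have S0: "0 \<in> S" using \<delta> by (simp add: S_def)
  have int: "integrable \<nu> (\<lambda>p. indicator U p * F t p)" if "t \<in> S" for t
    by (rule integrable_vol_bounded[OF U(1,2) smooth_ffam_measurable[OF F W S(1)[OF that] U(1) UW], of C1])
       (use b1(3) S[OF that] closure_subset in blast)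
  have lip: "\<bar>F t p - F 0 p\<bar> \<le> C2 * \<bar>t\<bar>" if t: "t \<in> S" and p: "p \<in> U" for t p
  proof -
    have "norm (F t p - F 0 p) \<le> C2 * norm (t - 0)"
    proof (rule field_differentiable_bound[of S "\<lambda>s. F s p" "\<lambda>s. ?D s p"])
      show "((\<lambda>s. F s p) has_field_derivative ?D s p) (at s within S)" if "s \<in> S" for s
        using smooth_ffam_DERIV[OF F S(1)[OF that]] p UW has_field_derivative_at_within by blast
      show "norm (?D s p) \<le> C2" if "s \<in> S" for s using b2(3)[OF S(3)[OF that]] p closure_subset by auto
    qed (use t S0 in \<open>auto simp: S_def\<close>)
    then show ?thesis by simp
  qed
  let ?J = "\<lambda>t. LINT p|\<nu>. indicator U p * F t p"
  have "((\<lambda>h. (?J h - ?J 0) / h) \<longlongrightarrow> (LINT p|\<nu>. indicator U p * ?D 0 p)) (at 0 within S)"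
    unfolding tendsto_at_iff_sequentially
  proof (intro allI impI)
    fix X assume X: "\<forall>i. X i \<in> S - {0}" and lim: "X \<longlonglongrightarrow> 0"
    have Xi: "X i \<in> S" "X i \<noteq> 0" for i using X by auto
    have eq: "((\<lambda>h. (?J h - ?J 0) / h) \<circ> X) i = (LINT p|\<nu>. indicator U p * ((F (X i) p - F 0 p) / X i))" for i
    proof -
      have "?J (X i) - ?J 0 = (LINT p|\<nu>. indicator U p * F (X i) p - indicator U p * F 0 p)"
        by (rule Bochner_Integration.integral_diff[OF int[OF Xi(1)] int[OF S0], symmetric])
      then have "(?J (X i) - ?J 0) / X i = (LINT p|\<nu>. (indicator U p * F (X i) p - indicator U p * F 0 p) / X i)"
        by simp
      also have "\<dots> = (LINT p|\<nu>. indicator U p * ((F (X i) p - F 0 p) / X i))"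
        by (intro Bochner_Integration.integral_cong) (auto simp: algebra_simps diff_divide_distrib)
      finally show ?thesis by simp
    qed
    have "(\<lambda>i. LINT p|\<nu>. indicator U p * ((F (X i) p - F 0 p) / X i)) \<longlonglongrightarrow> (LINT p|\<nu>. indicator U p * ?D 0 p)"
    proof (rule integral_dominated_convergence)
      have ms: "(\<lambda>p. indicator U p * F t p) \<in> borel_measurable \<nu>" if "t \<in> S" for t
        using int[OF that] by simp
      show "(\<lambda>p. indicator U p * ?D 0 p) \<in> borel_measurable \<nu>"
        using smooth_ffam_measurable[OF D W S(1)[OF S0] U(1) UW] by (simp add: measurable_cong_sets[OF sets_vol[OF g \<nu>_def] refl])
      show "(\<lambda>p. indicator U p * ((F (X i) p - F 0 p) / X i)) \<in> borel_measurable \<nu>" for i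
      proof -
        have "(\<lambda>p. (indicator U p * F (X i) p - indicator U p * F 0 p) / X i) \<in> borel_measurable \<nu>"
          using ms[OF Xi(1)] ms[OF S0] by measurable
        then show ?thesis by (simp add: right_diff_distrib)
      qed
      show "integrable \<nu> (\<lambda>p. indicator U p * C2)"
        by (rule integrable_vol_bounded[OF U(1,2), of _ "\<bar>C2\<bar>"]) (use U in auto)
      have "(\<lambda>i. indicator U p * ((F (X i) p - F 0 p) / X i)) \<longlonglongrightarrow> indicator U p * ?D 0 p" for p
      proof (cases "p \<in> U")
        case True
        have "((\<lambda>h. (F (0 + h) p - F 0 p) / h) \<longlongrightarrow> ?D 0 p) (at 0)"
          using smooth_ffam_DERIV[OF F S(1)[OF S0]] True UW unfolding DERIV_def by blast
        then have "((\<lambda>h. (F (0 + h) p - F 0 p) / h) \<longlongrightarrow> ?D 0 p) (at 0 within S)"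
          by (rule tendsto_within_subset) simp
        then have "((\<lambda>h. (F (0 + h) p - F 0 p) / h) \<circ> X) \<longlonglongrightarrow> ?D 0 p"
          unfolding tendsto_at_iff_sequentially using X lim by blast
        then show ?thesis using True by (simp add: o_def)
      qed simp
      then show "AE p in \<nu>. (\<lambda>i. indicator U p * ((F (X i) p - F 0 p) / X i)) \<longlonglongrightarrow> indicator U p * ?D 0 p" by simp
      have "norm (indicator U p * ((F (X i) p - F 0 p) / X i)) \<le> indicator U p * C2" for i p
        using lip[OF Xi(1)[of i], of p] Xi(2)[of i] by (cases "p \<in> U") (auto simp: abs_mult field_simps)
      then show "AE p in \<nu>. norm (indicator U p * ((F (X i) p - F 0 p) / X i)) \<le> indicator U p * C2" for i by simp
    qed
    then show "((\<lambda>h. (?J h - ?J 0) / h) \<circ> X) \<longlonglongrightarrow> (LINT p|\<nu>. indicator U p * ?D 0 p)"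
      by (simp only: eq[abs_def])
  qed
  moreover have "at 0 within S = at 0" using S0 by (intro at_within_open) (auto simp: S_def)
  ultimately show ?thesis unfolding DERIV_def by simp
qed

end

end


section \<open>The scalar curvature along a variation\<close>

text \<open>Expansion into scalar components and their first derivatives. Differences are written
  with the factor \<open>(- 1)\<close>, so that only the closure rules for sums, products and
  spatial derivatives are needed afterwards.\<close>

lemma coord_scal_components:
  fixes \<Gamma> :: "real ^ 'n::finite \<Rightarrow> real ^ 'n \<Rightarrow> real ^ 'n \<Rightarrow> real ^ 'n"
  assumes S: "open S" "y \<in> S" and \<Gamma>: "\<And>y. y \<in> S \<Longrightarrow> bilinear (\<Gamma> y)" "\<And>u v. smooth_on S (\<lambda>y. \<Gamma> y u v)"
  shows "coord_scal G \<Gamma> y = (\<Sum>l\<in>UNIV. \<Sum>m\<in>UNIV. \<Sum>r\<in>UNIV. dual_axis G l $ r *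
    (frechet_derivative (\<lambda>y. \<Gamma> y (axis l 1) (axis r 1) $ m) (at y) (axis m 1)
     + (- 1) * frechet_derivative (\<lambda>y. \<Gamma> y (axis m 1) (axis r 1) $ m) (at y) (axis l 1)
     + ((\<Sum>j\<in>UNIV. \<Gamma> y (axis l 1) (axis r 1) $ j * \<Gamma> y (axis m 1) (axis j 1) $ m)
     + (- 1) * (\<Sum>j\<in>UNIV. \<Gamma> y (axis m 1) (axis r 1) $ j * \<Gamma> y (axis l 1) (axis j 1) $ m))))"
proof -
  have tri: "linear (coord_curv \<Gamma> y u v)" for u v
    using trilinear_coord_curv[OF S \<Gamma>] by (simp add: trilinear_def)
  have b: "linear (\<Gamma> y u)" for u using \<Gamma>(1)[OF S(2)] by (simp add: bilinear_def)
  have G2: "\<Gamma> y u v $ m = (\<Sum>j\<in>UNIV. v $ j * \<Gamma> y u (axis j 1) $ m)" for u v m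
    using arg_cong[OF linear_axis_expansion[OF b, of u v], of "\<lambda>x. x $ m"] by (simp only: sum_component vector_scaleR_component real_scaleR_def)
  have pd: "pderiv_field \<Gamma> y w u v $ m = frechet_derivative (\<lambda>y. \<Gamma> y u v $ m) (at y) w" for u v w m
    unfolding pderiv_field_def
    by (rule smooth_on_inner_derivative[OF \<Gamma>(2) S(2), of u v "axis m 1" w, unfolded cart_eq_inner_axis[symmetric], symmetric])
  have C: "coord_curv \<Gamma> y u v w $ m = (\<Sum>r\<in>UNIV. w $ r * coord_curv \<Gamma> y u v (axis r 1) $ m)" for u v w m
    using arg_cong[OF linear_axis_expansion[OF tri, of u v w], of "\<lambda>x. x $ m"] by (simp only: sum_component vector_scaleR_component real_scaleR_def)
  have E: "coord_scal G \<Gamma> y = (\<Sum>l\<in>UNIV. \<Sum>m\<in>UNIV. \<Sum>r\<in>UNIV. dual_axis G l $ r * coord_curv \<Gamma> y (axis l 1) (axis m 1) (axis r 1) $ m)"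
    unfolding coord_scal_def by (intro sum.cong refl C)
  have "coord_curv \<Gamma> y (axis l 1) (axis m 1) (axis r 1) $ m =
     frechet_derivative (\<lambda>y. \<Gamma> y (axis l 1) (axis r 1) $ m) (at y) (axis m 1)
     + (- 1) * frechet_derivative (\<lambda>y. \<Gamma> y (axis m 1) (axis r 1) $ m) (at y) (axis l 1)
     + ((\<Sum>j\<in>UNIV. \<Gamma> y (axis l 1) (axis r 1) $ j * \<Gamma> y (axis m 1) (axis j 1) $ m)
     + (- 1) * (\<Sum>j\<in>UNIV. \<Gamma> y (axis m 1) (axis r 1) $ j * \<Gamma> y (axis l 1) (axis j 1) $ m))" for l m r
    unfolding coord_curv_def vector_add_component vector_minus_component pd
      G2[of "axis m 1" "\<Gamma> y (axis l 1) (axis r 1)"] G2[of "axis l 1" "\<Gamma> y (axis m 1) (axis r 1)"] by simp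
  then show ?thesis unfolding E by (intro sum.cong refl arg_cong2[where f = "(*)"])
qed

text \<open>Both Gram matrices refer to the preferred chart, whose influence cancels in the
  quotient. Where it is positive, its square root is the density of one volume with respect to the
  other.\<close>

definition det_ratio :: "('m, 'n::finite) tensor02 \<Rightarrow> ('m, 'n) tensor02 \<Rightarrow> 'm \<Rightarrow> real" where
  "det_ratio g h p = det (gram (h p)) / det (gram (g p))"

context smooth_manifold
begin

text \<open>The scalar curvature uses \<open>onb\<close>, whose choice is meaningful once some
  orthonormal frame exists; this existence is carried along with the metric.\<close>

definition framed_metric :: "'m set \<Rightarrow> ('m, 'n) tensor02 \<Rightarrow> bool" where
  "framed_metric W h \<longleftrightarrow> metric_on A W h \<and> (\<forall>p\<in>W. \<exists>F. orthonormal_frame (h p) F)"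

lemma det_gram_chart:
  assumes c: "c \<in> A" "p \<in> fst c" and h: "bilinear (h p)"
  shows "det (gram (rep02 A c h (snd c p))) = (det (matrix (tvec A c p)))\<^sup>2 * det (gram (h p))"
    and "det (matrix (tvec A c p)) \<noteq> 0"
proof -
  have G: "rep02 A (chart_at A p) h (snd (chart_at A p) p) = h p" by (intro ext) (simp add: rep02_chart_at)
  have t: "tvec A c p = coord_change c (chart_at A p) p" by (intro ext) (simp add: tvec_def)
  show "det (gram (rep02 A c h (snd c p))) = (det (matrix (tvec A c p)))\<^sup>2 * det (gram (h p))"
    using vol_density_coord_change(1)[where h = h, OF c(1) chart_at_in(1) c(2) chart_at_in(2) h] unfolding G t .
  have "matrix (tvec A c p) ** matrix (comps A c p) = mat 1"
    using matrix_compose[OF linear_comps[OF c] linear_tvec[OF c]] c by (simp add: o_def matrix_id_mat_1[unfolded id_def])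
  then have "det (matrix (tvec A c p)) * det (matrix (comps A c p)) = 1"
    by (metis det_I det_mul)
  then show "det (matrix (tvec A c p)) \<noteq> 0" by auto
qed

lemma det_gram_metric_nonzero:
  assumes "metric_on A W g" "p \<in> W" shows "det (gram (g p)) \<noteq> 0"
  by (rule det_gram_nonzero) (use assms in \<open>auto simp: metric_on_def smooth_tensor02_def nondegenerate_on_def\<close>)

lemma det_ratio_chart:
  assumes g: "metric_on A W g" "metric_on A W h" and p: "p \<in> W" and c: "c \<in> A" "p \<in> fst c"
  shows "det_ratio g h p = det (gram (rep02 A c h (snd c p))) / det (gram (rep02 A c g (snd c p)))"
proof -
  have b: "bilinear (g p)" "bilinear (h p)" using g p by (auto simp: metric_on_def smooth_tensor02_def)
  show ?thesis
    using det_gram_chart(1)[where h = g, OF c b(1)] det_gram_chart(1)[where h = h, OF c b(2)] det_gram_chart(2)[where h = g, OF c b(1)]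
    by (simp add: det_ratio_def)
qed

lemma vol_density_ratio:
  assumes g: "metric_on A W g" "metric_on A W h" and p: "p \<in> W" and c: "c \<in> A" "p \<in> fst c" and pos: "det_ratio g h p > 0"
  shows "vol_density A c h (snd c p) = sqrt (det_ratio g h p) * vol_density A c g (snd c p)"
proof -
  let ?a = "det (gram (rep02 A c h (snd c p)))" and ?b = "det (gram (rep02 A c g (snd c p)))"
  have r: "det_ratio g h p = ?a / ?b" by (rule det_ratio_chart[OF g p c])
  have "?b \<noteq> 0" using pos r by auto
  then have "?a = det_ratio g h p * ?b" by (simp add: r)
  then have "\<bar>?a\<bar> = det_ratio g h p * \<bar>?b\<bar>" using pos by (simp only: abs_mult abs_of_pos)
  then show ?thesis by (simp add: vol_density_def gram_def[symmetric] real_sqrt_mult)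
qed

section \<open>Quantities of a metric that inherit the jet relation\<close>

context
  fixes W :: "'m set" and I :: "real set" and g :: "('m, 'n) tensor02" and T :: "('m, 'n) tensor12"
    and g1 g2 g3 :: "real \<Rightarrow> ('m, 'n) tensor02" and a b :: real and c :: "('m, 'n) chart" and V
  assumes W: "open W" and I: "open I" "0 \<in> I" and g: "metric_on A W g" and T: "smooth_tensor12 A W T"
    and fr: "\<And>t. t \<in> I \<Longrightarrow> framed_metric W (g1 t)" "\<And>t. t \<in> I \<Longrightarrow> framed_metric W (g2 t)" "\<And>t. t \<in> I \<Longrightarrow> framed_metric W (g3 t)"
    and sf: "smooth_family02 A W I g1" "smooth_family02 A W I g2" "smooth_family02 A W I g3"
    and init: "\<And>p. p \<in> W \<Longrightarrow> g1 0 p = g p" "\<And>p. p \<in> W \<Longrightarrow> g2 0 p = g p" "\<And>p. p \<in> W \<Longrightarrow> g3 0 p = g p"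
    and lin: "\<And>p u v. p \<in> W \<Longrightarrow> deriv (\<lambda>t. g3 t p u v) 0 = a * deriv (\<lambda>t. g1 t p u v) 0 + b * deriv (\<lambda>t. g2 t p u v) 0"
    and c: "c \<in> A" and V: "V = snd c ` (fst c \<inter> W)"
begin

text \<open>\<open>Q\<close> assigns to a metric a function of the coordinates; its values along
  three families with linearly related velocities are to form a jet triple. The scalar curvature is
  reached by composing such quantities.\<close>

abbreviation J :: "(('m, 'n) tensor02 \<Rightarrow> real ^ 'n \<Rightarrow> real) \<Rightarrow> bool" where
  "J Q \<equiv> jet3 a b I V (\<lambda>z. Q (g1 (fst z)) (snd z)) (\<lambda>z. Q (g2 (fst z)) (snd z)) (\<lambda>z. Q (g3 (fst z)) (snd z))"

lemma Vo: "open V" unfolding V by (rule chart_image_open_Int[OF c W])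

lemma J_cong:
  assumes "J Q" "\<And>h y. framed_metric W h \<Longrightarrow> y \<in> V \<Longrightarrow> Q h y = Q' h y" shows "J Q'"
  by (rule jet3_cong[OF I Vo assms(1)]) (use assms(2) fr in auto)

lemma J_static: "smooth_on V f \<Longrightarrow> J (\<lambda>h y. f y)"
  by (rule jet3_static[OF I Vo])

lemma J_add: "J P \<Longrightarrow> J Q \<Longrightarrow> J (\<lambda>h y. P h y + Q h y)"
  by (rule jet3_add[OF I Vo])

lemma J_mult: "J P \<Longrightarrow> J Q \<Longrightarrow> J (\<lambda>h y. P h y * Q h y)"
  by (rule jet3_mult[OF I Vo])

lemma J_sum: "(\<And>i. i \<in> X \<Longrightarrow> J (Q i)) \<Longrightarrow> J (\<lambda>h y. \<Sum>i\<in>X. Q i h y)"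
  by (rule jet3_sum[OF I Vo])

lemma J_det: "(\<And>i j. J (\<lambda>h y. M h y $ i $ j)) \<Longrightarrow> J (\<lambda>h y. det (M h y :: real ^ 'k::finite ^ 'k))"
  by (rule jet3_det[OF I Vo])

lemma J_inverse:
  assumes "J Q" "\<And>h y. framed_metric W h \<Longrightarrow> y \<in> V \<Longrightarrow> Q h y \<noteq> 0" shows "J (\<lambda>h y. inverse (Q h y))"
  by (rule jet3_inverse[OF I Vo assms(1)]) (use assms(2) fr in auto)

text \<open>For a joint function of time and place the direction \<open>(0, w)\<close> is
  differentiation at a fixed time, as it occurs in Christoffel symbols and curvature.\<close>

lemma J_space_deriv:
  assumes "J Q" shows "J (\<lambda>h y. frechet_derivative (\<lambda>y. Q h y) (at y) w)"
proof -
  have eq: "frechet_derivative (\<lambda>z. Q (gt (fst z)) (snd z)) (at (t, y)) (0, w) = frechet_derivative (\<lambda>y. Q (gt t) y) (at y) w"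
    if "smooth_on (I \<times> V) (\<lambda>z. Q (gt (fst z)) (snd z))" "t \<in> I" "y \<in> V" for gt t y
    using fun_cong[OF frechet_derivative_at[OF smooth_on_space_slice[OF that]], of w] by simp
  show ?thesis
    by (rule jet3_cong[OF I Vo jet3_space_deriv[OF I Vo assms, of w]])
       (use assms in \<open>auto simp: jet3_def eq\<close>)
qed

text \<open>The starting point: for the components of the metric the relation is the assumption on
  the velocities.\<close>

lemma J_rep02: "J (\<lambda>h y. rep02 A c h y u v)"
proof -
  have sm: "smooth_on (I \<times> V) (\<lambda>z. rep02 A c (gt (fst z)) (snd z) u v)" if "smooth_family02 A W I gt" for gt
    using that c by (simp add: smooth_family02_def V case_prod_beta')
  have td: "time_deriv (\<lambda>z. rep02 A c (gt (fst z)) (snd z) u v) y =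
      deriv (\<lambda>t. gt t (cinv c y) (tvec A c (cinv c y) u) (tvec A c (cinv c y) v)) 0"
    if "smooth_family02 A W I gt" "y \<in> V" for gt y
    using DERIV_imp_deriv[OF time_deriv_slice[OF sm[OF that(1)] I(2) that(2)]] by (simp add: rep02_def)
  show ?thesis
    unfolding jet3_def
  proof (intro conjI ballI sm sf)
    fix y assume y: "y \<in> V"
    then have p: "cinv c y \<in> W" using c by (auto simp: V)
    show "rep02 A c (g1 (fst (0, y))) (snd (0, y)) u v = rep02 A c (g3 (fst (0, y))) (snd (0, y)) u v"
      "rep02 A c (g2 (fst (0, y))) (snd (0, y)) u v = rep02 A c (g3 (fst (0, y))) (snd (0, y)) u v"
      using init[OF p] by (simp_all add: rep02_def)
    show "time_deriv (\<lambda>z. rep02 A c (g3 (fst z)) (snd z) u v) y =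
      a * time_deriv (\<lambda>z. rep02 A c (g1 (fst z)) (snd z) u v) y + b * time_deriv (\<lambda>z. rep02 A c (g2 (fst z)) (snd z) u v) y"
      unfolding td[OF sf(1) y] td[OF sf(2) y] td[OF sf(3) y] by (rule lin[OF p])
  qed
qed

lemma J_det_gram: "J (\<lambda>h y. det (gram (rep02 A c h y)))"
  by (rule J_det) (simp add: gram_def J_rep02)

lemma det_gram_rep_nonzero:
  assumes "framed_metric W h" "y \<in> V" shows "det (gram (rep02 A c h y)) \<noteq> 0"
  using metric_fieldD(4)[OF metric_field_rep02[OF _ W c]] assms by (auto simp: framed_metric_def V)

lemma J_dual_axis: "J (\<lambda>h y. dual_axis (rep02 A c h y) l $ i)"
proof -
  have "J (\<lambda>h y. det (\<chi> r s. if s = i then axis l 1 $ r else gram (rep02 A c h y) $ r $ s) * inverse (det (gram (rep02 A c h y))))"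
  proof (rule J_mult[OF J_det J_inverse[OF J_det_gram det_gram_rep_nonzero]])
    fix r s
    show "J (\<lambda>h y. (\<chi> r s. if s = i then axis l 1 $ r else gram (rep02 A c h y) $ r $ s) $ r $ s)"
      by (cases "s = i") (simp_all add: gram_def J_rep02 jet3_const[OF I Vo])
  qed
  then show ?thesis by (simp add: dual_axis_def divide_inverse)
qed

lemma J_koszul: "J (\<lambda>h y. koszul (rep02 A c h) y u v w)"
proof -
  have "J (\<lambda>h y. (1/2) * (pderiv_field (rep02 A c h) y u v w + (pderiv_field (rep02 A c h) y v u w + (-1) * pderiv_field (rep02 A c h) y w u v)))"
    unfolding pderiv_field_def
    by (rule J_mult[OF J_static[OF smooth_on_const] J_add[OF J_space_deriv[OF J_rep02] J_add[OF J_space_deriv[OF J_rep02]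
          J_mult[OF J_static[OF smooth_on_const] J_space_deriv[OF J_rep02]]]]])
  then show ?thesis by (rule J_cong) (simp add: koszul_def)
qed

lemma J_conn_coeff: "J (\<lambda>h y. conn_coeff A h T c y u v $ m)"
proof -
  have sT: "smooth_on V (\<lambda>y. rep12 A c T y u v $ m)"
    using smooth_on_linear_image[OF bounded_linear_vec_nth Vo, of "\<lambda>y. rep12 A c T y u v" m]
      smooth_tensor12_on[OF T c] by (simp add: V)
  have "J (\<lambda>h y. (\<Sum>l\<in>UNIV. koszul (rep02 A c h) y u v (axis l 1) * dual_axis (rep02 A c h y) l $ m) + rep12 A c T y u v $ m)"
    by (rule J_add[OF J_sum[OF J_mult[OF J_koszul J_dual_axis]] J_static[OF sT]])
  then show ?thesis by (rule J_cong) (simp add: conn_coeff_def christoffel_def)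
qed

text \<open>The coordinate expression is built from quantities already treated; the existence of a
  frame identifies it with the definition through \<open>onb\<close>.\<close>

lemma J_scalar_curv: "J (\<lambda>h y. scalar_curv A h T (cinv c y))"
proof -
  let ?\<Gamma> = "\<lambda>h. conn_coeff A h T c"
  have "J (\<lambda>h y. \<Sum>l\<in>UNIV. \<Sum>m\<in>UNIV. \<Sum>r\<in>UNIV. dual_axis (rep02 A c h y) l $ r *
    (frechet_derivative (\<lambda>y. ?\<Gamma> h y (axis l 1) (axis r 1) $ m) (at y) (axis m 1)
     + (- 1) * frechet_derivative (\<lambda>y. ?\<Gamma> h y (axis m 1) (axis r 1) $ m) (at y) (axis l 1)
     + ((\<Sum>j\<in>UNIV. ?\<Gamma> h y (axis l 1) (axis r 1) $ j * ?\<Gamma> h y (axis m 1) (axis j 1) $ m)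
     + (- 1) * (\<Sum>j\<in>UNIV. ?\<Gamma> h y (axis m 1) (axis r 1) $ j * ?\<Gamma> h y (axis l 1) (axis j 1) $ m))))"
    by (rule J_sum J_mult[OF J_dual_axis] J_add J_space_deriv J_conn_coeff J_mult[OF J_conn_coeff J_conn_coeff]
       J_mult[OF J_static[OF smooth_on_const]])+
  then show ?thesis
  proof (rule J_cong)
    fix h y assume h: "framed_metric W h" and y: "y \<in> V"
    then obtain p where p: "p \<in> fst c" "p \<in> W" "y = snd c p" by (auto simp: V)
    have hm: "metric_on A W h" using h by (simp add: framed_metric_def)
    obtain F where F: "orthonormal_frame (h p) F" using h p by (auto simp: framed_metric_def)
    have "scalar_curv A h T p = coord_scal (rep02 A c h y) (?\<Gamma> h) y"
      unfolding p(3) by (rule scalar_curv_chart[OF hm T W p(2) c p(1) F])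
    also note coord_scal_components[of "snd c ` (fst c \<inter> W)", OF chart_image_open_Int[OF c W] _
         bilinear_conn_coeff[OF hm T W c] smooth_on_conn_coeff[OF hm T W c], of y]
    finally show "(\<Sum>l\<in>UNIV. \<Sum>m\<in>UNIV. \<Sum>r\<in>UNIV. dual_axis (rep02 A c h y) l $ r *
      (frechet_derivative (\<lambda>y. ?\<Gamma> h y (axis l 1) (axis r 1) $ m) (at y) (axis m 1)
       + (- 1) * frechet_derivative (\<lambda>y. ?\<Gamma> h y (axis m 1) (axis r 1) $ m) (at y) (axis l 1)
       + ((\<Sum>j\<in>UNIV. ?\<Gamma> h y (axis l 1) (axis r 1) $ j * ?\<Gamma> h y (axis m 1) (axis j 1) $ m)
       + (- 1) * (\<Sum>j\<in>UNIV. ?\<Gamma> h y (axis m 1) (axis r 1) $ j * ?\<Gamma> h y (axis l 1) (axis j 1) $ m)))) =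
      scalar_curv A h T (cinv c y)"
      using y p c by (simp add: V)
  qed
qed

lemma J_det_ratio: "J (\<lambda>h y. det_ratio g h (cinv c y))"
proof -
  have sg: "smooth_on V (\<lambda>y. inverse (det (gram (rep02 A c g y))))"
  proof -
    note mf = metric_field_rep02[OF g W c]
    show ?thesis unfolding V
      by (intro smooth_on_inverse smooth_on_det metric_fieldD(1)[OF mf])
         (auto simp: gram_def metric_fieldD(5)[OF mf] metric_fieldD(4)[OF mf, unfolded gram_def])
  qed
  show ?thesis
  proof (rule J_cong[OF J_mult[OF J_det_gram J_static[OF sg]]])
    fix h y assume h: "framed_metric W h" and y: "y \<in> V"
    then obtain p where p: "p \<in> fst c" "p \<in> W" "y = snd c p" by (auto simp: V)
    then show "det (gram (rep02 A c h y)) * inverse (det (gram (rep02 A c g y))) = det_ratio g h (cinv c y)"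
      using det_ratio_chart[OF g _ p(2) c p(1)] h c by (simp add: framed_metric_def divide_inverse)
  qed
qed

end

end


section \<open>Variations\<close>

lemma smooth_on_slice:
  fixes \<phi> :: "real \<times> 'a::euclidean_space \<Rightarrow> 'b::real_normed_vector"
  assumes "open I" "open V" "smooth_on (I \<times> V) \<phi>" "t \<in> I"
  shows "smooth_on V (\<lambda>y. \<phi> (t, y))"
proof (rule smooth_on_compose[OF assms(2) open_Times[OF assms(1,2)] assms(3)])
  have "smooth_on V (\<lambda>y. (t, 0) + (0, y) :: real \<times> 'a)"
    by (intro smooth_on_add assms smooth_on_const smooth_on_bounded_linear bounded_linear_Pair bounded_linear_zero bounded_linear_ident)
  then show "smooth_on V (Pair t)" by simp
qed (use assms in auto)

lemma zero_derivative_constant: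
  fixes f :: "real \<Rightarrow> 'a::real_normed_vector"
  assumes "\<And>t. t \<in> {-\<epsilon><..<\<epsilon>} \<Longrightarrow> (f has_vector_derivative 0) (at t)" "t \<in> {-\<epsilon><..<\<epsilon>}"
  shows "f t = f 0"
proof -
  obtain c where c: "\<And>s. s \<in> {-\<epsilon><..<\<epsilon>} \<Longrightarrow> f s = c"
    using has_vector_derivative_zero_constant[of "{-\<epsilon><..<\<epsilon>}" f]
      assms(1) has_vector_derivative_at_within convex_real_interval by metis
  have "0 \<in> {-\<epsilon><..<\<epsilon>}" using assms(2) by auto
  then show ?thesis using c assms(2) by metis
qed

text \<open>Off \<open>K\<close> the velocity vanishes at every time, not only at time 0, so the
  metric is constant there.\<close>

lemma metric_variation_static:
  assumes "metric_variation A W g \<epsilon> gt K" "p \<in> W" "p \<notin> K" "t \<in> {-\<epsilon><..<\<epsilon>}"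
  shows "gt t p = g p"
proof (intro ext)
  fix u v
  have "gt t p u v = gt 0 p u v"
    by (rule zero_derivative_constant[OF _ assms(4)])
       (use assms in \<open>auto simp: metric_variation_def has_real_derivative_iff_has_vector_derivative\<close>)
  then show "gt t p u v = g p u v" using assms by (simp add: metric_variation_def)
qed

lemma contorsion_variation_static:
  assumes "contorsion_variation A W T \<epsilon> Tt K" "p \<in> W" "p \<notin> K" "t \<in> {-\<epsilon><..<\<epsilon>}"
  shows "Tt t p = T p"
proof (intro ext)
  fix u v
  have "Tt t p u v = Tt 0 p u v"
    by (rule zero_derivative_constant[OF _ assms(4)])
       (use assms in \<open>auto simp: contorsion_variation_def\<close>)
  then show "Tt t p u v = T p u v" using assms by (simp add: contorsion_variation_def)
qed

lemma metric_variation_mono: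
  assumes "metric_variation A W g \<epsilon> gt K" "0 < \<epsilon>'" "\<epsilon>' \<le> \<epsilon>" shows "metric_variation A W g \<epsilon>' gt K"
proof -
  have sub: "{-\<epsilon>'<..<\<epsilon>'} \<subseteq> {-\<epsilon><..<\<epsilon>}" using assms by auto
  have "smooth_family02 A W {-\<epsilon>'<..<\<epsilon>'} gt"
    using assms(1) smooth_on_subset[OF _ Sigma_mono[OF sub order_refl]]
    unfolding metric_variation_def smooth_family02_def by blast
  then show ?thesis using assms(1,2) sub unfolding metric_variation_def by (auto dest: subsetD[OF sub])
qed

lemma adapted_variation_mono:
  assumes "adapted_variation A k D W g \<epsilon> gt K" "0 < \<epsilon>'" "\<epsilon>' \<le> \<epsilon>" shows "adapted_variation A k D W g \<epsilon>' gt K"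
  using assms metric_variation_mono[of A W g \<epsilon> gt K \<epsilon>'] by (auto simp: adapted_variation_def)

context smooth_manifold
begin

text \<open>\<open>W\<close> and the complement of \<open>K\<close> are open and cover the
  manifold.\<close>

lemma smooth_on_glue:
  fixes \<phi> :: "real \<times> (real ^ 'n) \<Rightarrow> 'b::real_normed_vector"
  assumes c: "c \<in> A" and I: "open I" and W: "open W" "closed K" "K \<subseteq> W"
    and sm: "smooth_on (I \<times> snd c ` (fst c \<inter> W)) \<phi>" "smooth_on (I \<times> snd c ` (fst c \<inter> - K)) \<phi>"
  shows "smooth_on (I \<times> snd c ` (fst c \<inter> UNIV)) \<phi>"
proof (rule smooth_on_locally)
  fix z assume z: "z \<in> I \<times> snd c ` (fst c \<inter> UNIV)"
  have "open (I \<times> snd c ` (fst c \<inter> W))" "open (I \<times> snd c ` (fst c \<inter> - K))"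
    using W by (auto intro!: open_Times I chart_image_open_Int c)
  moreover have "z \<in> I \<times> snd c ` (fst c \<inter> W) \<or> z \<in> I \<times> snd c ` (fst c \<inter> - K)" using z W by auto
  ultimately show "\<exists>V. open V \<and> z \<in> V \<and> smooth_on V \<phi>" using sm by blast
qed

lemma metric_on_family_slice:
  assumes "\<And>p. p \<in> W \<Longrightarrow> bilinear (h t p) \<and> (\<forall>u v. h t p u v = h t p v u) \<and> nondegenerate_on (h t) p UNIV"
    and "smooth_family02 A W I h" "open I" "open W" "t \<in> I"
  shows "metric_on A W (h t)"
  unfolding metric_on_def smooth_tensor02_def
proof (intro conjI ballI allI)
  fix c u v assume c: "c \<in> A"
  have "smooth_on (I \<times> snd c ` (fst c \<inter> W)) (\<lambda>(t, y). rep02 A c (h t) y u v)"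
    using assms(2) c by (simp add: smooth_family02_def)
  from smooth_on_slice[OF assms(3) chart_image_open_Int[OF c assms(4)] this assms(5)]
  show "smooth_on (snd c ` (fst c \<inter> W)) (\<lambda>y. rep02 A c (h t) y u v)" by simp
qed (use assms(1) in blast)+

text \<open>Near the boundary of \<open>W\<close> the variation is already constant, because its
  support is compact inside \<open>W\<close>; continuing it by \<open>g\<close> is therefore
  smooth.\<close>

lemma metric_variation_extend:
  assumes v: "metric_variation A W g \<epsilon> h K" and W: "open W" and g: "metric_on A UNIV g"
    and off: "\<And>t p. p \<notin> W \<Longrightarrow> h t p = g p"
  shows "metric_variation A UNIV g \<epsilon> h K"
proof -
  let ?I = "{-\<epsilon><..<\<epsilon>}"
  have K: "compact K" "closed K" "K \<subseteq> W" and \<epsilon>: "\<epsilon> > 0" using v by (auto simp: metric_variation_def compact_imp_closed)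
  have st: "h t p = g p" if "p \<notin> K" "t \<in> ?I" for t p
    using metric_variation_static[OF v _ that] off by (cases "p \<in> W") auto
  have sf: "smooth_family02 A UNIV ?I h"
    unfolding smooth_family02_def
  proof (intro ballI allI)
    fix c u v' assume c: "c \<in> A"
    show "smooth_on (?I \<times> snd c ` (fst c \<inter> UNIV)) (\<lambda>(t, y). rep02 A c (h t) y u v')"
    proof (rule smooth_on_glue[OF c _ W K(2,3)])
      show "smooth_on (?I \<times> snd c ` (fst c \<inter> W)) (\<lambda>(t, y). rep02 A c (h t) y u v')"
        using v c by (simp add: metric_variation_def smooth_family02_def)
      have o: "open (snd c ` (fst c \<inter> - K))" using K by (intro chart_image_open_Int c) auto
      have "smooth_on (snd c ` (fst c \<inter> - K)) (\<lambda>y. rep02 A c g y u v')"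
        using smooth_tensor02_subset[of A UNIV g "- K"] g c by (simp add: metric_on_def smooth_tensor02_on)
      from smooth_on_snd[OF _ o this, of ?I]
      have s: "smooth_on (?I \<times> snd c ` (fst c \<inter> - K)) (\<lambda>z. rep02 A c g (snd z) u v')" by simp
      show "smooth_on (?I \<times> snd c ` (fst c \<inter> - K)) (\<lambda>(t, y). rep02 A c (h t) y u v')"
        by (rule smooth_on_cong[OF _ _ s]) (use c o st in \<open>auto simp: rep02_def intro!: open_Times\<close>)
    qed auto
  qed
  have pt: "bilinear (h t p) \<and> (\<forall>u v. h t p u v = h t p v u) \<and> nondegenerate_on (h t) p UNIV" if "t \<in> ?I" for t p
  proof (cases "p \<in> W")
    case True
    then show ?thesis using v that by (auto simp: metric_variation_def metric_on_def smooth_tensor02_def)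
  next
    case False
    then show ?thesis using off g by (auto simp: metric_on_def smooth_tensor02_def nondegenerate_on_def)
  qed
  have zero: "((\<lambda>s. h s p u v) has_real_derivative 0) (at t)" if "p \<notin> K" "t \<in> ?I" for p t u v
    by (rule has_field_derivative_transform_within_open[of "\<lambda>_. g p u v", OF _ _ that(2)]) (use st[OF that(1)] in auto)
  show ?thesis
    unfolding metric_variation_def
    using \<epsilon> K sf zero v off metric_on_family_slice[of UNIV h _ ?I, OF pt sf]
    by (auto simp: metric_variation_def)
qed

lemma contorsion_variation_extend:
  assumes v: "contorsion_variation A W T \<epsilon> Tt K" and W: "open W" and T: "smooth_tensor12 A UNIV T"
    and off: "\<And>t p. p \<notin> W \<Longrightarrow> Tt t p = T p"
  shows "contorsion_variation A UNIV T \<epsilon> Tt K"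
proof -
  let ?I = "{-\<epsilon><..<\<epsilon>}"
  have K: "compact K" "closed K" "K \<subseteq> W" and \<epsilon>: "\<epsilon> > 0" using v by (auto simp: contorsion_variation_def compact_imp_closed)
  have st: "Tt t p = T p" if "p \<notin> K" "t \<in> ?I" for t p
    using contorsion_variation_static[OF v _ that] off by (cases "p \<in> W") auto
  have sf: "smooth_family12 A UNIV ?I Tt"
    unfolding smooth_family12_def
  proof (intro ballI allI)
    fix c u v' assume c: "c \<in> A"
    show "smooth_on (?I \<times> snd c ` (fst c \<inter> UNIV)) (\<lambda>(t, y). rep12 A c (Tt t) y u v')"
    proof (rule smooth_on_glue[OF c _ W K(2,3)])
      show "smooth_on (?I \<times> snd c ` (fst c \<inter> W)) (\<lambda>(t, y). rep12 A c (Tt t) y u v')"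
        using v c by (simp add: contorsion_variation_def smooth_family12_def)
      have o: "open (snd c ` (fst c \<inter> - K))" using K by (intro chart_image_open_Int c) auto
      have "smooth_on (snd c ` (fst c \<inter> - K)) (\<lambda>y. rep12 A c T y u v')"
        using smooth_tensor12_subset[of A UNIV T "- K"] T c by (simp add: smooth_tensor12_on)
      from smooth_on_snd[OF _ o this, of ?I]
      have s: "smooth_on (?I \<times> snd c ` (fst c \<inter> - K)) (\<lambda>z. rep12 A c T (snd z) u v')" by simp
      show "smooth_on (?I \<times> snd c ` (fst c \<inter> - K)) (\<lambda>(t, y). rep12 A c (Tt t) y u v')"
        by (rule smooth_on_cong[OF _ _ s]) (use c o st in \<open>auto simp: rep12_def intro!: open_Times\<close>)
    qed auto
  qed
  have pt: "bilinear (Tt t p)" if "t \<in> ?I" for t p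
    using v that T off by (cases "p \<in> W") (auto simp: contorsion_variation_def smooth_tensor12_def)
  have sl: "smooth_tensor12 A UNIV (Tt t)" if t: "t \<in> ?I" for t
    unfolding smooth_tensor12_def
  proof (intro conjI ballI allI pt[OF t])
    fix c u v' assume c: "c \<in> A"
    have "smooth_on (?I \<times> snd c ` (fst c \<inter> UNIV)) (\<lambda>(t, y). rep12 A c (Tt t) y u v')"
      using sf c by (simp add: smooth_family12_def)
    from smooth_on_slice[OF _ chart_image_open_Int[OF c open_UNIV] this t]
    show "smooth_on (snd c ` (fst c \<inter> UNIV)) (\<lambda>y. rep12 A c (Tt t) y u v')" by simp
  qed
  have zero: "((\<lambda>s. Tt s p u v) has_vector_derivative 0) (at t)" if "p \<notin> K" "t \<in> ?I" for p t u v
    by (rule has_vector_derivative_transform_within_open[of "\<lambda>_. T p u v", OF _ _ that(2)]) (use st[OF that(1)] in auto)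
  have init: "Tt 0 p = T p" for p
    using v off by (cases "p \<in> W") (auto simp: contorsion_variation_def)
  show ?thesis
    unfolding contorsion_variation_def using \<epsilon> K sf zero sl init by simp
qed

lemma variation_DERIV:
  assumes "smooth_family02 A W I gt" "p \<in> W" "t \<in> I"
  shows "((\<lambda>s. gt s p u v) has_real_derivative deriv (\<lambda>s. gt s p u v) t) (at t)"
proof -
  let ?c = "chart_at A p"
  have "smooth_on (I \<times> snd ?c ` (fst ?c \<inter> W)) (\<lambda>z. rep02 A ?c (gt (fst z)) (snd z) u v)"
    using assms(1) by (simp add: smooth_family02_def case_prod_beta')
  from smooth_on_time_slice[OF this assms(3), of "snd ?c p"] assms(2)
  show ?thesis by (simp add: rep02_chart_at DERIV_imp_deriv)
qed

lemma variation_deriv_bilinear: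
  assumes "smooth_family02 A W I gt" "p \<in> W" "t \<in> I" "open I" "\<And>s. s \<in> I \<Longrightarrow> bilinear (gt s p)"
  shows "bilinear (\<lambda>u v. deriv (\<lambda>s. gt s p u v) t)"
proof -
  have "bilinear (pderiv_field (\<lambda>s. gt s p) t 1)"
    by (rule bilinear_pderiv_field[OF assms(4,3,5)])
       (use variation_DERIV[OF assms(1-3)] in \<open>auto simp: differentiable_def has_field_derivative_def\<close>)
  moreover have "pderiv_field (\<lambda>s. gt s p) t 1 u v = deriv (\<lambda>s. gt s p u v) t" for u v
    using fun_cong[OF frechet_derivative_at[OF variation_DERIV[OF assms(1-3), of u v, unfolded has_field_derivative_def]], of 1]
    by (simp add: pderiv_field_def)
  ultimately show ?thesis by (simp add: pderiv_field_def[abs_def])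
qed

end


section \<open>Adapted variations on a splitting into lines\<close>

locale line_splitting = smooth_manifold A
  for A :: "('m::{t2_space,second_countable_topology}, 'n::finite) chart set" +
  fixes g :: "('m, 'n) tensor02" and T :: "('m, 'n) tensor12"
    and \<Omega> :: "'m set" and k :: nat and D :: "nat \<Rightarrow> 'm \<Rightarrow> (real ^ 'n) set"
  assumes g: "metric_on A UNIV g" and T: "smooth_tensor12 A UNIV T" and \<Omega>: "open \<Omega>"
    and D: "\<And>\<mu>. \<mu> \<in> {1..k} \<Longrightarrow> smooth_distribution A \<Omega> 1 (D \<mu>)"
    and span_D: "\<And>p. p \<in> \<Omega> \<Longrightarrow> span (\<Union>\<mu>\<in>{1..k}. D \<mu> p) = UNIV"
    and ad: "adapted_metric A \<Omega> k D g"
begin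

abbreviation \<nu> where "\<nu> \<equiv> vol_measure A UNIV g"

abbreviation AV where "AV \<equiv> adapted_variation A k D \<Omega> g"

text \<open>The integrand of the total action with respect to the fixed measure
  \<open>\<nu>\<close>. The square root is written as a power, to share the smoothness and jet rules
  for general exponents.\<close>

definition dens :: "(real \<Rightarrow> ('m, 'n) tensor02) \<Rightarrow> real \<Rightarrow> 'm \<Rightarrow> real" where
  "dens gt t p = det_ratio g (gt t) p powr (1 / 2) * scalar_curv A (gt t) T p"

definition dens_deriv :: "(real \<Rightarrow> ('m, 'n) tensor02) \<Rightarrow> 'm \<Rightarrow> real" where
  "dens_deriv gt p = deriv (\<lambda>t. dens gt t p) 0"

definition vol_deriv :: "(real \<Rightarrow> ('m, 'n) tensor02) \<Rightarrow> 'm \<Rightarrow> real" where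
  "vol_deriv gt p = deriv (\<lambda>t. det_ratio g (gt t) p powr (1 / 2)) 0"

lemma D_line: "p \<in> \<Omega> \<Longrightarrow> \<mu> \<in> {1..k} \<Longrightarrow> subspace (D \<mu> p) \<and> dim (D \<mu> p) = 1"
  using D by (auto simp: smooth_distribution_def)

lemma g_\<Omega>: "metric_on A \<Omega> g" by (rule metric_on_subset[OF g]) simp

lemma T_\<Omega>: "smooth_tensor12 A \<Omega> T" by (rule smooth_tensor12_subset[OF T]) simp

lemma frame_at:
  assumes "adapted_metric A \<Omega> k D h" "p \<in> \<Omega>"
  obtains e where "\<And>\<mu>. \<mu> \<in> {1..k} \<Longrightarrow> e \<mu> \<in> D \<mu> p" "inj_on e {1..k}" "orthonormal_frame (h p) (e ` {1..k})"
  using adapted_frame[OF assms D_line[OF assms(2)] span_D[OF assms(2)]] by metis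

lemma framed: "adapted_metric A \<Omega> k D h \<Longrightarrow> framed_metric \<Omega> h"
  unfolding framed_metric_def using frame_at by (metis adapted_metric_def)

lemma mixed_eq:
  assumes "adapted_metric A \<Omega> k D h" "smooth_tensor12 A \<Omega> T'" "p \<in> \<Omega>"
  shows "mixed_scalar_curv A k D h T' p = scalar_curv A h T' p / 2"
  using mixed_scalar_curv_eq[OF assms(1,2) \<Omega> assms(3) D_line[OF assms(3)] span_D[OF assms(3)]] .

lemma AV_D:
  assumes "AV \<epsilon> gt K"
  shows "\<epsilon> > 0" "\<And>t. t \<in> {-\<epsilon><..<\<epsilon>} \<Longrightarrow> adapted_metric A \<Omega> k D (gt t)" "\<And>t. t \<in> {-\<epsilon><..<\<epsilon>} \<Longrightarrow> framed_metric \<Omega> (gt t)"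
    "smooth_family02 A \<Omega> {-\<epsilon><..<\<epsilon>} gt" "\<And>p. p \<in> \<Omega> \<Longrightarrow> gt 0 p = g p" "compact K" "K \<subseteq> \<Omega>"
    "0 \<in> {-\<epsilon><..<\<epsilon>}" "\<And>t. t \<in> {-\<epsilon><..<\<epsilon>} \<Longrightarrow> metric_on A \<Omega> (gt t)" "metric_variation A \<Omega> g \<epsilon> gt K"
  using assms framed by (auto simp: adapted_variation_def metric_variation_def)

text \<open>The open set \<open>W\<close> may be smaller than \<Omega>, so that a relation valid
  only off the support can be used.\<close>

lemma AV_jets:
  assumes v: "AV \<epsilon> g1 K1" "AV \<epsilon> g2 K2" "AV \<epsilon> g3 K3" and W: "open W" "W \<subseteq> \<Omega>"
    and lin: "\<And>p u v. p \<in> W \<Longrightarrow> deriv (\<lambda>t. g3 t p u v) 0 = a * deriv (\<lambda>t. g1 t p u v) 0 + b * deriv (\<lambda>t. g2 t p u v) 0"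
    and c: "c \<in> A" and I: "I = {-\<epsilon><..<\<epsilon>}" and V: "V = snd c ` (fst c \<inter> W)"
  shows "jet3 a b I V (\<lambda>z. det_ratio g (g1 (fst z)) (cinv c (snd z))) (\<lambda>z. det_ratio g (g2 (fst z)) (cinv c (snd z)))
      (\<lambda>z. det_ratio g (g3 (fst z)) (cinv c (snd z)))"
    "jet3 a b I V (\<lambda>z. scalar_curv A (g1 (fst z)) T (cinv c (snd z))) (\<lambda>z. scalar_curv A (g2 (fst z)) T (cinv c (snd z)))
      (\<lambda>z. scalar_curv A (g3 (fst z)) T (cinv c (snd z)))"
proof -
  have sub: "framed_metric W h" if "framed_metric \<Omega> h" for h
    using that metric_on_subset[OF _ W(2)] W(2) by (auto simp: framed_metric_def)
  have sf: "smooth_family02 A W I gt" if "AV \<epsilon> gt K" for gt K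
  proof -
    have "I \<times> snd c ` (fst c \<inter> W) \<subseteq> {-\<epsilon><..<\<epsilon>} \<times> snd c ` (fst c \<inter> \<Omega>)" for c :: "('m, 'n) chart"
      using W(2) I by auto
    then show ?thesis using AV_D(4)[OF that] smooth_on_subset unfolding smooth_family02_def by blast
  qed
  have I': "open I" "0 \<in> I" using AV_D(8)[OF v(1)] by (auto simp: I)
  have gW: "metric_on A W g" "smooth_tensor12 A W T"
    using metric_on_subset[OF g] smooth_tensor12_subset[OF T] by auto
  have f: "\<And>t. t \<in> I \<Longrightarrow> framed_metric W (g1 t)" "\<And>t. t \<in> I \<Longrightarrow> framed_metric W (g2 t)" "\<And>t. t \<in> I \<Longrightarrow> framed_metric W (g3 t)"
    using AV_D(3)[OF v(1)] AV_D(3)[OF v(2)] AV_D(3)[OF v(3)] sub by (auto simp: I)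
  have i: "\<And>p. p \<in> W \<Longrightarrow> g1 0 p = g p" "\<And>p. p \<in> W \<Longrightarrow> g2 0 p = g p" "\<And>p. p \<in> W \<Longrightarrow> g3 0 p = g p"
    using AV_D(5)[OF v(1)] AV_D(5)[OF v(2)] AV_D(5)[OF v(3)] W(2) by auto
  show "jet3 a b I V (\<lambda>z. det_ratio g (g1 (fst z)) (cinv c (snd z))) (\<lambda>z. det_ratio g (g2 (fst z)) (cinv c (snd z)))
      (\<lambda>z. det_ratio g (g3 (fst z)) (cinv c (snd z)))"
    by (rule J_det_ratio[OF W(1) I' gW f sf[OF v(1)] sf[OF v(2)] sf[OF v(3)] i lin c V])
  show "jet3 a b I V (\<lambda>z. scalar_curv A (g1 (fst z)) T (cinv c (snd z))) (\<lambda>z. scalar_curv A (g2 (fst z)) T (cinv c (snd z)))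
      (\<lambda>z. scalar_curv A (g3 (fst z)) T (cinv c (snd z)))"
    by (rule J_scalar_curv[OF W(1) I' gW f sf[OF v(1)] sf[OF v(2)] sf[OF v(3)] i lin c V])
qed

text \<open>Three equal families with coefficients 1 and 0 satisfy the relation trivially; the
  smoothness contained in \<open>jet3\<close> is what is extracted.\<close>

lemma smooth_ffam_variation:
  assumes v: "AV \<epsilon> gt K"
  shows "smooth_ffam \<Omega> {-\<epsilon><..<\<epsilon>} (\<lambda>t. det_ratio g (gt t))"
    and "smooth_ffam \<Omega> {-\<epsilon><..<\<epsilon>} (\<lambda>t. scalar_curv A (gt t) T)"
  using AV_jets[OF v v v \<Omega> order_refl, of 1 0] by (auto simp: smooth_ffam_def jet3_def)

lemma det_ratio_initial: "AV \<epsilon> gt K \<Longrightarrow> p \<in> \<Omega> \<Longrightarrow> det_ratio g (gt 0) p = 1"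
  using AV_D(5) det_gram_metric_nonzero[OF g] by (simp add: det_ratio_def)

text \<open>Nondegeneracy keeps the ratio away from zero, and it starts at 1; the intermediate value
  theorem rules out a change of sign.\<close>

lemma det_ratio_positive:
  assumes v: "AV \<epsilon> gt K" and t: "t \<in> {-\<epsilon><..<\<epsilon>}" and p: "p \<in> \<Omega>"
  shows "det_ratio g (gt t) p > 0"
proof (rule ccontr)
  let ?r = "\<lambda>s. det_ratio g (gt s) p"
  have cont: "isCont ?r s" if "s \<in> {-\<epsilon><..<\<epsilon>}" for s
    using smooth_ffam_DERIV[OF smooth_ffam_variation(1)[OF v] that p] DERIV_isCont by blast
  have nz: "?r s \<noteq> 0" if "s \<in> {-\<epsilon><..<\<epsilon>}" for s
    using det_gram_metric_nonzero[OF g UNIV_I] det_gram_metric_nonzero[OF AV_D(9)[OF v that] p] by (simp add: det_ratio_def)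
  assume "\<not> ?r t > 0"
  then have neg: "?r t \<le> 0" by simp
  have one: "?r 0 = 1" by (rule det_ratio_initial[OF v p])
  have "\<exists>s. s \<in> {-\<epsilon><..<\<epsilon>} \<and> ?r s = 0"
  proof (cases "0 \<le> t")
    case True
    have "\<exists>x\<ge>0. x \<le> t \<and> ?r x = 0"
      by (rule IVT2) (use True neg one cont t in auto)
    then obtain x where "0 \<le> x" "x \<le> t" "?r x = 0" by blast
    then show ?thesis using t AV_D(1)[OF v] by (intro exI[of _ x]) auto
  next
    case False
    have "\<exists>x\<ge>t. x \<le> 0 \<and> ?r x = 0"
      by (rule IVT) (use False neg one cont t in auto)
    then obtain x where "t \<le> x" "x \<le> 0" "?r x = 0" by blast
    then show ?thesis using t AV_D(1)[OF v] by (intro exI[of _ x]) auto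
  qed
  then show False using nz by blast
qed

lemma smooth_ffam_vol:
  assumes v: "AV \<epsilon> gt K"
  shows "smooth_ffam \<Omega> {-\<epsilon><..<\<epsilon>} (\<lambda>t p. det_ratio g (gt t) p powr r)"
  unfolding smooth_ffam_def
proof
  fix c assume c: "c \<in> A"
  have o: "open ({-\<epsilon><..<\<epsilon>} \<times> snd c ` (fst c \<inter> \<Omega>))" by (intro open_Times chart_image_open_Int c \<Omega>) auto
  show "smooth_on ({-\<epsilon><..<\<epsilon>} \<times> snd c ` (fst c \<inter> \<Omega>)) (\<lambda>z. det_ratio g (gt (fst z)) (cinv c (snd z)) powr r)"
    by (rule smooth_on_powr[OF o])
       (use smooth_ffam_variation(1)[OF v] c det_ratio_positive[OF v] in \<open>auto simp: smooth_ffam_def\<close>)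
qed

lemma smooth_ffam_mult:
  assumes "smooth_ffam W I F" "smooth_ffam W I G" "open I" "open W"
  shows "smooth_ffam W I (\<lambda>t p. F t p * G t p)"
  using assms by (auto simp: smooth_ffam_def intro!: smooth_on_mult open_Times chart_image_open_Int)

lemma smooth_ffam_dens: "AV \<epsilon> gt K \<Longrightarrow> smooth_ffam \<Omega> {-\<epsilon><..<\<epsilon>} (dens gt)"
  unfolding dens_def [abs_def]
  by (rule smooth_ffam_mult[OF smooth_ffam_vol smooth_ffam_variation(2)]) (auto simp: \<Omega>)

text \<open>The first variation of the action density is linear in the velocity of the metric near
  the point. Variations can thus be compared without an explicit formula for that linear
  map.\<close>

lemma dens_deriv_linear:
  assumes v: "AV \<epsilon> g1 K1" "AV \<epsilon> g2 K2" "AV \<epsilon> g3 K3" and W: "open W" "W \<subseteq> \<Omega>" "p \<in> W"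
    and lin: "\<And>p u v. p \<in> W \<Longrightarrow> deriv (\<lambda>t. g3 t p u v) 0 = a * deriv (\<lambda>t. g1 t p u v) 0 + b * deriv (\<lambda>t. g2 t p u v) 0"
  shows "dens_deriv g3 p = a * dens_deriv g1 p + b * dens_deriv g2 p"
proof -
  let ?c = "chart_at A p" let ?I = "{-\<epsilon><..<\<epsilon>}"
  let ?V = "snd ?c ` (fst ?c \<inter> W)"
  note I = open_greaterThanLessThan[of "-\<epsilon>" \<epsilon>] AV_D(8)[OF v(1)]
  have V: "open ?V" by (intro chart_image_open_Int W) simp
  note j = AV_jets[OF v W(1,2) lin chart_at_in(1) refl refl, of p]
  have pos: "det_ratio g (g1 (fst z)) (cinv ?c (snd z)) > 0" "det_ratio g (g2 (fst z)) (cinv ?c (snd z)) > 0"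
    "det_ratio g (g3 (fst z)) (cinv ?c (snd z)) > 0" if "z \<in> ?I \<times> ?V" for z
    using that det_ratio_positive[OF v(1)] det_ratio_positive[OF v(2)] det_ratio_positive[OF v(3)] W(2) by auto
  have J: "jet3 a b ?I ?V (\<lambda>z. dens g1 (fst z) (cinv ?c (snd z))) (\<lambda>z. dens g2 (fst z) (cinv ?c (snd z)))
      (\<lambda>z. dens g3 (fst z) (cinv ?c (snd z)))"
    unfolding dens_def by (intro jet3_mult[OF I V] jet3_powr[OF I V] j pos)
  have y: "snd ?c p \<in> ?V" using W by auto
  have td: "time_deriv (\<lambda>z. dens gt (fst z) (cinv ?c (snd z))) (snd ?c p) = dens_deriv gt p"
    if "smooth_on (?I \<times> ?V) (\<lambda>z. dens gt (fst z) (cinv ?c (snd z)))" for gt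
    using DERIV_imp_deriv[OF time_deriv_slice[OF that I(2) y]] by (simp add: dens_deriv_def)
  have s: "smooth_on (?I \<times> ?V) (\<lambda>z. dens g1 (fst z) (cinv ?c (snd z)))"
    "smooth_on (?I \<times> ?V) (\<lambda>z. dens g2 (fst z) (cinv ?c (snd z)))"
    "smooth_on (?I \<times> ?V) (\<lambda>z. dens g3 (fst z) (cinv ?c (snd z)))"
    using J unfolding jet3_def by blast+
  show ?thesis
    using J[unfolded jet3_def, THEN conjunct2, THEN conjunct2, THEN conjunct2, rule_format, OF y]
    unfolding td[OF s(1)] td[OF s(2)] td[OF s(3)] by blast
qed

lemma static_off_support:
  assumes v: "AV \<epsilon> gt K" and p: "p \<in> \<Omega>" "p \<notin> K"
  shows "dens_deriv gt p = 0" "vol_deriv gt p = 0"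
proof -
  have st: "gt t q = g q" if "q \<in> \<Omega> - K" "t \<in> {-\<epsilon><..<\<epsilon>}" for q t
    by (rule metric_variation_static[OF AV_D(10)[OF v]]) (use that in auto)
  have z: "deriv (\<lambda>t. gt t q u v) 0 = 0" if "q \<in> \<Omega> - K" for q u v
    by (rule DERIV_imp_deriv, rule has_field_derivative_transform_within_open[of "\<lambda>_. g q u v" 0 0 "{-\<epsilon><..<\<epsilon>}"])
       (use AV_D(8)[OF v] st[OF that] in auto)
  \<comment> \<open>The zero velocity is a combination of any velocities with coefficients 0. It is
    used on an open set because the density involves derivatives in space.\<close>
  have "dens_deriv gt p = 0 * dens_deriv gt p + 0 * dens_deriv gt p"
    by (rule dens_deriv_linear[OF v v v, of "\<Omega> - K"])
       (use \<Omega> AV_D(6)[OF v] p z in \<open>auto simp: compact_imp_closed intro!: open_Diff\<close>)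
  then show "dens_deriv gt p = 0" by simp
  show "vol_deriv gt p = 0" unfolding vol_deriv_def
    by (rule DERIV_imp_deriv, rule has_field_derivative_transform_within_open[of "\<lambda>_. det_ratio g g p powr (1/2)" 0 0 "{-\<epsilon><..<\<epsilon>}"])
       (use AV_D(8)[OF v] st[of p] p in \<open>auto simp: det_ratio_def\<close>)
qed

lemma vol_density_variation:
  assumes v: "AV \<epsilon> gt K" and t: "t \<in> {-\<epsilon><..<\<epsilon>}" and c: "c \<in> A" "p \<in> fst c" "p \<in> \<Omega>"
  shows "vol_density A c (gt t) (snd c p) = det_ratio g (gt t) p powr (1 / 2) * vol_density A c g (snd c p)"
  using vol_density_ratio[OF g_\<Omega> AV_D(9)[OF v t] c(3,1,2) det_ratio_positive[OF v t c(3)]]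
    det_ratio_positive[OF v t c(3)] by (simp add: powr_half_sqrt)

section \<open>Actions and volumes over one domain of integration\<close>

context
  fixes U assumes U: "open U" "compact (closure U)" "closure U \<subseteq> \<Omega>"
begin

lemma U\<Omega>: "U \<subseteq> \<Omega>" using U closure_subset by blast

lemma total_action_eq:
  assumes v: "AV \<epsilon> gt K" and t: "t \<in> {-\<epsilon><..<\<epsilon>}"
  shows "total_action A U (gt t) T = (LINT p|\<nu>. indicator U p * dens gt t p)"
  unfolding total_action_def dens_def
  by (rule integral_vol_density[OF g refl U(1) smooth_ffam_measurable[OF smooth_ffam_vol[OF v] \<Omega> t U(1) U\<Omega>] _ _
        smooth_ffam_measurable[OF smooth_ffam_variation(2)[OF v] \<Omega> t U(1) U\<Omega>]])
     (use vol_density_variation[OF v t] U\<Omega> in auto)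

lemma mixed_action_eq:
  assumes v: "AV \<epsilon> gt K" and t: "t \<in> {-\<epsilon><..<\<epsilon>}"
  shows "mixed_action A k D U (gt t) T = (LINT p|\<nu>. indicator U p * dens gt t p) / 2"
proof -
  have eq: "indicator U p * mixed_scalar_curv A k D (gt t) T p = indicator U p * scalar_curv A (gt t) T p / 2" for p
    using mixed_eq[OF AV_D(2)[OF v t] T_\<Omega>, of p] U\<Omega> by (auto simp: indicator_def)
  have m: "(\<lambda>p. indicator U p * mixed_scalar_curv A k D (gt t) T p) \<in> borel_measurable borel"
    unfolding eq using smooth_ffam_measurable[OF smooth_ffam_variation(2)[OF v] \<Omega> t U(1) U\<Omega>] by measurable
  have "mixed_action A k D U (gt t) T =
     (LINT p|\<nu>. indicator U p * (det_ratio g (gt t) p powr (1 / 2) * mixed_scalar_curv A k D (gt t) T p))"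
    unfolding mixed_action_def
    by (rule integral_vol_density[OF g refl U(1) smooth_ffam_measurable[OF smooth_ffam_vol[OF v] \<Omega> t U(1) U\<Omega>] _ _ m])
       (use vol_density_variation[OF v t] U\<Omega> in auto)
  also have "\<dots> = (LINT p|\<nu>. indicator U p * dens gt t p / 2)"
  proof (rule Bochner_Integration.integral_cong[OF refl])
    fix p
    show "indicator U p * (det_ratio g (gt t) p powr (1 / 2) * mixed_scalar_curv A k D (gt t) T p) = indicator U p * dens gt t p / 2"
      using eq[of p] by (auto simp: dens_def indicator_def)
  qed
  finally show ?thesis by simp
qed

lemma measure_variation:
  assumes v: "AV \<epsilon> gt K" and t: "t \<in> {-\<epsilon><..<\<epsilon>}"
  shows "measure (vol_measure A U (gt t)) U = (LINT p|\<nu>. indicator U p * det_ratio g (gt t) p powr (1 / 2))"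
  by (rule measure_vol_density[OF g refl U(1) smooth_ffam_measurable[OF smooth_ffam_vol[OF v] \<Omega> t U(1) U\<Omega>]])
     (use vol_density_variation[OF v t] U\<Omega> in auto)

lemma dens_leibniz:
  assumes v: "AV \<epsilon> gt K"
  shows "((\<lambda>t. LINT p|\<nu>. indicator U p * dens gt t p) has_real_derivative (LINT p|\<nu>. indicator U p * dens_deriv gt p)) (at 0)"
  unfolding dens_deriv_def by (rule leibniz_vol[OF g refl smooth_ffam_dens[OF v] AV_D(1)[OF v] \<Omega> U])

lemma mixed_action_deriv:
  assumes v: "AV \<epsilon> gt K"
  shows "((\<lambda>t. mixed_action A k D U (gt t) T) has_real_derivative (LINT p|\<nu>. indicator U p * dens_deriv gt p) / 2) (at 0)"
  by (rule has_field_derivative_transform_within_open[OF DERIV_cdivide[OF dens_leibniz[OF v]], of "{-\<epsilon><..<\<epsilon>}"])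
     (use AV_D(8)[OF v] mixed_action_eq[OF v] in auto)

text \<open>Once continued by \<open>g\<close>, an adapted variation with exactly constant volume is
  admissible for \<open>critical_pair\<close>; uniqueness of derivatives then makes the integral
  vanish.\<close>

lemma critical_volume_preserving:
  assumes cp: "critical_pair A g T" and v: "AV \<epsilon> h K" and K: "K \<subseteq> U" and off: "\<And>t p. p \<notin> \<Omega> \<Longrightarrow> h t p = g p"
    and vol: "\<And>t. t \<in> {-\<epsilon><..<\<epsilon>} \<Longrightarrow> (LINT p|\<nu>. indicator U p * det_ratio g (h t) p powr (1 / 2)) = (LINT p|\<nu>. indicator U p)"
  shows "(LINT p|\<nu>. indicator U p * dens_deriv h p) = 0"
proof -
  have mv: "metric_variation A UNIV g \<epsilon> h K" by (rule metric_variation_extend[OF AV_D(10)[OF v] \<Omega> g off])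
  have idom: "integration_domain UNIV K U" using U K by (simp add: integration_domain_def)
  have "measure (vol_measure A U g) U = (LINT p|\<nu>. indicator U p * 1)"
    by (rule measure_vol_density[OF g refl U(1)]) (use U(1) in auto)
  then have "\<forall>t\<in>{-\<epsilon><..<\<epsilon>}. measure (vol_measure A U (h t)) U = measure (vol_measure A U g) U"
    using measure_variation[OF v] vol by simp
  then have "((\<lambda>t. total_action A U (h t) T) has_real_derivative 0) (at 0)"
    using cp mv idom unfolding critical_pair_def by blast
  then have "((\<lambda>t. LINT p|\<nu>. indicator U p * dens h t p) has_real_derivative 0) (at 0)"
    by (rule has_field_derivative_transform_within_open[of _ _ _ "{-\<epsilon><..<\<epsilon>}"])
       (use AV_D(8)[OF v] total_action_eq[OF v] in auto)
  then show ?thesis using DERIV_unique[OF dens_leibniz[OF v]] by blast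
qed

end

end


section \<open>The Lagrange multiplier\<close>

context smooth_manifold
begin

lemma smooth_ffam_mono: "smooth_ffam W I F \<Longrightarrow> I' \<subseteq> I \<Longrightarrow> smooth_ffam W I' F"
  unfolding smooth_ffam_def by (meson Sigma_mono order_refl smooth_on_subset)

lemma smooth_ffam_static:
  assumes F: "smooth_ffam W I F" "open I" "t \<in> I" "open W"
  shows "smooth_ffam W UNIV (\<lambda>_. F t)"
  unfolding smooth_ffam_def
proof
  fix c assume c: "c \<in> A"
  have V: "open (snd c ` (fst c \<inter> W))" by (rule chart_image_open_Int[OF c F(4)])
  have "smooth_on (snd c ` (fst c \<inter> W)) (\<lambda>y. F t (cinv c y))"
    using smooth_on_slice[OF F(2) V _ F(3), of "\<lambda>z. F (fst z) (cinv c (snd z))"] F(1) c by (simp add: smooth_ffam_def)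
  from smooth_on_snd[OF open_UNIV V this]
  show "smooth_on ((UNIV :: real set) \<times> snd c ` (fst c \<inter> W)) (\<lambda>z. F t (cinv c (snd z)))" by simp
qed

lemma smooth_ffam_affine:
  assumes "smooth_ffam W I F" "smooth_ffam W I G" "open I" "open W"
  shows "smooth_ffam W I (\<lambda>t p. F t p + r * G t p)"
  using assms by (auto simp: smooth_ffam_def intro!: smooth_on_add smooth_on_mult smooth_on_const open_Times chart_image_open_Int)

end

context line_splitting
begin

text \<open>A positive factor keeps the lines orthogonal and nondegenerate, and it enters the Gram
  determinant with the power \<open>CARD('n)\<close>, which determines the exponent. Applied to the
  constant variation, the same construction produces purely conformal velocities.\<close>

lemma volume_normalization:
  assumes v: "AV \<epsilon> gt K" and \<eta>: "smooth_ffam \<Omega> UNIV (\<lambda>_. \<eta>)" and K1: "compact K1" "K1 \<subseteq> \<Omega>"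
    and off: "\<And>p. p \<in> \<Omega> \<Longrightarrow> p \<notin> K1 \<Longrightarrow> \<eta> p = 0"
  obtains \<epsilon>' h where "0 < \<epsilon>'" "\<epsilon>' \<le> \<epsilon>" "AV \<epsilon>' h (K \<union> K1)" "\<And>t p. p \<notin> \<Omega> \<Longrightarrow> h t p = g p"
    "\<And>t p. t \<in> {-\<epsilon>'<..<\<epsilon>'} \<Longrightarrow> p \<in> \<Omega> \<Longrightarrow> det_ratio g (h t) p powr (1 / 2) = 1 + t * \<eta> p"
    "\<And>p u v. p \<in> \<Omega> \<Longrightarrow> deriv (\<lambda>t. h t p u v) 0 =
       deriv (\<lambda>t. gt t p u v) 0 + 2 / real CARD('n) * (\<eta> p - vol_deriv gt p) * g p u v"
proof -
  define n where "n = real CARD('n)"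
  have n: "n > 0" by (simp add: n_def)
  obtain \<delta> :: real and C where "\<delta> > 0" "\<delta> < 1" and C: "\<And>t p. \<bar>t\<bar> \<le> \<delta> \<Longrightarrow> p \<in> K1 \<Longrightarrow> \<bar>\<eta> p\<bar> \<le> C"
    using smooth_ffam_bounded[OF smooth_ffam_mono[OF \<eta> subset_UNIV] zero_less_one \<Omega> K1] by metis
  have bd: "\<bar>\<eta> p\<bar> \<le> \<bar>C\<bar>" if "p \<in> \<Omega>" for p
    using C[of 0 p] \<open>\<delta> > 0\<close> off[OF that] by (cases "p \<in> K1") auto
  \<comment> \<open>Keeps \<open>1 + t * \<eta> p\<close> positive; adding 1 to the bound avoids
    division by zero and makes the estimate strict.\<close>
  define \<epsilon>' where "\<epsilon>' = min \<epsilon> (1 / (\<bar>C\<bar> + 1))"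
  have \<epsilon>': "0 < \<epsilon>'" "\<epsilon>' \<le> \<epsilon>" using AV_D(1)[OF v] by (auto simp: \<epsilon>'_def)
  let ?I = "{-\<epsilon>'<..<\<epsilon>'}"
  have I0: "0 \<in> ?I" using \<epsilon>' by auto
  have sub: "?I \<subseteq> {-\<epsilon><..<\<epsilon>}" using \<epsilon>' by auto
  have v': "AV \<epsilon>' gt K" by (rule adapted_variation_mono[OF v \<epsilon>'])
  have pos: "1 + t * \<eta> p > 0" if t: "t \<in> ?I" and p: "p \<in> \<Omega>" for t p
  proof -
    have "\<bar>t * \<eta> p\<bar> \<le> \<bar>t\<bar> * \<bar>C\<bar>" using bd[OF p] by (simp add: abs_mult mult_left_mono)
    also have "\<dots> \<le> (1 / (\<bar>C\<bar> + 1)) * \<bar>C\<bar>" using t by (intro mult_right_mono) (auto simp: \<epsilon>'_def)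
    also have "\<dots> < 1" by (simp add: field_simps)
    finally show ?thesis by (simp add: abs_less_iff)
  qed
  define w where "w t p = det_ratio g (gt t) p powr (1 / 2)" for t p
  have r: "det_ratio g (gt t) p > 0" if "t \<in> ?I" "p \<in> \<Omega>" for t p by (rule det_ratio_positive[OF v' that])
  have w: "w t p > 0" if "t \<in> ?I" "p \<in> \<Omega>" for t p using r[OF that] by (simp add: w_def)
  define q where "q t p = (1 + t * \<eta> p) / w t p" for t p
  have q: "q t p > 0" if "t \<in> ?I" "p \<in> \<Omega>" for t p using pos[OF that] w[OF that] by (simp add: q_def)
  define \<phi> where "\<phi> t p = q t p powr (2 / n)" for t p
  have \<phi>: "\<phi> t p > 0" if "t \<in> ?I" "p \<in> \<Omega>" for t p using q[OF that] by (simp add: \<phi>_def)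
  have w0: "w 0 p = 1" "q 0 p = 1" "\<phi> 0 p = 1" if "p \<in> \<Omega>" for p
    using det_ratio_initial[OF v that] by (simp_all add: w_def q_def \<phi>_def)
  \<comment> \<open>The quotient as a product with a negative power, the form whose smoothness in
    time and place is known.\<close>
  have q_alt: "q t p = (1 + t * \<eta> p) * det_ratio g (gt t) p powr (- (1 / 2))" if "t \<in> ?I" "p \<in> \<Omega>" for t p
    unfolding q_def w_def divide_inverse[of "1 + t * \<eta> p"] powr_minus[symmetric] ..
  define h where "h t p = (if p \<in> \<Omega> then (\<lambda>u v. \<phi> t p * gt t p u v) else g p)" for t p
  have h: "h t p u v = \<phi> t p * gt t p u v" if "p \<in> \<Omega>" for t p u v using that by (simp add: h_def)
  have sf: "smooth_family02 A \<Omega> ?I h"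
    unfolding smooth_family02_def
  proof (intro ballI allI)
    fix c u v' assume c: "c \<in> A"
    let ?V = "snd c ` (fst c \<inter> \<Omega>)"
    have o: "open (?I \<times> ?V)" by (intro open_Times chart_image_open_Int c \<Omega>) simp
    have s1: "smooth_on (?I \<times> ?V) (\<lambda>z. 1 + fst z * \<eta> (cinv c (snd z)))"
      using smooth_on_subset[of "UNIV \<times> ?V" "\<lambda>z. \<eta> (cinv c (snd z))" "?I \<times> ?V"] \<eta> c
      by (intro smooth_on_add smooth_on_mult o smooth_on_const smooth_on_bounded_linear[OF bounded_linear_fst])
         (auto simp: smooth_ffam_def)
    have s2: "smooth_on (?I \<times> ?V) (\<lambda>z. det_ratio g (gt (fst z)) (cinv c (snd z)) powr (- (1 / 2)))"
      using smooth_ffam_vol[OF v', of "- (1 / 2)"] c by (simp add: smooth_ffam_def)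
    have s3: "smooth_on (?I \<times> ?V) (\<lambda>z. q (fst z) (cinv c (snd z)))"
      by (rule smooth_on_cong[OF o _ smooth_on_mult[OF o s1 s2]]) (use q_alt c in auto)
    have s4: "smooth_on (?I \<times> ?V) (\<lambda>z. \<phi> (fst z) (cinv c (snd z)))"
      unfolding \<phi>_def by (rule smooth_on_powr[OF o s3]) (use q c in auto)
    have s5: "smooth_on (?I \<times> ?V) (\<lambda>z. rep02 A c (gt (fst z)) (snd z) u v')"
      using AV_D(4)[OF v'] c by (simp add: smooth_family02_def case_prod_beta')
    show "smooth_on (?I \<times> ?V) (\<lambda>(t, y). rep02 A c (h t) y u v')"
      by (rule smooth_on_cong[OF o _ smooth_on_mult[OF o s4 s5]]) (use c in \<open>auto simp: rep02_def h\<close>)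
  qed
  have gt: "bilinear (gt t p)" "gt t p u v = gt t p v u" "nondegenerate_on (gt t) p UNIV"
    if "t \<in> ?I" "p \<in> \<Omega>" for t p u v
    using AV_D(9)[OF v' that(1)] that(2) by (auto simp: metric_on_def smooth_tensor02_def)
  have bil: "bilinear (h t p)" if "t \<in> ?I" "p \<in> \<Omega>" for t p
    unfolding bilinear_def h[OF that(2), abs_def]
    using gt(1)[OF that] by (auto simp: bilinear_ladd bilinear_radd bilinear_lmul bilinear_rmul algebra_simps intro!: linearI)
  have met: "metric_on A \<Omega> (h t)" if t: "t \<in> ?I" for t
  proof (rule metric_on_family_slice[OF _ sf open_greaterThanLessThan \<Omega> t])
    fix p assume p: "p \<in> \<Omega>"
    have "nondegenerate_on (h t) p UNIV"
      using gt(3)[OF t p] \<phi>[OF t p] unfolding nondegenerate_on_def h[OF p] by auto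
    then show "bilinear (h t p) \<and> (\<forall>u v. h t p u v = h t p v u) \<and> nondegenerate_on (h t) p UNIV"
      using bil[OF t p] gt(2)[OF t p] by (simp add: h[OF p])
  qed
  have adp: "adapted_metric A \<Omega> k D (h t)" if t: "t \<in> ?I" for t
    unfolding adapted_metric_def
  proof (intro conjI met[OF t] ballI impI)
    fix p \<mu> assume p: "p \<in> \<Omega>" "\<mu> \<in> {1..k}"
    have "nondegenerate_on (gt t) p (D \<mu> p)" using AV_D(2)[OF v' t] p by (simp add: adapted_metric_def)
    then show "nondegenerate_on (h t) p (D \<mu> p)"
      using \<phi>[OF t p(1)] unfolding nondegenerate_on_def h[OF p(1)] by auto
  next
    fix p \<mu> \<nu>' u v' assume p: "p \<in> \<Omega>" "\<mu> \<in> {1..k}" "\<nu>' \<in> {1..k}" "\<mu> \<noteq> \<nu>'" "u \<in> D \<mu> p" "v' \<in> D \<nu>' p"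
    have "gt t p u v' = 0" using AV_D(2)[OF v' t] p unfolding adapted_metric_def by blast
    then show "h t p u v' = 0" by (simp add: h[OF p(1)])
  qed
  have init: "h 0 p = g p" if "p \<in> \<Omega>" for p
    by (intro ext) (simp add: h[OF that] w0[OF that] AV_D(5)[OF v that])
  have st: "h t p = g p" if "p \<in> \<Omega> - (K \<union> K1)" "t \<in> ?I" for t p
  proof -
    have p: "p \<in> \<Omega>" using that by simp
    have gtp: "gt t p = g p" by (rule metric_variation_static[OF AV_D(10)[OF v'] p _ that(2)]) (use that in auto)
    then have "w t p = 1" using det_gram_metric_nonzero[OF g, of p] by (simp add: w_def det_ratio_def)
    moreover have "\<eta> p = 0" using off p that by auto
    ultimately have "\<phi> t p = 1" by (simp add: \<phi>_def q_def)
    then show ?thesis by (intro ext) (simp add: h[OF p] gtp)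
  qed
  have zero: "((\<lambda>s. h s p u v) has_real_derivative 0) (at t)" if "p \<in> \<Omega> - (K \<union> K1)" "t \<in> ?I" for p t u v
    by (rule has_field_derivative_transform_within_open[of "\<lambda>_. g p u v" 0 t ?I]) (use st[OF that(1)] that(2) in auto)
  have AVh: "AV \<epsilon>' h (K \<union> K1)"
    unfolding adapted_variation_def metric_variation_def
    using \<epsilon>' met sf init zero adp AV_D(6,7)[OF v] K1 by (simp add: compact_Un)
  have vr: "det_ratio g (h t) p powr (1 / 2) = 1 + t * \<eta> p" if t: "t \<in> ?I" and p: "p \<in> \<Omega>" for t p
  proof -
    have "gram (h t p) = (\<chi> i. \<phi> t p *s gram (gt t p) $ i)" by (simp add: gram_def vec_eq_iff h[OF p])
    then have "det (gram (h t p)) = \<phi> t p ^ CARD('n) * det (gram (gt t p))"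
      by (simp add: det_rows_mul)
    then have "det_ratio g (h t) p = \<phi> t p ^ CARD('n) * det_ratio g (gt t) p"
      by (simp add: det_ratio_def)
    also have "\<phi> t p ^ CARD('n) = \<phi> t p powr n" using powr_realpow[OF \<phi>[OF t p]] by (simp add: n_def)
    also have "\<dots> = q t p powr 2" using n by (simp add: \<phi>_def powr_powr)
    finally have "det_ratio g (h t) p powr (1 / 2) = (q t p powr 2) powr (1 / 2) * w t p"
      using r[OF t p] by (simp add: powr_mult w_def)
    also have "\<dots> = q t p * w t p" using q[OF t p] by (simp add: powr_powr)
    also have "\<dots> = 1 + t * \<eta> p" using w[OF t p] by (simp add: q_def)
    finally show ?thesis .
  qed
  \<comment> \<open>At time 0 the factor \<open>\<phi>\<close> is 1, and the base of its power has
    derivative \<open>\<eta> p - vol_deriv gt p\<close>.\<close>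
  have dh: "deriv (\<lambda>t. h t p u v) 0 =
       deriv (\<lambda>t. gt t p u v) 0 + 2 / real CARD('n) * (\<eta> p - vol_deriv gt p) * g p u v" if p: "p \<in> \<Omega>" for p u v
  proof -
    have "((\<lambda>t. w t p) has_real_derivative vol_deriv gt p) (at 0)"
      unfolding w_def vol_deriv_def by (rule smooth_ffam_DERIV[OF smooth_ffam_vol[OF v] AV_D(8)[OF v] p])
    then have "((\<lambda>t. q t p) has_real_derivative (\<eta> p - vol_deriv gt p)) (at 0)"
      unfolding q_def by (auto intro!: derivative_eq_intros simp: w0[OF p])
    from DERIV_chain2[OF has_real_derivative_powr[of "q 0 p" "2 / n"] this]
    have "((\<lambda>t. \<phi> t p) has_real_derivative (2 / n * (\<eta> p - vol_deriv gt p))) (at 0)"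
      unfolding \<phi>_def by (simp add: w0[OF p])
    from DERIV_mult[OF this variation_DERIV[OF AV_D(4)[OF v] p AV_D(8)[OF v], of u v]]
    have "((\<lambda>t. h t p u v) has_real_derivative
       (2 / n * (\<eta> p - vol_deriv gt p) * g p u v + deriv (\<lambda>t. gt t p u v) 0)) (at 0)"
      by (simp add: h[OF p] w0[OF p] AV_D(5)[OF v p])
    from DERIV_imp_deriv[OF this] show ?thesis by (simp add: n_def)
  qed
  show thesis by (rule that[OF \<epsilon>' AVh _ vr dh]) (simp_all add: h_def)
qed

lemma integrable_ffam:
  assumes F: "smooth_ffam \<Omega> {-\<epsilon><..<\<epsilon>} F" "\<epsilon> > 0" and U: "open U" "compact (closure U)" "closure U \<subseteq> \<Omega>"
  shows "integrable \<nu> (\<lambda>p. indicator U p * F 0 p)"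
proof -
  obtain \<delta> C where C: "\<delta> > 0" "\<And>t p. \<bar>t\<bar> \<le> \<delta> \<Longrightarrow> p \<in> closure U \<Longrightarrow> \<bar>F t p\<bar> \<le> C"
    using smooth_ffam_bounded[OF F \<Omega> U(2,3)] by metis
  have b: "\<bar>F 0 p\<bar> \<le> C" if "p \<in> U" for p using C(2)[of 0 p] C(1) that closure_subset by auto
  have m: "(\<lambda>p. indicator U p * F 0 p) \<in> borel_measurable borel"
    by (rule smooth_ffam_measurable[OF F(1) \<Omega> _ U(1)]) (use F(2) U closure_subset in auto)
  show ?thesis by (rule integrable_vol_bounded[OF g refl U(1,2) m b])
qed

lemma smooth_ffam_time_deriv:
  "AV \<epsilon> gt K \<Longrightarrow> smooth_ffam \<Omega> {-\<epsilon><..<\<epsilon>} (\<lambda>t p. deriv (\<lambda>s. det_ratio g (gt s) p powr (1 / 2)) t)"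
  "AV \<epsilon> gt K \<Longrightarrow> smooth_ffam \<Omega> {-\<epsilon><..<\<epsilon>} (\<lambda>t p. deriv (\<lambda>s. dens gt s p) t)"
  using smooth_ffam_deriv[OF smooth_ffam_vol _ \<Omega>] smooth_ffam_deriv[OF smooth_ffam_dens _ \<Omega>] by simp_all

lemma smooth_vol_deriv: "AV \<epsilon> gt K \<Longrightarrow> smooth_ffam \<Omega> UNIV (\<lambda>_. vol_deriv gt)"
  using smooth_ffam_static[OF smooth_ffam_time_deriv(1) _ AV_D(8) \<Omega>] unfolding vol_deriv_def [abs_def] by simp

lemma integrable_time_deriv:
  assumes "AV \<epsilon> gt K" "open U" "compact (closure U)" "closure U \<subseteq> \<Omega>"
  shows "integrable \<nu> (\<lambda>p. indicator U p * vol_deriv gt p)" "integrable \<nu> (\<lambda>p. indicator U p * dens_deriv gt p)"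
  using integrable_ffam[OF smooth_ffam_time_deriv(1)[OF assms(1)] AV_D(1)[OF assms(1)] assms(2-4)]
    integrable_ffam[OF smooth_ffam_time_deriv(2)[OF assms(1)] AV_D(1)[OF assms(1)] assms(2-4)]
  unfolding vol_deriv_def dens_deriv_def by simp_all

lemma integral_support:
  assumes "AV \<epsilon> gt K" "K \<subseteq> U" "U \<subseteq> U'" "U' \<subseteq> \<Omega>"
  shows "(LINT p|\<nu>. indicator U' p * vol_deriv gt p) = (LINT p|\<nu>. indicator U p * vol_deriv gt p)"
    "(LINT p|\<nu>. indicator U' p * dens_deriv gt p) = (LINT p|\<nu>. indicator U p * dens_deriv gt p)"
proof -
  have eq: "indicator U' p * vol_deriv gt p = indicator U p * vol_deriv gt p"
    "indicator U' p * dens_deriv gt p = indicator U p * dens_deriv gt p" for p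
    using static_off_support[OF assms(1), of p] assms(2-4) by (auto simp: indicator_def)
  show "(LINT p|\<nu>. indicator U' p * vol_deriv gt p) = (LINT p|\<nu>. indicator U p * vol_deriv gt p)"
    "(LINT p|\<nu>. indicator U' p * dens_deriv gt p) = (LINT p|\<nu>. indicator U p * dens_deriv gt p)"
    by (rule Bochner_Integration.integral_cong[OF refl], rule eq)+
qed

text \<open>After normalisation the volume of \<open>U\<close> is affine in \<open>t\<close> with
  slope the integral of \<open>\<eta>\<close>, so mean zero gives exact preservation at all times,
  as criticality demands.\<close>

lemma balanced_variation:
  assumes cp: "critical_pair A g T" and v: "AV \<epsilon> gt K" and \<eta>: "smooth_ffam \<Omega> UNIV (\<lambda>_. \<eta>)"
    and K1: "compact K1" "K1 \<subseteq> U" and off: "\<And>p. p \<in> \<Omega> \<Longrightarrow> p \<notin> K1 \<Longrightarrow> \<eta> p = 0"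
    and U: "open U" "compact (closure U)" "closure U \<subseteq> \<Omega>" "K \<subseteq> U"
    and bal: "(LINT p|\<nu>. indicator U p * \<eta> p) = 0"
  obtains \<epsilon>' h where "0 < \<epsilon>'" "\<epsilon>' \<le> \<epsilon>" "AV \<epsilon>' h (K \<union> K1)" "(LINT p|\<nu>. indicator U p * dens_deriv h p) = 0"
    "\<And>p u v. p \<in> \<Omega> \<Longrightarrow> deriv (\<lambda>t. h t p u v) 0 =
       deriv (\<lambda>t. gt t p u v) 0 + 2 / real CARD('n) * (\<eta> p - vol_deriv gt p) * g p u v"
proof -
  have U\<Omega>: "U \<subseteq> \<Omega>" using U closure_subset by blast
  obtain \<epsilon>' h where h: "0 < \<epsilon>'" "\<epsilon>' \<le> \<epsilon>" "AV \<epsilon>' h (K \<union> K1)" "\<And>t p. p \<notin> \<Omega> \<Longrightarrow> h t p = g p"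
    "\<And>t p. t \<in> {-\<epsilon>'<..<\<epsilon>'} \<Longrightarrow> p \<in> \<Omega> \<Longrightarrow> det_ratio g (h t) p powr (1 / 2) = 1 + t * \<eta> p"
    "\<And>p u v. p \<in> \<Omega> \<Longrightarrow> deriv (\<lambda>t. h t p u v) 0 =
       deriv (\<lambda>t. gt t p u v) 0 + 2 / real CARD('n) * (\<eta> p - vol_deriv gt p) * g p u v"
    using volume_normalization[OF v \<eta> K1(1) order_trans[OF K1(2) U\<Omega>] off] by blast
  have i1: "integrable \<nu> (\<lambda>p. indicator U p * \<eta> p)"
    by (rule integrable_ffam[OF smooth_ffam_mono[OF \<eta>], of 1]) (use U in auto)
  have i2: "integrable \<nu> (\<lambda>p. indicator U p * (1 :: real))"
    by (rule integrable_vol_bounded[OF g refl U(1,2), of _ 1]) (use U(1) in auto)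
  have "(LINT p|\<nu>. indicator U p * det_ratio g (h t) p powr (1 / 2)) = (LINT p|\<nu>. indicator U p)" if t: "t \<in> {-\<epsilon>'<..<\<epsilon>'}" for t
  proof -
    have "(LINT p|\<nu>. indicator U p * det_ratio g (h t) p powr (1 / 2)) = (LINT p|\<nu>. indicator U p * 1 + t * (indicator U p * \<eta> p))"
    proof (rule Bochner_Integration.integral_cong[OF refl])
      fix p show "indicator U p * det_ratio g (h t) p powr (1 / 2) = indicator U p * 1 + t * (indicator U p * \<eta> p)"
        using h(5)[OF t, of p] U\<Omega> by (auto simp: indicator_def)
    qed
    also have "\<dots> = (LINT p|\<nu>. indicator U p * 1) + t * (LINT p|\<nu>. indicator U p * \<eta> p)"
      using i1 i2 by simp
    finally show ?thesis using bal by simp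
  qed
  then have "(LINT p|\<nu>. indicator U p * dens_deriv h p) = 0"
    using critical_volume_preserving[OF U(1-3) cp h(3) _ h(4)] U(4) K1(2) by auto
  then show thesis using that h by blast
qed

lemma constant_variation: "AV 1 (\<lambda>_. g) {}"
proof -
  have "smooth_family02 A \<Omega> {-1<..<1} (\<lambda>_. g)"
    unfolding smooth_family02_def
  proof (intro ballI allI)
    fix c u v assume c: "c \<in> A"
    from smooth_on_snd[OF _ chart_image_open_Int[OF c \<Omega>], of "{-1<..<1}" "\<lambda>y. rep02 A c g y u v"] g_\<Omega> c
    show "smooth_on ({-1<..<1 :: real} \<times> snd c ` (fst c \<inter> \<Omega>)) (\<lambda>(t, y). rep02 A c g y u v)"
      by (simp add: metric_on_def smooth_tensor02_on case_prod_beta')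
  qed
  then show ?thesis using ad g_\<Omega> by (simp add: adapted_variation_def metric_variation_def)
qed

text \<open>One constant has to serve all variations and all domains. It is read off from a single
  variation whose volume changes to first order; if there is none, normalisation alters no velocity
  and the constant 0 works.\<close>

lemma lagrange_multiplier:
  assumes cp: "critical_pair A g T"
  shows "\<exists>\<Lambda>. \<forall>\<epsilon> gt K U. AV \<epsilon> gt K \<longrightarrow> integration_domain \<Omega> K U \<longrightarrow>
    (LINT p|\<nu>. indicator U p * dens_deriv gt p) = \<Lambda> * (LINT p|\<nu>. indicator U p * vol_deriv gt p)"
proof (cases "\<exists>\<epsilon> gt K U. AV \<epsilon> gt K \<and> integration_domain \<Omega> K U \<and> (LINT p|\<nu>. indicator U p * vol_deriv gt p) \<noteq> 0")
  case False
  have "(LINT p|\<nu>. indicator U p * dens_deriv gt p) = 0" if v: "AV \<epsilon> gt K" and dom: "integration_domain \<Omega> K U" for \<epsilon> gt K U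
  proof -
    have bal: "(LINT p|\<nu>. indicator U p * vol_deriv gt p) = 0" using False v dom by blast
    have U: "open U" "compact (closure U)" "closure U \<subseteq> \<Omega>" "K \<subseteq> U" using dom by (auto simp: integration_domain_def)
    obtain \<epsilon>' h where h: "0 < \<epsilon>'" "\<epsilon>' \<le> \<epsilon>" "AV \<epsilon>' h (K \<union> K)" "(LINT p|\<nu>. indicator U p * dens_deriv h p) = 0"
      "\<And>p u v. p \<in> \<Omega> \<Longrightarrow> deriv (\<lambda>t. h t p u v) 0 =
       deriv (\<lambda>t. gt t p u v) 0 + 2 / real CARD('n) * (vol_deriv gt p - vol_deriv gt p) * g p u v"
      using balanced_variation[OF cp v smooth_vol_deriv[OF v] AV_D(6)[OF v] U(4) static_off_support(2)[OF v] U bal] by blast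
    have v': "AV \<epsilon>' gt K" by (rule adapted_variation_mono[OF v h(1,2)])
    \<comment> \<open>With \<open>\<eta>\<close> equal to the volume derivative the conformal
      correction vanishes, so \<open>h\<close> and \<open>gt\<close> have equal velocities.\<close>
    have "dens_deriv h p = 1 * dens_deriv gt p + 0 * dens_deriv gt p" if "p \<in> \<Omega>" for p
      by (rule dens_deriv_linear[OF v' v' h(3) \<Omega> order_refl that]) (simp add: h(5))
    then have "indicator U p * dens_deriv h p = indicator U p * dens_deriv gt p" for p
      using U(3) closure_subset by (auto simp: indicator_def)
    then have "(LINT p|\<nu>. indicator U p * dens_deriv h p) = (LINT p|\<nu>. indicator U p * dens_deriv gt p)"
      by (rule Bochner_Integration.integral_cong[OF refl])
    then show ?thesis using h(4) by simp
  qed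
  then show ?thesis by (intro exI[of _ 0]) simp
next
  case True
  then obtain \<epsilon>0 g0 K0 U0 where v0: "AV \<epsilon>0 g0 K0" and dom0: "integration_domain \<Omega> K0 U0"
    and c0: "(LINT p|\<nu>. indicator U0 p * vol_deriv g0 p) \<noteq> 0" by blast
  define c0' where "c0' = (LINT p|\<nu>. indicator U0 p * vol_deriv g0 p)"
  have U0: "open U0" "compact (closure U0)" "closure U0 \<subseteq> \<Omega>" "K0 \<subseteq> U0" using dom0 by (auto simp: integration_domain_def)
  \<comment> \<open>The correction of a general variation is a multiple of the conformal velocity
    formed from the volume derivative of \<open>g0\<close>. The variation \<open>q\<close> has this
    velocity, which \<open>g0\<close> itself need not have.\<close>
  obtain \<epsilon>q q where q: "0 < \<epsilon>q" "\<epsilon>q \<le> 1" "AV \<epsilon>q q ({} \<union> K0)"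
    "\<And>p u v. p \<in> \<Omega> \<Longrightarrow> deriv (\<lambda>t. q t p u v) 0 =
       deriv (\<lambda>t. g p u v) 0 + 2 / real CARD('n) * (vol_deriv g0 p - vol_deriv (\<lambda>_. g) p) * g p u v"
  proof (rule volume_normalization[OF constant_variation smooth_vol_deriv[OF v0] AV_D(6,7)[OF v0] static_off_support(2)[OF v0]])
    fix \<epsilon>' h assume "0 < \<epsilon>'" "\<epsilon>' \<le> 1" "AV \<epsilon>' h ({} \<union> K0)"
      and "\<And>p u v. p \<in> \<Omega> \<Longrightarrow> deriv (\<lambda>t. h t p u v) 0 =
       deriv (\<lambda>t. g p u v) 0 + 2 / real CARD('n) * (vol_deriv g0 p - vol_deriv (\<lambda>_. g) p) * g p u v"
    then show thesis by (rule that)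
  qed
  have dq: "deriv (\<lambda>t. q t p u v) 0 = 2 / real CARD('n) * vol_deriv g0 p * g p u v" if "p \<in> \<Omega>" for p u v
    using q(4)[OF that] static_off_support(2)[OF constant_variation that] by simp
  have vq: "AV \<epsilon>q q K0" using q(3) by simp
  \<comment> \<open>\<open>Q / c0'\<close> is the multiplier: the derivative of the action along
    \<open>q\<close> over that of the volume, which \<open>q\<close> shares with
    \<open>g0\<close>.\<close>
  define Q where "Q = (LINT p|\<nu>. indicator U0 p * dens_deriv q p)"
  have "(LINT p|\<nu>. indicator U p * dens_deriv gt p) = (Q / c0') * (LINT p|\<nu>. indicator U p * vol_deriv gt p)"
    if v: "AV \<epsilon> gt K" and dom: "integration_domain \<Omega> K U" for \<epsilon> gt K U
  proof -
    have U: "open U" "compact (closure U)" "closure U \<subseteq> \<Omega>" "K \<subseteq> U" using dom by (auto simp: integration_domain_def)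
    define c where "c = (LINT p|\<nu>. indicator U p * vol_deriv gt p)"
    define \<kappa> where "\<kappa> = c / c0'"
    \<comment> \<open>Both supports must lie in one domain; enlarging a domain beyond the support
      changes none of the integrals.\<close>
    define U' where "U' = U \<union> U0"
    have U': "open U'" "compact (closure U')" "closure U' \<subseteq> \<Omega>" "K \<subseteq> U'" "K0 \<subseteq> U'" "U' \<subseteq> \<Omega>" "K \<union> K0 \<subseteq> U'"
      using U U0 closure_subset[of U] closure_subset[of U0] by (auto simp: U'_def closure_Un compact_Un)
    define \<eta> where "\<eta> p = vol_deriv gt p + (- \<kappa>) * vol_deriv g0 p" for p
    have \<eta>: "smooth_ffam \<Omega> UNIV (\<lambda>_. \<eta>)"
      unfolding \<eta>_def [abs_def] by (rule smooth_ffam_affine[OF smooth_vol_deriv[OF v] smooth_vol_deriv[OF v0] open_UNIV \<Omega>])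
    have bal: "(LINT p|\<nu>. indicator U' p * \<eta> p) = 0"
    proof -
      have "(LINT p|\<nu>. indicator U' p * \<eta> p) =
         (LINT p|\<nu>. indicator U' p * vol_deriv gt p + (- \<kappa>) * (indicator U' p * vol_deriv g0 p))"
        by (rule Bochner_Integration.integral_cong) (auto simp: \<eta>_def algebra_simps)
      also have "\<dots> = (LINT p|\<nu>. indicator U' p * vol_deriv gt p) + (- \<kappa>) * (LINT p|\<nu>. indicator U' p * vol_deriv g0 p)"
        using integrable_time_deriv(1)[OF v U'(1-3)] integrable_time_deriv(1)[OF v0 U'(1-3)] by simp
      also have "\<dots> = c + (- \<kappa>) * c0'"
        using integral_support(1)[OF v U(4), of U'] integral_support(1)[OF v0 U0(4), of U'] U'(6)
        by (simp add: U'_def c_def c0'_def)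
      also have "\<dots> = 0" using c0 by (simp add: \<kappa>_def c0'_def)
      finally show ?thesis .
    qed
    have off: "\<eta> p = 0" if "p \<in> \<Omega>" "p \<notin> K \<union> K0" for p
      using static_off_support(2)[OF v that(1)] static_off_support(2)[OF v0 that(1)] that(2) by (simp add: \<eta>_def)
    obtain \<epsilon>' h where h: "0 < \<epsilon>'" "\<epsilon>' \<le> \<epsilon>" "AV \<epsilon>' h (K \<union> (K \<union> K0))" "(LINT p|\<nu>. indicator U' p * dens_deriv h p) = 0"
      "\<And>p u v. p \<in> \<Omega> \<Longrightarrow> deriv (\<lambda>t. h t p u v) 0 =
       deriv (\<lambda>t. gt t p u v) 0 + 2 / real CARD('n) * (\<eta> p - vol_deriv gt p) * g p u v"
      using balanced_variation[OF cp v \<eta> compact_Un[OF AV_D(6)[OF v] AV_D(6)[OF v0]] U'(7) off U'(1-4) bal] by blast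
    \<comment> \<open>The linear comparison takes three variations on a common time
      interval.\<close>
    define \<delta> where "\<delta> = min \<epsilon>' \<epsilon>q"
    have \<delta>: "0 < \<delta>" "\<delta> \<le> \<epsilon>" "\<delta> \<le> \<epsilon>'" "\<delta> \<le> \<epsilon>q" using h q by (auto simp: \<delta>_def)
    have lin: "dens_deriv h p = 1 * dens_deriv gt p + (- \<kappa>) * dens_deriv q p" if "p \<in> \<Omega>" for p
      by (rule dens_deriv_linear[OF adapted_variation_mono[OF v \<delta>(1,2)] adapted_variation_mono[OF vq \<delta>(1,4)]
            adapted_variation_mono[OF h(3) \<delta>(1,3)] \<Omega> order_refl that])
         (simp add: h(5) dq \<eta>_def)
    have "(LINT p|\<nu>. indicator U' p * dens_deriv h p) =
         (LINT p|\<nu>. indicator U' p * dens_deriv gt p + (- \<kappa>) * (indicator U' p * dens_deriv q p))"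
      by (rule Bochner_Integration.integral_cong) (use U'(6) in \<open>auto simp: lin indicator_def\<close>)
    also have "\<dots> = (LINT p|\<nu>. indicator U' p * dens_deriv gt p) + (- \<kappa>) * (LINT p|\<nu>. indicator U' p * dens_deriv q p)"
      using integrable_time_deriv(2)[OF v U'(1-3)] integrable_time_deriv(2)[OF vq U'(1-3)] by simp
    also have "\<dots> = (LINT p|\<nu>. indicator U p * dens_deriv gt p) + (- \<kappa>) * Q"
      using integral_support(2)[OF v U(4), of U'] integral_support(2)[OF vq U0(4), of U'] U'(6)
      by (simp add: U'_def Q_def)
    finally show ?thesis using h(4) by (simp add: \<kappa>_def c_def)
  qed
  then show ?thesis by blast
qed

end


section \<open>The Euler--Lagrange equations\<close>

context line_splitting
begin

text \<open>Jacobi's formula for the derivative of a determinant. Since the metrics stay adapted,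
  the Gram matrix in the frame along the lines is diagonal at all times, and the ratio of
  determinants is a product of scalars. The factor 2 undoes the square root.\<close>

lemma vol_deriv_trace:
  assumes v: "AV \<epsilon> gt K" and p: "p \<in> \<Omega>"
  shows "inner02 g p (\<lambda>u v. l * g p u v) (\<lambda>u v. deriv (\<lambda>t. gt t p u v) 0) = 2 * l * vol_deriv gt p"
proof -
  define B where "B u v = deriv (\<lambda>t. gt t p u v) 0" for u v
  let ?I = "{-\<epsilon><..<\<epsilon>}"
  have gb: "bilinear (g p)" "g p u v = g p v u" for u v using g by (auto simp: metric_on_def smooth_tensor02_def)
  have gtb: "bilinear (gt t p)" if "t \<in> ?I" for t
    using AV_D(9)[OF v that] p by (simp add: metric_on_def smooth_tensor02_def)
  have det: "det (gram (g p)) \<noteq> 0" by (rule det_gram_metric_nonzero[OF g]) simp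
  have Bb: "bilinear B"
    unfolding B_def by (rule variation_deriv_bilinear[OF AV_D(4)[OF v] p AV_D(8)[OF v] open_greaterThanLessThan gtb])
  obtain e where e: "\<And>\<mu>. \<mu> \<in> {1..k} \<Longrightarrow> e \<mu> \<in> D \<mu> p" "inj_on e {1..k}" "orthonormal_frame (g p) (e ` {1..k})"
    using frame_at[OF ad p] by metis
  let ?F = "e ` {1..k}" and ?O = "onb g p UNIV"
  have O: "orthonormal_frame (g p) ?O" by (rule orthonormal_frame_onb[where g = g, OF e(3)])
  have "inner02 g p (\<lambda>u v. l * g p u v) B = (\<Sum>a\<in>?O. \<Sum>b\<in>?O. if b = a then l * (g p a a * B a a) else 0)"
    unfolding inner02_def
  proof (intro sum.cong refl)
    fix a b assume ab: "a \<in> ?O" "b \<in> ?O"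
    show "g p a a * g p b b * (l * g p a b * B a b) = (if b = a then l * (g p a a * B a a) else 0)"
    proof (cases "b = a")
      case True
      then show ?thesis using orthonormal_frame_sign[OF O ab(1)] by simp
    next
      case False
      then have "g p a b = 0" using O ab by (auto simp: orthonormal_frame_def)
      then show ?thesis using False by simp
    qed
  qed
  also have "\<dots> = l * (\<Sum>a\<in>?O. g p a a * B a a)"
    using O by (simp add: orthonormal_frame_def sum_distrib_left)
  \<comment> \<open>The frame chosen by \<open>onb\<close> gives way to the one along the lines; the
    trace is the same for both.\<close>
  also have "(\<Sum>a\<in>?O. g p a a * B a a) = (\<Sum>a\<in>?F. g p a a * B a a)"
    using frame_trace[OF gb(1) det O gb(2) Bb] frame_trace[OF gb(1) det e(3) gb(2) Bb] by simp
  finally have inner: "inner02 g p (\<lambda>u v. l * g p u v) B = l * (\<Sum>a\<in>?F. g p a a * B a a)" .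
  have orth: "gt t p x y = 0" if "t \<in> ?I" "x \<in> ?F" "y \<in> ?F" "x \<noteq> y" for t x y
  proof -
    obtain \<mu> \<mu>' where "\<mu> \<in> {1..k}" "\<mu>' \<in> {1..k}" "x = e \<mu>" "y = e \<mu>'" "\<mu> \<noteq> \<mu>'" using \<open>x \<in> ?F\<close> \<open>y \<in> ?F\<close> \<open>x \<noteq> y\<close> by blast
    then show ?thesis using AV_D(2)[OF v that(1)] p e(1) unfolding adapted_metric_def by blast
  qed
  have ratio: "det_ratio g (gt t) p = (\<Prod>x\<in>?F. g p x x * gt t p x x)" if "t \<in> ?I" for t
    using det_gram_diagonal[OF gb(1) det e(3) gb(2) gtb[OF that] orth[OF that]] det by (simp add: det_ratio_def)
  have one: "g p x x * gt 0 p x x = 1" if "x \<in> ?F" for x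
    using orthonormal_frame_sign[OF e(3) that] AV_D(5)[OF v p] by simp
  have d1: "((\<lambda>t. g p x x * gt t p x x) has_derivative (\<lambda>s. s * (g p x x * B x x))) (at 0)" for x
    using DERIV_cmult[OF variation_DERIV[OF AV_D(4)[OF v] p AV_D(8)[OF v], of x x], of "g p x x"]
    by (simp add: has_field_derivative_def B_def mult_commute_abs)
  have "((\<lambda>t. \<Prod>x\<in>?F. g p x x * gt t p x x) has_derivative
      (\<lambda>s. \<Sum>x\<in>?F. s * (g p x x * B x x) * (\<Prod>y\<in>?F - {x}. g p y y * gt 0 p y y))) (at 0)"
    by (rule has_derivative_prod[OF d1])
  \<comment> \<open>At time 0 each remaining factor is the square of a sign, hence 1.\<close>
  moreover have "(\<lambda>s. \<Sum>x\<in>?F. s * (g p x x * B x x) * (\<Prod>y\<in>?F - {x}. g p y y * gt 0 p y y)) =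
      (*) (\<Sum>x\<in>?F. g p x x * B x x)"
  proof
    fix s
    have "(\<Sum>x\<in>?F. s * (g p x x * B x x) * (\<Prod>y\<in>?F - {x}. g p y y * gt 0 p y y)) = (\<Sum>x\<in>?F. s * (g p x x * B x x))"
    proof (rule sum.cong[OF refl])
      fix x assume "x \<in> ?F"
      have "(\<Prod>y\<in>?F - {x}. g p y y * gt 0 p y y) = 1" by (rule prod.neutral) (use one in blast)
      then show "s * (g p x x * B x x) * (\<Prod>y\<in>?F - {x}. g p y y * gt 0 p y y) = s * (g p x x * B x x)" by simp
    qed
    then show "(\<Sum>x\<in>?F. s * (g p x x * B x x) * (\<Prod>y\<in>?F - {x}. g p y y * gt 0 p y y)) = (\<Sum>x\<in>?F. g p x x * B x x) * s"
      by (simp only: sum_distrib_left[symmetric] mult.commute)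
  qed
  ultimately have "((\<lambda>t. \<Prod>x\<in>?F. g p x x * gt t p x x) has_real_derivative (\<Sum>x\<in>?F. g p x x * B x x)) (at 0)"
    by (simp add: has_field_derivative_def)
  then have "((\<lambda>t. det_ratio g (gt t) p) has_real_derivative (\<Sum>x\<in>?F. g p x x * B x x)) (at 0)"
    by (rule has_field_derivative_transform_within_open[of _ _ _ ?I]) (use AV_D(8)[OF v] ratio in auto)
  from DERIV_chain2[OF has_real_derivative_powr[of "det_ratio g (gt 0) p" "1 / 2"] this]
  have "((\<lambda>t. det_ratio g (gt t) p powr (1 / 2)) has_real_derivative (1 / 2 * (\<Sum>x\<in>?F. g p x x * B x x))) (at 0)"
    using det_ratio_initial[OF v p] by simp
  then have "vol_deriv gt p = 1 / 2 * (\<Sum>x\<in>?F. g p x x * B x x)"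
    unfolding vol_deriv_def by (rule DERIV_imp_deriv)
  then show ?thesis using inner unfolding B_def by simp
qed

lemma metric_gradient_exists:
  assumes cp: "critical_pair A g T"
  shows "\<exists>l. metric_gradient A k D \<Omega> g T (\<lambda>p u v. l * g p u v)"
proof -
  obtain \<Lambda> where \<Lambda>: "\<And>\<epsilon> gt K U. AV \<epsilon> gt K \<Longrightarrow> integration_domain \<Omega> K U \<Longrightarrow>
    (LINT p|\<nu>. indicator U p * dens_deriv gt p) = \<Lambda> * (LINT p|\<nu>. indicator U p * vol_deriv gt p)"
    using lagrange_multiplier[OF cp] by blast
  \<comment> \<open>One factor 1/2 comes from the mixed action being half of the total one, the
    other from the volume derivative being half the trace.\<close>
  define l where "l = \<Lambda> / 4"
  let ?P = "\<lambda>p u v. l * g p u v"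
  have gb: "bilinear (g p)" "g p u v = g p v u" for p u v using g by (auto simp: metric_on_def smooth_tensor02_def)
  have "metric_gradient A k D \<Omega> g T ?P"
    unfolding metric_gradient_def
  proof (intro conjI allI impI ballI)
    show "smooth_tensor02 A \<Omega> ?P"
      unfolding smooth_tensor02_def
    proof (intro conjI ballI allI)
      show "bilinear (?P p)" for p
        unfolding bilinear_def using gb(1)[of p]
        by (auto simp: bilinear_ladd bilinear_radd bilinear_lmul bilinear_rmul algebra_simps intro!: linearI)
      fix c u v assume c: "c \<in> A"
      have "smooth_on (snd c ` (fst c \<inter> \<Omega>)) (\<lambda>y. l * rep02 A c g y u v)"
        using g_\<Omega> c by (intro smooth_on_mult smooth_on_const chart_image_open_Int \<Omega>) (auto simp: metric_on_def smooth_tensor02_on)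
      then show "smooth_on (snd c ` (fst c \<inter> \<Omega>)) (\<lambda>y. rep02 A c ?P y u v)" by (simp add: rep02_def)
    qed
    show "?P p u v = ?P p v u" for p u v using gb(2) by simp
    show "?P p u v = 0" if "p \<in> \<Omega>" "\<mu> \<in> {1..k}" "\<mu>' \<in> {1..k}" "\<mu> \<noteq> \<mu>'" "u \<in> D \<mu> p" "v \<in> D \<mu>' p" for p \<mu> \<mu>' u v
      using ad that by (auto simp: adapted_metric_def)
    fix \<epsilon> gt K U assume v: "AV \<epsilon> gt K" and dom: "integration_domain \<Omega> K U"
    have U: "open U" "compact (closure U)" "closure U \<subseteq> \<Omega>" "U \<subseteq> \<Omega>"
      using dom closure_subset[of U] by (auto simp: integration_domain_def)
    let ?B = "\<lambda>p u v. deriv (\<lambda>t. gt t p u v) 0"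
    have eq: "indicator U p * inner02 g p (?P p) (?B p) = 2 * l * (indicator U p * vol_deriv gt p)" for p
      using vol_deriv_trace[OF v, of p l] U(4) by (auto simp: indicator_def)
    have m: "(\<lambda>p. indicator U p * inner02 g p (?P p) (?B p)) \<in> borel_measurable borel"
      unfolding eq using smooth_ffam_measurable[OF smooth_vol_deriv[OF v] \<Omega> UNIV_I U(1,4)] by measurable
    have "(LINT p|vol_measure A U g. inner02 g p (?P p) (?B p)) = (LINT p|\<nu>. 2 * l * (indicator U p * vol_deriv gt p))"
      unfolding integral_vol_restrict[OF g refl U(1) m] eq ..
    also have "\<dots> = (LINT p|\<nu>. indicator U p * dens_deriv gt p) / 2"
      using \<Lambda>[OF v dom] by (simp add: l_def)
    finally have E: "(LINT p|vol_measure A U g. inner02 g p (?P p) (?B p)) = (LINT p|\<nu>. indicator U p * dens_deriv gt p) / 2" .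
    show "((\<lambda>t. mixed_action A k D U (gt t) T) has_real_derivative
        (LINT p|vol_measure A U g. inner02 g p (?P p) (?B p))) (at 0)"
      unfolding E by (rule mixed_action_deriv[OF U(1-3) v])
  qed
  then show ?thesis by blast
qed

text \<open>Curvature involves derivatives of the contorsion, so agreement on the open set \<Omega>
  is used, not only at \<open>p\<close>. It allows values off \<Omega> to be replaced.\<close>

lemma scalar_curv_local:
  assumes T': "smooth_tensor12 A \<Omega> T1" "smooth_tensor12 A \<Omega> T2" and eq: "\<And>p. p \<in> \<Omega> \<Longrightarrow> T1 p = T2 p" and p: "p \<in> \<Omega>"
  shows "scalar_curv A g T1 p = scalar_curv A g T2 p"
proof -
  let ?c = "chart_at A p" let ?y = "snd ?c p"
  let ?V = "snd ?c ` (fst ?c \<inter> \<Omega>)"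
  have V: "open ?V" "?y \<in> ?V" using p by (auto intro!: chart_image_open_Int \<Omega>)
  obtain e where e: "orthonormal_frame (g p) (e ` {1..k})" using frame_at[OF ad p] by metis
  have cc: "conn_coeff A g T1 ?c y = conn_coeff A g T2 ?c y" if "y \<in> ?V" for y
    using that eq by (auto simp: conn_coeff_def[abs_def] rep12_def fun_eq_iff)
  have "pderiv_field (conn_coeff A g T1 ?c) ?y w u v = pderiv_field (conn_coeff A g T2 ?c) ?y w u v" for u v w
  proof -
    have "frechet_derivative (\<lambda>y. conn_coeff A g T1 ?c y u v) (at ?y) = frechet_derivative (\<lambda>y. conn_coeff A g T2 ?c y u v) (at ?y)"
      by (rule frechet_derivative_transform_within_open[OF smooth_on_differentiable[OF smooth_on_conn_coeff[OF g_\<Omega> T'(1) \<Omega>]] V])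
         (use V cc in auto)
    then show ?thesis by (simp add: pderiv_field_def)
  qed
  then have "coord_curv (conn_coeff A g T1 ?c) ?y u v w = coord_curv (conn_coeff A g T2 ?c) ?y u v w" for u v w
    using cc[OF V(2)] by (simp add: coord_curv_def)
  then show ?thesis
    using scalar_curv_chart[OF g_\<Omega> T'(1) \<Omega> p chart_at_in e] scalar_curv_chart[OF g_\<Omega> T'(2) \<Omega> p chart_at_in e]
    by (simp add: coord_scal_def)
qed

text \<open>No volume constraint is attached to variations of the contorsion, so criticality gives
  derivative 0 at once and the zero tensor represents it.\<close>

lemma contorsion_gradient_zero:
  assumes cp: "critical_pair A g T"
  shows "contorsion_gradient A k D \<Omega> g T (\<lambda>p u v. 0)"
  unfolding contorsion_gradient_def
proof (intro conjI allI impI)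
  show "smooth_tensor12 A \<Omega> (\<lambda>p u v. 0)"
    unfolding smooth_tensor12_def
  proof (intro conjI ballI allI)
    show "bilinear (\<lambda>u v. 0 :: real ^ 'n)" for p :: 'm by (simp add: bilinear_def linear_zero)
    fix c u v assume c: "c \<in> A"
    show "smooth_on (snd c ` (fst c \<inter> \<Omega>)) (\<lambda>y. rep12 A c (\<lambda>p u v. 0) y u v)"
      by (rule smooth_on_cong[OF chart_image_open_Int[OF c \<Omega>] _ smooth_on_const[of _ 0]])
         (use c linear_0[OF linear_comps[OF c]] in \<open>auto simp: rep12_def\<close>)
  qed
  fix \<epsilon> Tt K U assume v: "contorsion_variation A \<Omega> T \<epsilon> Tt K" and dom: "integration_domain \<Omega> K U"
  have U: "open U" "U \<subseteq> \<Omega>" using dom closure_subset[of U] by (auto simp: integration_domain_def)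
  let ?I = "{-\<epsilon><..<\<epsilon>}"
  have \<epsilon>: "0 \<in> ?I" using v by (simp add: contorsion_variation_def)
  \<comment> \<open>Off \<Omega> the values of \<open>Tt\<close> are unrestricted; those of
    \<open>T\<close> take their place, to obtain a variation on the whole manifold.\<close>
  define S where "S t p = (if p \<in> \<Omega> then Tt t p else T p)" for t p
  have S\<Omega>: "S t p = Tt t p" if "p \<in> \<Omega>" for t p using that by (simp add: S_def)
  have repS: "rep12 A c (S t) y u w = rep12 A c (Tt t) y u w" if "c \<in> A" "y \<in> snd c ` (fst c \<inter> \<Omega>)" for c t y u w
    using that S\<Omega> by (auto simp: rep12_def)
  have smT: "smooth_tensor12 A \<Omega> (Tt t)" if "t \<in> ?I" for t using v that by (simp add: contorsion_variation_def)
  have smS: "smooth_tensor12 A \<Omega> (S t)" if "t \<in> ?I" for t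
    unfolding smooth_tensor12_def
  proof (intro conjI ballI allI)
    show "bilinear (S t p)" if "p \<in> \<Omega>" for p
      using smT[OF \<open>t \<in> ?I\<close>] that by (simp add: S\<Omega> smooth_tensor12_def)
    fix c u w assume c: "c \<in> A"
    show "smooth_on (snd c ` (fst c \<inter> \<Omega>)) (\<lambda>y. rep12 A c (S t) y u w)"
      by (rule smooth_on_cong[OF chart_image_open_Int[OF c \<Omega>] _ smooth_tensor12_on[OF smT[OF \<open>t \<in> ?I\<close>] c]])
         (simp add: repS[OF c])
  qed
  have famS: "smooth_family12 A \<Omega> ?I S"
    unfolding smooth_family12_def
  proof (intro ballI allI)
    fix c u w assume c: "c \<in> A"
    have o: "open (?I \<times> snd c ` (fst c \<inter> \<Omega>))" by (intro open_Times chart_image_open_Int[OF c \<Omega>]) simp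
    have "smooth_on (?I \<times> snd c ` (fst c \<inter> \<Omega>)) (\<lambda>(t, y). rep12 A c (Tt t) y u w)"
      using v c by (simp add: contorsion_variation_def smooth_family12_def)
    then show "smooth_on (?I \<times> snd c ` (fst c \<inter> \<Omega>)) (\<lambda>(t, y). rep12 A c (S t) y u w)"
      by (rule smooth_on_cong[OF o, rotated]) (use repS[OF c] in auto)
  qed
  have "contorsion_variation A \<Omega> T \<epsilon> S K"
    using v smS famS unfolding contorsion_variation_def by (simp add: S\<Omega>)
  then have "contorsion_variation A UNIV T \<epsilon> S K"
    by (rule contorsion_variation_extend[OF _ \<Omega> T]) (simp add: S_def)
  moreover have "integration_domain UNIV K U" using dom by (auto simp: integration_domain_def)
  ultimately have crit: "((\<lambda>t. total_action A U g (S t)) has_real_derivative 0) (at 0)"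
    using cp unfolding critical_pair_def by blast
  \<comment> \<open>The two integrands are compared only at points of \<Omega>.\<close>
  have space: "space (vol_measure A U g) = U"
  proof -
    have e: "vol_measure A U g = restrict_space (density \<nu> (\<lambda>p. ennreal (indicator U p * 1))) U"
      by (rule vol_measure_density[OF g refl U(1)]) (use U(1) in auto)
    show ?thesis unfolding e by (simp add: space_restrict_space space_vol[OF g refl])
  qed
  have act: "total_action A U g (S t) / 2 = mixed_action A k D U g (Tt t)" if t: "t \<in> ?I" for t
  proof -
    have "mixed_action A k D U g (Tt t) = (LINT p|vol_measure A U g. scalar_curv A g (S t) p / 2)"
      unfolding mixed_action_def
    proof (rule Bochner_Integration.integral_cong[OF refl])
      fix p assume "p \<in> space (vol_measure A U g)"
      then have p: "p \<in> \<Omega>" using space U by auto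
      show "mixed_scalar_curv A k D g (Tt t) p = scalar_curv A g (S t) p / 2"
        using mixed_eq[OF ad smT[OF t] p] scalar_curv_local[OF smS[OF t] smT[OF t] S\<Omega> p] by simp
    qed
    then show ?thesis by (simp add: total_action_def)
  qed
  have "((\<lambda>t. mixed_action A k D U g (Tt t)) has_real_derivative 0 / 2) (at 0)"
    by (rule has_field_derivative_transform_within_open[OF DERIV_cdivide[OF crit], of ?I]) (use \<epsilon> act in auto)
  moreover have "inner12 g p (\<lambda>u v. 0) C = 0" for p C
  proof -
    have "bilinear (g p)" using g by (simp add: metric_on_def smooth_tensor02_def)
    then show ?thesis by (simp add: inner12_def bilinear_lzero)
  qed
  ultimately show "((\<lambda>t. mixed_action A k D U g (Tt t)) has_real_derivative
      (LINT p|vol_measure A U g. inner12 g p (\<lambda>u v. 0) (\<lambda>u v. vector_derivative (\<lambda>t. Tt t p u v) (at 0)))) (at 0)"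
    by simp
qed

end

theorem proposition4:
  fixes A :: "('m::{t2_space,second_countable_topology}, 'n::finite) chart set"
    and g :: "('m, 'n) tensor02" and T :: "('m, 'n) tensor12"
    and \<Omega> :: "'m set" and k :: nat and D :: "nat \<Rightarrow> 'm \<Rightarrow> (real ^ 'n) set"
  assumes "smooth_atlas A"
    and "metric_on A UNIV g"
    and "smooth_tensor12 A UNIV T"
    and "critical_pair A g T"
    and "open \<Omega>"
    and "\<And>\<mu>. \<mu> \<in> {1..k} \<Longrightarrow> smooth_distribution A \<Omega> 1 (D \<mu>)"
    and "\<And>p. p \<in> \<Omega> \<Longrightarrow> span (\<Union>\<mu>\<in>{1..k}. D \<mu> p) = UNIV"
    and "adapted_metric A \<Omega> k D g"
  shows "(\<exists>P (l::real). metric_gradient A k D \<Omega> g T P \<and>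
            (\<forall>p\<in>\<Omega>. \<forall>\<mu>\<in>{1..k}. \<forall>u\<in>D \<mu> p. \<forall>v\<in>D \<mu> p. P p u v = l * g p u v)) \<and>
         (\<exists>Q. contorsion_gradient A k D \<Omega> g T Q \<and> (\<forall>p\<in>\<Omega>. \<forall>u v. Q p u v = 0))"
proof -
  interpret line_splitting A g T \<Omega> k D
    by unfold_locales (use assms in auto)
  obtain l where "metric_gradient A k D \<Omega> g T (\<lambda>p u v. l * g p u v)"
    using metric_gradient_exists[OF assms(4)] by blast
  moreover have "contorsion_gradient A k D \<Omega> g T (\<lambda>p u v. 0)"
    by (rule contorsion_gradient_zero[OF assms(4)])
  ultimately show ?thesis
    by (intro conjI exI[of _ "\<lambda>p u v. l * g p u v"] exI[of _ l] exI[of _ "\<lambda>p u v. 0"]) auto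
qed

end
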